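(* In both the basic Fraenkel model $\mathcal{N}1$ and the ordered Mostowski model $\mathcal{N}3$: (1) $\mathsf{EDM_{T}}$ is true. (2) $\mathsf{PC}({>}\aleph_0,{<}\aleph_0,{>}\aleph_0)$ is true. (3) $\mathsf{PC}({\nleq}\aleph_0,{<}\aleph_0,{>}\aleph_0)$ is false. (4) $\mathsf{EDM_{DM}}$ and $\mathsf{EDM_{BG}}$ are false.
   Context: Fraenkel–Mostowski models. Let $\mathcal{M}$ be a model of $\mathsf{ZFA}+\mathsf{AC}$ ($\mathsf{ZFA}$ is $\mathsf{ZF}$ modified to allow a set of atoms) with set of atoms $A$, and let $\mathcal{G}$ be a group of permutations of $A$. Each $\phi\in\mathcal{G}$ extends to an automorphism of $\mathcal{M}$ by $\phi(x)=\{\phi(y):y\in x\}$ for $x\notin A$. For $x\in\mathcal{M}$ put $\mathrm{Sym}_{\mathcal{G}}(x)=\{\phi\in\mathcal{G}:\phi(x)=x\}$ and $\mathrm{fix}_{\mathcal{G}}(x)=\{\phi\in\mathcal{G}:\forall t\in x,\ \phi(t)=t\}$. A normal filter $\Gamma$ of subgroups of $\mathcal{G}$ is a collection of subgroups that contains $\mathcal{G}$, is closed under supergroups (within $\mathcal{G}$), intersections of two members and conjugation by elements of $\mathcal{G}$, and contains $\mathrm{Sym}_{\mathcal{G}}(a)$ for all $a\in A$. The Fraenkel–Mostowski model determined by $\mathcal{M},\mathcal{G},\Gamma$ is the class of all $x\in\mathcal{M}$ such that $x$ and every element of its transitive closure have $\mathrm{Sym}_{\mathcal{G}}$ in $\Gamma$;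 it is a model of $\mathsf{ZFA}$. $\mathcal{N}1$: $A$ is countably infinite in $\mathcal{M}$, $\mathcal{G}$ is the group of all permutations of $A$, and $\Gamma=\{H\le\mathcal{G}: \mathrm{fix}_{\mathcal{G}}(E)\subseteq H\text{ for some finite }E\subseteq A\}$. $\mathcal{N}3$: $A$ is countable in $\mathcal{M}$ with an ordering $\le$ such that $(A,\le)$ is order isomorphic to $(\mathbb{Q},\le)$, $\mathcal{G}$ is the group of order automorphisms of $(A,\le)$, and $\Gamma=\{H\le\mathcal{G}: \mathrm{fix}_{\mathcal{G}}(E)\subseteq H\text{ for some finite }E\subseteq A\}$. Principles. $|X|\le|Y|$ means there is an injection $X\to Y$; $|X|=|Y|$ a bijection; $|X|<|Y|$ (equivalently $|Y|>|X|$) means $|X|\le|Y|$ and $|X|\ne|Y|$. So $|X|\nless\aleph_0$ means $X$ is infinite, $|X|\nleq\aleph_0$ means $X$ is not countable. A graph $G=(V,E)$ is a set $V$ with a set $E$ of unordered pairs of distinct elements of $V$; $I\subseteq V$ is independent if no pair of distinct elements of $I$ is in $E$; a subgraph $(V',E')$ has $V'\subseteq V$, $E'\subseteq E$, and is a clique if any two distinct elements of $V'$ form an edge in $E'$. $\mathsf{EDM_{DM}}$ / $\mathsf{EDM_{BG}}$ / $\mathsf{EDM_{T}}$: for every graph $G=(V,E)$ with $|V|\nleq\aleph_0$, either $V$ contains an independent set $I$ with, respectively, $|I|\ge\aleph_0$ / $|I|\ge\aleph_0$ / $|I|\nless\aleph_0$, or $G$ has a subgraph $(V',E')$ which is a clique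 with, respectively, $|V'|=|V|$ / $|V'|\nleq\aleph_0$ / $|V'|\nleq\aleph_0$. $\mathsf{PC}({>}\aleph_0,{<}\aleph_0,{>}\aleph_0)$ (respectively $\mathsf{PC}({\nleq}\aleph_0,{<}\aleph_0,{>}\aleph_0)$): every family $X$ of non-empty finite sets with $|X|>\aleph_0$ (respectively $|X|\nleq\aleph_0$) has a subfamily $Y$ with $|Y|>\aleph_0$ which has a choice function. *)

theory Defs
  imports Main
begin

section \<open>Structures for the language of ZFA\<close>

text \<open>
  A structure has a universe, a membership relation and a constant for the set of atoms. All
  set-theoretic notions below are interpreted inside a structure \<open>M\<close>: quantifiers range over
  \<open>univ M\<close>, so that "function", "finite", "countable" mean what they mean in \<open>M\<close>. This
  matters because \<open>M\<close> need be neither well-founded nor an \<open>\<omega>\<close>-model, and because the same notions are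
  evaluated both in the ground model and in its Fraenkel--Mostowski submodels.
\<close>

record 'm struct =
  univ :: "'m set"
  mem :: "'m \<Rightarrow> 'm \<Rightarrow> bool"
  atoms :: 'm

definition elts :: "'m struct \<Rightarrow> 'm \<Rightarrow> 'm set" where
  "elts M x = {y \<in> univ M. mem M y x}"

definition is_set :: "'m struct \<Rightarrow> 'm \<Rightarrow> bool" where
  "is_set M x \<longleftrightarrow> x \<in> univ M \<and> x \<notin> elts M (atoms M)"

definition is_empty :: "'m struct \<Rightarrow> 'm \<Rightarrow> bool" where
  "is_empty M x \<longleftrightarrow> is_set M x \<and> elts M x = {}"

definition is_upair :: "'m struct \<Rightarrow> 'm \<Rightarrow> 'm \<Rightarrow> 'm \<Rightarrow> bool" where
  "is_upair M p x y \<longleftrightarrow> is_set M p \<and> elts M p = {x, y}"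

definition is_opair :: "'m struct \<Rightarrow> 'm \<Rightarrow> 'm \<Rightarrow> 'm \<Rightarrow> bool" where
  "is_opair M p x y \<longleftrightarrow>
    (\<exists>a\<in>univ M. \<exists>b\<in>univ M. is_upair M a x x \<and> is_upair M b x y \<and> is_upair M p a b)"

definition is_succ :: "'m struct \<Rightarrow> 'm \<Rightarrow> 'm \<Rightarrow> bool" where
  "is_succ M y x \<longleftrightarrow> is_set M y \<and> elts M y = insert x (elts M x)"

definition is_inductive :: "'m struct \<Rightarrow> 'm \<Rightarrow> bool" where
  "is_inductive M i \<longleftrightarrow> is_set M i \<and> (\<exists>e\<in>elts M i. is_empty M e) \<and>
    (\<forall>x\<in>elts M i. \<exists>y\<in>elts M i. is_succ M y x)"

definition omega :: "'m struct \<Rightarrow> 'm" where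
  "omega M = (THE w. is_inductive M w \<and>
    (\<forall>i\<in>univ M. is_inductive M i \<longrightarrow> elts M w \<subseteq> elts M i))"

definition rel :: "'m struct \<Rightarrow> 'm \<Rightarrow> 'm \<Rightarrow> 'm \<Rightarrow> bool" where
  "rel M r x y \<longleftrightarrow> (\<exists>p\<in>elts M r. is_opair M p x y)"

definition is_function_on :: "'m struct \<Rightarrow> 'm \<Rightarrow> 'm \<Rightarrow> bool" where
  "is_function_on M f X \<longleftrightarrow> is_set M f \<and>
    (\<forall>p\<in>elts M f. \<exists>x\<in>elts M X. \<exists>y\<in>univ M. is_opair M p x y) \<and>
    (\<forall>x\<in>elts M X. \<exists>!y. y \<in> univ M \<and> rel M f x y)"

definition app :: "'m struct \<Rightarrow> 'm \<Rightarrow> 'm \<Rightarrow> 'm" where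
  "app M f x = (THE y. y \<in> univ M \<and> rel M f x y)"

definition is_map :: "'m struct \<Rightarrow> 'm \<Rightarrow> 'm \<Rightarrow> 'm \<Rightarrow> bool" where
  "is_map M f X Y \<longleftrightarrow> is_function_on M f X \<and> (\<forall>x\<in>elts M X. app M f x \<in> elts M Y)"

definition is_injection :: "'m struct \<Rightarrow> 'm \<Rightarrow> 'm \<Rightarrow> 'm \<Rightarrow> bool" where
  "is_injection M f X Y \<longleftrightarrow> is_map M f X Y \<and> inj_on (app M f) (elts M X)"

definition is_bijection :: "'m struct \<Rightarrow> 'm \<Rightarrow> 'm \<Rightarrow> 'm \<Rightarrow> bool" where
  "is_bijection M f X Y \<longleftrightarrow> is_map M f X Y \<and> bij_betw (app M f) (elts M X) (elts M Y)"

definition card_le :: "'m struct \<Rightarrow> 'm \<Rightarrow> 'm \<Rightarrow> bool" where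
  "card_le M X Y \<longleftrightarrow> (\<exists>f\<in>univ M. is_injection M f X Y)"

definition card_eq :: "'m struct \<Rightarrow> 'm \<Rightarrow> 'm \<Rightarrow> bool" where
  "card_eq M X Y \<longleftrightarrow> (\<exists>f\<in>univ M. is_bijection M f X Y)"

definition card_less :: "'m struct \<Rightarrow> 'm \<Rightarrow> 'm \<Rightarrow> bool" where
  "card_less M X Y \<longleftrightarrow> card_le M X Y \<and> \<not> card_eq M X Y"

definition has_choice_function :: "'m struct \<Rightarrow> 'm \<Rightarrow> bool" where
  "has_choice_function M X \<longleftrightarrow>
    (\<exists>f\<in>univ M. is_function_on M f X \<and> (\<forall>x\<in>elts M X. app M f x \<in> elts M x))"

section \<open>Models of ZFA + AC\<close>

text \<open>First-order formulas with named variables, needed for the axiom schemas of ZFA.\<close>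

datatype fm =
    FMem nat nat
  | FEq nat nat
  | FAtom nat
  | FNeg fm
  | FConj fm fm
  | FAll nat fm

primrec sat :: "'m struct \<Rightarrow> (nat \<Rightarrow> 'm) \<Rightarrow> fm \<Rightarrow> bool" where
  "sat M s (FMem i j) \<longleftrightarrow> mem M (s i) (s j)"
| "sat M s (FEq i j) \<longleftrightarrow> s i = s j"
| "sat M s (FAtom i) \<longleftrightarrow> mem M (s i) (atoms M)"
| "sat M s (FNeg \<phi>) \<longleftrightarrow> \<not> sat M s \<phi>"
| "sat M s (FConj \<phi> \<psi>) \<longleftrightarrow> sat M s \<phi> \<and> sat M s \<psi>"
| "sat M s (FAll i \<phi>) \<longleftrightarrow> (\<forall>x\<in>univ M. sat M (s(i := x)) \<phi>)"

definition ax_atoms :: "'m struct \<Rightarrow> bool" where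
  "ax_atoms M \<longleftrightarrow> is_set M (atoms M) \<and> (\<forall>a\<in>elts M (atoms M). elts M a = {})"

definition ax_extensionality :: "'m struct \<Rightarrow> bool" where
  "ax_extensionality M \<longleftrightarrow>
    (\<forall>x y. is_set M x \<and> is_set M y \<and> elts M x = elts M y \<longrightarrow> x = y)"

definition ax_empty :: "'m struct \<Rightarrow> bool" where
  "ax_empty M \<longleftrightarrow> (\<exists>x. is_empty M x)"

definition ax_pairing :: "'m struct \<Rightarrow> bool" where
  "ax_pairing M \<longleftrightarrow> (\<forall>x\<in>univ M. \<forall>y\<in>univ M. \<exists>p. is_upair M p x y)"

definition ax_union :: "'m struct \<Rightarrow> bool" where
  "ax_union M \<longleftrightarrow> (\<forall>x\<in>univ M. \<exists>u. is_set M u \<and> elts M u = (\<Union>y\<in>elts M x. elts M y))"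

definition ax_power :: "'m struct \<Rightarrow> bool" where
  "ax_power M \<longleftrightarrow> (\<forall>x\<in>univ M. \<exists>p. is_set M p \<and>
    elts M p = {y. is_set M y \<and> elts M y \<subseteq> elts M x})"

definition ax_infinity :: "'m struct \<Rightarrow> bool" where
  "ax_infinity M \<longleftrightarrow> (\<exists>i. is_inductive M i)"

definition ax_foundation :: "'m struct \<Rightarrow> bool" where
  "ax_foundation M \<longleftrightarrow>
    (\<forall>x\<in>univ M. elts M x \<noteq> {} \<longrightarrow> (\<exists>y\<in>elts M x. elts M y \<inter> elts M x = {}))"

text \<open>In the two schemas the assignment \<open>s\<close> supplies arbitrary parameters.\<close>

definition ax_separation :: "'m struct \<Rightarrow> bool" where
  "ax_separation M \<longleftrightarrow> (\<forall>\<phi> s. range s \<subseteq> univ M \<longrightarrow>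
    (\<forall>x\<in>univ M. \<exists>y. is_set M y \<and> elts M y = {z \<in> elts M x. sat M (s(0 := z)) \<phi>}))"

definition ax_replacement :: "'m struct \<Rightarrow> bool" where
  "ax_replacement M \<longleftrightarrow> (\<forall>\<phi> s. range s \<subseteq> univ M \<longrightarrow>
    (\<forall>x\<in>univ M.
      (\<forall>z\<in>elts M x. \<forall>v\<in>univ M. \<forall>v'\<in>univ M.
        sat M (s(0 := z, 1 := v)) \<phi> \<and> sat M (s(0 := z, 1 := v')) \<phi> \<longrightarrow> v = v') \<longrightarrow>
      (\<exists>y. is_set M y \<and>
        elts M y = {v \<in> univ M. \<exists>z\<in>elts M x. sat M (s(0 := z, 1 := v)) \<phi>})))"

definition ZFA :: "'m struct \<Rightarrow> bool" where
  "ZFA M \<longleftrightarrow> ax_atoms M \<and> ax_extensionality M \<and> ax_empty M \<and> ax_pairing M \<and> ax_union M \<and>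
    ax_power M \<and> ax_infinity M \<and> ax_foundation M \<and> ax_separation M \<and> ax_replacement M"

definition AC :: "'m struct \<Rightarrow> bool" where
  "AC M \<longleftrightarrow> (\<forall>X. is_set M X \<and> (\<forall>x\<in>elts M X. elts M x \<noteq> {}) \<longrightarrow> has_choice_function M X)"

section \<open>Fraenkel--Mostowski models\<close>

definition is_transitive :: "'m struct \<Rightarrow> 'm \<Rightarrow> bool" where
  "is_transitive M T \<longleftrightarrow> is_set M T \<and> (\<forall>t\<in>elts M T. elts M t \<subseteq> elts M T)"

definition trans_closure :: "'m struct \<Rightarrow> 'm \<Rightarrow> 'm set" where
  "trans_closure M x =
    {y \<in> univ M. \<forall>T. is_transitive M T \<and> elts M x \<subseteq> elts M T \<longrightarrow> y \<in> elts M T}"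

definition is_perm :: "'m struct \<Rightarrow> 'm \<Rightarrow> bool" where
  "is_perm M \<phi> \<longleftrightarrow> is_bijection M \<phi> (atoms M) (atoms M)"

text \<open>
  The extension of a permutation \<open>\<phi>\<close> of the atoms to \<open>M\<close>, by \<open>\<in>\<close>-recursion carried out inside \<open>M\<close>:
  \<open>g\<close> is an approximation, an element of \<open>M\<close> which obeys the recursion on a transitive set \<open>T\<close>.
  (When \<open>M\<close> is not well-founded, being an automorphism that extends \<open>\<phi>\<close> would not determine it.)
\<close>

definition is_perm_approx :: "'m struct \<Rightarrow> 'm \<Rightarrow> 'm \<Rightarrow> 'm \<Rightarrow> bool" where
  "is_perm_approx M \<phi> T g \<longleftrightarrow> is_transitive M T \<and> is_function_on M g T \<and>
    (\<forall>t\<in>elts M T.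
      if t \<in> elts M (atoms M) then app M g t = app M \<phi> t
      else is_set M (app M g t) \<and> elts M (app M g t) = app M g ` elts M t)"

definition perm_ext :: "'m struct \<Rightarrow> 'm \<Rightarrow> 'm \<Rightarrow> 'm" where
  "perm_ext M \<phi> x = (THE y. \<exists>T\<in>univ M. \<exists>g\<in>univ M.
    is_perm_approx M \<phi> T g \<and> x \<in> elts M T \<and> app M g x = y)"

definition Sym :: "'m struct \<Rightarrow> 'm \<Rightarrow> 'm \<Rightarrow> 'm set" where
  "Sym M G x = {\<phi> \<in> elts M G. perm_ext M \<phi> x = x}"

definition Fix :: "'m struct \<Rightarrow> 'm \<Rightarrow> 'm \<Rightarrow> 'm set" where
  "Fix M G x = {\<phi> \<in> elts M G. \<forall>t\<in>elts M x. perm_ext M \<phi> t = t}"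

definition is_perm_group :: "'m struct \<Rightarrow> 'm \<Rightarrow> bool" where
  "is_perm_group M H \<longleftrightarrow> is_set M H \<and> (\<forall>\<phi>\<in>elts M H. is_perm M \<phi>) \<and>
    (\<exists>\<iota>\<in>elts M H. \<forall>a\<in>elts M (atoms M). app M \<iota> a = a) \<and>
    (\<forall>\<phi>\<in>elts M H. \<forall>\<psi>\<in>elts M H. \<exists>\<chi>\<in>elts M H.
      \<forall>a\<in>elts M (atoms M). app M \<chi> a = app M \<phi> (app M \<psi> a)) \<and>
    (\<forall>\<phi>\<in>elts M H. \<exists>\<psi>\<in>elts M H. \<forall>a\<in>elts M (atoms M). app M \<psi> (app M \<phi> a) = a)"

definition is_subgroup :: "'m struct \<Rightarrow> 'm \<Rightarrow> 'm \<Rightarrow> bool" where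
  "is_subgroup M H G \<longleftrightarrow> is_perm_group M H \<and> elts M H \<subseteq> elts M G"

definition is_symmetric :: "'m struct \<Rightarrow> 'm \<Rightarrow> 'm \<Rightarrow> 'm \<Rightarrow> bool" where
  "is_symmetric M G \<Gamma> x \<longleftrightarrow> (\<exists>H\<in>elts M \<Gamma>. elts M H = Sym M G x)"

definition FM_model :: "'m struct \<Rightarrow> 'm \<Rightarrow> 'm \<Rightarrow> 'm struct" where
  "FM_model M G \<Gamma> = M\<lparr>univ := {x \<in> univ M. is_symmetric M G \<Gamma> x \<and>
    (\<forall>y\<in>trans_closure M x. is_symmetric M G \<Gamma> y)}\<rparr>"

text \<open>\<open>\<Gamma>\<close> is the set of all \<open>H \<le> G\<close> such that \<open>fix\<^sub>G(E) \<subseteq> H\<close> for some finite set \<open>E\<close> of atoms.\<close>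

definition is_finite_support_filter :: "'m struct \<Rightarrow> 'm \<Rightarrow> 'm \<Rightarrow> bool" where
  "is_finite_support_filter M G \<Gamma> \<longleftrightarrow> is_set M \<Gamma> \<and>
    elts M \<Gamma> = {H. is_subgroup M H G \<and>
      (\<exists>E. is_set M E \<and> elts M E \<subseteq> elts M (atoms M) \<and> card_less M E (omega M) \<and>
        Fix M G E \<subseteq> elts M H)}"

definition basic_Fraenkel_model :: "'m struct \<Rightarrow> 'm struct \<Rightarrow> bool" where
  "basic_Fraenkel_model M N \<longleftrightarrow> card_eq M (atoms M) (omega M) \<and>
    (\<exists>G \<Gamma>. is_set M G \<and> elts M G = {\<phi>. is_perm M \<phi>} \<and>
      is_finite_support_filter M G \<Gamma> \<and> N = FM_model M G \<Gamma>)"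

subsection \<open>The rationals of a model and the ordered Mostowski model\<close>

definition zero :: "'m struct \<Rightarrow> 'm" where
  "zero M = (THE x. is_empty M x)"

definition succ :: "'m struct \<Rightarrow> 'm \<Rightarrow> 'm" where
  "succ M x = (THE y. is_succ M y x)"

definition is_nat_recursion :: "'m struct \<Rightarrow> 'm \<Rightarrow> ('m \<Rightarrow> 'm) \<Rightarrow> 'm \<Rightarrow> bool" where
  "is_nat_recursion M a h g \<longleftrightarrow> is_map M g (omega M) (omega M) \<and> app M g (zero M) = a \<and>
    (\<forall>n\<in>elts M (omega M). app M g (succ M n) = h (app M g n))"

definition nat_add :: "'m struct \<Rightarrow> 'm \<Rightarrow> 'm \<Rightarrow> 'm" where
  "nat_add M m n =
    (THE k. \<exists>g\<in>univ M. is_nat_recursion M m (succ M) g \<and> app M g n = k)"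

definition nat_mult :: "'m struct \<Rightarrow> 'm \<Rightarrow> 'm \<Rightarrow> 'm" where
  "nat_mult M m n =
    (THE k. \<exists>g\<in>univ M. is_nat_recursion M (zero M) (\<lambda>j. nat_add M j m) g \<and> app M g n = k)"

definition nat_le :: "'m struct \<Rightarrow> 'm \<Rightarrow> 'm \<Rightarrow> bool" where
  "nat_le M m n \<longleftrightarrow> m = n \<or> mem M m n"

text \<open>
  The triple \<open>(a, b, c)\<close> of natural numbers of \<open>M\<close>, with \<open>c \<noteq> 0\<close>, represents the rational number
  \<open>(a - b) / c\<close>; a rational number of \<open>M\<close> is an equivalence class of such triples.
\<close>

definition fracs :: "'m struct \<Rightarrow> ('m \<times> 'm \<times> 'm) set" where
  "fracs M = elts M (omega M) \<times> elts M (omega M) \<times> (elts M (omega M) - {zero M})"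

fun frac_le :: "'m struct \<Rightarrow> 'm \<times> 'm \<times> 'm \<Rightarrow> 'm \<times> 'm \<times> 'm \<Rightarrow> bool" where
  "frac_le M (a, b, c) (a', b', c') \<longleftrightarrow>
    nat_le M (nat_add M (nat_mult M a c') (nat_mult M b' c))
             (nat_add M (nat_mult M a' c) (nat_mult M b c'))"

fun frac_eq :: "'m struct \<Rightarrow> 'm \<times> 'm \<times> 'm \<Rightarrow> 'm \<times> 'm \<times> 'm \<Rightarrow> bool" where
  "frac_eq M (a, b, c) (a', b', c') \<longleftrightarrow>
    nat_add M (nat_mult M a c') (nat_mult M b' c) =
    nat_add M (nat_mult M a' c) (nat_mult M b c')"

fun is_triple :: "'m struct \<Rightarrow> 'm \<Rightarrow> 'm \<times> 'm \<times> 'm \<Rightarrow> bool" where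
  "is_triple M t (a, b, c) \<longleftrightarrow> (\<exists>p\<in>univ M. is_opair M p a b \<and> is_opair M t p c)"

definition is_rat_of :: "'m struct \<Rightarrow> 'm \<Rightarrow> 'm \<times> 'm \<times> 'm \<Rightarrow> bool" where
  "is_rat_of M q u \<longleftrightarrow> u \<in> fracs M \<and> is_set M q \<and>
    elts M q = {t \<in> univ M. \<exists>v\<in>fracs M. frac_eq M u v \<and> is_triple M t v}"

definition is_rationals :: "'m struct \<Rightarrow> 'm \<Rightarrow> bool" where
  "is_rationals M Q \<longleftrightarrow> is_set M Q \<and> elts M Q = {q. \<exists>u. is_rat_of M q u}"

definition rat_le :: "'m struct \<Rightarrow> 'm \<Rightarrow> 'm \<Rightarrow> bool" where
  "rat_le M q r \<longleftrightarrow> (\<exists>u v. is_rat_of M q u \<and> is_rat_of M r v \<and> frac_le M u v)"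

text \<open>That \<open>R\<close> is a linear ordering of the atoms is a consequence of the isomorphism.\<close>

definition is_rational_order :: "'m struct \<Rightarrow> 'm \<Rightarrow> bool" where
  "is_rational_order M R \<longleftrightarrow> is_set M R \<and>
    (\<forall>p\<in>elts M R. \<exists>a\<in>elts M (atoms M). \<exists>b\<in>elts M (atoms M). is_opair M p a b) \<and>
    (\<exists>Q f. is_rationals M Q \<and> is_bijection M f (atoms M) Q \<and>
      (\<forall>a\<in>elts M (atoms M). \<forall>b\<in>elts M (atoms M).
        rel M R a b \<longleftrightarrow> rat_le M (app M f a) (app M f b)))"

definition is_order_automorphism :: "'m struct \<Rightarrow> 'm \<Rightarrow> 'm \<Rightarrow> bool" where
  "is_order_automorphism M R \<phi> \<longleftrightarrow> is_perm M \<phi> \<and>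
    (\<forall>a\<in>elts M (atoms M). \<forall>b\<in>elts M (atoms M).
      rel M R a b \<longleftrightarrow> rel M R (app M \<phi> a) (app M \<phi> b))"

definition ordered_Mostowski_model :: "'m struct \<Rightarrow> 'm struct \<Rightarrow> bool" where
  "ordered_Mostowski_model M N \<longleftrightarrow> card_le M (atoms M) (omega M) \<and>
    (\<exists>R G \<Gamma>. is_rational_order M R \<and>
      is_set M G \<and> elts M G = {\<phi>. is_order_automorphism M R \<phi>} \<and>
      is_finite_support_filter M G \<Gamma> \<and> N = FM_model M G \<Gamma>)"

section \<open>The principles, as statements about a structure\<close>

definition is_subset :: "'m struct \<Rightarrow> 'm \<Rightarrow> 'm \<Rightarrow> bool" where
  "is_subset M X Y \<longleftrightarrow> is_set M X \<and> elts M X \<subseteq> elts M Y"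

definition is_graph :: "'m struct \<Rightarrow> 'm \<Rightarrow> 'm \<Rightarrow> bool" where
  "is_graph M V E \<longleftrightarrow> is_set M V \<and> is_set M E \<and>
    (\<forall>e\<in>elts M E. \<exists>x\<in>elts M V. \<exists>y\<in>elts M V. x \<noteq> y \<and> is_upair M e x y)"

definition is_edge :: "'m struct \<Rightarrow> 'm \<Rightarrow> 'm \<Rightarrow> 'm \<Rightarrow> bool" where
  "is_edge M E x y \<longleftrightarrow> (\<exists>e\<in>elts M E. is_upair M e x y)"

definition is_independent :: "'m struct \<Rightarrow> 'm \<Rightarrow> 'm \<Rightarrow> 'm \<Rightarrow> bool" where
  "is_independent M V E I \<longleftrightarrow> is_subset M I V \<and>
    (\<forall>x\<in>elts M I. \<forall>y\<in>elts M I. x \<noteq> y \<longrightarrow> \<not> is_edge M E x y)"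

definition is_clique_subgraph :: "'m struct \<Rightarrow> 'm \<Rightarrow> 'm \<Rightarrow> 'm \<Rightarrow> 'm \<Rightarrow> bool" where
  "is_clique_subgraph M V E V' E' \<longleftrightarrow> is_graph M V' E' \<and> is_subset M V' V \<and> is_subset M E' E \<and>
    (\<forall>x\<in>elts M V'. \<forall>y\<in>elts M V'. x \<noteq> y \<longrightarrow> is_edge M E' x y)"

definition EDM_DM :: "'m struct \<Rightarrow> bool" where
  "EDM_DM M \<longleftrightarrow> (\<forall>V E. is_graph M V E \<and> \<not> card_le M V (omega M) \<longrightarrow>
    (\<exists>I. is_independent M V E I \<and> card_le M (omega M) I) \<or>
    (\<exists>V' E'. is_clique_subgraph M V E V' E' \<and> card_eq M V' V))"

definition EDM_BG :: "'m struct \<Rightarrow> bool" where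
  "EDM_BG M \<longleftrightarrow> (\<forall>V E. is_graph M V E \<and> \<not> card_le M V (omega M) \<longrightarrow>
    (\<exists>I. is_independent M V E I \<and> card_le M (omega M) I) \<or>
    (\<exists>V' E'. is_clique_subgraph M V E V' E' \<and> \<not> card_le M V' (omega M)))"

definition EDM_T :: "'m struct \<Rightarrow> bool" where
  "EDM_T M \<longleftrightarrow> (\<forall>V E. is_graph M V E \<and> \<not> card_le M V (omega M) \<longrightarrow>
    (\<exists>I. is_independent M V E I \<and> \<not> card_less M I (omega M)) \<or>
    (\<exists>V' E'. is_clique_subgraph M V E V' E' \<and> \<not> card_le M V' (omega M)))"

definition is_family_of_finite_sets :: "'m struct \<Rightarrow> 'm \<Rightarrow> bool" where
  "is_family_of_finite_sets M X \<longleftrightarrow> is_set M X \<and>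
    (\<forall>x\<in>elts M X. is_set M x \<and> elts M x \<noteq> {} \<and> card_less M x (omega M))"

text \<open>\<open>PC_gt\<close> is \<open>PC(> \<aleph>\<^sub>0, < \<aleph>\<^sub>0, > \<aleph>\<^sub>0)\<close>, and \<open>PC_nle\<close> has \<open>|X| \<nleq> \<aleph>\<^sub>0\<close> in the first place instead.\<close>

definition PC_gt :: "'m struct \<Rightarrow> bool" where
  "PC_gt M \<longleftrightarrow> (\<forall>X. is_family_of_finite_sets M X \<and> card_less M (omega M) X \<longrightarrow>
    (\<exists>Y. is_subset M Y X \<and> card_less M (omega M) Y \<and> has_choice_function M Y))"

definition PC_nle :: "'m struct \<Rightarrow> bool" where
  "PC_nle M \<longleftrightarrow> (\<forall>X. is_family_of_finite_sets M X \<and> \<not> card_le M X (omega M) \<longrightarrow>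
    (\<exists>Y. is_subset M Y X \<and> card_less M (omega M) Y \<and> has_choice_function M Y))"

end

theory Submission
  imports Defs
begin

text \<open>
  Since the ground model \<open>M\<close> may be ill-founded, every induction and recursion is carried out inside
  \<open>M\<close>, through definable predicates and the two schemas.

  Let \<open>E\<^sub>0\<close> be a finite support of the given graph or family \<open>X\<close>. If all elements of \<open>X\<close> are supported
  by \<open>E\<^sub>0\<close>, then so are all functions and subsets of \<open>X\<close> that are wanted, and the principle for \<open>X\<close>
  follows from the axiom of choice in \<open>M\<close>: an uncountable graph has an uncountable clique or a
  countably infinite independent set. Otherwise some \<open>x \<in> X\<close> is supported by \<open>E \<union> {a}\<close> and not by
  \<open>E\<close>, for a finite \<open>E \<supseteq> E\<^sub>0\<close> and an atom \<open>a\<close>, and \<open>\<phi> x \<mapsto> \<phi> a\<close> is a bijection between the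
  \<open>fix(E)\<close>-orbits of \<open>x\<close> and \<open>a\<close>. The orbit of \<open>x\<close> is therefore uncountable in the submodel, it is a
  clique or independent because \<open>fix(E)\<close> is transitive on its unordered pairs, and an element of the
  finite set \<open>x\<close>, being supported by \<open>E \<union> {a}\<close>, is carried around to a choice function on the orbit.

  The set \<open>A\<close> of atoms is infinite and Dedekind finite in the submodel. Hence the family of singletons of
  atoms and the graph on \<open>A\<close> without edges refute the other principles.
\<close>

section \<open>Definability in a model of ZFA\<close>

text \<open>Sets that \<open>M\<close> takes for finite, and \<omega> itself, may be nonstandard, so
  neither \<open>finite\<close> nor \<open>nat\<close> can stand in for the notions of
  \<open>M\<close>. Hence the calculus of \<open>D\<close>, \<open>Tm\<close> and \<open>Ds\<close>:
  an HOL predicate may enter an induction only after it has been shown definable.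

  The two models enter only through the properties \<open>H0\<close> to \<open>H3\<close> of their
  groups. In place of a least support, the argument uses a support in which one atom is
  indispensable.

  An orbit is not countable in the submodel because every permutation fixes the numbers: an
  injection into \<omega> supported by \<open>F\<close> cannot separate two points that
  \<open>fx F\<close> carries into each other. The same fact controls the elements of a finite set:
  one that is not supported by a support of the set would drag its whole orbit into the set.

  The hypothesis |X| > aleph_0 in (2) supplies a copy of \<omega>, which is joined to the orbit.
  Orbits are Dedekind finite and do not exceed aleph_0 by themselves. Without such a copy the
  statement becomes (3).\<close>

primrec rename_fm :: "(nat \<Rightarrow> nat) \<Rightarrow> fm \<Rightarrow> fm" where
  "rename_fm f (FMem i j) = FMem (f i) (f j)"
| "rename_fm f (FEq i j) = FEq (f i) (f j)"
| "rename_fm f (FAtom i) = FAtom (f i)"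
| "rename_fm f (FNeg \<phi>) = FNeg (rename_fm f \<phi>)"
| "rename_fm f (FConj \<phi> \<psi>) = FConj (rename_fm f \<phi>) (rename_fm f \<psi>)"
| "rename_fm f (FAll i \<phi>) = FAll (f i) (rename_fm f \<phi>)"

text \<open>Bound variables are renamed along with the free ones. Injectivity of \<open>f\<close>
  prevents capture: an update at \<open>f i\<close> touches no other renamed variable.\<close>

lemma sat_rename_fm:
  assumes "inj f"
  shows "sat M s (rename_fm f \<phi>) \<longleftrightarrow> sat M (s \<circ> f) \<phi>"
proof (induction \<phi> arbitrary: s)
  case (FAll i \<phi>)
  have "s(f i := x) \<circ> f = (s \<circ> f)(i := x)" for x
    using assms by (auto simp: fun_eq_iff inj_eq)
  then show ?case by (simp only: rename_fm.simps sat.simps FAll.IH)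
qed (simp_all add: comp_def)

definition ilv :: "(nat \<Rightarrow> 'a) \<Rightarrow> (nat \<Rightarrow> 'a) \<Rightarrow> (nat \<Rightarrow> 'a) \<Rightarrow> nat \<Rightarrow> 'a" where
  "ilv e p q n = (if n mod 3 = 0 then e (n div 3) else if n mod 3 = 1 then p (n div 3) else q (n div 3))"

lemma ilv_simps [simp]:
  "ilv e p q (3 * i) = e i" "ilv e p q (Suc (3 * i)) = p i" "ilv e p q (Suc (Suc (3 * i))) = q i"
proof -
  have "3 * i mod 3 = 0" "Suc (3 * i) mod 3 = 1" "Suc (Suc (3 * i)) mod 3 = 2"
    "3 * i div 3 = i" "Suc (3 * i) div 3 = i" "Suc (Suc (3 * i)) div 3 = i"
    by presburger+
  then show "ilv e p q (3 * i) = e i" "ilv e p q (Suc (3 * i)) = p i"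
    "ilv e p q (Suc (Suc (3 * i))) = q i"
    by (simp_all add: ilv_def)
qed

lemma mod3_cases: obtains i where "n = 3 * i" | i where "n = Suc (3 * i)" | i where "n = Suc (Suc (3 * i))"
proof -
  have "n = 3 * (n div 3) \<or> n = Suc (3 * (n div 3)) \<or> n = Suc (Suc (3 * (n div 3)))" by presburger
  then show ?thesis using that by blast
qed

lemma inj_ilvI:
  assumes "\<And>i. \<exists>j. e i = 3 * j" "\<And>i. \<exists>j. p i = Suc (3 * j)" "\<And>i. \<exists>j. q i = Suc (Suc (3 * j))"
    "inj e" "inj p" "inj q"
  shows "inj (ilv e p q)"
proof (rule injI)
  fix x y assume eq: "ilv e p q x = ilv e p q y"
  have ne: "3 * i \<noteq> Suc (3 * j)" "3 * i \<noteq> Suc (Suc (3 * j))" "Suc (3 * i) \<noteq> Suc (Suc (3 * j))" for i j :: nat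
    by presburger+
  have "e i \<noteq> p j" "e i \<noteq> q j" "p i \<noteq> q j" for i j
    using assms(1)[of i] assms(2)[of i] assms(2)[of j] assms(3)[of j] ne by metis+
  note * = this this[symmetric]
  show "x = y"
    by (rule mod3_cases[of x]; rule mod3_cases[of y]; use eq * assms(4-6) in \<open>auto simp: inj_eq\<close>)
qed

locale zfa =
  fixes M :: "'m struct"
  assumes ZFA: "ZFA M"
begin

abbreviation U :: "'m set" where "U \<equiv> univ M"
abbreviation At :: 'm where "At \<equiv> atoms M"
abbreviation el :: "'m \<Rightarrow> 'm set" where "el \<equiv> elts M"

definition env :: "(nat \<Rightarrow> 'm) \<Rightarrow> bool" where
  "env e \<longleftrightarrow> range e \<subseteq> U"

text \<open>
  Definability with parameters from the model. Variables of index \<open>3 i\<close> are the arguments,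
  those of index \<open>3 i + 1\<close> hold the parameters and those of index \<open>3 i + 2\<close> are kept for bound
  variables, so that every renaming needed below can be chosen injective. In the closure rules a
  bound variable is pushed on the front of the assignment \<open>e\<close>, so that they can be applied by
  unification.
\<close>

definition D :: "((nat \<Rightarrow> 'm) \<Rightarrow> bool) \<Rightarrow> bool" where
  "D P \<longleftrightarrow> (\<exists>\<phi> p. env p \<and> (\<forall>e q. env e \<longrightarrow> env q \<longrightarrow> (sat M (ilv e p q) \<phi> \<longleftrightarrow> P e)))"

text \<open>An operation is represented by its graph: the value sits in variable 0 and the arguments
  are shifted up by one, in the same way as a bound variable is pushed on an assignment.\<close>

definition Tm :: "((nat \<Rightarrow> 'm) \<Rightarrow> 'm) \<Rightarrow> bool" where
  "Tm t \<longleftrightarrow> (\<forall>e. env e \<longrightarrow> t e \<in> U) \<and> D (\<lambda>e. e 0 = t (\<lambda>i. e (Suc i)))"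

text \<open>A definable family of classes; that its members are sets of \<open>M\<close> is a
  separate matter, expressed later by \<open>small\<close>.\<close>

definition Ds :: "((nat \<Rightarrow> 'm) \<Rightarrow> 'm set) \<Rightarrow> bool" where
  "Ds S \<longleftrightarrow> (\<forall>e. env e \<longrightarrow> S e \<subseteq> U) \<and> D (\<lambda>e. e 0 \<in> S (\<lambda>i. e (Suc i)))"

lemma env_at: "env e \<Longrightarrow> e i \<in> U" by (auto simp: env_def)
lemma env_const [simp]: "x \<in> U \<Longrightarrow> env (\<lambda>_. x)" by (auto simp: env_def)
lemma env_comp: "env e \<Longrightarrow> env (\<lambda>i. e (g i))" by (auto simp: env_def)
lemma env_cons: "env (case_nat x e) \<longleftrightarrow> x \<in> U \<and> env e"
  by (auto simp: env_def split: nat.splits) (metis old.nat.simps(4,5) rangeI subsetD)+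

lemma D_cong: "(\<And>e. env e \<Longrightarrow> P e \<longleftrightarrow> Q e) \<Longrightarrow> D P \<longleftrightarrow> D Q"
  unfolding D_def by (rule iff_exI, rule iff_exI) auto

lemma D_eqI: "D P \<Longrightarrow> (\<And>e. env e \<Longrightarrow> P e \<longleftrightarrow> Q e) \<Longrightarrow> D Q"
  by (rule D_cong[THEN iffD1])

lemma univ_nonempty: "\<exists>x. x \<in> U"
  using ZFA by (auto simp: ZFA_def ax_empty_def is_empty_def is_set_def)

lemma D_neg: "D P \<Longrightarrow> D (\<lambda>e. \<not> P e)"
  unfolding D_def by (metis sat.simps(4))

lemma D_True: "D (\<lambda>e. True)"
proof -
  obtain x where "x \<in> U" using univ_nonempty by blast
  then have "env (\<lambda>_. x)" by (auto simp: env_def)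
  then show ?thesis unfolding D_def
    by (intro exI[of _ "FEq 0 0"] exI[of _ "\<lambda>_. x"]) auto
qed

lemma D_conj:
  assumes "D P" "D Q"
  shows "D (\<lambda>e. P e \<and> Q e)"
proof -
  obtain \<phi> p where p: "env p" "\<And>e q. env e \<Longrightarrow> env q \<Longrightarrow> (sat M (ilv e p q) \<phi> \<longleftrightarrow> P e)"
    using assms(1) unfolding D_def by blast
  obtain \<psi> p' where p': "env p'" "\<And>e q. env e \<Longrightarrow> env q \<Longrightarrow> (sat M (ilv e p' q) \<psi> \<longleftrightarrow> Q e)"
    using assms(2) unfolding D_def by blast
  \<comment> \<open>The two parameter sequences are merged, one on the even and one on the odd
    positions, so that a single assignment serves both formulas.\<close>
  define r where "r n = (if even n then p (n div 2) else p' (n div 2))" for n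
  define f where "f = ilv (\<lambda>i. 3 * i) (\<lambda>i. Suc (3 * (2 * i))) (\<lambda>i. Suc (Suc (3 * i)))"
  define g where "g = ilv (\<lambda>i. 3 * i) (\<lambda>i. Suc (3 * (2 * i + 1))) (\<lambda>i. Suc (Suc (3 * i)))"
  have r: "env r" using p p' by (auto simp: env_def r_def)
  have "inj f" "inj g" unfolding f_def g_def by (intro inj_ilvI; (presburger | auto simp: inj_def))+
  have f: "ilv e r q \<circ> f = ilv e p q" for e q :: "nat \<Rightarrow> 'm"
  proof
    fix n
    have *: "r (2 * i) = p i" for i by (simp add: r_def)
    show "(ilv e r q \<circ> f) n = ilv e p q n"
      by (rule mod3_cases[of n]; simp only: f_def comp_def ilv_simps *)
  qed
  have g: "ilv e r q \<circ> g = ilv e p' q" for e q :: "nat \<Rightarrow> 'm"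
  proof
    fix n
    have *: "r (2 * i + 1) = p' i" for i by (simp add: r_def)
    show "(ilv e r q \<circ> g) n = ilv e p' q n"
      by (rule mod3_cases[of n]; simp only: g_def comp_def ilv_simps *)
  qed
  have "\<forall>e q. env e \<longrightarrow> env q \<longrightarrow>
      (sat M (ilv e r q) (FConj (rename_fm f \<phi>) (rename_fm g \<psi>)) \<longleftrightarrow> P e \<and> Q e)"
    using p(2) p'(2) by (simp add: sat_rename_fm \<open>inj f\<close> \<open>inj g\<close> f g)
  with r show ?thesis unfolding D_def by blast
qed

lemma D_all:
  assumes "D (\<lambda>e. P (e 0) (\<lambda>i. e (Suc i)))"
  shows "D (\<lambda>e. \<forall>x\<in>U. P x e)"
proof -
  obtain \<phi> p where p: "env p"
    "\<And>e q. env e \<Longrightarrow> env q \<Longrightarrow> (sat M (ilv e p q) \<phi> \<longleftrightarrow> P (e 0) (\<lambda>i. e (Suc i)))"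
    using assms unfolding D_def by blast
  \<comment> \<open>The pushed argument becomes the bound variable 2, the other arguments move down
    by one place, the parameters stay, and the reserve moves up by one place to make room.\<close>
  define f where "f n = (if n = 0 then 2
    else ilv (\<lambda>i. 3 * (i - 1)) (\<lambda>i. Suc (3 * i)) (\<lambda>i. Suc (Suc (3 * Suc i))) n)" for n
  have fs: "f 0 = Suc (Suc (3 * 0))" "f (3 * Suc i) = 3 * i" "f (Suc (3 * i)) = Suc (3 * i)"
    "f (Suc (Suc (3 * i))) = Suc (Suc (3 * Suc i))" for i
    using ilv_simps(1)[of "\<lambda>i. 3 * (i - 1)" _ _ "Suc i"] by (simp_all add: f_def)
  have ne: "3 * i \<noteq> Suc (3 * j)" "3 * i \<noteq> Suc (Suc (3 * j))" "Suc (3 * i) \<noteq> Suc (Suc (3 * j))" for i j :: nat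
    by presburger+
  have cs: "n = 0 \<or> (\<exists>i. n = 3 * Suc i) \<or> (\<exists>i. n = Suc (3 * i)) \<or> (\<exists>i. n = Suc (Suc (3 * i)))" for n
    by (rule mod3_cases[of n]) (metis not0_implies_Suc mult_0_right, blast+)
  have "inj f"
  proof (rule injI)
    fix x y assume eq: "f x = f y"
    show "x = y"
      using cs[of x] cs[of y] eq ne ne[symmetric]
      by (elim disjE exE; simp only: fs; (metis Suc_inject mult_cancel1 zero_neq_numeral nat.distinct(1)))
  qed
  have f: "(ilv e p q)(2 := x) \<circ> f = ilv (case_nat x e) p (\<lambda>i. q (Suc i))" for e q :: "nat \<Rightarrow> 'm" and x
  proof
    fix n
    have 2: "(2::nat) = Suc (Suc (3 * 0))" by simp
    have z: "ilv (case_nat x e) p (\<lambda>i. q (Suc i)) 0 = x"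
      using ilv_simps(1)[of "case_nat x e" p _ 0] by simp
    have w: "((ilv e p q)(Suc (Suc (3 * 0)) := x)) (3 * i) = e i"
       "((ilv e p q)(Suc (Suc (3 * 0)) := x)) (Suc (3 * i)) = p i"
       "((ilv e p q)(Suc (Suc (3 * 0)) := x)) (Suc (Suc (3 * Suc i))) = q (Suc i)" for i
      using ne(2)[of i 0] ne(3)[of i 0] ilv_simps(3)[of e p q "Suc i"] ilv_simps(2)[of e p q i]
        ilv_simps(1)[of e p q "i"] by auto
    show "((ilv e p q)(2 := x) \<circ> f) n = ilv (case_nat x e) p (\<lambda>i. q (Suc i)) n"
      unfolding 2 comp_def
      using cs[of n] by (elim disjE exE; simp only: fs w z ilv_simps; simp)
  qed
  have "\<forall>e q. env e \<longrightarrow> env q \<longrightarrow>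
      (sat M (ilv e p q) (FAll 2 (rename_fm f \<phi>)) \<longleftrightarrow> (\<forall>x\<in>U. P x e))"
  proof (intro allI impI)
    fix e q assume eq: "env e" "env q"
    have "sat M ((ilv e p q)(2 := x)) (rename_fm f \<phi>) \<longleftrightarrow> P x e" if "x \<in> U" for x
      using p(2)[of "case_nat x e" "\<lambda>i. q (Suc i)"] that eq
      by (simp add: sat_rename_fm \<open>inj f\<close> f env_cons env_comp)
    then show "sat M (ilv e p q) (FAll 2 (rename_fm f \<phi>)) \<longleftrightarrow> (\<forall>x\<in>U. P x e)" by simp
  qed
  with p(1) show ?thesis unfolding D_def by blast
qed

lemma D_rename:
  assumes "inj g" "D P"
  shows "D (\<lambda>e. P (\<lambda>i. e (g i)))"
proof -
  obtain \<phi> p where p: "env p" "\<And>e q. env e \<Longrightarrow> env q \<Longrightarrow> (sat M (ilv e p q) \<phi> \<longleftrightarrow> P e)"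
    using assms(2) unfolding D_def by blast
  define f where "f = ilv (\<lambda>i. 3 * g i) (\<lambda>i. Suc (3 * i)) (\<lambda>i. Suc (Suc (3 * i)))"
  have "inj f" unfolding f_def using assms(1) by (intro inj_ilvI; auto simp: inj_def)
  have f: "ilv e p q \<circ> f = ilv (\<lambda>i. e (g i)) p q" for e q :: "nat \<Rightarrow> 'm"
  proof
    fix n show "(ilv e p q \<circ> f) n = ilv (\<lambda>i. e (g i)) p q n"
      by (rule mod3_cases[of n]) (simp_all add: f_def)
  qed
  have "\<forall>e q. env e \<longrightarrow> env q \<longrightarrow>
      (sat M (ilv e p q) (rename_fm f \<phi>) \<longleftrightarrow> P (\<lambda>i. e (g i)))"
    using p(2) by (simp add: sat_rename_fm \<open>inj f\<close> f env_comp)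
  with p(1) show ?thesis unfolding D_def by blast
qed

lemma D_mem_var: "D (\<lambda>e. mem M (e i) (e j))"
proof -
  obtain x where "x \<in> U" using univ_nonempty by blast
  then have "env (\<lambda>_. x)" by (auto simp: env_def)
  then show ?thesis unfolding D_def
    by (intro exI[of _ "FMem (3 * i) (3 * j)"] exI[of _ "\<lambda>_. x"]) simp
qed

lemma D_eq_var: "D (\<lambda>e. e i = e j)"
proof -
  obtain x where "x \<in> U" using univ_nonempty by blast
  then have "env (\<lambda>_. x)" by (auto simp: env_def)
  then show ?thesis unfolding D_def
    by (intro exI[of _ "FEq (3 * i) (3 * j)"] exI[of _ "\<lambda>_. x"]) simp
qed

lemma D_eq_const: "a \<in> U \<Longrightarrow> D (\<lambda>e. e i = a)"
  unfolding D_def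
  by (intro exI[of _ "FEq (3 * i) (Suc (3 * 0))"] exI[of _ "\<lambda>_. a"] conjI allI impI)
    (auto simp: env_def simp del: mult_0_right mult_zero_right)

lemma D_const: "D (\<lambda>e. b)"
  by (cases b) (use D_True D_neg[OF D_True] in auto)

lemma disj_conv_conj: "P \<or> Q \<longleftrightarrow> \<not> (\<not> P \<and> \<not> Q)" by blast

lemma D_disj: "D P \<Longrightarrow> D Q \<Longrightarrow> D (\<lambda>e. P e \<or> Q e)"
  unfolding disj_conv_conj by (intro D_neg D_conj)

lemma D_imp: "D P \<Longrightarrow> D Q \<Longrightarrow> D (\<lambda>e. P e \<longrightarrow> Q e)"
  unfolding imp_conv_disj by (intro D_disj D_neg)

lemma D_iff: "D P \<Longrightarrow> D Q \<Longrightarrow> D (\<lambda>e. P e = (Q e :: bool))"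
  unfolding iff_conv_conj_imp by (intro D_conj D_imp)

lemma D_if: "D P \<Longrightarrow> D Q \<Longrightarrow> D R \<Longrightarrow> D (\<lambda>e. if P e then Q e else R e)"
  unfolding if_bool_eq_conj by (intro D_conj D_imp D_neg)

lemma D_ex:
  assumes "D (\<lambda>e. P (e 0) (\<lambda>i. e (Suc i)))"
  shows "D (\<lambda>e. \<exists>x\<in>U. P x e)"
  using D_neg[OF D_all[OF D_neg[OF assms]]] by simp

lemma D_shift: "D P \<Longrightarrow> D (\<lambda>e. P (\<lambda>i. e (Suc i)))"
  by (rule D_rename) auto

lemma Tm_shift: assumes "Tm t" shows "Tm (\<lambda>e. t (\<lambda>i. e (Suc i)))"
  unfolding Tm_def
proof (intro conjI allI impI)
  fix e assume "env e" then show "t (\<lambda>i. e (Suc i)) \<in> U"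
    using assms by (auto simp: Tm_def intro: env_comp)
next
  have "inj (case_nat 0 (\<lambda>i. Suc (Suc i)))" by (auto simp: inj_def split: nat.splits)
  from D_rename[OF this] assms show "D (\<lambda>e. e 0 = t (\<lambda>i. e (Suc (Suc i))))"
    unfolding Tm_def by force
qed

text \<open>Renaming is restricted to injective maps and can neither identify variables nor insert
  terms. Substitution is therefore expressed by a quantifier over the value of the term.\<close>

lemma D_subst:
  assumes "Tm t" "D (\<lambda>e. P (e 0) (\<lambda>i. e (Suc i)))"
  shows "D (\<lambda>e. P (t e) e)"
proof -
  have "D (\<lambda>e. \<exists>x\<in>U. x = t e \<and> P x e)"
    by (rule D_ex, rule D_conj) (use assms in \<open>auto simp: Tm_def\<close>)
  then show ?thesis
    by (rule D_eqI) (use assms(1) in \<open>auto simp: Tm_def\<close>)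
qed

lemma Tm_var: "Tm (\<lambda>e. e i)"
  unfolding Tm_def by (intro conjI allI impI, erule env_at, rule D_eq_var)

lemma Tm_const: "a \<in> U \<Longrightarrow> Tm (\<lambda>e. a)"
  unfolding Tm_def using D_eq_const by simp

text \<open>This rule and its versions for more arguments let definability be shown once, for plain
  variables, and then be used at arbitrary definable terms. The permutation lemmas in between bring
  the argument to be substituted to the front.\<close>

lemma D_lift1: "D (\<lambda>e. R (e 0)) \<Longrightarrow> Tm t \<Longrightarrow> D (\<lambda>e. R (t e))"
  by (rule D_subst[where P="\<lambda>x e. R x"])

lemma D_lift2: 
  assumes "D (\<lambda>e. R (e 0) (e (Suc 0)))" "Tm t" "Tm u"
  shows "D (\<lambda>e. R (t e) (u e))"
proof (rule D_subst[where P="\<lambda>x e. R x (u e)", OF assms(2)])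
  have "D (\<lambda>e. R (e (Suc 0)) (e 0))"
  proof -
    have "inj (\<lambda>i. if i = 0 then Suc 0 else if i = Suc 0 then 0 else i)" by (auto simp: inj_def)
    from D_rename[OF this assms(1)] show ?thesis by simp
  qed
  then show "D (\<lambda>e. R (e 0) (u (\<lambda>i. e (Suc i))))"
    by (intro D_subst[where P="\<lambda>x e. R (e 0) x", OF Tm_shift[OF assms(3)]])
qed

lemma D_perm3: assumes "D (\<lambda>e. R (e 0) (e (Suc 0)) (e (Suc (Suc 0))))" 
  shows "D (\<lambda>e. R (e (Suc (Suc 0))) (e (Suc 0)) (e 0))"
proof -
  have "inj (\<lambda>i. if i = 0 then Suc (Suc 0) else if i = Suc (Suc 0) then 0 else i)" by (auto simp: inj_def)
  from D_rename[OF this assms] show ?thesis by simp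
qed

lemma D_lift3: 
  assumes "D (\<lambda>e. R (e 0) (e (Suc 0)) (e (Suc (Suc 0))))" "Tm t" "Tm u" "Tm v"
  shows "D (\<lambda>e. R (t e) (u e) (v e))"
proof -
  note 1 = D_subst[where P="\<lambda>x e. R (e (Suc 0)) (e 0) x", OF Tm_shift[OF Tm_shift[OF assms(4)]], OF D_perm3[OF assms(1)]]
  note 2 = D_subst[where P="\<lambda>x e. R (e 0) x (v (\<lambda>i. e (Suc i)))", OF Tm_shift[OF assms(3)], OF 1]
  show ?thesis by (rule D_subst[where P="\<lambda>x e. R x (u e) (v e)", OF assms(2) 2])
qed

lemma D_perm4: assumes "D (\<lambda>e. R (e 0) (e (Suc 0)) (e (Suc (Suc 0))) (e (Suc (Suc (Suc 0)))))" 
  shows "D (\<lambda>e. R (e (Suc (Suc (Suc 0)))) (e (Suc (Suc 0))) (e (Suc 0)) (e 0))"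
proof -
  have "inj (\<lambda>i. if i = 0 then Suc (Suc (Suc 0)) else if i = Suc (Suc (Suc 0)) then 0
     else if i = Suc 0 then Suc (Suc 0) else if i = Suc (Suc 0) then Suc 0 else i)" by (auto simp: inj_def)
  from D_rename[OF this assms] show ?thesis by simp
qed

lemma D_lift4: 
  assumes "D (\<lambda>e. R (e 0) (e (Suc 0)) (e (Suc (Suc 0))) (e (Suc (Suc (Suc 0)))))" "Tm t" "Tm u" "Tm v" "Tm w"
  shows "D (\<lambda>e. R (t e) (u e) (v e) (w e))"
proof -
  note 1 = D_subst[where P="\<lambda>x e. R (e (Suc (Suc 0))) (e (Suc 0)) (e 0) x", OF Tm_shift[OF Tm_shift[OF Tm_shift[OF assms(5)]]], OF D_perm4[OF assms(1)]]
  note 2 = D_subst[where P="\<lambda>x e. R (e (Suc 0)) (e 0) x (w (\<lambda>i. e (Suc (Suc i))))", OF Tm_shift[OF Tm_shift[OF assms(4)]], OF 1]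
  note 3 = D_subst[where P="\<lambda>x e. R (e 0) x (v (\<lambda>i. e (Suc i))) (w (\<lambda>i. e (Suc i)))", OF Tm_shift[OF assms(3)], OF 2]
  show ?thesis by (rule D_subst[where P="\<lambda>x e. R x (u e) (v e) (w e)", OF assms(2) 3])
qed

lemma Tm_U: "Tm t \<Longrightarrow> env e \<Longrightarrow> t e \<in> U" by (auto simp: Tm_def)

lemma Tm_U1: "Tm (\<lambda>e. f (e 0)) \<Longrightarrow> x \<in> U \<Longrightarrow> f x \<in> U"
  using Tm_U[of "\<lambda>e. f (e 0)" "\<lambda>_. x"] by (auto simp: env_def)

lemma Tm_lift1: assumes "Tm (\<lambda>e. f (e 0))" "Tm t" shows "Tm (\<lambda>e. f (t e))"
proof -
  have "D (\<lambda>e. e 0 = f (e (Suc 0)))" using assms(1) by (simp add: Tm_def)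
  from D_lift2[where R="\<lambda>x y. x = f y", OF this Tm_var[of 0] Tm_shift[OF assms(2)]]
  show ?thesis using Tm_U1[OF assms(1)] assms(2) unfolding Tm_def by auto
qed

lemma Tm_lift2: assumes "Tm (\<lambda>e. f (e 0) (e (Suc 0)))" "Tm t" "Tm u" shows "Tm (\<lambda>e. f (t e) (u e))"
proof -
  have "D (\<lambda>e. e 0 = f (e (Suc 0)) (e (Suc (Suc 0))))" using assms(1) by (simp add: Tm_def)
  note d = D_lift3[where R="\<lambda>x y z. x = f y z", OF this Tm_var[of 0] Tm_shift[OF assms(2)] Tm_shift[OF assms(3)]]
  have "f x y \<in> U" if "x \<in> U" "y \<in> U" for x y
    using Tm_U[OF assms(1), of "case_nat x (\<lambda>_. y)"] that by (simp add: env_cons)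
  with d show ?thesis using assms(2,3) unfolding Tm_def by auto
qed

lemma Tm_lift3: assumes "Tm (\<lambda>e. f (e 0) (e (Suc 0)) (e (Suc (Suc 0))))" "Tm t" "Tm u" "Tm v"
  shows "Tm (\<lambda>e. f (t e) (u e) (v e))"
proof -
  have "D (\<lambda>e. e 0 = f (e (Suc 0)) (e (Suc (Suc 0))) (e (Suc (Suc (Suc 0)))))" using assms(1) by (simp add: Tm_def)
  note d = D_lift4[where R="\<lambda>x y z w. x = f y z w", OF this Tm_var[of 0] Tm_shift[OF assms(2)] Tm_shift[OF assms(3)] Tm_shift[OF assms(4)]]
  have "f x y z \<in> U" if "x \<in> U" "y \<in> U" "z \<in> U" for x y z
    using Tm_U[OF assms(1), of "case_nat x (case_nat y (\<lambda>_. z))"] that by (simp add: env_cons)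
  with d show ?thesis using assms(2-4) unfolding Tm_def by auto
qed

lemma D_mem: "Tm t \<Longrightarrow> Tm u \<Longrightarrow> D (\<lambda>e. mem M (t e) (u e))"
  by (rule D_lift2[where R="mem M", OF D_mem_var])

lemma D_eq: "Tm t \<Longrightarrow> Tm u \<Longrightarrow> D (\<lambda>e. t e = u e)"
  by (rule D_lift2[where R="(=)", OF D_eq_var])

lemma Ds_U: "Ds S \<Longrightarrow> env e \<Longrightarrow> S e \<subseteq> U" by (auto simp: Ds_def)

lemma DsI: "D (\<lambda>e. e 0 \<in> S (\<lambda>i. e (Suc i))) \<Longrightarrow> (\<And>e. env e \<Longrightarrow> S e \<subseteq> U) \<Longrightarrow> Ds S"
  by (auto simp: Ds_def)

lemma D_in: "Tm t \<Longrightarrow> Ds S \<Longrightarrow> D (\<lambda>e. t e \<in> S e)"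
  by (rule D_subst[where P="\<lambda>x e. x \<in> S e"]) (auto simp: Ds_def)

lemma D_Ball:
  assumes "Ds S" "D (\<lambda>e. P (e 0) (\<lambda>i. e (Suc i)))"
  shows "D (\<lambda>e. \<forall>x\<in>S e. P x e)"
proof -
  have "D (\<lambda>e. \<forall>x\<in>U. x \<in> S e \<longrightarrow> P x e)"
    by (rule D_all, rule D_imp, rule assms(1)[unfolded Ds_def, THEN conjunct2], rule assms(2))
  then show ?thesis
  proof (rule D_eqI)
    fix e assume "env e"
    with Ds_U[OF assms(1)] have "S e \<subseteq> U" by simp
    then show "(\<forall>x\<in>U. x \<in> S e \<longrightarrow> P x e) \<longleftrightarrow> (\<forall>x\<in>S e. P x e)" by blast
  qed
qed

lemma D_Bex:
  assumes "Ds S" "D (\<lambda>e. P (e 0) (\<lambda>i. e (Suc i)))"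
  shows "D (\<lambda>e. \<exists>x\<in>S e. P x e)"
  using D_neg[OF D_Ball[OF assms(1) D_neg[OF assms(2)]]] by simp

lemma Ds_shift: assumes "Ds t" shows "Ds (\<lambda>e. t (\<lambda>i. e (Suc i)))"
  unfolding Ds_def
proof (intro conjI allI impI)
  fix e assume "env e" then show "t (\<lambda>i. e (Suc i)) \<subseteq> U"
    using assms by (auto simp: Ds_def env_comp)
next
  have "inj (case_nat 0 (\<lambda>i. Suc (Suc i)))" by (auto simp: inj_def split: nat.splits)
  from D_rename[OF this] assms show "D (\<lambda>e. e 0 \<in> t (\<lambda>i. e (Suc (Suc i))))"
    unfolding Ds_def by force
qed

lemma D_subset: "Ds S \<Longrightarrow> Ds T \<Longrightarrow> D (\<lambda>e. S e \<subseteq> T e)"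
  unfolding subset_iff Ball_def[symmetric] by (intro D_Ball D_in Tm_var Ds_shift)

lemma D_set_eq: "Ds S \<Longrightarrow> Ds T \<Longrightarrow> D (\<lambda>e. S e = T e)"
  unfolding set_eq_subset by (intro D_conj D_subset)

lemma Ds_univ: "Ds (\<lambda>e. U)"
  unfolding Ds_def
proof (intro conjI allI impI)
  show "D (\<lambda>e. e 0 \<in> U)" by (rule D_eqI[OF D_True]) (use env_at[of _ 0] in blast)
qed simp

lemma Ds_empty: "Ds (\<lambda>e. {})"
  by (rule DsI) (auto intro: D_const)

lemma Ds_elts: assumes "Tm t" shows "Ds (\<lambda>e. el (t e))"
proof (rule DsI)
  have "D (\<lambda>e. mem M (e 0) (t (\<lambda>i. e (Suc i))))"
    by (intro D_mem Tm_var Tm_shift assms)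
  then show "D (\<lambda>e. e 0 \<in> el (t (\<lambda>i. e (Suc i))))"
  proof (rule D_eqI)
    fix e :: "nat \<Rightarrow> 'm" assume "env e"
    then have "e 0 \<in> U" by (rule env_at)
    then show "mem M (e 0) (t (\<lambda>i. e (Suc i))) = (e 0 \<in> el (t (\<lambda>i. e (Suc i))))" by (simp add: elts_def)
  qed
qed (auto simp: elts_def)

lemma Ds_Collect: "Ds S \<Longrightarrow> D (\<lambda>e. P (e 0) (\<lambda>i. e (Suc i))) \<Longrightarrow> Ds (\<lambda>e. {x \<in> S e. P x e})"
  by (rule DsI) (auto intro!: D_conj simp: Ds_def)

lemma Ds_Un: "Ds S \<Longrightarrow> Ds T \<Longrightarrow> Ds (\<lambda>e. S e \<union> T e)"
  by (rule DsI) (auto intro!: D_disj simp: Ds_def)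

lemma Ds_Int: "Ds S \<Longrightarrow> Ds T \<Longrightarrow> Ds (\<lambda>e. S e \<inter> T e)"
  by (rule DsI) (auto intro!: D_conj simp: Ds_def)

lemma Ds_Diff: "Ds S \<Longrightarrow> Ds T \<Longrightarrow> Ds (\<lambda>e. S e - T e)"
  by (rule DsI) (auto intro!: D_conj D_neg simp: Ds_def)

lemma Ds_insert: "Tm t \<Longrightarrow> Ds S \<Longrightarrow> Ds (\<lambda>e. insert (t e) (S e))"
  by (rule DsI) (auto intro!: D_disj simp: Ds_def Tm_def)

lemma Ds_image: assumes "Ds S" "Tm (\<lambda>e. f (e 0) (\<lambda>i. e (Suc i)))"
  shows "Ds (\<lambda>e. (\<lambda>x. f x e) ` S e)"
proof (rule DsI)
  have "D (\<lambda>e. e 0 = f (e (Suc 0)) (\<lambda>i. e (Suc (Suc i))))" using assms(2) by (simp add: Tm_def)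
  moreover have "inj (\<lambda>i. if i = 0 then Suc 0 else if i = Suc 0 then 0 else i)" by (auto simp: inj_def)
  ultimately have "D (\<lambda>e. e (Suc 0) = f (e 0) (\<lambda>i. e (Suc (Suc i))))"
    using D_rename[of "\<lambda>i. if i = 0 then Suc 0 else if i = Suc 0 then 0 else i" "\<lambda>e. e 0 = f (e (Suc 0)) (\<lambda>i. e (Suc (Suc i)))"]
    by simp
  then have "D (\<lambda>e. \<exists>x\<in>S (\<lambda>i. e (Suc i)). e 0 = f x (\<lambda>i. e (Suc i)))"
    by (intro D_Bex Ds_shift assms)
  then show "D (\<lambda>e. e 0 \<in> (\<lambda>x. f x (\<lambda>i. e (Suc i))) ` S (\<lambda>i. e (Suc i)))"
    by (simp add: image_iff)
next
  fix e assume e: "env e"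
  show "(\<lambda>x. f x e) ` S e \<subseteq> U"
  proof
    fix y assume "y \<in> (\<lambda>x. f x e) ` S e"
    then obtain x where x: "x \<in> S e" "y = f x e" by auto
    with Ds_U[OF assms(1) e] have "env (case_nat x e)" using e by (auto simp: env_cons)
    from Tm_U[OF assms(2) this] x show "y \<in> U" by simp
  qed
qed

lemma Ds_UN: assumes "Ds S" "Ds (\<lambda>e. T (e 0) (\<lambda>i. e (Suc i)))"
  shows "Ds (\<lambda>e. \<Union>x\<in>S e. T x e)"
proof (rule DsI)
  have "D (\<lambda>e. e 0 \<in> T (e (Suc 0)) (\<lambda>i. e (Suc (Suc i))))" using assms(2) by (simp add: Ds_def)
  moreover have "inj (\<lambda>i. if i = 0 then Suc 0 else if i = Suc 0 then 0 else i)" by (auto simp: inj_def)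
  ultimately have "D (\<lambda>e. e (Suc 0) \<in> T (e 0) (\<lambda>i. e (Suc (Suc i))))"
    using D_rename[of "\<lambda>i. if i = 0 then Suc 0 else if i = Suc 0 then 0 else i" "\<lambda>e. e 0 \<in> T (e (Suc 0)) (\<lambda>i. e (Suc (Suc i)))"]
    by simp
  then have "D (\<lambda>e. \<exists>x\<in>S (\<lambda>i. e (Suc i)). e 0 \<in> T x (\<lambda>i. e (Suc i)))"
    by (intro D_Bex Ds_shift assms)
  then show "D (\<lambda>e. e 0 \<in> (\<Union>x\<in>S (\<lambda>i. e (Suc i)). T x (\<lambda>i. e (Suc i))))"
    by simp
next
  fix e assume e: "env e"
  show "(\<Union>x\<in>S e. T x e) \<subseteq> U"
  proof (intro UN_least)
    fix x assume x: "x \<in> S e"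
    with Ds_U[OF assms(1) e] have "env (case_nat x e)" using e by (auto simp: env_cons)
    from Ds_U[OF assms(2) this] x show "T x e \<subseteq> U" by simp
  qed
qed

lemma Tm_if: assumes "D P" "Tm t" "Tm u" shows "Tm (\<lambda>e. if P e then t e else u e)"
  unfolding Tm_def
proof (intro conjI allI impI)
  have "D (\<lambda>e. if P (\<lambda>i. e (Suc i)) then e 0 = t (\<lambda>i. e (Suc i)) else e 0 = u (\<lambda>i. e (Suc i)))"
    by (intro D_if D_shift D_eq Tm_shift assms Tm_var)
  then show "D (\<lambda>e. e 0 = (if P (\<lambda>i. e (Suc i)) then t (\<lambda>i. e (Suc i)) else u (\<lambda>i. e (Suc i))))"
    by (rule D_cong[THEN iffD1, rotated]) auto
qed (use assms Tm_U in auto)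

lemmas dfn = D_const D_neg D_conj D_disj D_imp D_iff D_if D_ex D_all D_Ball D_Bex D_mem D_eq D_in D_subset D_set_eq
  Ds_univ Ds_empty Ds_elts Ds_Collect Ds_Un Ds_Int Ds_Diff Ds_insert Ds_image Ds_UN Tm_var Tm_const Tm_if

end

section \<open>Sets, pairs and functions of the model\<close>

named_theorems df

context zfa begin

declare dfn [df]

lemma el_U: "x \<in> el y \<Longrightarrow> x \<in> U" by (simp add: elts_def)

lemma set_ext: "is_set M x \<Longrightarrow> is_set M y \<Longrightarrow> el x = el y \<Longrightarrow> x = y"
  using ZFA unfolding ZFA_def ax_extensionality_def by blast

lemma set_U: "is_set M x \<Longrightarrow> x \<in> U" by (simp add: is_set_def)

lemma set_At: "is_set M At" and el_atom: "a \<in> el At \<Longrightarrow> el a = {}"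
  using ZFA unfolding ZFA_def ax_atoms_def by blast+

lemma At_U [simp]: "At \<in> U" using set_At set_U by blast

lemma D_is_set: "Tm t \<Longrightarrow> D (\<lambda>e. is_set M (t e))"
  unfolding is_set_def by (intro dfn At_U)

section \<open>Classes that are sets of the model\<close>

definition small :: "'m set \<Rightarrow> bool" where
  "small S \<longleftrightarrow> (\<exists>x. is_set M x \<and> el x = S)"

text \<open>A class that is not a set of \<open>M\<close> is coded by the empty set. This makes
  \<open>mk\<close> total, and \<open>Tm_mk\<close> holds without side conditions.\<close>

definition mk :: "'m set \<Rightarrow> 'm" where
  "mk S = (THE x. is_set M x \<and> el x = (if small S then S else {}))"

lemma smallE: assumes "small S" obtains x where "is_set M x" "el x = S"
  using assms by (auto simp: small_def)

lemma smallI: "is_set M x \<Longrightarrow> el x = S \<Longrightarrow> small S"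
  by (auto simp: small_def)

lemma small_empty [simp]: "small {}"
  using ZFA by (auto simp: ZFA_def ax_empty_def is_empty_def small_def)

lemma mk_props: "is_set M (mk S)" "el (mk S) = (if small S then S else {})"
proof -
  let ?S = "if small S then S else {}"
  have "small ?S" by simp
  then obtain x where x: "is_set M x \<and> el x = ?S" unfolding small_def by blast
  have "is_set M (mk S) \<and> el (mk S) = ?S"
    unfolding mk_def by (rule theI[where P="\<lambda>x. is_set M x \<and> el x = ?S", OF x]) (use x set_ext in force)
  then show "is_set M (mk S)" "el (mk S) = ?S" by blast+
qed

lemma set_mk [simp]: "is_set M (mk S)" by (rule mk_props)
lemma mk_U [simp]: "mk S \<in> U" by (rule set_U) simp
lemma el_mk: "small S \<Longrightarrow> el (mk S) = S" using mk_props by simp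
lemma el_mk_empty [simp]: "el (mk {}) = {}" by (simp add: el_mk)
lemma mk_el: "is_set M x \<Longrightarrow> mk (el x) = x"
  by (rule set_ext) (simp, simp, subst el_mk, auto simp: small_def)

lemma mk_eqI: "is_set M x \<Longrightarrow> el x = S \<Longrightarrow> x = mk S" using mk_el by auto

lemma small_sub_U: "small S \<Longrightarrow> S \<subseteq> U" by (auto simp: small_def dest: el_U)

lemma small_el [simp]: "x \<in> U \<Longrightarrow> small (el x)"
  by (metis el_atom is_set_def small_empty smallI)

lemma small_iff: "small T \<longleftrightarrow> (\<exists>x\<in>U. is_set M x \<and> el x = T)"
  unfolding small_def using set_U by blast

lemma eq_mk_iff: "y = mk T \<longleftrightarrow> is_set M y \<and> (el y = T \<or> \<not> small T \<and> el y = {})"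
proof
  assume "y = mk T" then show "is_set M y \<and> (el y = T \<or> \<not> small T \<and> el y = {})"
    using mk_props[of T] by auto
next
  assume y: "is_set M y \<and> (el y = T \<or> \<not> small T \<and> el y = {})"
  show "y = mk T"
  proof (rule set_ext)
    show "el y = el (mk T)"
      using y mk_props(2)[of T] smallI[of y T] by argo
  qed (use y in simp_all)
qed

lemma Tm_mk: assumes S: "Ds S" shows "Tm (\<lambda>e. mk (S e))"
  unfolding Tm_def
proof (intro conjI allI impI)
  let ?S = "\<lambda>e. S (\<lambda>i. e (Suc i))"
  have "D (\<lambda>e. is_set M (e 0) \<and> (el (e 0) = ?S e \<or>
      \<not> (\<exists>x\<in>U. is_set M x \<and> el x = ?S e) \<and> el (e 0) = {}))"
    by (intro D_conj D_disj D_neg D_ex D_set_eq Ds_elts Ds_empty Tm_var D_is_set Ds_shift[OF Ds_shift[OF S]] Ds_shift[OF S])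
  then show "D (\<lambda>e. e 0 = mk (?S e))"
  proof (rule D_eqI)
    fix e assume e: "env e"
    show "(is_set M (e 0) \<and> (el (e 0) = ?S e \<or>
      \<not> (\<exists>x\<in>U. is_set M x \<and> el x = ?S e) \<and> el (e 0) = {})) = (e 0 = mk (?S e))"
      by (simp only: eq_mk_iff small_iff)
  qed
qed simp

text \<open>A total form of the definite description, as the latter is unspecified on junk.\<close>

definition tot :: "('m \<Rightarrow> bool) \<Rightarrow> 'm" where
  "tot P = (if \<exists>!y. y \<in> U \<and> P y then THE y. y \<in> U \<and> P y else mk {})"

lemma tot_U [simp]: "tot P \<in> U"
proof (cases "\<exists>!y. y \<in> U \<and> P y")
  case True from theI'[OF this] show ?thesis by (simp add: tot_def True)
next
  case False then show ?thesis unfolding tot_def by (simp only: if_False mk_U)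
qed

lemma tot_eqI: "y \<in> U \<Longrightarrow> P y \<Longrightarrow> (\<And>z. z \<in> U \<Longrightarrow> P z \<Longrightarrow> z = y) \<Longrightarrow> tot P = y"
  unfolding tot_def by (subst if_P) (blast, rule the_equality, blast+)

lemma tot_prop: "\<exists>!y. y \<in> U \<and> P y \<Longrightarrow> P (tot P)"
  using tot_eqI by metis

lemma eq_tot_iff: "x = tot P \<longleftrightarrow> (\<exists>y\<in>U. (P y \<and> (\<forall>z\<in>U. P z \<longrightarrow> z = y)) \<and> x = y) \<or>
    \<not> (\<exists>y\<in>U. P y \<and> (\<forall>z\<in>U. P z \<longrightarrow> z = y)) \<and> x = mk {}"
proof (cases "\<exists>y\<in>U. P y \<and> (\<forall>z\<in>U. P z \<longrightarrow> z = y)")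
  case True
  then obtain y where y: "y \<in> U" "P y" "\<And>z. z \<in> U \<Longrightarrow> P z \<Longrightarrow> z = y" by blast
  then have "tot P = y" by (rule tot_eqI)
  with y show ?thesis by blast
next
  case False
  then have "tot P = mk {}" unfolding tot_def by (subst if_not_P) blast+
  then show ?thesis using False by (simp only:) blast
qed

lemma Tm_tot: assumes P: "D (\<lambda>e. P (e 0) (\<lambda>i. e (Suc i)))" shows "Tm (\<lambda>e. tot (\<lambda>y. P y e))"
  unfolding Tm_def
proof (intro conjI allI impI)
  have i: "inj (\<lambda>i. if i = 0 then 0 else Suc i)" "inj (\<lambda>i. if i = 0 then 0 else Suc (Suc i))" by (auto simp: inj_def)
  have 1: "D (\<lambda>e. P (e 0) (\<lambda>i. e (Suc (Suc i))))" using D_rename[OF i(1) P] by simp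
  have 2: "D (\<lambda>e. P (e 0) (\<lambda>i. e (Suc (Suc (Suc i)))))" using D_rename[OF i(2) P] by simp
  let ?Q = "\<lambda>y e. P y (\<lambda>i. e (Suc i)) \<and> (\<forall>z\<in>U. P z (\<lambda>i. e (Suc i)) \<longrightarrow> z = y)"
  have "D (\<lambda>e. (\<exists>y\<in>U. ?Q y e \<and> e 0 = y) \<or> \<not> (\<exists>y\<in>U. ?Q y e) \<and> e 0 = mk {})"
    by (intro dfn 1 2 mk_U)
  then show "D (\<lambda>e. e 0 = tot (\<lambda>y. P y (\<lambda>i. e (Suc i))))"
  proof (rule D_eqI)
    fix e assume e: "env e"
    show "((\<exists>y\<in>U. ?Q y e \<and> e 0 = y) \<or> \<not> (\<exists>y\<in>U. ?Q y e) \<and> e 0 = mk {}) = (e 0 = tot (\<lambda>y. P y (\<lambda>i. e (Suc i))))"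
      by (rule eq_tot_iff[symmetric])
  qed
qed simp

lemma env_upd: "env e \<Longrightarrow> x \<in> U \<Longrightarrow> env (e(i := x))"
  by (auto simp: env_def)

lemma small_Collect: assumes "small S" "D (\<lambda>e. P (e 0))" shows "small {x \<in> S. P x}"
proof -
  obtain x where x: "is_set M x" "el x = S" using assms(1) by (rule smallE)
  obtain \<phi> p where p: "env p" "\<And>e q. env e \<Longrightarrow> env q \<Longrightarrow> (sat M (ilv e p q) \<phi> \<longleftrightarrow> P (e 0))"
    using assms(2) unfolding D_def by blast
  have "range (ilv p p p) \<subseteq> U" using p(1) by (auto simp: env_def ilv_def)
  then obtain y where y: "is_set M y" "el y = {z \<in> el x. sat M ((ilv p p p)(0 := z)) \<phi>}"
    using ZFA set_U[OF x(1)] unfolding ZFA_def ax_separation_def by blast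
  have "(ilv p p p)(0 := z) = ilv (p(0 := z)) p p" for z by (auto simp: fun_eq_iff ilv_def)
  with p have "sat M ((ilv p p p)(0 := z)) \<phi> \<longleftrightarrow> P z" if "z \<in> U" for z
    using p(2)[OF env_upd[OF p(1) that] p(1)] by simp
  with y x have "el y = {x \<in> S. P x}" using el_U by blast
  with y(1) show ?thesis by (rule smallI)
qed

lemma small_subset: assumes "small S" "T \<subseteq> S" "Ds (\<lambda>e. T)" shows "small T"
proof -
  have "small {x \<in> S. x \<in> T}"
    by (rule small_Collect[OF assms(1)]) (use assms(3) in \<open>simp add: Ds_def\<close>)
  moreover have "{x \<in> S. x \<in> T} = T" using assms(2) by blast
  ultimately show ?thesis by simp
qed

lemma small_image: assumes F: "Tm (\<lambda>e. F (e 0))" and S: "small S" shows "small (F ` S)"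
proof -
  obtain x where x: "is_set M x" "el x = S" using S by (rule smallE)
  have "D (\<lambda>e. e 0 = F (e (Suc 0)))" using F by (simp add: Tm_def)
  then obtain \<phi> p where p: "env p" "\<And>e q. env e \<Longrightarrow> env q \<Longrightarrow> (sat M (ilv e p q) \<phi> \<longleftrightarrow> e 0 = F (e (Suc 0)))"
    unfolding D_def by blast
  \<comment> \<open>The schema has the argument in variable 0 and the value in variable 1, while the
    graph of \<open>F\<close> has the value in 0 and the argument in 3. Parameter 0 is thereby
    displaced from variable 1 and is kept in variable 3.\<close>
  define f where "f n = (if n = 0 then 1 else if n = 3 then 0 else if n = 1 then 3 else n)" for n :: nat
  have "inj f" by (auto simp: f_def inj_def split: if_splits)
  let ?s = "(\<lambda>n. if n = 3 then p 0 else ilv p p p n) :: nat \<Rightarrow> 'm"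
  have eq: "(?s(0 := z, 1 := v)) \<circ> f = ilv (p(0 := v, Suc 0 := z)) p p" for z v
  proof
    fix n show "((?s(0 := z, 1 := v)) \<circ> f) n = ilv (p(0 := v, Suc 0 := z)) p p n"
      by (auto simp: f_def ilv_def)
  qed
  have sat: "sat M (?s(0 := z, 1 := v)) (rename_fm f \<phi>) \<longleftrightarrow> v = F z" if "z \<in> U" "v \<in> U" for z v
    unfolding sat_rename_fm[OF \<open>inj f\<close>] eq using p(2)[OF env_upd[OF env_upd[OF p(1) that(2), of 0] that(1), of "Suc 0"] p(1)]
    by simp
  have r: "range ?s \<subseteq> U" using p(1) by (auto simp: env_def ilv_def)
  have "\<forall>z\<in>el x. \<forall>v\<in>U. \<forall>v'\<in>U.
        sat M (?s(0 := z, 1 := v)) (rename_fm f \<phi>) \<and> sat M (?s(0 := z, 1 := v')) (rename_fm f \<phi>) \<longrightarrow> v = v'"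
    using sat el_U by metis
  moreover have "ax_replacement M" using ZFA by (simp add: ZFA_def)
  note this[unfolded ax_replacement_def, rule_format, OF r set_U[OF x(1)], of "rename_fm f \<phi>"]
  ultimately obtain y where y: "is_set M y" "el y = {v \<in> U. \<exists>z\<in>el x. sat M (?s(0 := z, 1 := v)) (rename_fm f \<phi>)}"
    by blast
  have "el y = F ` S"
    unfolding y(2) x(2) using sat small_sub_U[OF S] Tm_U1[OF F] by blast
  with y(1) show ?thesis by (rule smallI)
qed


declare D_is_set [df] Tm_mk [df] Tm_tot [df] mk_U [df] tot_U [df] At_U [df]

lemma small_insert: assumes "x \<in> U" "small S" shows "small (insert x S)"
proof -
  obtain y where y: "is_set M y" "el y = S" using assms(2) by (rule smallE)
  have up: "\<exists>p. is_set M p \<and> el p = {a, b}" if "a \<in> U" "b \<in> U" for a b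
    using ZFA that unfolding ZFA_def ax_pairing_def is_upair_def by blast
  obtain q where q: "is_set M q" "el q = {x, x}" using up assms(1) by blast
  obtain r where r: "is_set M r" "el r = {y, q}" using up set_U y(1) q(1) by blast
  obtain u where u: "is_set M u" "el u = (\<Union>z\<in>el r. el z)"
    using ZFA set_U[OF r(1)] unfolding ZFA_def ax_union_def by blast
  have "el u = insert x S" using u(2) r(2) q(2) y(2) by auto
  with u(1) show ?thesis by (rule smallI)
qed

lemma small_Union: assumes "small S" shows "small (\<Union>x\<in>S. el x)"
proof -
  obtain y where y: "is_set M y" "el y = S" using assms by (rule smallE)
  obtain u where u: "is_set M u" "el u = (\<Union>z\<in>el y. el z)"
    using ZFA set_U[OF y(1)] unfolding ZFA_def ax_union_def by blast
  then show ?thesis using y by (auto intro: smallI)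
qed

lemma small_UN: assumes "small S" "Tm (\<lambda>e. F (e 0))" shows "small (\<Union>x\<in>S. el (F x))"
  using small_Union[OF small_image[OF assms(2,1)]] by simp

lemma small_Un: assumes "small S" "small T" shows "small (S \<union> T)"
proof -
  obtain y z where y: "is_set M y" "el y = S" and z: "is_set M z" "el z = T"
    using assms by (metis smallE)
  have "small {y, z}" using set_U y z by (intro small_insert) auto
  from small_Union[OF this] y z show ?thesis by simp
qed

lemma small_Pow: assumes "x \<in> U" shows "small {y. is_set M y \<and> el y \<subseteq> el x}"
  using ZFA assms unfolding ZFA_def ax_power_def by (blast intro: smallI)

section \<open>Kuratowski pairs and functions inside the model\<close>

definition pr :: "'m \<Rightarrow> 'm \<Rightarrow> 'm" where "pr x y = mk {mk {x}, mk {x, y}}"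

lemma pr_U [simp]: "pr x y \<in> U" by (simp add: pr_def)

lemma el_sing: "x \<in> U \<Longrightarrow> el (mk {x}) = {x}" by (simp add: el_mk small_insert)
lemma el_upair: "x \<in> U \<Longrightarrow> y \<in> U \<Longrightarrow> el (mk {x, y}) = {x, y}" by (simp add: el_mk small_insert)

lemma mk_inj: "small S \<Longrightarrow> small T \<Longrightarrow> mk S = mk T \<longleftrightarrow> S = T"
  using el_mk by metis

lemma pr_eq_iff: assumes "x \<in> U" "y \<in> U" "x' \<in> U" "y' \<in> U" shows "pr x y = pr x' y' \<longleftrightarrow> x = x' \<and> y = y'"
proof
  assume "pr x y = pr x' y'"
  then have "{mk {x}, mk {x, y}} = {mk {x'}, mk {x', y'}}"
    unfolding pr_def using assms by (simp add: mk_inj small_insert)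
  then have "({x} = {x'} \<and> {x, y} = {x', y'}) \<or> ({x} = {x', y'} \<and> {x, y} = {x'})"
    using assms by (simp only: doubleton_eq_iff mk_inj small_insert small_empty)
  then show "x = x' \<and> y = y'" by (auto simp: doubleton_eq_iff)
qed simp

lemma Tm_pr [df]: "Tm t \<Longrightarrow> Tm u \<Longrightarrow> Tm (\<lambda>e. pr (t e) (u e))"
  unfolding pr_def by (intro df)

lemma is_upair_iff: "is_upair M p x y \<longleftrightarrow> p = mk {x, y} \<and> x \<in> U \<and> y \<in> U"
  unfolding is_upair_def using mk_eqI[of p "{x, y}"] el_upair[of x y] el_U[of _ p] by auto

lemma is_opair_iff: "is_opair M p x y \<longleftrightarrow> p = pr x y \<and> x \<in> U \<and> y \<in> U"
  unfolding is_opair_def is_upair_iff pr_def by auto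

lemma rel_iff: "rel M r x y \<longleftrightarrow> x \<in> U \<and> y \<in> U \<and> pr x y \<in> el r"
  unfolding rel_def is_opair_iff by auto

text \<open>A total and definable counterpart of \<open>app\<close>; by \<open>app_ap\<close> the
  two agree on the domain of a function.\<close>

definition ap :: "'m \<Rightarrow> 'm \<Rightarrow> 'm" where "ap f x = tot (\<lambda>y. pr x y \<in> el f)"

lemma ap_U [simp, df]: "ap f x \<in> U" by (simp add: ap_def)
lemma Tm_ap [df]: "Tm t \<Longrightarrow> Tm u \<Longrightarrow> Tm (\<lambda>e. ap (t e) (u e))"
proof (rule Tm_lift2[where f=ap])
  show "Tm (\<lambda>e. ap (e 0) (e (Suc 0)))" unfolding ap_def by (intro df)
qed

text \<open>Puts unique existence into bounded quantifiers, for which closure rules are at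
  hand.\<close>

lemma ex1_U: "(\<exists>!y. y \<in> U \<and> P y) \<longleftrightarrow> (\<exists>y\<in>U. P y \<and> (\<forall>z\<in>U. P z \<longrightarrow> z = y))"
  by blast

lemma is_function_on_iff: "is_function_on M f X \<longleftrightarrow> is_set M f \<and>
   (\<forall>p\<in>el f. \<exists>x\<in>el X. \<exists>y\<in>U. p = pr x y) \<and> (\<forall>x\<in>el X. \<exists>!y. y \<in> U \<and> pr x y \<in> el f)"
  unfolding is_function_on_def is_opair_iff rel_iff using el_U[of _ X] by (intro conj_cong refl) blast+

lemma app_ap: "x \<in> el X \<Longrightarrow> is_function_on M f X \<Longrightarrow> app M f x = ap f x"
  unfolding app_def ap_def tot_def rel_iff is_function_on_iff using el_U[of x X] by simp

lemma D_is_function_on [df]: "Tm t \<Longrightarrow> Tm u \<Longrightarrow> D (\<lambda>e. is_function_on M (t e) (u e))"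
proof (rule D_lift2[where R="is_function_on M"])
  show "D (\<lambda>e. is_function_on M (e 0) (e (Suc 0)))" unfolding is_function_on_iff ex1_U
    by (intro df)
qed

end

context zfa begin

lemma Tm_rename: assumes "inj g" "Tm t" shows "Tm (\<lambda>e. t (\<lambda>i. e (g i)))"
proof -
  define u where "u e = t (\<lambda>i. e (g i))" for e
  have "Tm u" unfolding Tm_def
  proof (intro conjI allI impI)
    fix e :: "nat \<Rightarrow> 'm" assume "env e"
    then have "env (\<lambda>i. e (g i))" by (rule env_comp)
    then show "u e \<in> U" unfolding u_def by (rule Tm_U[OF assms(2)])
  next
    have i: "inj (case_nat 0 (\<lambda>i. Suc (g i)))"
    proof (rule injI)
      fix x y assume "case_nat 0 (\<lambda>i. Suc (g i)) x = case_nat 0 (\<lambda>i. Suc (g i)) y"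
      then show "x = y" using injD[OF assms(1)] by (cases x; cases y) auto
    qed
    have "D (\<lambda>e. e 0 = t (\<lambda>i. e (Suc i)))" using assms(2) by (simp add: Tm_def)
    from D_rename[OF i this] show "D (\<lambda>e. e 0 = u (\<lambda>i. e (Suc i)))" unfolding u_def by simp
  qed
  then show ?thesis unfolding u_def .
qed

lemma Tm_subst: assumes t: "Tm t" and f: "Tm (\<lambda>e. f (e 0) (\<lambda>i. e (Suc i)))" shows "Tm (\<lambda>e. f (t e) e)"
  unfolding Tm_def
proof (intro conjI allI impI)
  fix e assume e: "env e"
  then have "env (case_nat (t e) e)" using Tm_U[OF t] by (simp add: env_cons)
  from Tm_U[OF f this] show "f (t e) e \<in> U" by simp
next
  have "D (\<lambda>e. e 0 = f (e (Suc 0)) (\<lambda>i. e (Suc (Suc i))))" using f by (simp add: Tm_def)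
  moreover have "inj (\<lambda>i. if i = 0 then Suc 0 else if i = Suc 0 then 0 else i)" by (auto simp: inj_def)
  ultimately have "D (\<lambda>e. e (Suc 0) = f (e 0) (\<lambda>i. e (Suc (Suc i))))"
    using D_rename[of "\<lambda>i. if i = 0 then Suc 0 else if i = Suc 0 then 0 else i" "\<lambda>e. e 0 = f (e (Suc 0)) (\<lambda>i. e (Suc (Suc i)))"]
    by simp
  then show "D (\<lambda>e. e 0 = f (t (\<lambda>i. e (Suc i))) (\<lambda>i. e (Suc i)))"
    by (rule D_subst[OF Tm_shift[OF t], where P="\<lambda>x e. e 0 = f x (\<lambda>i. e (Suc i))"])
qed

text \<open>The usual source of functions of \<open>M\<close>: replacement turns the graph of a
  definable operation on a set into a set.\<close>

definition gr :: "('m \<Rightarrow> 'm) \<Rightarrow> 'm \<Rightarrow> 'm" where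
  "gr F X = mk ((\<lambda>x. pr x (F x)) ` el X)"

lemma gr_U [simp, df]: "gr F X \<in> U" by (simp add: gr_def)

lemma Tm_gr [df]:
  assumes "Tm u" "Tm (\<lambda>e. F (e 0) (\<lambda>i. e (Suc i)))"
  shows "Tm (\<lambda>e. gr (\<lambda>x. F x e) (u e))"
  unfolding gr_def by (intro df assms)

lemma el_gr: assumes "Tm (\<lambda>e. F (e 0))" "X \<in> U" shows "el (gr F X) = (\<lambda>x. pr x (F x)) ` el X"
  unfolding gr_def by (intro el_mk small_image df assms small_el)

lemma gr_ap:
  assumes F: "Tm (\<lambda>e. F (e 0))" and X: "X \<in> U"
  shows gr_fun: "is_function_on M (gr F X) X" and ap_gr: "x \<in> el X \<Longrightarrow> ap (gr F X) x = F x"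
proof -
  have *: "pr x y \<in> el (gr F X) \<longleftrightarrow> y = F x" if "x \<in> el X" "y \<in> U" for x y
    using that el_gr[OF F X] pr_eq_iff el_U[of _ X] Tm_U1[OF F] by auto
  show "is_function_on M (gr F X) X"
    unfolding is_function_on_iff
  proof (intro conjI ballI)
    show "is_set M (gr F X)" by (simp add: gr_def)
    fix p assume "p \<in> el (gr F X)"
    then show "\<exists>x\<in>el X. \<exists>y\<in>U. p = pr x y"
      unfolding el_gr[OF F X] using el_U[of _ X] Tm_U1[OF F] by blast
  next
    fix x assume x: "x \<in> el X"
    show "\<exists>!y. y \<in> U \<and> pr x y \<in> el (gr F X)"
      by (rule ex1I[of _ "F x"]) (use * x el_U[OF x] Tm_U1[OF F] in auto)
  qed
  show "ap (gr F X) x = F x" if x: "x \<in> el X"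
    unfolding ap_def by (rule tot_eqI) (use * x el_U[OF x] Tm_U1[OF F] in auto)
qed

lemma ap_iff: "is_function_on M f X \<Longrightarrow> x \<in> el X \<Longrightarrow> y \<in> U \<Longrightarrow> pr x y \<in> el f \<longleftrightarrow> ap f x = y"
  unfolding is_function_on_iff ap_def using tot_prop[of "\<lambda>y. pr x y \<in> el f"] tot_eqI[of y "\<lambda>y. pr x y \<in> el f"]
  by blast

lemma fun_el: assumes "is_function_on M f X" shows "el f = (\<lambda>x. pr x (ap f x)) ` el X"
proof (intro set_eqI iffI)
  fix p assume p: "p \<in> el f"
  then obtain x y where xy: "x \<in> el X" "y \<in> U" "p = pr x y" using assms unfolding is_function_on_iff by blast
  then show "p \<in> (\<lambda>x. pr x (ap f x)) ` el X" using ap_iff[OF assms xy(1,2)] p by auto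
next
  fix p assume "p \<in> (\<lambda>x. pr x (ap f x)) ` el X"
  then show "p \<in> el f" using ap_iff[OF assms] by auto
qed

lemma fun_ext: assumes "is_function_on M f X" "is_function_on M g X" "\<And>x. x \<in> el X \<Longrightarrow> ap f x = ap g x"
  shows "f = g"
proof (rule set_ext)
  show "is_set M f" "is_set M g" using assms by (auto simp: is_function_on_iff)
  show "el f = el g" using fun_el[OF assms(1)] fun_el[OF assms(2)] assms(3) by auto
qed

lemma is_map_iff: "is_map M f X Y \<longleftrightarrow> is_function_on M f X \<and> (\<forall>x\<in>el X. ap f x \<in> el Y)"
  unfolding is_map_def using app_ap[of _ X f] by auto

lemma inj_app: "is_function_on M f X \<Longrightarrow> inj_on (app M f) (el X) \<longleftrightarrow> inj_on (ap f) (el X)"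
  by (rule inj_on_cong) (rule app_ap)

lemma is_injection_iff: "is_injection M f X Y \<longleftrightarrow> is_function_on M f X \<and> (\<forall>x\<in>el X. ap f x \<in> el Y) \<and> inj_on (ap f) (el X)"
  unfolding is_injection_def is_map_iff using inj_app by blast

lemma is_bijection_iff: "is_bijection M f X Y \<longleftrightarrow> is_function_on M f X \<and> bij_betw (ap f) (el X) (el Y)"
  unfolding is_bijection_def is_map_iff using bij_betw_cong[of "el X" "app M f" "ap f"] app_ap[of _ X f]
  by (auto simp: bij_betw_def)

lemma fun_U: "is_function_on M f X \<Longrightarrow> f \<in> U"
  unfolding is_function_on_iff using set_U by blast

section \<open>Comparison of cardinalities\<close>

lemma card_leE:
  assumes "card_le M X Y"
  obtains f where "f \<in> U" "is_function_on M f X" "\<And>x. x \<in> el X \<Longrightarrow> ap f x \<in> el Y" "inj_on (ap f) (el X)"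
  using assms unfolding card_le_def is_injection_iff by blast

lemma card_eqE:
  assumes "card_eq M X Y"
  obtains f where "f \<in> U" "is_function_on M f X" "bij_betw (ap f) (el X) (el Y)"
  using assms unfolding card_eq_def is_bijection_iff by blast

lemma card_leI:
  assumes "Tm (\<lambda>e. F (e 0))" "X \<in> U" "\<And>x. x \<in> el X \<Longrightarrow> F x \<in> el Y" "inj_on F (el X)"
  shows "card_le M X Y"
  unfolding card_le_def is_injection_iff
proof (intro bexI[of _ "gr F X"] conjI ballI)
  show "is_function_on M (gr F X) X" by (rule gr_fun assms)+
  show "inj_on (ap (gr F X)) (el X)"
    using assms(4) ap_gr[OF assms(1,2)] inj_on_cong[of "el X" "ap (gr F X)" F] by blast
  show "x \<in> el X \<Longrightarrow> ap (gr F X) x \<in> el Y" for x using ap_gr[OF assms(1,2)] assms(3) by simp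
qed simp

lemma card_eqI:
  assumes "Tm (\<lambda>e. F (e 0))" "X \<in> U" "bij_betw F (el X) (el Y)"
  shows "card_eq M X Y"
  unfolding card_eq_def is_bijection_iff
proof (intro bexI[of _ "gr F X"] conjI)
  show "is_function_on M (gr F X) X" by (rule gr_fun assms)+
  show "bij_betw (ap (gr F X)) (el X) (el Y)"
    using assms(3) ap_gr[OF assms(1,2)] bij_betw_cong[of "el X" "ap (gr F X)" F] by blast
qed simp

lemma D_card_le [df]: "Tm t \<Longrightarrow> Tm u \<Longrightarrow> D (\<lambda>e. card_le M (t e) (u e))"
proof (rule D_lift2[where R="card_le M"])
  show "D (\<lambda>e. card_le M (e 0) (e (Suc 0)))"
    unfolding card_le_def is_injection_iff inj_on_def by (intro df)
qed

lemma card_le_trans: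
  assumes "card_le M X Y" "card_le M Y Z" "X \<in> U" shows "card_le M X Z"
proof -
  obtain f where f: "f \<in> U" "is_function_on M f X" "\<And>x. x \<in> el X \<Longrightarrow> ap f x \<in> el Y" "inj_on (ap f) (el X)"
    using assms(1) by (rule card_leE) blast
  obtain g where g: "g \<in> U" "is_function_on M g Y" "\<And>x. x \<in> el Y \<Longrightarrow> ap g x \<in> el Z" "inj_on (ap g) (el Y)"
    using assms(2) by (rule card_leE) blast
  show ?thesis
  proof (rule card_leI[where F="\<lambda>x. ap g (ap f x)"])
    show "Tm (\<lambda>e. ap g (ap f (e 0)))" by (intro df f g)
    show "inj_on (\<lambda>x. ap g (ap f x)) (el X)" using f(3,4) g(4) by (auto simp: inj_on_def)
  qed (use f g assms in auto)
qed

lemma card_le_subset: "X \<in> U \<Longrightarrow> el X \<subseteq> el Y \<Longrightarrow> card_le M X Y"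
  by (rule card_leI[where F="\<lambda>x. x"]) (auto intro: df)


section \<open>The natural numbers of the model\<close>

abbreviation om :: 'm where "om \<equiv> omega M"
abbreviation ze :: 'm where "ze \<equiv> mk {}"
definition sc :: "'m \<Rightarrow> 'm" where "sc x = mk (insert x (el x))"

lemma sc_U [simp]: "sc x \<in> U" and set_sc [simp]: "is_set M (sc x)" by (simp_all add: sc_def)
lemma el_sc: "x \<in> U \<Longrightarrow> el (sc x) = insert x (el x)" by (simp add: sc_def el_mk small_insert)
lemma Tm_sc [df]: "Tm t \<Longrightarrow> Tm (\<lambda>e. sc (t e))" unfolding sc_def by (intro df)

lemma is_empty_iff: "is_empty M x \<longleftrightarrow> x = ze"
  unfolding is_empty_def using mk_eqI[of x "{}"] by auto

lemma is_succ_iff: "x \<in> U \<Longrightarrow> is_succ M y x \<longleftrightarrow> y = sc x"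
  unfolding is_succ_def using mk_eqI[of y "insert x (el x)"] el_sc[of x] sc_def by auto

lemma zero_eq: "zero M = ze"
  unfolding zero_def is_empty_iff by simp

lemma succ_eq: "x \<in> U \<Longrightarrow> succ M x = sc x"
  unfolding succ_def by (simp add: is_succ_iff)

lemma is_inductive_iff: "is_inductive M i \<longleftrightarrow> is_set M i \<and> ze \<in> el i \<and> (\<forall>x\<in>el i. sc x \<in> el i)"
  unfolding is_inductive_def is_empty_iff using is_succ_iff[OF el_U[of _ i]] by auto

lemma D_is_inductive: "Tm t \<Longrightarrow> D (\<lambda>e. is_inductive M (t e))"
  unfolding is_inductive_iff 
proof (rule D_lift1[where R="\<lambda>i. is_set M i \<and> ze \<in> el i \<and> (\<forall>x\<in>el i. sc x \<in> el i)"])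
  show "D (\<lambda>e. is_set M (e 0) \<and> ze \<in> el (e 0) \<and> (\<forall>x\<in>el (e 0). sc x \<in> el (e 0)))"
    by (intro df)
qed

lemma omega_props: "is_inductive M om" "\<And>i. is_inductive M i \<Longrightarrow> el om \<subseteq> el i"
proof -
  obtain i where i: "is_inductive M i" using ZFA unfolding ZFA_def ax_infinity_def by blast
  \<comment> \<open>The least inductive set is cut out of an arbitrary one, so that separation
    applies.\<close>
  define w where "w = mk {n \<in> el i. \<forall>j\<in>U. is_inductive M j \<longrightarrow> n \<in> el j}"
  have "i \<in> U" using i by (simp add: is_inductive_def set_U)
  then have "small {n \<in> el i. \<forall>j\<in>U. is_inductive M j \<longrightarrow> n \<in> el j}"
    by (intro small_Collect small_el df D_is_inductive)
  then have w: "el w = {n \<in> el i. \<forall>j\<in>U. is_inductive M j \<longrightarrow> n \<in> el j}" by (simp add: w_def el_mk)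
  have "is_inductive M w"
    unfolding is_inductive_iff w using i by (auto simp: w_def is_inductive_iff)
  moreover have le: "el w \<subseteq> el j" if "is_inductive M j" for j
    using that unfolding w by (auto simp: is_inductive_def set_U)
  ultimately have *: "is_inductive M w \<and> (\<forall>i\<in>univ M. is_inductive M i \<longrightarrow> elts M w \<subseteq> elts M i)" by blast
  have "om = w" unfolding omega_def
  proof (rule the_equality)
    show "is_inductive M w \<and> (\<forall>i\<in>univ M. is_inductive M i \<longrightarrow> elts M w \<subseteq> elts M i)" by (rule *)
  next
    fix v assume v: "is_inductive M v \<and> (\<forall>i\<in>univ M. is_inductive M i \<longrightarrow> elts M v \<subseteq> elts M i)"
    then have "el v = el w" using * by (metis set_U is_inductive_def subset_antisym)
    then show "v = w" using v * by (intro set_ext) (auto simp: is_inductive_def)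
  qed
  then show "is_inductive M om" "\<And>i. is_inductive M i \<Longrightarrow> el om \<subseteq> el i" using * le by auto
qed

lemma set_om [simp]: "is_set M om" and ze_om [simp]: "ze \<in> el om" and sc_om [simp]: "n \<in> el om \<Longrightarrow> sc n \<in> el om"
  using omega_props(1) unfolding is_inductive_iff by blast+

lemma om_U [simp, df]: "om \<in> U" using set_U by simp

text \<open>By separation the numbers with property \<open>P\<close> form an inductive set. An
  undefinable \<open>P\<close> could single out a proper initial segment of a nonstandard
  \<omega>.\<close>

lemma om_induct [consumes 1, case_names D zero Suc]:
  assumes "n \<in> el om" "D (\<lambda>e. P (e 0))" "P ze" "\<And>n. n \<in> el om \<Longrightarrow> P n \<Longrightarrow> P (sc n)"
  shows "P n"
proof -
  let ?S = "{n \<in> el om. P n}"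
  have S: "small ?S" by (rule small_Collect) (use assms in auto)
  have "is_inductive M (mk ?S)"
    unfolding is_inductive_iff el_mk[OF S] using assms by auto
  from omega_props(2)[OF this] assms(1) show ?thesis unfolding el_mk[OF S] by blast
qed

lemma foundation: assumes "small S" "S \<noteq> {}" obtains y where "y \<in> S" "el y \<inter> S = {}"
proof -
  obtain x where x: "is_set M x" "el x = S" using assms(1) by (rule smallE)
  then have "\<exists>y\<in>el x. el y \<inter> el x = {}"
    using ZFA assms(2) set_U[OF x(1)] unfolding ZFA_def ax_foundation_def by blast
  with that x show ?thesis by blast
qed

lemma not_self: "x \<notin> el x"
proof
  assume x: "x \<in> el x"
  then have "small {x}" using el_U by (intro small_insert) auto
  then show False by (rule foundation) (use x in auto)
qed

lemma no_2cycle: "x \<in> el y \<Longrightarrow> y \<notin> el x"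
proof
  assume x: "x \<in> el y" "y \<in> el x"
  then have "small {x, y}" using el_U by (intro small_insert) auto
  then show False by (rule foundation) (use x in auto)
qed

text \<open>If \<open>x\<close> and \<open>y\<close> differed, each would be an element of the
  other, which foundation excludes.\<close>

lemma sc_inj: "x \<in> U \<Longrightarrow> y \<in> U \<Longrightarrow> sc x = sc y \<longleftrightarrow> x = y"
  using el_sc[of x] el_sc[of y] no_2cycle[of x y] by (metis insertE insertI1)

lemma sc_ne_ze [simp]: "x \<in> U \<Longrightarrow> sc x \<noteq> ze" "x \<in> U \<Longrightarrow> ze \<noteq> sc x"
  using el_mk_empty el_sc empty_not_insert by metis+

lemma sc_ne [simp]: "x \<in> U \<Longrightarrow> sc x \<noteq> x" "x \<in> U \<Longrightarrow> x \<noteq> sc x"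
  using not_self el_sc insertI1 by metis+

lemma om_cases: assumes "n \<in> el om" obtains "n = ze" | m where "m \<in> el om" "n = sc m"
proof -
  have "n = ze \<or> (\<exists>m\<in>el om. n = sc m)"
    using assms by (rule om_induct) (auto intro!: df)
  with that show ?thesis by blast
qed

lemma om_el_U [simp]: "n \<in> el om \<Longrightarrow> n \<in> U" by (rule el_U)

lemma om_trans: "n \<in> el om \<Longrightarrow> el n \<subseteq> el om"
  by (erule om_induct[where P="\<lambda>n. el n \<subseteq> el om"]) (auto simp: el_sc intro!: df)

lemma om_el: "n \<in> el om \<Longrightarrow> m \<in> el n \<Longrightarrow> m \<in> el om" using om_trans by blast

lemma nat_trans: assumes "n \<in> el om" "m \<in> el n" shows "el m \<subseteq> el n"
proof -
  have "\<forall>m\<in>el n. el m \<subseteq> el n"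
    using assms(1) by (rule om_induct[where P="\<lambda>n. \<forall>m\<in>el n. el m \<subseteq> el n"]) (auto simp: el_sc intro!: df)
  with assms show ?thesis by blast
qed

lemma ze_le: "n \<in> el om \<Longrightarrow> n = ze \<or> ze \<in> el n"
  by (erule om_induct[where P="\<lambda>n. n = ze \<or> ze \<in> el n"]) (auto simp: el_sc intro!: df)

lemma sc_mono: assumes "n \<in> el om" "m \<in> el n" shows "sc m \<in> el (sc n)"
proof -
  have "\<forall>m\<in>el n. sc m \<in> el (sc n)"
    using assms(1) 
  proof (rule om_induct[where P="\<lambda>n. \<forall>m\<in>el n. sc m \<in> el (sc n)"])
    show "D (\<lambda>e. \<forall>m\<in>el (e 0). sc m \<in> el (sc (e 0)))" by (intro df)
  qed (auto simp: el_sc)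
  with assms show ?thesis by blast
qed

lemma nat_linear: assumes "n \<in> el om" "m \<in> el om" shows "m \<in> el n \<or> m = n \<or> n \<in> el m"
  using assms(1)
proof (rule om_induct[where P="\<lambda>n. m \<in> el n \<or> m = n \<or> n \<in> el m"])
  show "D (\<lambda>e. m \<in> el (e 0) \<or> m = e 0 \<or> e 0 \<in> el m)" by (intro df) (use assms in auto)
  show "m \<in> el ze \<or> m = ze \<or> ze \<in> el m" using ze_le assms(2) by blast
  fix n assume n: "n \<in> el om" "m \<in> el n \<or> m = n \<or> n \<in> el m"
  then show "m \<in> el (sc n) \<or> m = sc n \<or> sc n \<in> el m"
    using sc_mono[OF assms(2), of n] el_sc[of n] el_sc[of m] assms(2) by auto
qed

text \<open>Foundation gives an \<in>-minimal number with the property, and linearity makes it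
  least.\<close>

lemma nat_least:
  assumes "D (\<lambda>e. P (e 0))" "n \<in> el om" "P n"
  obtains m where "m \<in> el om" "P m" "\<And>k. k \<in> el om \<Longrightarrow> P k \<Longrightarrow> k = m \<or> m \<in> el k"
proof -
  have "small {n \<in> el om. P n}" by (rule small_Collect) (use assms in auto)
  moreover have "{n \<in> el om. P n} \<noteq> {}" using assms by blast
  ultimately obtain m where m: "m \<in> {n \<in> el om. P n}" "el m \<inter> {n \<in> el om. P n} = {}" by (rule foundation)
  have "k = m \<or> m \<in> el k" if "k \<in> el om" "P k" for k
    using nat_linear[of m k] m that by blast
  with m that show ?thesis by blast
qed

subsection \<open>Recursion\<close>

text \<open>An approximation to the recursion; its domain \<open>sc n\<close> consists of the
  numbers up to and including \<open>n\<close>.\<close>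

definition nrec_fun :: "'m \<Rightarrow> ('m \<Rightarrow> 'm) \<Rightarrow> 'm \<Rightarrow> 'm \<Rightarrow> bool" where
  "nrec_fun a F n g \<longleftrightarrow> is_function_on M g (sc n) \<and> ap g ze = a \<and> (\<forall>m\<in>el n. ap g (sc m) = F (ap g m))"

text \<open>The value is read off from an approximation that is an element of \<open>M\<close>. This
  makes iteration along a possibly nonstandard \<omega> definable.\<close>

definition nrec :: "'m \<Rightarrow> ('m \<Rightarrow> 'm) \<Rightarrow> 'm \<Rightarrow> 'm" where
  "nrec a F n = tot (\<lambda>k. \<exists>g\<in>U. nrec_fun a F n g \<and> ap g n = k)"

lemma nrec_U [simp, df]: "nrec a F n \<in> U" by (simp add: nrec_def)

lemma Tm_nrec [df]:
  assumes "Tm a" "Tm n" and F: "Tm (\<lambda>e. F (e 0) (\<lambda>i. e (Suc i)))"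
  shows "Tm (\<lambda>e. nrec (a e) (\<lambda>x. F x e) (n e))"
proof -
  have i: "inj (case_nat 0 (\<lambda>i. Suc (Suc (Suc (Suc i)))))" by (auto simp: inj_def split: nat.splits)
  have f: "Tm (\<lambda>e. F (ap (e (Suc 0)) (e 0)) (\<lambda>i. e (Suc (Suc (Suc i)))))"
    by (rule Tm_subst[where f="\<lambda>x e. F x (\<lambda>i. e (Suc (Suc (Suc i))))"])
      (use Tm_rename[OF i F] in \<open>auto intro: df\<close>)
  show ?thesis unfolding nrec_def nrec_fun_def
    by (intro df f Tm_shift[OF Tm_shift[OF Tm_shift]] Tm_shift[OF Tm_shift] assms(1,2))
qed

lemma nrec_unique:
  assumes F: "Tm (\<lambda>e. F (e 0))" and n: "n \<in> el om" "n' \<in> el om" and g: "nrec_fun a F n g" and g': "nrec_fun a F n' g'" 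
    and k: "k \<in> el (sc n)" "k \<in> el (sc n')"
  shows "ap g k = ap g' k"
proof -
  have gU: "g \<in> U" "g' \<in> U" using g g' fun_U unfolding nrec_fun_def by blast+
  have kom: "k \<in> el om" using k n om_el[of n k] by (auto simp: el_sc)
  have "k \<in> el (sc n) \<longrightarrow> k \<in> el (sc n') \<longrightarrow> ap g k = ap g' k"
    using kom
  proof (rule om_induct[where P="\<lambda>k. k \<in> el (sc n) \<longrightarrow> k \<in> el (sc n') \<longrightarrow> ap g k = ap g' k"])
    show "D (\<lambda>e. e 0 \<in> el (sc n) \<longrightarrow> e 0 \<in> el (sc n') \<longrightarrow> ap g (e 0) = ap g' (e 0))"
      by (intro df) (use gU n in auto)
    show "ze \<in> el (sc n) \<longrightarrow> ze \<in> el (sc n') \<longrightarrow> ap g ze = ap g' ze"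
      using g g' by (auto simp: nrec_fun_def)
    fix k assume k: "k \<in> el om" and IH: "k \<in> el (sc n) \<longrightarrow> k \<in> el (sc n') \<longrightarrow> ap g k = ap g' k"
    have *: "k \<in> el m \<and> k \<in> el (sc m)" if "m \<in> el om" "sc k \<in> el (sc m)" for m
      using that nat_trans[OF sc_om[OF that(1)] that(2)] nat_trans[OF that(1), of "sc k"] k
      by (auto simp: el_sc)
    show "sc k \<in> el (sc n) \<longrightarrow> sc k \<in> el (sc n') \<longrightarrow> ap g (sc k) = ap g' (sc k)"
      using *[OF n(1)] *[OF n(2)] IH g g' by (auto simp: nrec_fun_def)
  qed
  with k show ?thesis by blast
qed

lemma nrec_eqI:
  assumes F: "Tm (\<lambda>e. F (e 0))" and n: "n \<in> el om" and g: "nrec_fun a F n g"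
  shows "nrec a F n = ap g n"
  unfolding nrec_def
proof (rule tot_eqI)
  have "g \<in> U" using g fun_U unfolding nrec_fun_def by blast
  then show "\<exists>g'\<in>U. nrec_fun a F n g' \<and> ap g' n = ap g n" using g by blast
  fix z assume "\<exists>g'\<in>U. nrec_fun a F n g' \<and> ap g' n = z"
  then show "z = ap g n" using nrec_unique[OF F n n _ g, of _ n] n by (auto simp: el_sc)
qed simp

lemma nrec_props:
  assumes F: "Tm (\<lambda>e. F (e 0))" and a: "a \<in> U" and n: "n \<in> el om"
  shows "nrec_fun a F n (gr (nrec a F) (sc n))"
proof -
  have N: "Tm (\<lambda>e. nrec a F (e 0))" by (intro df F a)
  have Fs: "Tm (\<lambda>e. F (e (Suc 0)))" by (intro Tm_lift1[OF F] df)
  have grU: "ap (gr (nrec a F) (sc n)) k = nrec a F k" if "k \<in> el (sc n)" for n k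
    using that by (rule ap_gr[OF N sc_U])
  show ?thesis using n
  proof (rule om_induct[where P="\<lambda>n. nrec_fun a F n (gr (nrec a F) (sc n))"])
    show "D (\<lambda>e. nrec_fun a F (e 0) (gr (nrec a F) (sc (e 0))))"
      unfolding nrec_fun_def by (intro df Tm_lift1[OF F] a)
    define g where "g = gr (\<lambda>x. a) (sc ze)"
    have ca: "Tm (\<lambda>e. a)" by (intro df a)
    have g: "nrec_fun a F ze g"
      unfolding nrec_fun_def using gr_fun[OF ca sc_U] ap_gr[OF ca sc_U, of ze ze] by (simp add: g_def el_sc)
    then have "nrec a F ze = a" using nrec_eqI[OF F ze_om g] by (simp add: nrec_fun_def)
    then show "nrec_fun a F ze (gr (nrec a F) (sc ze))"
      unfolding nrec_fun_def using gr_fun[OF N sc_U] grU by (simp add: el_sc)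
  next
    fix n assume n: "n \<in> el om" and IH: "nrec_fun a F n (gr (nrec a F) (sc n))"
    \<comment> \<open>The approximation for \<open>n\<close> is prolonged by one value at
      \<open>sc n\<close>.\<close>
    let ?G = "\<lambda>x. if x = sc n then F (nrec a F n) else nrec a F x"
    define g where "g = gr ?G (sc (sc n))"
    have G: "Tm (\<lambda>e. ?G (e 0))" by (intro df Tm_lift1[OF F] a) (use n in auto)
    have "is_function_on M g (sc (sc n))" unfolding g_def by (rule gr_fun[OF G sc_U])
    moreover have apg: "ap g k = ?G k" if "k \<in> el (sc (sc n))" for k
      unfolding g_def using that by (rule ap_gr[OF G sc_U])
    have z: "ze \<in> el (sc n)" using ze_le[OF n] n by (auto simp: el_sc)
    have z': "ze \<in> el (sc (sc n))" using z by (simp add: el_sc)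
    have 0: "nrec a F ze = a" using IH grU[OF z] by (simp add: nrec_fun_def)
    have "ap g ze = a" using apg[OF z'] 0 n by simp
    moreover have "ap g (sc m) = F (ap g m)" if m: "m \<in> el (sc n)" for m
    proof -
      have mo: "m \<in> el om" using m n om_el[of "sc n" m] by simp
      have sm: "sc m \<in> el (sc (sc n))" using sc_mono[of "sc n" m] m n by simp
      have m2: "m \<in> el (sc (sc n))" using m by (simp add: el_sc)
      have ne: "m \<noteq> sc n" using m not_self by blast
      show ?thesis
      proof (cases "m = n")
        case True then show ?thesis using apg[OF sm] apg[OF m2] ne by simp
      next
        case False
        then have mn: "m \<in> el n" using m n by (auto simp: el_sc)
        have "sc m \<noteq> sc n" using False sc_inj mo n by simp
        moreover have "sc m \<in> el (sc n)" using sc_mono[OF n mn] .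
        moreover have "nrec a F (sc m) = F (nrec a F m)"
          using IH mn grU[OF calculation(2)] grU[OF m] by (simp add: nrec_fun_def)
        ultimately show ?thesis using apg[OF sm] apg[OF m2] ne by simp
      qed
    qed
    ultimately have g: "nrec_fun a F (sc n) g" by (auto simp: nrec_fun_def)
    have "ap g k = nrec a F k" if k: "k \<in> el (sc (sc n))" for k
    proof (cases "k = sc n")
      case True
      then show ?thesis using nrec_eqI[OF F sc_om[OF n] g] by simp
    next
      case False then show ?thesis using apg[OF k] by simp
    qed
    then have "g = gr (nrec a F) (sc (sc n))"
      using gr_fun[OF N sc_U] grU g by (intro fun_ext[of g "sc (sc n)"]) (auto simp: nrec_fun_def)
    with g show "nrec_fun a F (sc n) (gr (nrec a F) (sc (sc n)))" by simp
  qed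
qed

lemma nrec_ze: assumes "Tm (\<lambda>e. F (e 0))" "a \<in> U" shows "nrec a F ze = a"
  using nrec_props[OF assms ze_om] nrec_eqI[OF assms(1) ze_om nrec_props[OF assms ze_om]] by (simp add: nrec_fun_def)

lemma nrec_sc: assumes F: "Tm (\<lambda>e. F (e 0))" and a: "a \<in> U" and n: "n \<in> el om" shows "nrec a F (sc n) = F (nrec a F n)"
proof -
  have N: "Tm (\<lambda>e. nrec a F (e 0))" by (intro df F a)
  have "ap (gr (nrec a F) (sc (sc n))) (sc n) = F (ap (gr (nrec a F) (sc (sc n))) n)"
    using nrec_props[OF F a sc_om[OF n]] n by (simp add: nrec_fun_def el_sc)
  then show ?thesis using n by (simp add: ap_gr[OF N sc_U] el_sc)
qed

end

section \<open>Membership induction and the extension of permutations\<close>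

context zfa begin

section \<open>Transitive closures and membership induction\<close>

definition tcs :: "'m \<Rightarrow> 'm set" where
  \<comment> \<open>Iterated unions along the \<omega> of \<open>M\<close>, starting with the
    elements of \<open>x\<close>; so \<open>x\<close> itself is not included. This form shows that
    the closure is a set of \<open>M\<close>, and \<open>trans_closure_eq\<close> identifies it with
    the intersection used in the definition of the submodel.\<close>
  "tcs x = (\<Union>n\<in>el om. el (nrec x (\<lambda>y. mk (\<Union>z\<in>el y. el z)) n))"

lemma small_tcs [simp]: "x \<in> U \<Longrightarrow> small (tcs x)"
  unfolding tcs_def by (intro small_UN df small_el)

lemma Ds_tcs [df]: "Tm t \<Longrightarrow> Ds (\<lambda>e. tcs (t e))"
proof -
  assume t: "Tm t"
  have "Ds (\<lambda>e. tcs (e 0))" unfolding tcs_def by (intro df)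
  then have "D (\<lambda>e. e 0 \<in> tcs (e (Suc 0)))" by (simp add: Ds_def)
  from D_lift2[where R="\<lambda>x y. x \<in> tcs y", OF this Tm_var[of 0] Tm_shift[OF t]]
  have "D (\<lambda>e. e 0 \<in> tcs (t (\<lambda>i. e (Suc i))))" .
  then show ?thesis by (rule DsI) (auto simp: tcs_def dest: el_U)
qed

lemma D_is_transitive [df]: "Tm t \<Longrightarrow> D (\<lambda>e. is_transitive M (t e))"
proof (rule D_lift1[where R="is_transitive M"])
  show "D (\<lambda>e. is_transitive M (e 0))" unfolding is_transitive_def by (intro df)
qed

lemma
  assumes x: "x \<in> U"
  shows el_sub_tcs: "el x \<subseteq> tcs x"
    and tcs_trans: "y \<in> tcs x \<Longrightarrow> el y \<subseteq> tcs x"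
    and tcs_least: "is_transitive M T \<Longrightarrow> el x \<subseteq> el T \<Longrightarrow> tcs x \<subseteq> el T"
proof -
  let ?F = "\<lambda>y. mk (\<Union>z\<in>el y. el z)"
  have F: "Tm (\<lambda>e. ?F (e 0))" by (intro df)
  have el_F: "el (?F y) = (\<Union>z\<in>el y. el z)" if "y \<in> U" for y
    using small_Union[OF small_el[OF that]] by (rule el_mk)
  note z = nrec_ze[OF F x] and s = nrec_sc[OF F x]
  have up: "el (nrec x ?F n) \<subseteq> tcs x" if "n \<in> el om" for n
    unfolding tcs_def using that by (rule UN_upper)
  show "el x \<subseteq> tcs x" using up[OF ze_om] unfolding z .
  show "el y \<subseteq> tcs x" if y: "y \<in> tcs x"
  proof -
    obtain n where n: "n \<in> el om" "y \<in> el (nrec x ?F n)" using y unfolding tcs_def by (rule UN_E)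
    have "el y \<subseteq> el (nrec x ?F (sc n))" unfolding s[OF n(1)] el_F[OF nrec_U] using n(2) by (rule UN_upper)
    then show ?thesis using up[OF sc_om[OF n(1)]] by (rule subset_trans)
  qed
  assume T: "is_transitive M T" "el x \<subseteq> el T"
  have "el (nrec x ?F n) \<subseteq> el T" if "n \<in> el om" for n
    using that
  proof (rule om_induct[where P="\<lambda>n. el (nrec x ?F n) \<subseteq> el T"])
    show "D (\<lambda>e. el (nrec x ?F (e 0)) \<subseteq> el T)"
      by (intro df x set_U) (use T in \<open>simp add: is_transitive_def\<close>)
    show "el (nrec x ?F ze) \<subseteq> el T" using z T by simp
    fix n assume "n \<in> el om" "el (nrec x ?F n) \<subseteq> el T"
    then show "el (nrec x ?F (sc n)) \<subseteq> el T"
      using T s[of n] el_F[OF nrec_U] unfolding is_transitive_def by auto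
  qed
  then show "tcs x \<subseteq> el T" unfolding tcs_def by (rule UN_least)
qed

lemma el_mk_tcs: "x \<in> U \<Longrightarrow> el (mk (tcs x)) = tcs x" by (simp add: el_mk)

lemma trans_closure_eq: assumes "x \<in> U" shows "trans_closure M x = tcs x"
proof
  have "is_transitive M (mk (tcs x))"
    unfolding is_transitive_def el_mk_tcs[OF assms] using tcs_trans[OF assms] by auto
  then show "trans_closure M x \<subseteq> tcs x"
    unfolding trans_closure_def using el_mk_tcs[OF assms] el_sub_tcs[OF assms] by blast
  show "tcs x \<subseteq> trans_closure M x"
    unfolding trans_closure_def using tcs_least[OF assms] small_sub_U[OF small_tcs[OF assms]] by blast
qed

lemma mem_induct [consumes 1, case_names D step]:
  assumes x: "x \<in> U" and D: "D (\<lambda>e. P (e 0))" and step: "\<And>x. x \<in> U \<Longrightarrow> (\<And>y. y \<in> el x \<Longrightarrow> P y) \<Longrightarrow> P x"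
  shows "P x"
proof (rule ccontr)
  assume nP: "\<not> P x"
  \<comment> \<open>The counterexamples in the transitive closure of \<open>x\<close>, together with
    \<open>x\<close>, form a set, so that foundation yields a minimal one.\<close>
  let ?S = "{y \<in> insert x (tcs x). \<not> P y}"
  have "small ?S" by (intro small_Collect small_insert small_tcs x D_neg D)
  moreover have "?S \<noteq> {}" using nP by blast
  ultimately obtain y where y: "y \<in> ?S" "el y \<inter> ?S = {}" by (rule foundation)
  have "el y \<subseteq> insert x (tcs x)" using y(1) el_sub_tcs[OF x] tcs_trans[OF x] by blast
  then have "P z" if "z \<in> el y" for z using y(2) that by blast
  moreover have "y \<in> U" using y(1) x small_sub_U[OF small_tcs[OF x]] by blast
  ultimately show False using step y(1) by blast
qed

section \<open>Extension of a permutation of the atoms by recursion\<close>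

definition apx :: "'m \<Rightarrow> 'm \<Rightarrow> 'm \<Rightarrow> bool" where
  "apx \<phi> T g \<longleftrightarrow> is_transitive M T \<and> is_function_on M g T \<and>
     (\<forall>t\<in>el T. ap g t = (if t \<in> el At then ap \<phi> t else mk (ap g ` el t)))"

text \<open>A total counterpart of \<open>perm_ext\<close>, definable in both arguments;
  \<open>perm_ext_eq\<close> identifies the two for functions on the atoms.\<close>

definition pe :: "'m \<Rightarrow> 'm \<Rightarrow> 'm" where
  "pe \<phi> x = tot (\<lambda>y. \<exists>T\<in>U. \<exists>g\<in>U. apx \<phi> T g \<and> x \<in> el T \<and> ap g x = y)"

lemma pe_U [simp, df]: "pe \<phi> x \<in> U" by (simp add: pe_def)

lemma Tm_pe [df]: "Tm t \<Longrightarrow> Tm u \<Longrightarrow> Tm (\<lambda>e. pe (t e) (u e))"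
proof (rule Tm_lift2[where f=pe])
  show "Tm (\<lambda>e. pe (e 0) (e (Suc 0)))" unfolding pe_def apx_def by (intro df)
qed

lemma small_ap_image: "f \<in> U \<Longrightarrow> small S \<Longrightarrow> small (ap f ` S)"
  by (intro small_image df)

lemma small_pe_image: "\<phi> \<in> U \<Longrightarrow> small S \<Longrightarrow> small (pe \<phi> ` S)"
  by (intro small_image df)

lemma eq_mk_small: "small S \<Longrightarrow> y = mk S \<longleftrightarrow> is_set M y \<and> el y = S"
  by (simp add: eq_mk_iff)

text \<open>By transitivity of \<open>T\<close> the elements of \<open>t\<close> lie in the domain
  of \<open>g\<close>, where \<open>app\<close> and \<open>ap\<close> agree.\<close>

lemma is_perm_approx_iff:
  assumes "is_function_on M \<phi> At"
  shows "is_perm_approx M \<phi> T g \<longleftrightarrow> apx \<phi> T g"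
proof (cases "is_transitive M T \<and> is_function_on M g T")
  case True
  then have g: "is_function_on M g T" and gU: "g \<in> U" using fun_U by blast+
  have "(if t \<in> el At then app M g t = app M \<phi> t
      else is_set M (app M g t) \<and> el (app M g t) = app M g ` el t) \<longleftrightarrow>
     ap g t = (if t \<in> el At then ap \<phi> t else mk (ap g ` el t))" if t: "t \<in> el T" for t
  proof -
    have "app M g ` el t = ap g ` el t"
      using True t app_ap[OF _ g] unfolding is_transitive_def by (intro image_cong) auto
    moreover have "is_set M (ap g t) \<and> el (ap g t) = ap g ` el t \<longleftrightarrow> ap g t = mk (ap g ` el t)"
      using small_ap_image[OF gU small_el[OF el_U[OF t]]] by (rule eq_mk_small[symmetric])
    ultimately show ?thesis
      by (cases "t \<in> el At") (simp_all add: app_ap[OF t g] app_ap[OF _ assms])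
  qed
  then show ?thesis unfolding is_perm_approx_def apx_def
    by (intro conj_cong refl ball_cong)
next
  case False then show ?thesis unfolding is_perm_approx_def apx_def by blast
qed

lemma apx_unique:
  assumes \<phi>: "\<phi> \<in> U" and a: "apx \<phi> T g" "apx \<phi> T' g'" and x: "x \<in> el T" "x \<in> el T'"
  shows "ap g x = ap g' x"
proof -
  have U: "g \<in> U" "g' \<in> U" "T \<in> U" "T' \<in> U" using a fun_U set_U unfolding apx_def is_transitive_def by blast+
  have "x \<in> el T \<longrightarrow> x \<in> el T' \<longrightarrow> ap g x = ap g' x"
    using el_U[OF x(1)]
  proof (rule mem_induct[where P="\<lambda>x. x \<in> el T \<longrightarrow> x \<in> el T' \<longrightarrow> ap g x = ap g' x"])
    show "D (\<lambda>e. e 0 \<in> el T \<longrightarrow> e 0 \<in> el T' \<longrightarrow> ap g (e 0) = ap g' (e 0))" by (intro df U)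
    fix x assume IH: "\<And>y. y \<in> el x \<Longrightarrow> y \<in> el T \<longrightarrow> y \<in> el T' \<longrightarrow> ap g y = ap g' y"
    show "x \<in> el T \<longrightarrow> x \<in> el T' \<longrightarrow> ap g x = ap g' x"
    proof (intro impI)
      assume x: "x \<in> el T" "x \<in> el T'"
      then have "el x \<subseteq> el T" "el x \<subseteq> el T'" using a unfolding apx_def is_transitive_def by blast+
      then have "ap g ` el x = ap g' ` el x" using IH by (intro image_cong) auto
      then show "ap g x = ap g' x" using a x unfolding apx_def by simp
    qed
  qed
  with x show ?thesis by blast
qed

lemma pe_eqI: assumes "\<phi> \<in> U" "apx \<phi> T g" "x \<in> el T" shows "pe \<phi> x = ap g x"
  unfolding pe_def
proof (rule tot_eqI)
  have "g \<in> U" "T \<in> U" using assms fun_U set_U unfolding apx_def is_transitive_def by blast+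
  then show "\<exists>T\<in>U. \<exists>g'\<in>U. apx \<phi> T g' \<and> x \<in> el T \<and> ap g' x = ap g x" using assms by blast
  fix z assume "\<exists>T\<in>U. \<exists>g'\<in>U. apx \<phi> T g' \<and> x \<in> el T \<and> ap g' x = z"
  then show "z = ap g x" using apx_unique[OF assms(1) _ assms(2)] assms(3) by blast
qed simp

lemma apx_exists:
  assumes \<phi>: "\<phi> \<in> U" and x: "x \<in> U"
  shows "\<exists>T\<in>U. \<exists>g\<in>U. apx \<phi> T g \<and> x \<in> el T"
proof -
  define E where "E x \<longleftrightarrow> (\<exists>T\<in>U. \<exists>g\<in>U. apx \<phi> T g \<and> x \<in> el T)" for x
  have DE: "D (\<lambda>e. E (e 0))" unfolding E_def apx_def by (intro df \<phi>)
  define G where "G t = (if t \<in> el At then ap \<phi> t else mk (pe \<phi> ` el t))" for t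
  have TG: "Tm (\<lambda>e. G (e 0))" unfolding G_def by (intro df \<phi>)
  have Gpe: "pe \<phi> t = G t \<and> (\<forall>s\<in>el t. E s)" if t: "E t" for t
  proof -
    obtain T g where T: "T \<in> U" "g \<in> U" "apx \<phi> T g" "t \<in> el T" using t unfolding E_def by blast
    have sub: "el t \<subseteq> el T" using T unfolding apx_def is_transitive_def by blast
    then have "ap g ` el t = pe \<phi> ` el t" using pe_eqI[OF \<phi> T(3)] by (intro image_cong) auto
    then have "pe \<phi> t = G t" using pe_eqI[OF \<phi> T(3,4)] T(3,4) unfolding apx_def G_def by simp
    with sub T show ?thesis unfolding E_def by blast
  qed
  have "E x" using x
  proof (rule mem_induct[where P=E])
    show "D (\<lambda>e. E (e 0))" by (rule DE)
    fix x assume x: "x \<in> U" and IH: "\<And>y. y \<in> el x \<Longrightarrow> E y"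
    \<comment> \<open>Whatever lies in an approximation has its elements in it too. So this part of
      the transitive closure is transitive and, containing the elements of \<open>x\<close>, it is
      everything. Since \<open>pe\<close> gives the common value of all approximations, they can be
      glued without choosing among them.\<close>
    let ?T' = "{t \<in> tcs x. E t}"
    have sm: "small ?T'" by (intro small_Collect small_tcs x DE)
    have "is_transitive M (mk ?T')"
      unfolding is_transitive_def el_mk[OF sm] using tcs_trans[OF x] Gpe by auto
    from tcs_least[OF x this] have tE: "E t" if "t \<in> tcs x" for t
      using that IH el_sub_tcs[OF x] unfolding el_mk[OF sm] by blast
    define T where "T = mk (insert x (tcs x))"
    have elT: "el T = insert x (tcs x)" unfolding T_def by (intro el_mk small_insert small_tcs x)
    have TU: "T \<in> U" by (simp add: T_def)
    have sub: "el t \<subseteq> tcs x" if "t \<in> el T" for t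
      using that el_sub_tcs[OF x] tcs_trans[OF x] unfolding elT by blast
    have "apx \<phi> T (gr G T)"
      unfolding apx_def
    proof (intro conjI ballI)
      show "is_transitive M T" unfolding is_transitive_def using sub elT by (auto simp: T_def)
      show "is_function_on M (gr G T) T" by (rule gr_fun[OF TG TU])
      fix t assume t: "t \<in> el T"
      have "ap (gr G T) ` el t = pe \<phi> ` el t"
      proof (rule image_cong[OF refl])
        fix s assume "s \<in> el t"
        then have s: "s \<in> tcs x" using sub[OF t] by blast
        then show "ap (gr G T) s = pe \<phi> s" using ap_gr[OF TG TU, of s] Gpe[OF tE[OF s]] elT by simp
      qed
      then show "ap (gr G T) t = (if t \<in> el At then ap \<phi> t else mk (ap (gr G T) ` el t))"
        unfolding ap_gr[OF TG TU t] G_def[of t] by simp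
    qed
    then show "E x" unfolding E_def using TU elT by (intro bexI[of _ T] bexI[of _ "gr G T"]) auto
  qed
  then show ?thesis by (simp add: E_def)
qed

lemma pe_unfold: assumes "\<phi> \<in> U" "x \<in> U" shows "pe \<phi> x = (if x \<in> el At then ap \<phi> x else mk (pe \<phi> ` el x))"
proof -
  obtain T g where T: "apx \<phi> T g" "x \<in> el T" using apx_exists[OF assms] by blast
  then have "el x \<subseteq> el T" unfolding apx_def is_transitive_def by blast
  then have "ap g ` el x = pe \<phi> ` el x" using pe_eqI[OF assms(1) T(1)] by (intro image_cong) auto
  then show ?thesis using pe_eqI[OF assms(1) T] T unfolding apx_def by simp
qed

lemma pe_atom: "\<phi> \<in> U \<Longrightarrow> a \<in> el At \<Longrightarrow> pe \<phi> a = ap \<phi> a"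
  using pe_unfold[of \<phi> a] el_U by auto

lemma perm_ext_eq: assumes "is_function_on M \<phi> At" "x \<in> U" shows "perm_ext M \<phi> x = pe \<phi> x"
proof -
  have \<phi>: "\<phi> \<in> U" using assms(1) by (rule fun_U)
  obtain T g where T: "T \<in> U" "g \<in> U" "apx \<phi> T g" "x \<in> el T" using apx_exists[OF \<phi> assms(2)] by blast
  show ?thesis unfolding perm_ext_def
  proof (rule the_equality)
    have *: "app M g x = ap g x" if "apx \<phi> T g" "x \<in> el T" for T g
      using that app_ap unfolding apx_def by blast
    show "\<exists>T\<in>U. \<exists>g\<in>U. is_perm_approx M \<phi> T g \<and> x \<in> el T \<and> app M g x = pe \<phi> x"
      using T *[OF T(3,4)] pe_eqI[OF \<phi> T(3,4)] is_perm_approx_iff[OF assms(1)] by metis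
    fix y assume "\<exists>T\<in>U. \<exists>g\<in>U. is_perm_approx M \<phi> T g \<and> x \<in> el T \<and> app M g x = y"
    then show "y = pe \<phi> x" using * pe_eqI[OF \<phi>] is_perm_approx_iff[OF assms(1)] by metis
  qed
qed

definition perm :: "'m \<Rightarrow> bool" where
  "perm \<phi> \<longleftrightarrow> is_function_on M \<phi> At \<and> bij_betw (ap \<phi>) (el At) (el At)"

lemma is_perm_iff: "is_perm M \<phi> \<longleftrightarrow> perm \<phi>"
  unfolding is_perm_def is_bijection_iff perm_def ..

lemma perm_U: "perm \<phi> \<Longrightarrow> \<phi> \<in> U" unfolding perm_def using fun_U by blast

lemma perm_At: "perm \<phi> \<Longrightarrow> a \<in> el At \<Longrightarrow> ap \<phi> a \<in> el At"
  unfolding perm_def by (auto simp: bij_betw_def)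

lemma set_not_atom: "is_set M x \<Longrightarrow> x \<notin> el At" by (simp add: is_set_def)

lemma pe_set: "perm \<phi> \<Longrightarrow> is_set M x \<Longrightarrow> pe \<phi> x = mk (pe \<phi> ` el x)"
  using pe_unfold[OF perm_U set_U] set_not_atom by auto

lemma pe_At_iff: assumes "perm \<phi>" "x \<in> U" shows "pe \<phi> x \<in> el At \<longleftrightarrow> x \<in> el At"
  using pe_unfold[OF perm_U assms(2)] assms perm_At set_not_atom[OF set_mk] by (metis (full_types))

lemma el_pe: assumes "perm \<phi>" "x \<in> U" shows "el (pe \<phi> x) = pe \<phi> ` el x"
proof (cases "x \<in> el At")
  case True
  then show ?thesis using assms el_atom pe_At_iff by simp
next
  case False
  have "small (pe \<phi> ` el x)" using assms perm_U by (intro small_pe_image) auto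
  with False show ?thesis using pe_unfold[OF perm_U assms(2)] assms el_mk by simp
qed

lemma pe_is_set: "perm \<phi> \<Longrightarrow> is_set M x \<Longrightarrow> is_set M (pe \<phi> x)"
  using pe_set by simp

lemma pe_inj: assumes p: "perm \<phi>" and "x \<in> U" "y \<in> U" "pe \<phi> x = pe \<phi> y" shows "x = y"
proof -
  have "\<forall>y\<in>U. pe \<phi> x = pe \<phi> y \<longrightarrow> x = y" using assms(2)
  proof (rule mem_induct[where P="\<lambda>x. \<forall>y\<in>U. pe \<phi> x = pe \<phi> y \<longrightarrow> x = y"])
    show "D (\<lambda>e. \<forall>y\<in>U. pe \<phi> (e 0) = pe \<phi> y \<longrightarrow> e 0 = y)" by (intro df perm_U p)
    fix x assume x: "x \<in> U" and IH: "\<And>z. z \<in> el x \<Longrightarrow> \<forall>y\<in>U. pe \<phi> z = pe \<phi> y \<longrightarrow> z = y"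
    show "\<forall>y\<in>U. pe \<phi> x = pe \<phi> y \<longrightarrow> x = y"
    proof (intro ballI impI)
      fix y assume y: "y \<in> U" and eq: "pe \<phi> x = pe \<phi> y"
      show "x = y"
      proof (cases "x \<in> el At")
        case True
        then have "y \<in> el At" using eq pe_At_iff[OF p] x y by metis
        then show ?thesis using True eq p pe_atom[OF perm_U[OF p]] unfolding perm_def bij_betw_def by (auto dest: inj_onD)
      next
        case False
        then have s: "is_set M x" "is_set M y" using eq pe_At_iff[OF p] x y unfolding is_set_def by metis+
        have "pe \<phi> ` el x = pe \<phi> ` el y" using eq el_pe[OF p] x y by metis
        have "el x = el y"
        proof (intro set_eqI iffI)
          fix z assume z: "z \<in> el x"
          then have "pe \<phi> z \<in> pe \<phi> ` el y" unfolding \<open>pe \<phi> ` el x = _\<close>[symmetric] by (rule imageI)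
          then obtain w where "w \<in> el y" "pe \<phi> z = pe \<phi> w" by (rule imageE)
          then show "z \<in> el y" using IH[OF z] el_U by metis
        next
          fix w assume w: "w \<in> el y"
          then have "pe \<phi> w \<in> pe \<phi> ` el x" unfolding \<open>pe \<phi> ` el x = _\<close> by (rule imageI)
          then obtain z where "z \<in> el x" "pe \<phi> w = pe \<phi> z" by (rule imageE)
          then show "w \<in> el x" using IH[of z] el_U[OF w] by metis
        qed
        with s show ?thesis by (rule set_ext)
      qed
    qed
  qed
  with assms show ?thesis by blast
qed

lemma pe_id: assumes p: "perm \<iota>" and i: "\<And>a. a \<in> el At \<Longrightarrow> ap \<iota> a = a" and x: "x \<in> U" shows "pe \<iota> x = x"
  using x
proof (rule mem_induct[where P="\<lambda>x. pe \<iota> x = x"])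
  show "D (\<lambda>e. pe \<iota> (e 0) = e 0)" by (intro df perm_U p)
  fix x assume x: "x \<in> U" "\<And>y. y \<in> el x \<Longrightarrow> pe \<iota> y = y"
  show "pe \<iota> x = x"
  proof (cases "x \<in> el At")
    case True then show ?thesis using pe_atom[OF perm_U[OF p]] i by simp
  next
    case False
    then have "is_set M x" using x by (simp add: is_set_def)
    then show ?thesis using pe_set[OF p, of x] x mk_el[of x] by simp
  qed
qed

text \<open>Group laws need only be known on the atoms; \<in>-induction carries them to all of
  \<open>M\<close>.\<close>

lemma pe_comp:
  assumes p: "perm \<phi>" "perm \<psi>" "perm \<chi>" and c: "\<And>a. a \<in> el At \<Longrightarrow> ap \<chi> a = ap \<phi> (ap \<psi> a)" and x: "x \<in> U"
  shows "pe \<chi> x = pe \<phi> (pe \<psi> x)"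
  using x
proof (rule mem_induct[where P="\<lambda>x. pe \<chi> x = pe \<phi> (pe \<psi> x)"])
  show "D (\<lambda>e. pe \<chi> (e 0) = pe \<phi> (pe \<psi> (e 0)))" by (intro df perm_U p)
  fix x assume x: "x \<in> U" "\<And>y. y \<in> el x \<Longrightarrow> pe \<chi> y = pe \<phi> (pe \<psi> y)"
  show "pe \<chi> x = pe \<phi> (pe \<psi> x)"
  proof (cases "x \<in> el At")
    case True then show ?thesis using pe_atom[OF perm_U] p c perm_At by simp
  next
    case False
    then have s: "is_set M x" using x by (simp add: is_set_def)
    have "pe \<chi> ` el x = (\<lambda>y. pe \<phi> (pe \<psi> y)) ` el x" using x(2) by (intro image_cong) auto
    also have "\<dots> = pe \<phi> ` el (pe \<psi> x)" using el_pe[OF p(2) x(1)] by (simp add: image_image)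
    finally show ?thesis using pe_set[OF p(3) s] pe_set[OF p(1) pe_is_set[OF p(2) s]] by simp
  qed
qed

lemma pe_mk: assumes "perm \<phi>" "small S" shows "pe \<phi> (mk S) = mk (pe \<phi> ` S)"
  using pe_set[OF assms(1), of "mk S"] el_mk[OF assms(2)] by simp

lemma pe_pr: assumes "perm \<phi>" "x \<in> U" "y \<in> U" shows "pe \<phi> (pr x y) = pr (pe \<phi> x) (pe \<phi> y)"
proof -
  have "small {x}" "small {x, y}" "small {mk {x}, mk {x, y}}" using assms by (auto intro!: small_insert)
  then show ?thesis unfolding pr_def using assms by (simp add: pe_mk)
qed

text \<open>No atoms occur in the construction of a number. This rigidity is what restricts the
  functions between \<omega> and other sets in the submodel.\<close>

lemma pe_om: assumes p: "perm \<phi>" and n: "n \<in> el om" shows "pe \<phi> n = n"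
  using n
proof (rule om_induct[where P="\<lambda>n. pe \<phi> n = n"])
  show "D (\<lambda>e. pe \<phi> (e 0) = e 0)" by (intro df perm_U p)
  show "pe \<phi> ze = ze" using pe_mk[OF p small_empty] by simp
  fix n assume n: "n \<in> el om" "pe \<phi> n = n"
  then have "pe \<phi> ` insert n (el n) = insert n (el n)" using el_pe[OF p, of n] by simp
  then show "pe \<phi> (sc n) = sc n" unfolding sc_def using pe_mk[OF p small_insert[OF _ small_el]] n by simp
qed

lemma pe_omega: assumes p: "perm \<phi>" shows "pe \<phi> om = om"
  using pe_set[OF p set_om] pe_om[OF p] mk_el[OF set_om] by simp

lemma pe_atoms: assumes p: "perm \<phi>" shows "pe \<phi> At = At"
proof -
  have "pe \<phi> ` el At = ap \<phi> ` el At" using pe_atom[OF perm_U[OF p]] by (intro image_cong) auto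
  also have "\<dots> = el At" using p unfolding perm_def bij_betw_def by blast
  finally show ?thesis using pe_set[OF p set_At] mk_el[OF set_At] by simp
qed

end

section \<open>Finite sets\<close>

context zfa begin

definition ins :: "'m \<Rightarrow> 'm \<Rightarrow> 'm" where "ins a S = mk (insert a (el S))"

lemma ins_U [simp, df]: "ins a S \<in> U" and set_ins [simp]: "is_set M (ins a S)" by (simp_all add: ins_def)
lemma Tm_ins [df]: "Tm t \<Longrightarrow> Tm u \<Longrightarrow> Tm (\<lambda>e. ins (t e) (u e))" unfolding ins_def by (intro df)
lemma el_ins: "a \<in> U \<Longrightarrow> S \<in> U \<Longrightarrow> el (ins a S) = insert a (el S)" by (simp add: ins_def el_mk small_insert)

definition un :: "'m \<Rightarrow> 'm \<Rightarrow> 'm" where "un S T = mk (el S \<union> el T)"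

lemma un_U [simp, df]: "un S T \<in> U" and set_un [simp]: "is_set M (un S T)" by (simp_all add: un_def)
lemma Tm_un [df]: "Tm t \<Longrightarrow> Tm u \<Longrightarrow> Tm (\<lambda>e. un (t e) (u e))" unfolding un_def by (intro df)
lemma el_un: "S \<in> U \<Longrightarrow> T \<in> U \<Longrightarrow> el (un S T) = el S \<union> el T" by (simp add: un_def el_mk small_Un)

text \<open>
  Kuratowski finiteness, which gives induction over finite sets; it agrees with \<open>|E| < \<aleph>\<^sub>0\<close> by
  \<open>fin_iff\<close> below.
\<close>

definition kfin :: "'m \<Rightarrow> bool" where
  "kfin E \<longleftrightarrow> is_set M E \<and> (\<forall>F\<in>U. ze \<in> el F \<and> (\<forall>S\<in>el F. \<forall>a\<in>el E. ins a S \<in> el F) \<longrightarrow> E \<in> el F)"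

lemma D_kfin [df]: "Tm t \<Longrightarrow> D (\<lambda>e. kfin (t e))"
proof (rule D_lift1[where R=kfin])
  show "D (\<lambda>e. kfin (e 0))" unfolding kfin_def by (intro df)
qed

lemma kfin_set: "kfin E \<Longrightarrow> is_set M E" and kfin_U: "kfin E \<Longrightarrow> E \<in> U"
  unfolding kfin_def using set_U by blast+

lemma kfin_ze [simp]: "kfin ze" by (auto simp: kfin_def)

lemma kfin_ins: assumes "kfin S" "a \<in> U" shows "kfin (ins a S)"
  unfolding kfin_def
proof (intro conjI ballI impI)
  fix F assume F: "F \<in> U" "ze \<in> el F \<and> (\<forall>T\<in>el F. \<forall>b\<in>el (ins a S). ins b T \<in> el F)"
  have e: "el (ins a S) = insert a (el S)" using assms kfin_U by (simp add: el_ins)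
  have "S \<in> el F" using assms(1) F e unfolding kfin_def by blast
  then show "ins a S \<in> el F" using F e by blast
qed simp

lemma kfin_induct [consumes 1, case_names D zero ins]:
  assumes E: "kfin E" and D: "D (\<lambda>e. P (e 0))" and z: "P ze"
    and step: "\<And>S a. kfin S \<Longrightarrow> a \<in> el E \<Longrightarrow> el S \<subseteq> el E \<Longrightarrow> P S \<Longrightarrow> P (ins a S)"
  shows "P E"
proof -
  \<comment> \<open>Restricting to subsets of \<open>E\<close> makes this a set, to which the
    definition of \<open>kfin\<close> can be applied.\<close>
  let ?F = "{S \<in> {y. is_set M y \<and> el y \<subseteq> el E}. kfin S \<and> P S}"
  have sm: "small ?F" by (intro small_Collect small_Pow kfin_U E D_conj D df)
  have "ze \<in> el (mk ?F)" using el_mk[OF sm] z by simp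
  moreover have "ins a S \<in> el (mk ?F)" if "S \<in> el (mk ?F)" "a \<in> el E" for S a
    using that kfin_ins[of S a] step[of S a] el_ins[of a S] el_U[of a] set_U[of S] unfolding el_mk[OF sm] by auto
  ultimately have "E \<in> el (mk ?F)" using E mk_U unfolding kfin_def by blast
  then show ?thesis using el_mk[OF sm] by blast
qed

lemma kfin_subset: assumes E: "kfin E" and S: "is_set M S" "el S \<subseteq> el E" shows "kfin S"
proof -
  have "\<forall>S\<in>U. is_set M S \<and> el S \<subseteq> el E \<longrightarrow> kfin S"
    using E
  proof (rule kfin_induct[where P="\<lambda>E. \<forall>S\<in>U. is_set M S \<and> el S \<subseteq> el E \<longrightarrow> kfin S"])
    show "D (\<lambda>e. \<forall>S\<in>U. is_set M S \<and> el S \<subseteq> el (e 0) \<longrightarrow> kfin S)" by (intro df)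
    show "\<forall>S\<in>U. is_set M S \<and> el S \<subseteq> el ze \<longrightarrow> kfin S"
      by (metis kfin_ze mk_eqI subset_empty el_mk_empty)
    fix T a assume T: "kfin T" "a \<in> el E" "\<forall>S\<in>U. is_set M S \<and> el S \<subseteq> el T \<longrightarrow> kfin S"
    then have aU: "a \<in> U" using el_U by blast
    show "\<forall>S\<in>U. is_set M S \<and> el S \<subseteq> el (ins a T) \<longrightarrow> kfin S"
    proof (intro ballI impI)
      fix S assume S: "S \<in> U" "is_set M S \<and> el S \<subseteq> el (ins a T)"
      have sm: "small (el S - {a})" by (rule small_subset[of "el S"]) (use S aU in \<open>auto intro!: df\<close>)
      have sub: "el (mk (el S - {a})) \<subseteq> el T" using S aU kfin_U[OF T(1)] unfolding el_mk[OF sm] by (auto simp: el_ins)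
      then have k: "kfin (mk (el S - {a}))" using T(3) by simp
      show "kfin S"
      proof (cases "a \<in> el S")
        case True
        have "S = ins a (mk (el S - {a}))" unfolding ins_def el_mk[OF sm] using S True
          by (intro mk_eqI) auto
        then show ?thesis using kfin_ins[OF k aU] by simp
      next
        case False
        then have "mk (el S - {a}) = S" using S mk_el by simp
        then show ?thesis using k by simp
      qed
    qed
  qed
  with S set_U show ?thesis by blast
qed

lemma kfin_un: assumes "kfin S" "kfin T" shows "kfin (un S T)"
  using assms(2)
proof (rule kfin_induct[where P="\<lambda>T. kfin (un S T)"])
  show "D (\<lambda>e. kfin (un S (e 0)))" by (intro df kfin_U assms)
  show "kfin (un S ze)" unfolding un_def using mk_el[OF kfin_set[OF assms(1)]] assms(1) by simp
  fix R a assume R: "kfin R" "a \<in> el T" "kfin (un S R)"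
  then have "a \<in> U" using el_U by blast
  moreover have "un S (ins a R) = ins a (un S R)"
    unfolding un_def[of S "ins a R"] ins_def[of a "un S R"]
    using calculation R(1) assms(1) kfin_U by (simp add: el_ins el_un)
  ultimately show "kfin (un S (ins a R))" using kfin_ins[OF R(3)] by simp
qed

lemma kfin_image: assumes E: "kfin E" and F: "Tm (\<lambda>e. F (e 0))" shows "kfin (mk (F ` el E))"
  using E
proof (rule kfin_induct[where P="\<lambda>E. kfin (mk (F ` el E))"])
  show "D (\<lambda>e. kfin (mk (F ` el (e 0))))" by (intro df Tm_lift1[OF F])
  fix S a assume S: "kfin S" "a \<in> el E" "kfin (mk (F ` el S))"
  have "F ` el (ins a S) = insert (F a) (el (mk (F ` el S)))"
    using S kfin_U el_U[of a] el_mk[OF small_image[OF F small_el]] by (simp add: el_ins)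
  then have "mk (F ` el (ins a S)) = ins (F a) (mk (F ` el S))" by (simp add: ins_def)
  then show "kfin (mk (F ` el (ins a S)))" using kfin_ins[OF S(3)] Tm_U1[OF F el_U[OF S(2)]] by simp
qed simp

lemma card_le_ins: assumes "card_le M S om" "a \<in> U" "S \<in> U" shows "card_le M (ins a S) om"
proof -
  obtain f where f: "f \<in> U" "is_function_on M f S" "\<And>x. x \<in> el S \<Longrightarrow> ap f x \<in> el om" "inj_on (ap f) (el S)"
    using assms(1) by (rule card_leE) blast
  let ?F = "\<lambda>x. if x \<in> el S then sc (ap f x) else ze"
  show "card_le M (ins a S) om"
  proof (rule card_leI[where F="?F"])
    show "Tm (\<lambda>e. if e 0 \<in> el S then sc (ap f (e 0)) else ze)" by (intro df f assms)
    show "\<And>x. x \<in> el (ins a S) \<Longrightarrow> ?F x \<in> el om" using f(3) by auto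
    show "inj_on ?F (el (ins a S))"
      using f(3,4) assms sc_ne_ze[OF om_el_U] by (auto simp: inj_on_def el_ins sc_inj)
  qed simp
qed

lemma kfin_card_le: assumes "kfin E" shows "card_le M E om"
  using assms
proof (rule kfin_induct[where P="\<lambda>E. card_le M E om"])
  show "D (\<lambda>e. card_le M (e 0) om)" by (intro df)
  show "card_le M ze om" by (rule card_le_subset) auto
  show "card_le M (ins a S) om" if "kfin S" "a \<in> el E" "card_le M S om" for S a
    using card_le_ins[OF that(3) el_U[OF that(2)] kfin_U[OF that(1)]] .
qed

lemma kfin_not_om_le: assumes "kfin E" shows "\<not> card_le M om E"
  using assms
proof (rule kfin_induct[where P="\<lambda>E. \<not> card_le M om E"])
  show "D (\<lambda>e. \<not> card_le M om (e 0))" by (intro df)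
  show "\<not> card_le M om ze"
  proof
    assume "card_le M om ze"
    then obtain f where "\<And>x. x \<in> el om \<Longrightarrow> ap f x \<in> el ze" by (rule card_leE) blast
    from this[OF ze_om] show False by simp
  qed
  fix S a assume S: "kfin S" "a \<in> el E" "\<not> card_le M om S"
  then have aU: "a \<in> U" and SU: "S \<in> U" using el_U kfin_U by blast+
  show "\<not> card_le M om (ins a S)"
  proof
    assume "card_le M om (ins a S)"
    then obtain f where f: "f \<in> U" "is_function_on M f om" "\<And>x. x \<in> el om \<Longrightarrow> ap f x \<in> el (ins a S)" "inj_on (ap f) (el om)"
      by (rule card_leE) blast
    have inj: "ap f m = ap f n \<longleftrightarrow> m = n" if "m \<in> el om" "n \<in> el om" for m n
      using f(4) that by (meson inj_onD)
    \<comment> \<open>After the shift by \<open>sc\<close> the value \<open>ap f ze\<close> is free,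
      and it replaces the removed point \<open>a\<close>. If \<open>ap f ze\<close> is
      \<open>a\<close> itself, no other value is \<open>a\<close> and nothing is replaced.\<close>
    let ?F = "\<lambda>n. if ap f (sc n) = a then ap f ze else ap f (sc n)"
    have "card_le M om S"
    proof (rule card_leI[where F="?F"])
      show "Tm (\<lambda>e. if ap f (sc (e 0)) = a then ap f ze else ap f (sc (e 0)))" by (intro df f aU)
      fix n assume n: "n \<in> el om"
      then show "?F n \<in> el S"
        using f(3)[of "sc n"] f(3)[of ze] inj[of ze "sc n"] aU SU by (auto simp: el_ins)
    next
      show "inj_on ?F (el om)"
      proof (rule inj_onI)
        fix x y assume xy: "x \<in> el om" "y \<in> el om" and eq: "?F x = ?F y"
        then have "x \<in> U" "y \<in> U" by simp_all
        with eq show "x = y"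
          using inj[of "sc x" "sc y"] inj[of ze "sc y"] inj[of "sc x" ze] xy sc_inj[of x y] sc_ne_ze[of x] sc_ne_ze[of y]
          by (simp split: if_splits)
      qed
    qed simp
    with S(3) show False ..
  qed
qed

lemma tot_inv:
  assumes "inj_on F (el E)" "x \<in> el E" shows "tot (\<lambda>y. y \<in> el E \<and> F y = F x) = x"
proof (rule tot_eqI)
  show "x \<in> U" using assms(2) by (rule el_U)
  show "x \<in> el E \<and> F x = F x" using assms(2) by simp
  show "z = x" if "z \<in> el E \<and> F z = F x" for z using that assms by (metis inj_onD)
qed

lemma card_eq_om_le: assumes "card_eq M E om" "E \<in> U" shows "card_le M om E"
proof -
  obtain f where f: "f \<in> U" "is_function_on M f E" "bij_betw (ap f) (el E) (el om)"
    using assms(1) by (rule card_eqE) blast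
  define G where "G n = tot (\<lambda>x. x \<in> el E \<and> ap f x = n)" for n
  have inj: "inj_on (ap f) (el E)" and im: "ap f ` el E = el om" using f(3) unfolding bij_betw_def by blast+
  have G: "G (ap f x) = x" if "x \<in> el E" for x unfolding G_def using tot_inv[OF inj that] .
  have G': "G n \<in> el E \<and> ap f (G n) = n" if "n \<in> el om" for n
  proof -
    have "n \<in> ap f ` el E" using that im by simp
    then obtain x where "x \<in> el E" "n = ap f x" by (rule imageE)
    then show ?thesis using G by simp
  qed
  show ?thesis
  proof (rule card_leI[where F=G])
    show "Tm (\<lambda>e. G (e 0))" unfolding G_def by (intro df f assms)
    show "inj_on G (el om)" using G' by (metis inj_onI)
  qed (use G' in auto)
qed

lemma kfin_nat: assumes "n \<in> el om" shows "kfin n"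
  using assms
proof (rule om_induct[where P=kfin])
  show "D (\<lambda>e. kfin (e 0))" by (intro df)
  show "kfin (sc n)" if "n \<in> el om" "kfin n" for n
    using kfin_ins[OF that(2), of n] that(1) by (simp add: sc_def ins_def)
qed simp

text \<open>An infinite set of natural numbers is enumerated by iterating the next-element function.\<close>

lemma infinite_card_eq_om:
  assumes E: "card_le M E om" "is_set M E" and inf: "\<not> kfin E"
  shows "card_eq M E om"
proof -
  have EU: "E \<in> U" using E(2) by (rule set_U)
  obtain f where f: "f \<in> U" "is_function_on M f E" "\<And>x. x \<in> el E \<Longrightarrow> ap f x \<in> el om" "inj_on (ap f) (el E)"
    using E(1) by (rule card_leE) blast
  define S where "S = mk (ap f ` el E)"
  have SU: "S \<in> U" and elS: "el S = ap f ` el E"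
    unfolding S_def using el_mk[OF small_ap_image[OF f(1) small_el[OF EU]]] by simp_all
  have Som: "el S \<subseteq> el om" using elS f(3) by auto
  define G where "G n = tot (\<lambda>x. x \<in> el E \<and> ap f x = n)" for n
  have TG: "Tm (\<lambda>e. G (e 0))" unfolding G_def by (intro df f EU)
  have G: "G (ap f x) = x" if "x \<in> el E" for x unfolding G_def using tot_inv[OF f(4) that] .
  have infS: "\<not> kfin S"
  proof
    assume "kfin S"
    from kfin_image[OF this TG] have "kfin (mk (G ` el S))" .
    moreover have "G ` el S = el E" unfolding elS image_image using G by simp
    ultimately show False using inf mk_el[OF E(2)] by simp
  qed
  have unb: "\<exists>k\<in>el S. n \<in> el k" if n: "n \<in> el om" for n
  proof (rule ccontr)
    assume "\<not> (\<exists>k\<in>el S. n \<in> el k)"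
    then have "el S \<subseteq> el (sc n)" using nat_linear[OF n] Som n by (auto simp: el_sc)
    then show False using infS kfin_subset[OF kfin_nat[OF sc_om[OF n]], of S] by (simp add: S_def)
  qed
  define nx where "nx m = tot (\<lambda>k. k \<in> el S \<and> m \<in> el k \<and> (\<forall>j\<in>el S. m \<in> el j \<longrightarrow> j = k \<or> k \<in> el j))" for m
  have Tnx: "Tm (\<lambda>e. nx (e 0))" unfolding nx_def by (intro df SU)
  have least: "\<exists>k. k \<in> el S \<and> Q k \<and> (\<forall>j\<in>el S. Q j \<longrightarrow> j = k \<or> k \<in> el j)"
    if Q: "D (\<lambda>e. Q (e 0))" "\<exists>k\<in>el S. Q k" for Q
  proof -
    obtain k where k: "k \<in> el S" "Q k" using Q(2) by blast
    have "D (\<lambda>e. e 0 \<in> el S \<and> Q (e 0))" by (intro D_conj Q df SU)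
    then obtain m where "m \<in> el om" "m \<in> el S \<and> Q m" "\<And>k. k \<in> el om \<Longrightarrow> k \<in> el S \<and> Q k \<Longrightarrow> k = m \<or> m \<in> el k"
      by (rule nat_least[where P="\<lambda>k. k \<in> el S \<and> Q k"]) (use k Som in auto)
    then show ?thesis using Som by blast
  qed
  have nx: "nx m \<in> el S \<and> m \<in> el (nx m) \<and> (\<forall>j\<in>el S. m \<in> el j \<longrightarrow> j = nx m \<or> nx m \<in> el j)" if m: "m \<in> el om" for m
  proof -
    have "D (\<lambda>e. m \<in> el (e 0))" by (intro df) (use m in simp)
    from least[OF this unb[OF m]] obtain k where k: "k \<in> el S" "m \<in> el k" "\<forall>j\<in>el S. m \<in> el j \<longrightarrow> j = k \<or> k \<in> el j" by blast
    have "nx m = k" unfolding nx_def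
      by (rule tot_eqI) (use k el_U[of k] no_2cycle in blast)+
    with k show ?thesis by blast
  qed
  have "D (\<lambda>e. True)" "\<exists>k\<in>el S. True" using unb[OF ze_om] D_True by blast+
  from least[OF this] obtain s0 where s0: "s0 \<in> el S" "\<And>j. j \<in> el S \<Longrightarrow> j = s0 \<or> s0 \<in> el j" by blast
  have s0U: "s0 \<in> U" using s0(1) by (rule el_U)
  define g where "g n = nrec s0 nx n" for n
  have Tg: "Tm (\<lambda>e. g (e 0))" unfolding g_def by (intro df s0U Tm_lift1[OF Tnx])
  have g0: "g ze = s0" and gs: "n \<in> el om \<Longrightarrow> g (sc n) = nx (g n)" for n
    unfolding g_def using nrec_ze[OF Tnx s0U] nrec_sc[OF Tnx s0U] by auto
  have gS: "g n \<in> el S" if "n \<in> el om" for n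
    using that
  proof (rule om_induct[where P="\<lambda>n. g n \<in> el S"])
    show "D (\<lambda>e. g (e 0) \<in> el S)" by (intro df Tm_lift1[OF Tg] SU)
    show "g ze \<in> el S" using g0 s0(1) by simp
    show "g (sc n) \<in> el S" if "n \<in> el om" "g n \<in> el S" for n
      unfolding gs[OF that(1)] using nx[of "g n"] that(2) Som by blast
  qed
  have gom: "g n \<in> el om" if "n \<in> el om" for n using gS[OF that] Som by blast
  have ginc: "\<forall>m\<in>el n. g m \<in> el (g n)" if n: "n \<in> el om" for n
    using n
  proof (rule om_induct[where P="\<lambda>n. \<forall>m\<in>el n. g m \<in> el (g n)"])
    show "D (\<lambda>e. \<forall>m\<in>el (e 0). g m \<in> el (g (e 0)))" by (intro df Tm_lift1[OF Tg])
    fix n assume n: "n \<in> el om" "\<forall>m\<in>el n. g m \<in> el (g n)"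
    have "g n \<in> el (g (sc n))" using gs nx[OF gom] n by simp
    then show "\<forall>m\<in>el (sc n). g m \<in> el (g (sc n))"
      using n nat_trans[OF gom[OF sc_om[OF n(1)]], of "g n"] by (auto simp: el_sc)
  qed simp
  have ginj: "m = n" if "m \<in> el om" "n \<in> el om" "g m = g n" for m n
    using nat_linear[OF that(1,2)] ginc[OF that(1)] ginc[OF that(2)] that(3) not_self by metis
  \<comment> \<open>An increasing \<open>g\<close> satisfies n \<le> g n. An element k of
    \<open>S\<close> missed by \<open>g\<close> would exceed every g n, also g k, against k \<le> g
    k.\<close>
  have gge: "n = g n \<or> n \<in> el (g n)" if n: "n \<in> el om" for n
    using n
  proof (rule om_induct[where P="\<lambda>n. n = g n \<or> n \<in> el (g n)"])
    show "D (\<lambda>e. e 0 = g (e 0) \<or> e 0 \<in> el (g (e 0)))" by (intro df Tm_lift1[OF Tg])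
    show "ze = g ze \<or> ze \<in> el (g ze)" using ze_le[OF gom[OF ze_om]] by auto
    fix n assume n: "n \<in> el om" "n = g n \<or> n \<in> el (g n)"
    have "g n \<in> el (g (sc n))" using ginc[OF sc_om[OF n(1)]] n by (auto simp: el_sc)
    then have "n \<in> el (g (sc n))" using n nat_trans[OF gom[OF sc_om[OF n(1)]], of "g n"] by auto
    from sc_mono[OF gom[OF sc_om[OF n(1)]] this] show "sc n = g (sc n) \<or> sc n \<in> el (g (sc n))"
      using gom[OF sc_om[OF n(1)]] by (auto simp: el_sc)
  qed
  have gsurj: "\<exists>n\<in>el om. g n = k" if k: "k \<in> el S" for k
  proof (rule ccontr)
    assume no: "\<not> (\<exists>n\<in>el om. g n = k)"
    have kom: "k \<in> el om" using k Som by blast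
    have "g n \<in> el k" if "n \<in> el om" for n
      using that
    proof (rule om_induct[where P="\<lambda>n. g n \<in> el k"])
      show "D (\<lambda>e. g (e 0) \<in> el k)" by (intro df Tm_lift1[OF Tg]) (use kom in simp)
      show "g ze \<in> el k" using g0 s0(2)[OF k] no ze_om by metis
      show "g (sc n) \<in> el k" if "n \<in> el om" "g n \<in> el k" for n
        using nx[OF gom[OF that(1)]] k that gs[OF that(1)] no sc_om by metis
    qed
    from this[OF kom] gge[OF kom] show False using not_self no_2cycle by metis
  qed
  have "inj_on g (el om)" using ginj by (rule inj_onI)
  note ti = tot_inv[OF this]
  define H where "H x = tot (\<lambda>n. n \<in> el om \<and> g n = ap f x)" for x
  have H: "H x = n" if "n \<in> el om" "g n = ap f x" for x n
    unfolding H_def that(2)[symmetric] using that(1) by (rule ti)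
  show ?thesis
  proof (rule card_eqI[where F=H])
    show "Tm (\<lambda>e. H (e 0))" unfolding H_def by (intro df f Tm_lift1[OF Tg])
    have ex: "\<exists>n\<in>el om. g n = ap f x" if "x \<in> el E" for x using gsurj that elS by simp
    show "bij_betw H (el E) (el om)"
      unfolding bij_betw_def
    proof (intro conjI)
      show "inj_on H (el E)"
      proof (rule inj_onI)
        fix x y assume xy: "x \<in> el E" "y \<in> el E" "H x = H y"
        obtain n m where n: "n \<in> el om" "g n = ap f x" "m \<in> el om" "g m = ap f y" using ex xy by metis
        have "n = m" using H[OF n(1,2)] H[OF n(3,4)] xy(3) by simp
        then show "x = y" using n inj_onD[OF f(4) _ xy(1,2)] by simp
      qed
      show "H ` el E = el om"
      proof (intro set_eqI iffI)
        fix n assume n: "n \<in> el om"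
        have "g n \<in> ap f ` el E" using gS[OF n] elS by simp
        then obtain x where x: "x \<in> el E" "g n = ap f x" by (rule imageE)
        then have "n = H x" using H[OF n] by simp
        then show "n \<in> H ` el E" using x(1) by (rule image_eqI)
      next
        fix n assume "n \<in> H ` el E"
        then obtain x where x: "n = H x" "x \<in> el E" by (rule imageE)
        then show "n \<in> el om" using ex[OF x(2)] H by metis
      qed
    qed
  qed (rule EU)
qed

lemma fin_iff: assumes "is_set M E" shows "card_less M E om \<longleftrightarrow> kfin E"
  unfolding card_less_def
  using assms infinite_card_eq_om card_eq_om_le kfin_not_om_le kfin_card_le set_U by blast

end

section \<open>Arithmetic\<close>

context zfa begin

text \<open>Addition and multiplication as definable operations; \<open>nat_add_eq\<close> and
  \<open>nat_mult_eq\<close> identify them on \<omega> with \<open>nat_add\<close> and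
  \<open>nat_mult\<close>.\<close>

definition pl :: "'m \<Rightarrow> 'm \<Rightarrow> 'm" where "pl m n = nrec m sc n"
definition ts :: "'m \<Rightarrow> 'm \<Rightarrow> 'm" where "ts m n = nrec ze (\<lambda>j. pl j m) n"

lemma pl_U [simp, df]: "pl m n \<in> U" and ts_U [simp, df]: "ts m n \<in> U" by (simp_all add: pl_def ts_def)
lemma Tm_pl [df]: "Tm t \<Longrightarrow> Tm u \<Longrightarrow> Tm (\<lambda>e. pl (t e) (u e))"
proof (rule Tm_lift2[where f=pl])
  show "Tm (\<lambda>e. pl (e 0) (e (Suc 0)))" unfolding pl_def by (intro df)
qed
lemma Tm_ts [df]: "Tm t \<Longrightarrow> Tm u \<Longrightarrow> Tm (\<lambda>e. ts (t e) (u e))"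
proof (rule Tm_lift2[where f=ts])
  show "Tm (\<lambda>e. ts (e 0) (e (Suc 0)))" unfolding ts_def by (intro df)
qed

lemma pl_ze [simp]: "m \<in> el om \<Longrightarrow> pl m ze = m"
  unfolding pl_def by (rule nrec_ze) (intro df, simp)
lemma pl_sc [simp]: "m \<in> el om \<Longrightarrow> n \<in> el om \<Longrightarrow> pl m (sc n) = sc (pl m n)"
  unfolding pl_def by (rule nrec_sc) (intro df, simp_all)
lemma ts_ze [simp]: "m \<in> el om \<Longrightarrow> ts m ze = ze"
  unfolding ts_def by (rule nrec_ze) (intro df, simp_all)
lemma ts_sc [simp]: "m \<in> el om \<Longrightarrow> n \<in> el om \<Longrightarrow> ts m (sc n) = pl (ts m n) m"
  unfolding ts_def by (rule nrec_sc) (intro df, simp_all)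

lemma pl_om [simp]: assumes "m \<in> el om" "n \<in> el om" shows "pl m n \<in> el om"
  using assms(2) by (rule om_induct[where P="\<lambda>n. pl m n \<in> el om"]) (use assms(1) in \<open>auto intro!: df\<close>)
lemma ts_om [simp]: assumes "m \<in> el om" "n \<in> el om" shows "ts m n \<in> el om"
  using assms(2) by (rule om_induct[where P="\<lambda>n. ts m n \<in> el om"]) (use assms(1) in \<open>auto intro!: df\<close>)

lemma ze_pl [simp]: assumes "n \<in> el om" shows "pl ze n = n"
  using assms by (rule om_induct[where P="\<lambda>n. pl ze n = n"]) (auto intro!: df)
lemma sc_pl [simp]: assumes "m \<in> el om" "n \<in> el om" shows "pl (sc m) n = sc (pl m n)"
  using assms(2) by (rule om_induct[where P="\<lambda>n. pl (sc m) n = sc (pl m n)"]) (use assms(1) in \<open>auto intro!: df\<close>)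
lemma pl_comm: assumes "m \<in> el om" "n \<in> el om" shows "pl m n = pl n m"
  using assms(2) by (rule om_induct[where P="\<lambda>n. pl m n = pl n m"]) (use assms(1) in \<open>auto intro!: df\<close>)
lemma pl_assoc: assumes "m \<in> el om" "n \<in> el om" "k \<in> el om" shows "pl (pl m n) k = pl m (pl n k)"
  using assms(3) by (rule om_induct[where P="\<lambda>k. pl (pl m n) k = pl m (pl n k)"]) (use assms(1,2) in \<open>auto intro!: df\<close>)
lemma pl_lcomm: assumes "m \<in> el om" "n \<in> el om" "k \<in> el om" shows "pl m (pl n k) = pl n (pl m k)"
  using assms by (metis pl_comm pl_assoc)
lemma pl_cancel: assumes "m \<in> el om" "n \<in> el om" "k \<in> el om" shows "pl m k = pl n k \<longleftrightarrow> m = n"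
  using assms(3) by (rule om_induct[where P="\<lambda>k. pl m k = pl n k \<longleftrightarrow> m = n"]) (use assms(1,2) in \<open>auto intro!: df simp: sc_inj\<close>)

lemma ze_ts [simp]: assumes "n \<in> el om" shows "ts ze n = ze"
  using assms by (rule om_induct[where P="\<lambda>n. ts ze n = ze"]) (auto intro!: df)
lemma sc_ts [simp]: assumes "m \<in> el om" "n \<in> el om" shows "ts (sc m) n = pl (ts m n) n"
  using assms(2)
proof (rule om_induct[where P="\<lambda>n. ts (sc m) n = pl (ts m n) n"])
  show "D (\<lambda>e. ts (sc m) (e 0) = pl (ts m (e 0)) (e 0))" by (intro df) (use assms in simp_all)
  fix n assume "n \<in> el om" "ts (sc m) n = pl (ts m n) n"
  then show "ts (sc m) (sc n) = pl (ts m (sc n)) (sc n)" using assms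
    by (simp add: pl_assoc pl_comm[of n m])
qed (use assms in simp)
lemma ts_comm: assumes "m \<in> el om" "n \<in> el om" shows "ts m n = ts n m"
  using assms(2) by (rule om_induct[where P="\<lambda>n. ts m n = ts n m"]) (use assms(1) in \<open>auto intro!: df\<close>)
lemma ts_distrib: assumes "m \<in> el om" "n \<in> el om" "k \<in> el om" shows "ts m (pl n k) = pl (ts m n) (ts m k)"
  using assms(3) by (rule om_induct[where P="\<lambda>k. ts m (pl n k) = pl (ts m n) (ts m k)"]) (use assms(1,2) in \<open>auto intro!: df simp: pl_assoc\<close>)
lemma ts_distrib2: assumes "m \<in> el om" "n \<in> el om" "k \<in> el om" shows "ts (pl n k) m = pl (ts n m) (ts k m)"
  using assms ts_distrib[OF assms] by (simp add: ts_comm)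
lemma ts_assoc: assumes "m \<in> el om" "n \<in> el om" "k \<in> el om" shows "ts (ts m n) k = ts m (ts n k)"
  using assms(3) by (rule om_induct[where P="\<lambda>k. ts (ts m n) k = ts m (ts n k)"]) (use assms(1,2) in \<open>auto intro!: df simp: ts_distrib\<close>)
lemma ts_lcomm: assumes "m \<in> el om" "n \<in> el om" "k \<in> el om" shows "ts m (ts n k) = ts n (ts m k)"
  using assms by (metis ts_comm ts_assoc)

text \<open>As rewrite rules these bring polynomial expressions over the numbers of \<open>M\<close>
  into a common form; their side conditions are settled by \<open>pl_om\<close> and
  \<open>ts_om\<close>.\<close>

lemmas arith_om = pl_assoc pl_comm pl_lcomm ts_assoc ts_comm ts_lcomm ts_distrib ts_distrib2

section \<open>Order and cancellation for the numbers of the model\<close>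

definition le :: "'m \<Rightarrow> 'm \<Rightarrow> bool" where "le m n \<longleftrightarrow> m = n \<or> m \<in> el n"

lemma D_le [df]: "Tm t \<Longrightarrow> Tm u \<Longrightarrow> D (\<lambda>e. le (t e) (u e))"
proof (rule D_lift2[where R=le])
  show "D (\<lambda>e. le (e 0) (e (Suc 0)))" unfolding le_def by (intro df)
qed

lemma nat_le_iff: "m \<in> U \<Longrightarrow> nat_le M m n \<longleftrightarrow> le m n"
  unfolding nat_le_def le_def elts_def by blast

lemma le_refl [simp]: "le m m" by (simp add: le_def)
lemma le_total: "m \<in> el om \<Longrightarrow> n \<in> el om \<Longrightarrow> le m n \<or> le n m" using nat_linear[of m n] by (auto simp: le_def)
lemma le_antisym: "le m n \<Longrightarrow> le n m \<Longrightarrow> m = n" using no_2cycle by (auto simp: le_def)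
lemma le_trans: "k \<in> el om \<Longrightarrow> le m n \<Longrightarrow> le n k \<Longrightarrow> le m k" using nat_trans[of k n] by (auto simp: le_def)
lemma le_sc: "n \<in> el om \<Longrightarrow> le m (sc n) \<longleftrightarrow> le m n \<or> m = sc n" by (auto simp: le_def el_sc)

lemma le_pl: assumes "m \<in> el om" "k \<in> el om" shows "le m (pl m k)"
  using assms(2) by (rule om_induct[where P="\<lambda>k. le m (pl m k)"]) (use assms(1) in \<open>auto intro!: df simp: le_sc\<close>)

lemma leE: assumes "m \<in> el om" "n \<in> el om" "le m n" obtains k where "k \<in> el om" "n = pl m k"
proof -
  have "le m n \<longrightarrow> (\<exists>k\<in>el om. n = pl m k)"
    using assms(2)
  proof (rule om_induct[where P="\<lambda>n. le m n \<longrightarrow> (\<exists>k\<in>el om. n = pl m k)"])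
    show "D (\<lambda>e. le m (e 0) \<longrightarrow> (\<exists>k\<in>el om. e 0 = pl m k))" by (intro df) (use assms in simp_all)
    show "le m ze \<longrightarrow> (\<exists>k\<in>el om. ze = pl m k)" using assms(1) by (auto simp: le_def intro!: bexI[of _ ze])
    fix n assume n: "n \<in> el om" and IH: "le m n \<longrightarrow> (\<exists>k\<in>el om. n = pl m k)"
    show "le m (sc n) \<longrightarrow> (\<exists>k\<in>el om. sc n = pl m k)"
    proof
      assume "le m (sc n)"
      then consider "le m n" | "m = sc n" using le_sc[OF n] by blast
      then show "\<exists>k\<in>el om. sc n = pl m k"
      proof cases
        case 1
        then obtain k where "k \<in> el om" "n = pl m k" using IH by blast
        then show ?thesis using assms(1) by (intro bexI[of _ "sc k"]) auto
      next
        case 2 then show ?thesis using assms(1) by (intro bexI[of _ ze]) auto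
      qed
    qed
  qed
  with assms that show ?thesis by blast
qed

lemma le_pl_mono: assumes "m \<in> el om" "n \<in> el om" "k \<in> el om" "le m n" shows "le (pl m k) (pl n k)"
proof -
  obtain j where j: "j \<in> el om" "n = pl m j" using assms(1,2,4) by (rule leE)
  have "pl n k = pl (pl m k) j" unfolding j(2) using assms j(1) by (simp add: pl_assoc pl_comm[of k j])
  then show ?thesis using le_pl[of "pl m k" j] assms j by simp
qed

lemma le_pl_cancel: assumes "m \<in> el om" "n \<in> el om" "k \<in> el om" shows "le (pl m k) (pl n k) \<longleftrightarrow> le m n"
proof
  assume l: "le (pl m k) (pl n k)"
  show "le m n"
  proof (rule ccontr)
    assume "\<not> le m n"
    then have "le n m" "m \<noteq> n" using le_total assms by (auto simp: le_def)
    then have "pl n k = pl m k" using le_pl_mono[OF assms(2,1,3)] l le_antisym by blast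
    then show False using pl_cancel[OF assms(2,1,3)] \<open>m \<noteq> n\<close> by simp
  qed
qed (use le_pl_mono assms in blast)

lemma le_ts_mono: assumes "m \<in> el om" "n \<in> el om" "k \<in> el om" "le m n" shows "le (ts m k) (ts n k)"
proof -
  obtain j where j: "j \<in> el om" "n = pl m j" using assms(1,2,4) by (rule leE)
  show ?thesis unfolding j(2) using assms j(1) le_pl[of "ts m k" "ts j k"] by (simp add: ts_distrib2)
qed

lemma pl_eq_ze: "m \<in> el om \<Longrightarrow> n \<in> el om \<Longrightarrow> pl m n = ze \<Longrightarrow> n = ze"
  by (rule om_cases[of n]) auto

lemma ts_ne_ze: assumes "m \<in> el om" "n \<in> el om" "m \<noteq> ze" "n \<noteq> ze" shows "ts m n \<noteq> ze"
proof
  assume z: "ts m n = ze"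
  obtain k where k: "k \<in> el om" "n = sc k" using om_cases[OF assms(2)] assms(4) by metis
  have "pl (ts m k) m = ze" using z k assms(1) by simp
  then have "m = ze" using pl_eq_ze[of "ts m k" m] k assms(1) by simp
  then show False using assms(3) by simp
qed

lemma ts_cancel: assumes "m \<in> el om" "n \<in> el om" "k \<in> el om" "k \<noteq> ze" shows "ts m k = ts n k \<longleftrightarrow> m = n"
proof
  have *: "m = n" if h: "m \<in> el om" "n \<in> el om" "le m n" "ts m k = ts n k" for m n
  proof -
    obtain j where j: "j \<in> el om" "n = pl m j" using h(1-3) by (rule leE)
    have "pl (ts j k) (ts m k) = pl ze (ts m k)"
      using h j assms(3) by (simp add: ts_distrib2 pl_comm[of "ts j k"])
    then have "ts j k = ze" using pl_cancel[of "ts j k" ze "ts m k"] h j assms(3) by simp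
    then have "j = ze" using ts_ne_ze j assms by blast
    then show ?thesis using j h by simp
  qed
  assume "ts m k = ts n k"
  then show "m = n" using *[of m n] *[of n m] le_total[OF assms(1,2)] assms by metis
qed simp

lemma le_ts_cancel: assumes "m \<in> el om" "n \<in> el om" "k \<in> el om" "k \<noteq> ze" shows "le (ts m k) (ts n k) \<longleftrightarrow> le m n"
proof
  assume l: "le (ts m k) (ts n k)"
  show "le m n"
  proof (rule ccontr)
    assume "\<not> le m n"
    then have "le n m" "m \<noteq> n" using le_total assms by (auto simp: le_def)
    then have "ts n k = ts m k" using le_ts_mono[OF assms(2,1,3)] l le_antisym by blast
    then show False using ts_cancel[OF assms(2,1,3,4)] \<open>m \<noteq> n\<close> by simp
  qed
qed (use le_ts_mono assms in blast)

text \<open>The given step \<open>h\<close> has to agree with the definable \<open>F\<close> on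
  \<omega> only: elsewhere \<open>nat_add\<close> is a definite description whose value is not
  known.\<close>

lemma nat_recursion_the:
  assumes F: "Tm (\<lambda>e. F (e 0))" and a: "a \<in> el om" and n: "n \<in> el om"
    and h: "\<And>k. k \<in> el om \<Longrightarrow> h k = F k \<and> F k \<in> el om"
  shows "(THE k. \<exists>g\<in>U. is_nat_recursion M a h g \<and> app M g n = k) = nrec a F n"
proof -
  have aU: "a \<in> U" using a by simp
  have N: "Tm (\<lambda>e. nrec a F (e 0))" by (intro df F aU)
  note nz = nrec_ze[OF F aU] and ns = nrec_sc[OF F aU]
  have No: "nrec a F n \<in> el om" if "n \<in> el om" for n
    using that
  proof (rule om_induct[where P="\<lambda>n. nrec a F n \<in> el om"])
    show "D (\<lambda>e. nrec a F (e 0) \<in> el om)" by (intro df F aU)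
  qed (use nz ns h a in auto)
  define g where "g = gr (nrec a F) om"
  have gf: "is_function_on M g om" and ag: "\<And>n. n \<in> el om \<Longrightarrow> ap g n = nrec a F n"
    unfolding g_def by (rule gr_fun[OF N om_U], rule ap_gr[OF N om_U])
  have ag': "app M g n = nrec a F n" if "n \<in> el om" for n using app_ap[OF that gf] ag[OF that] by simp
  have g: "is_nat_recursion M a h g"
    unfolding is_nat_recursion_def is_map_iff zero_eq
    using gf ag ag' No nz ns h by (simp add: succ_eq)
  have un: "app M g' n = nrec a F n" if g': "is_nat_recursion M a h g'" for g'
  proof -
    have g'f: "is_function_on M g' om" and g'o: "\<And>n. n \<in> el om \<Longrightarrow> ap g' n \<in> el om"
      using g' unfolding is_nat_recursion_def is_map_iff by blast+
    have ag': "app M g' n = ap g' n" if "n \<in> el om" for n using app_ap[OF that g'f] .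
    have "ap g' n = nrec a F n" using n
    proof (rule om_induct[where P="\<lambda>n. ap g' n = nrec a F n"])
      show "D (\<lambda>e. ap g' (e 0) = nrec a F (e 0))" by (intro df F aU fun_U[OF g'f])
      show "ap g' ze = nrec a F ze" using g' ag'[OF ze_om] nz unfolding is_nat_recursion_def zero_eq by simp
      fix n assume n: "n \<in> el om" "ap g' n = nrec a F n"
      then show "ap g' (sc n) = nrec a F (sc n)"
        using g' ag'[OF n(1)] ag'[OF sc_om[OF n(1)]] ns h g'o[OF n(1)]
        unfolding is_nat_recursion_def by (simp add: succ_eq)
    qed
    then show ?thesis using ag'[OF n] by simp
  qed
  show ?thesis
  proof (rule the_equality)
    show "\<exists>g\<in>U. is_nat_recursion M a h g \<and> app M g n = nrec a F n"
      using g ag'[OF n] fun_U[OF gf] by blast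
  qed (use un in blast)
qed

lemma nat_add_eq: assumes "m \<in> el om" "n \<in> el om" shows "nat_add M m n = pl m n"
  unfolding nat_add_def pl_def
  by (rule nat_recursion_the) (use assms in \<open>auto simp: succ_eq intro: df\<close>)

lemma nat_mult_eq: assumes "m \<in> el om" "n \<in> el om" shows "nat_mult M m n = ts m n"
  unfolding nat_mult_def ts_def zero_eq
proof (rule nat_recursion_the)
  show "Tm (\<lambda>e. pl (e 0) m)" by (intro df) (use assms in simp_all)
qed (use assms in \<open>auto simp: nat_add_eq\<close>)

section \<open>Choice and countable unions\<close>

definition prd :: "'m \<Rightarrow> 'm \<Rightarrow> 'm" where "prd X Y = mk (\<Union>x\<in>el X. el (mk ((\<lambda>y. pr x y) ` el Y)))"

lemma prd_U [simp, df]: "prd X Y \<in> U" by (simp add: prd_def)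
lemma el_prd: assumes "X \<in> U" "Y \<in> U" shows "el (prd X Y) = (\<Union>x\<in>el X. (\<lambda>y. pr x y) ` el Y)"
proof -
  have "small (\<Union>x\<in>el X. el (mk ((\<lambda>y. pr x y) ` el Y)))" by (intro small_UN small_el assms df)
  then have "el (prd X Y) = (\<Union>x\<in>el X. el (mk ((\<lambda>y. pr x y) ` el Y)))" unfolding prd_def by (rule el_mk)
  also have "\<dots> = (\<Union>x\<in>el X. (\<lambda>y. pr x y) ` el Y)"
  proof (rule SUP_cong[OF refl])
    fix x assume "x \<in> el X"
    then have "small ((\<lambda>y. pr x y) ` el Y)" using el_U by (intro small_image small_el assms df) 
    then show "el (mk ((\<lambda>y. pr x y) ` el Y)) = (\<lambda>y. pr x y) ` el Y" by (rule el_mk)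
  qed
  finally show ?thesis .
qed

text \<open>Places functions inside a power set, so that a function can be chosen for each index
  from one set.\<close>

lemma fun_sub_prd: assumes "is_function_on M f X" "\<And>x. x \<in> el X \<Longrightarrow> ap f x \<in> el Y" "X \<in> U" "Y \<in> U"
  shows "is_set M f \<and> el f \<subseteq> el (prd X Y)"
  using fun_el[OF assms(1)] assms(1,2) el_prd[OF assms(3,4)] unfolding is_function_on_def by auto

text \<open>The pairing (m + n)^2 + m. It lies between (m + n)^2 and (m + n + 1)^2 - 1, which
  determines m + n and then m.\<close>

definition pp :: "'m \<Rightarrow> 'm \<Rightarrow> 'm" where "pp m n = pl (ts (pl m n) (pl m n)) m"

lemma Tm_pp [df]: "Tm t \<Longrightarrow> Tm u \<Longrightarrow> Tm (\<lambda>e. pp (t e) (u e))"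
  unfolding pp_def by (intro df)

lemma pp_inj: assumes "m \<in> el om" "n \<in> el om" "m' \<in> el om" "n' \<in> el om" "pp m n = pp m' n'" shows "m = m' \<and> n = n'"
proof -
  have *: False if "m \<in> el om" "n \<in> el om" "m' \<in> el om" "n' \<in> el om" "pp m n = pp m' n'" 
     and lt: "k \<in> el om" "pl m' n' = pl (sc k) (pl m n)" for m n m' n' k
  proof -
    define s where "s = pl m n"
    have s: "s \<in> el om" using that by (simp add: s_def)
    \<comment> \<open>With m' + n' = s + k + 1, the square is expanded and the value written as (s^2
      + m) + (j + 1); the summand m comes out of s = m + n.\<close>
    have "pp m' n' = pl (pl (ts s s) m) (sc (pl (pl n (ts s k)) (pl (pl (ts k s) k) (pl (pl (ts k k) k) (pl s m')))))"
    proof -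
      have "pp m' n' = pl (ts (sc (pl k s)) (sc (pl k s))) m'"
        unfolding pp_def lt(2) s_def[symmetric] using lt(1) s by simp
      also have "\<dots> = pl (pl (ts s s) s) (sc (pl (ts s k) (pl (pl (ts k s) k) (pl (pl (ts k k) k) (pl s m')))))"
        using lt(1) s that(3) by (simp add: arith_om)
      also have "\<dots> = pl (pl (ts s s) m) (sc (pl (pl n (ts s k)) (pl (pl (ts k s) k) (pl (pl (ts k k) k) (pl s m')))))"
        unfolding s_def using lt(1) that by (simp add: arith_om)
      finally show ?thesis .
    qed
    moreover define j where "j = pl (pl n (ts s k)) (pl (pl (ts k s) k) (pl (pl (ts k k) k) (pl s m')))"
    ultimately have j: "j \<in> el om" "pp m' n' = pl (pp m n) (sc j)"
      using s lt(1) that by (simp_all add: pp_def s_def[symmetric])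
    then have "pl (sc j) (pp m n) = pl ze (pp m n)"
      using that by (simp add: pp_def pl_comm[of "sc j"] pl_comm[of j])
    then show False using pl_cancel[of "sc j" ze "pp m n"] j that by (simp add: pp_def)
  qed
  let ?s = "pl m n" and ?t = "pl m' n'"
  have lt: "\<exists>k\<in>el om. b = pl (sc k) a" if h: "le a b" "a \<noteq> b" "a \<in> el om" "b \<in> el om" for a b
  proof -
    obtain j where j: "j \<in> el om" "b = pl a j" using h(3,4,1) by (rule leE)
    then have "j \<noteq> ze" using h by auto
    then obtain k where "k \<in> el om" "j = sc k" using om_cases[OF j(1)] by metis
    then show ?thesis using j h by (intro bexI[of _ k]) (auto simp: pl_comm)
  qed
  have "?s = ?t"
  proof (rule ccontr)
    assume ne: "?s \<noteq> ?t"
    have o: "?s \<in> el om" "?t \<in> el om" using assms by simp_all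
    from le_total[OF this] show False
      using lt[OF _ ne o] lt[OF _ ne[symmetric] o(2,1)] *[OF assms(1-5)] *[OF assms(3,4,1,2) assms(5)[symmetric]] by blast
  qed
  then have "pl m (ts ?s ?s) = pl m' (ts ?s ?s)" using assms by (simp add: pp_def pl_comm)
  then have m: "m = m'" using pl_cancel[of m m' "ts ?s ?s"] assms by simp
  then have "pl n m = pl n' m" using \<open>?s = ?t\<close> assms by (simp add: pl_comm)
  then show ?thesis using m pl_cancel[of n n' m] assms by simp
qed

text \<open>A bound \<open>Z\<close> on the values turns a definable relation into a family of
  non-empty sets, and \<open>AC\<close> applies to it.\<close>

lemma choice:
  assumes AC: "AC M" and R: "D (\<lambda>e. R (e 0) (e (Suc 0)))" and U: "S \<in> U" "Z \<in> U"
    and ex: "\<And>x. x \<in> el S \<Longrightarrow> \<exists>y\<in>el Z. R x y"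
  obtains f where "f \<in> U" "\<And>x. x \<in> el S \<Longrightarrow> ap f x \<in> el Z \<and> R x (ap f x)"
proof -
  define B where "B x = mk {y \<in> el Z. R x y}" for x
  have TB: "Tm (\<lambda>e. B (e 0))" unfolding B_def by (intro df D_lift2[OF R] U)
  have elB: "el (B x) = {y \<in> el Z. R x y}" if "x \<in> el S" for x
  proof -
    have "D (\<lambda>e. R x (e 0))" using el_U[OF that] by (intro D_lift2[where R=R, OF R] df)
    from small_Collect[OF small_el[OF U(2)] this] show ?thesis unfolding B_def by (rule el_mk)
  qed
  define X where "X = mk (B ` el S)"
  have elX: "el X = B ` el S" unfolding X_def by (intro el_mk small_image TB small_el U)
  have "\<forall>b\<in>el X. el b \<noteq> {}" using elX elB ex by fastforce
  then have "has_choice_function M X" using AC unfolding AC_def X_def by simp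
  then obtain c where c: "c \<in> U" "is_function_on M c X" "\<forall>x\<in>el X. app M c x \<in> el x"
    unfolding has_choice_function_def by blast
  define f where "f = gr (\<lambda>x. ap c (B x)) S"
  have Tc: "Tm (\<lambda>e. ap c (B (e 0)))" by (intro df c TB)
  have "ap f x \<in> el Z \<and> R x (ap f x)" if x: "x \<in> el S" for x
  proof -
    have "B x \<in> el X" using x elX by simp
    then have "ap c (B x) \<in> el (B x)" using c app_ap by metis
    then show ?thesis unfolding f_def ap_gr[OF Tc U(1) x] elB[OF x] by simp
  qed
  then show ?thesis using that[of f] by (simp add: f_def)
qed

lemma countable_union:
  assumes AC: "AC M" and K: "card_le M K om" "K \<in> U" and B: "Tm (\<lambda>e. B (e 0))"
    and c: "\<And>k. k \<in> el K \<Longrightarrow> card_le M (B k) om"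
    and W: "W \<in> U" "el W \<subseteq> (\<Union>k\<in>el K. el (B k))"
  shows "card_le M W om"
proof -
  obtain f where f: "f \<in> U" "is_function_on M f K" "\<And>x. x \<in> el K \<Longrightarrow> ap f x \<in> el om" "inj_on (ap f) (el K)"
    using K(1) by (rule card_leE) blast
  define UB where "UB = mk (\<Union>k\<in>el K. el (B k))"
  have elUB: "el UB = (\<Union>k\<in>el K. el (B k))" unfolding UB_def by (intro el_mk small_UN B small_el K)
  \<comment> \<open>A set that contains an injection into \<omega> for each \<open>B k\<close>, from
    which one can be chosen for every \<open>k\<close> at once.\<close>
  define Z where "Z = mk {g. is_set M g \<and> el g \<subseteq> el (prd UB om)}"
  have elZ: "el Z = {g. is_set M g \<and> el g \<subseteq> el (prd UB om)}" unfolding Z_def by (intro el_mk small_Pow) simp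
  define R where "R k g \<longleftrightarrow> (\<forall>x\<in>el (B k). ap g x \<in> el om) \<and> inj_on (ap g) (el (B k))" for k g
  have DR: "D (\<lambda>e. R (e 0) (e (Suc 0)))" unfolding R_def inj_on_def by (intro df Tm_lift1[OF B])
  have ex: "\<exists>g\<in>el Z. R k g" if k: "k \<in> el K" for k
  proof -
    have BU: "B k \<in> U" using Tm_U1[OF B el_U[OF k]] .
    obtain g where g: "g \<in> U" "is_function_on M g (B k)" "\<And>x. x \<in> el (B k) \<Longrightarrow> ap g x \<in> el om" "inj_on (ap g) (el (B k))"
      using c[OF k] by (rule card_leE) blast
    have "el (prd (B k) om) \<subseteq> el (prd UB om)" using el_prd BU elUB k by (auto simp: UB_def)
    then have "g \<in> el Z" using fun_sub_prd[OF g(2,3) BU om_U] elZ by blast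
    then show ?thesis using g unfolding R_def by blast
  qed
  obtain h where h: "h \<in> U" "\<And>k. k \<in> el K \<Longrightarrow> ap h k \<in> el Z \<and> R k (ap h k)"
    by (rule choice[where Z=Z, OF AC DR K(2) _ ex]) (simp_all add: Z_def)
  define Q where "Q x k \<longleftrightarrow> x \<in> el (B k)" for x k
  have DQ: "D (\<lambda>e. Q (e 0) (e (Suc 0)))" unfolding Q_def by (intro df Tm_lift1[OF B])
  obtain q where q: "q \<in> U" "\<And>x. x \<in> el W \<Longrightarrow> ap q x \<in> el K \<and> Q x (ap q x)"
    by (rule choice[OF AC DQ W(1) K(2)]) (use W(2) in \<open>auto simp: Q_def\<close>)
  \<comment> \<open>The number of the piece chosen for \<open>x\<close> is paired with the position
    of \<open>x\<close> in that piece.\<close>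
  let ?F = "\<lambda>x. pp (ap f (ap q x)) (ap (ap h (ap q x)) x)"
  show ?thesis
  proof (rule card_leI[where F="?F"])
    show "Tm (\<lambda>e. ?F (e 0))" by (intro df f h q)
    have *: "ap f (ap q x) \<in> el om" "ap (ap h (ap q x)) x \<in> el om" if "x \<in> el W" for x
      using q(2)[OF that] h(2)[of "ap q x"] f(3) unfolding R_def Q_def by blast+
    show "?F x \<in> el om" if "x \<in> el W" for x using *[OF that] by (simp add: pp_def)
    show "inj_on ?F (el W)"
    proof (rule inj_onI)
      fix x y assume xy: "x \<in> el W" "y \<in> el W" "?F x = ?F y"
      from pp_inj[OF *[OF xy(1)] *[OF xy(2)] xy(3)]
      have e: "ap f (ap q x) = ap f (ap q y)" "ap (ap h (ap q x)) x = ap (ap h (ap q y)) y" by blast+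
      have k: "ap q x = ap q y" using inj_onD[OF f(4) e(1)] q(2) xy by blast
      have "inj_on (ap (ap h (ap q y))) (el (B (ap q y)))" using h(2) q(2)[OF xy(2)] unfolding R_def by blast
      then show "x = y" using inj_onD e(2) q(2)[OF xy(1)] q(2)[OF xy(2)] unfolding k Q_def by metis
    qed
  qed (rule W)
qed

end

section \<open>A weak Erd\H{o}s--Dushnik--Miller theorem in the ground model\<close>

context zfa begin

definition Uni :: "'m \<Rightarrow> 'm" where "Uni G = mk (\<Union>z\<in>el G. el z)"

lemma Uni_U [simp, df]: "Uni G \<in> U" and set_Uni [simp]: "is_set M (Uni G)" by (simp_all add: Uni_def)
lemma Tm_Uni [df]: "Tm t \<Longrightarrow> Tm (\<lambda>e. Uni (t e))" unfolding Uni_def by (intro df)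
lemma el_Uni: "G \<in> U \<Longrightarrow> el (Uni G) = (\<Union>z\<in>el G. el z)" unfolding Uni_def by (intro el_mk small_Union small_el)

lemma set_antisymI: "is_set M x \<Longrightarrow> is_set M y \<Longrightarrow> el x \<subseteq> el y \<Longrightarrow> el y \<subseteq> el x \<Longrightarrow> x = y"
  using set_ext by blast

text \<open>
  Every inflationary operation on the subsets of \<open>W\<close> has a fixed point that is reached from below
  through successors and unions of chains: the sets so reached form a chain, and their union is fixed.
\<close>

lemma tower_fixpoint:
  assumes W: "W \<in> U" and s: "Tm (\<lambda>e. s (e 0))" and P: "D (\<lambda>e. P (e 0))"
    and s1: "\<And>K. is_set M K \<Longrightarrow> el K \<subseteq> el W \<Longrightarrow> is_set M (s K) \<and> el (s K) \<subseteq> el W \<and> el K \<subseteq> el (s K)"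
    and P1: "\<And>K. is_set M K \<Longrightarrow> el K \<subseteq> el W \<Longrightarrow> P K \<Longrightarrow> P (s K)"
    and P2: "\<And>G. G \<in> U \<Longrightarrow> (\<And>K. K \<in> el G \<Longrightarrow> is_set M K \<and> el K \<subseteq> el W \<and> P K) \<Longrightarrow>
        (\<And>K L. K \<in> el G \<Longrightarrow> L \<in> el G \<Longrightarrow> el K \<subseteq> el L \<or> el L \<subseteq> el K) \<Longrightarrow> P (Uni G)"
  obtains K where "is_set M K" "el K \<subseteq> el W" "P K" "s K = K"
proof -
  define cl where "cl F \<longleftrightarrow> (\<forall>K\<in>el F. s K \<in> el F) \<and> (\<forall>G\<in>U. el G \<subseteq> el F \<longrightarrow> Uni G \<in> el F)" for F
  have Dcl: "D (\<lambda>e. cl (e 0))" unfolding cl_def by (intro df Tm_lift1[OF s])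
  define Pw where "Pw = {y. is_set M y \<and> el y \<subseteq> el W}"
  have smPw: "small Pw" unfolding Pw_def by (rule small_Pow[OF W])
  \<comment> \<open>The least family closed under \<open>s\<close> and under all unions, obtained as
    an intersection inside the power set of \<open>W\<close>. It takes the place of a recursion
    along the ordinals of \<open>M\<close>.\<close>
  define T where "T = mk {K \<in> Pw. \<forall>F\<in>U. cl F \<longrightarrow> K \<in> el F}"
  have "small {K \<in> Pw. \<forall>F\<in>U. cl F \<longrightarrow> K \<in> el F}"
    by (intro small_Collect smPw D_all D_imp D_lift1[OF Dcl] df)
  then have elT: "el T = {K \<in> Pw. \<forall>F\<in>U. cl F \<longrightarrow> K \<in> el F}" unfolding T_def by (rule el_mk)
  have TU: "T \<in> U" by (simp add: T_def)
  have sPw: "s K \<in> Pw" if "K \<in> Pw" for K using s1 that unfolding Pw_def by blast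
  have UPw: "Uni G \<in> Pw" if "G \<in> U" "el G \<subseteq> Pw" for G
    using that el_Uni[OF that(1)] unfolding Pw_def by auto
  have TPw: "K \<in> Pw" if "K \<in> el T" for K using that elT by simp
  have sT: "s K \<in> el T" if K: "K \<in> el T" for K
    using K sPw[OF TPw[OF K]] unfolding elT cl_def by blast
  have UT: "Uni G \<in> el T" if G: "G \<in> U" "el G \<subseteq> el T" for G
  proof -
    have "Uni G \<in> Pw" by (rule UPw) (use G TPw in auto)
    moreover have "Uni G \<in> el F" if "F \<in> U" "cl F" for F
    proof -
      have "el G \<subseteq> el F" using G(2) that unfolding elT by blast
      with that(2) G(1) show ?thesis unfolding cl_def by blast
    qed
    ultimately show ?thesis unfolding elT by simp
  qed
  have ind: "Q K" if K: "K \<in> el T" and Q: "D (\<lambda>e. Q (e 0))"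
    and Q1: "\<And>K. K \<in> el T \<Longrightarrow> Q K \<Longrightarrow> Q (s K)"
    and Q2: "\<And>G. G \<in> U \<Longrightarrow> el G \<subseteq> el T \<Longrightarrow> (\<And>K. K \<in> el G \<Longrightarrow> Q K) \<Longrightarrow> Q (Uni G)" for K Q
  proof -
    have sm: "small {K \<in> el T. Q K}" by (intro small_Collect small_el TU Q)
    have "cl (mk {K \<in> el T. Q K})"
      unfolding cl_def el_mk[OF sm]
    proof (intro conjI ballI impI)
      show "K \<in> {K \<in> el T. Q K} \<Longrightarrow> s K \<in> {K \<in> el T. Q K}" for K using sT Q1 by simp
      fix G assume G: "G \<in> U" "el G \<subseteq> {K \<in> el T. Q K}"
      then show "Uni G \<in> {K \<in> el T. Q K}" using UT[OF G(1)] Q2[OF G(1)] by (simp add: subset_iff)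
    qed
    then have "K \<in> el (mk {K \<in> el T. Q K})" using K mk_U unfolding elT by blast
    then show ?thesis unfolding el_mk[OF sm] by simp
  qed
  have setT: "is_set M K" "el K \<subseteq> el W" if "K \<in> el T" for K using TPw[OF that] unfolding Pw_def by simp_all
  have incT: "el K \<subseteq> el (s K)" if "K \<in> el T" for K using s1 setT[OF that] by blast
  \<comment> \<open>The comparability argument of the Bourbaki-Witt theorem. A set is good if
    \<open>s\<close> takes nothing that is strictly below it beyond it; by \<open>cmp\<close> a good
    set is comparable with every member of \<open>T\<close>, and all members turn out to be
    good.\<close>
  define good where "good K \<longleftrightarrow> (\<forall>L\<in>el T. el L \<subseteq> el K \<and> L \<noteq> K \<longrightarrow> el (s L) \<subseteq> el K)" for K
  have Dgood: "D (\<lambda>e. good (e 0))" unfolding good_def by (intro df Tm_lift1[OF s] TU)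
  have cmp: "el L \<subseteq> el K \<or> el (s K) \<subseteq> el L" if K: "K \<in> el T" "good K" and L: "L \<in> el T" for K L
    using L
  proof (rule ind[where Q="\<lambda>L. el L \<subseteq> el K \<or> el (s K) \<subseteq> el L"])
    show "D (\<lambda>e. el (e 0) \<subseteq> el K \<or> el (s K) \<subseteq> el (e 0))"
      by (intro df Tm_lift1[OF s]) (use K el_U in blast)+
    fix L assume L: "L \<in> el T" "el L \<subseteq> el K \<or> el (s K) \<subseteq> el L"
    then show "el (s L) \<subseteq> el K \<or> el (s K) \<subseteq> el (s L)"
      using K(2) incT[OF L(1)] unfolding good_def by blast
  next
    fix G assume G: "G \<in> U" "el G \<subseteq> el T" "\<And>L. L \<in> el G \<Longrightarrow> el L \<subseteq> el K \<or> el (s K) \<subseteq> el L"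
    then show "el (Uni G) \<subseteq> el K \<or> el (s K) \<subseteq> el (Uni G)" unfolding el_Uni[OF G(1)] by blast
  qed
  have good: "good K" if "K \<in> el T" for K
    using that
  proof (rule ind[where Q=good, OF _ Dgood])
    fix K assume K: "K \<in> el T" "good K"
    show "good (s K)" unfolding good_def
    proof (intro ballI impI)
      fix L assume L: "L \<in> el T" "el L \<subseteq> el (s K) \<and> L \<noteq> s K"
      then have "el L \<subseteq> el K" using cmp[OF K L(1)] set_antisymI setT[OF L(1)] setT[OF sT[OF K(1)]] by blast
      then show "el (s L) \<subseteq> el (s K)" using K L(1) incT[OF K(1)] unfolding good_def by (cases "L = K") auto
    qed
  next
    fix G assume G: "G \<in> U" "el G \<subseteq> el T" "\<And>K. K \<in> el G \<Longrightarrow> good K"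
    show "good (Uni G)" unfolding good_def
    proof (intro ballI impI)
      fix L assume L: "L \<in> el T" "el L \<subseteq> el (Uni G) \<and> L \<noteq> Uni G"
      have *: "el L \<subseteq> el K" if "K \<in> el G" "\<not> el K \<subseteq> el L" for K
        using cmp[of K L] that G L(1) incT[of K] by blast
      have nsub: "\<not> el (Uni G) \<subseteq> el L" using L set_antisymI setT[OF L(1)] set_Uni by blast
      then obtain K where K: "K \<in> el G" "\<not> el K \<subseteq> el L" unfolding el_Uni[OF G(1)] by blast
      have "L \<noteq> K" using K by blast
      then have "el (s L) \<subseteq> el K" using G(3)[OF K(1)] *[OF K] L(1) unfolding good_def by blast
      then show "el (s L) \<subseteq> el (Uni G)" unfolding el_Uni[OF G(1)] using K(1) by blast
    qed
  qed
  have chain: "el K \<subseteq> el L \<or> el L \<subseteq> el K" if "K \<in> el T" "L \<in> el T" for K L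
    using cmp[OF that(1) good[OF that(1)] that(2)] incT[OF that(1)] by blast
  have PT: "P K" if "K \<in> el T" for K
    using that
  proof (rule ind[where Q=P, OF _ P])
    show "\<And>K. K \<in> el T \<Longrightarrow> P K \<Longrightarrow> P (s K)" using P1 setT by blast
    show "P (Uni G)" if G: "G \<in> U" "el G \<subseteq> el T" "\<And>K. K \<in> el G \<Longrightarrow> P K" for G
    proof (rule P2[OF G(1)])
      show "\<And>K. K \<in> el G \<Longrightarrow> is_set M K \<and> el K \<subseteq> el W \<and> P K" using G setT by blast
      show "\<And>K L. K \<in> el G \<Longrightarrow> L \<in> el G \<Longrightarrow> el K \<subseteq> el L \<or> el L \<subseteq> el K" using G chain by blast
    qed
  qed
  have X: "Uni T \<in> el T" by (rule UT[OF TU subset_refl])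
  have "el (s (Uni T)) \<subseteq> el (Uni T)" using sT[OF X] unfolding el_Uni[OF TU] by blast
  then have "s (Uni T) = Uni T" using set_antisymI setT(1)[OF sT[OF X]] incT[OF X] set_Uni by blast
  then show ?thesis using that[of "Uni T"] setT[OF X] PT[OF X] by blast
qed

text \<open>The step adds a chosen vertex that is joined to all present ones, as long as there is
  such a vertex. A clique fixed by the step is maximal.\<close>

lemma maximal_clique:
  assumes AC: "AC M" and W: "W \<in> U" and R: "D (\<lambda>e. R (e 0) (e (Suc 0)))" and sym: "\<And>x y. R x y \<Longrightarrow> R y x"
  obtains K where "is_set M K" "el K \<subseteq> el W" "\<And>x y. x \<in> el K \<Longrightarrow> y \<in> el K \<Longrightarrow> x \<noteq> y \<Longrightarrow> R x y"
    "\<And>y. y \<in> el W \<Longrightarrow> y \<notin> el K \<Longrightarrow> \<exists>x\<in>el K. \<not> R x y"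
proof -
  define can where "can K y \<longleftrightarrow> y \<in> el W \<and> y \<notin> el K \<and> (\<forall>x\<in>el K. R x y)" for K y
  have Dcan: "D (\<lambda>e. can (e 0) (e (Suc 0)))" unfolding can_def by (intro df D_lift2[OF R] W)
  define S where "S = mk {K \<in> {y. is_set M y \<and> el y \<subseteq> el W}. \<exists>y\<in>el W. can K y}"
  have "small {K \<in> {y. is_set M y \<and> el y \<subseteq> el W}. \<exists>y\<in>el W. can K y}"
    by (intro small_Collect small_Pow W df D_lift2[OF Dcan])
  then have elS: "el S = {K \<in> {y. is_set M y \<and> el y \<subseteq> el W}. \<exists>y\<in>el W. can K y}" unfolding S_def by (rule el_mk)
  have SU: "S \<in> U" by (simp add: S_def)
  obtain c where c: "c \<in> U" "\<And>K. K \<in> el S \<Longrightarrow> ap c K \<in> el W \<and> can K (ap c K)"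
    by (rule choice[where Z=W, OF AC Dcan SU W]) (use elS in auto)
  define s where "s K = (if K \<in> el S then ins (ap c K) K else K)" for K
  have Ts: "Tm (\<lambda>e. s (e 0))" unfolding s_def by (intro df SU c)
  define clq where "clq K \<longleftrightarrow> (\<forall>x\<in>el K. \<forall>y\<in>el K. x \<noteq> y \<longrightarrow> R x y)" for K
  have Dclq: "D (\<lambda>e. clq (e 0))" unfolding clq_def by (intro df D_lift2[OF R])
  obtain K where K: "is_set M K" "el K \<subseteq> el W" "clq K" "s K = K"
  proof (rule tower_fixpoint[OF W Ts Dclq])
    fix K assume K: "is_set M K" "el K \<subseteq> el W"
    have e: "el (s K) = (if K \<in> el S then insert (ap c K) (el K) else el K)"
      unfolding s_def using set_U[OF K(1)] by (simp add: el_ins)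
    show "is_set M (s K) \<and> el (s K) \<subseteq> el W \<and> el K \<subseteq> el (s K)"
      using K c(2)[of K] unfolding e by (auto simp: s_def)
    show "clq (s K)" if "clq K"
      using that c(2)[of K] sym unfolding clq_def e can_def by (auto split: if_splits)
  next
    fix G assume G: "G \<in> U" "\<And>K. K \<in> el G \<Longrightarrow> is_set M K \<and> el K \<subseteq> el W \<and> clq K"
      "\<And>K L. K \<in> el G \<Longrightarrow> L \<in> el G \<Longrightarrow> el K \<subseteq> el L \<or> el L \<subseteq> el K"
    show "clq (Uni G)" unfolding clq_def el_Uni[OF G(1)]
    proof (intro ballI impI)
      fix x y assume xy: "x \<in> (\<Union>z\<in>el G. el z)" "y \<in> (\<Union>z\<in>el G. el z)" "x \<noteq> y"
      obtain K L where KL: "K \<in> el G" "x \<in> el K" "L \<in> el G" "y \<in> el L" using xy by blast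
      then have "(x \<in> el K \<and> y \<in> el K) \<or> (x \<in> el L \<and> y \<in> el L)" using G(3)[of K L] by blast
      then show "R x y" using G(2)[OF KL(1)] G(2)[OF KL(3)] xy(3) unfolding clq_def by blast
    qed
  qed
  have "K \<notin> el S"
  proof
    assume KS: "K \<in> el S"
    then have "ap c K \<in> el (s K)" using set_U[OF K(1)] by (simp add: s_def el_ins)
    then show False using c(2)[OF KS] K(4) unfolding can_def by simp
  qed
  then have "\<exists>x\<in>el K. \<not> R x y" if "y \<in> el W" "y \<notin> el K" for y
    using that K unfolding elS can_def by blast
  with K that show ?thesis unfolding clq_def by blast
qed

text \<open>If some uncountable \<open>W\<close> has only countably many non-neighbours of each of
  its vertices inside \<open>W\<close>, a maximal clique of \<open>W\<close> cannot be countable,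
  because the non-neighbours of its vertices would cover \<open>W\<close>. Otherwise every
  uncountable set of vertices has a member with uncountably many non-neighbours in it, and \<omega>
  such choices in succession yield an infinite independent set.\<close>

theorem EDM_ground:
  assumes AC: "AC M" and V: "V \<in> U" "\<not> card_le M V om"
    and R: "D (\<lambda>e. R (e 0) (e (Suc 0)))" and sym: "\<And>x y. R x y \<Longrightarrow> R y x"
  shows "(\<exists>I. is_set M I \<and> el I \<subseteq> el V \<and> card_le M om I \<and> (\<forall>x\<in>el I. \<forall>y\<in>el I. x \<noteq> y \<longrightarrow> \<not> R x y)) \<or>
    (\<exists>K. is_set M K \<and> el K \<subseteq> el V \<and> \<not> card_le M K om \<and> (\<forall>x\<in>el K. \<forall>y\<in>el K. x \<noteq> y \<longrightarrow> R x y))"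
proof -
  define nn where "nn W x = mk {y \<in> el W. y \<noteq> x \<and> \<not> R x y}" for W x
  have Tnn: "Tm (\<lambda>e. nn (e 0) (e (Suc 0)))" unfolding nn_def by (intro df D_lift2[OF R])
  have elnn: "el (nn W x) = {y \<in> el W. y \<noteq> x \<and> \<not> R x y}" if "W \<in> U" "x \<in> U" for W x
  proof -
    have "small {y \<in> el W. y \<noteq> x \<and> \<not> R x y}"
      by (intro small_Collect small_el that(1) df D_lift2[OF R]) (rule that(2))+
    then show ?thesis unfolding nn_def by (rule el_mk)
  qed
  have nnU: "nn W x \<in> U" and set_nn: "is_set M (nn W x)" for W x by (simp_all add: nn_def)
  define unc where "unc W \<longleftrightarrow> is_set M W \<and> el W \<subseteq> el V \<and> \<not> card_le M W om" for W
  have Dunc: "D (\<lambda>e. unc (e 0))" unfolding unc_def by (intro df V)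
  show ?thesis
  proof (cases "\<exists>W. unc W \<and> (\<forall>x\<in>el W. card_le M (nn W x) om)")
    case True
    then obtain W where W: "unc W" "\<And>x. x \<in> el W \<Longrightarrow> card_le M (nn W x) om" by blast
    have WU: "W \<in> U" using W(1) set_U unfolding unc_def by blast
    obtain K where K: "is_set M K" "el K \<subseteq> el W" "\<And>x y. x \<in> el K \<Longrightarrow> y \<in> el K \<Longrightarrow> x \<noteq> y \<Longrightarrow> R x y"
      "\<And>y. y \<in> el W \<Longrightarrow> y \<notin> el K \<Longrightarrow> \<exists>x\<in>el K. \<not> R x y"
      by (rule maximal_clique[OF AC WU R sym]) blast+
    have KU: "K \<in> U" using K(1) by (rule set_U)
    have "\<not> card_le M K om"
    proof
      assume Kc: "card_le M K om"
      \<comment> \<open>By maximality each vertex of \<open>W\<close> is in \<open>K\<close> or is a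
        non-neighbour of some member of \<open>K\<close>; so these sets cover
        \<open>W\<close>.\<close>
      define B where "B k = ins k (nn W k)" for k
      have TB: "Tm (\<lambda>e. B (e 0))" unfolding B_def by (intro df Tm_lift2[OF Tnn] WU)
      have "card_le M W om"
      proof (rule countable_union[OF AC Kc KU TB _ WU])
        fix k assume k: "k \<in> el K"
        then have "k \<in> el W" using K by blast
        then show "card_le M (B k) om" unfolding B_def
          by (intro card_le_ins W(2) nnU el_U[OF k])
      next
        have elB: "el (B k) = insert k {y \<in> el W. y \<noteq> k \<and> \<not> R k y}" if "k \<in> el K" for k
          unfolding B_def using elnn[OF WU el_U[OF that]] el_ins[OF el_U[OF that] nnU] by simp
        show "el W \<subseteq> (\<Union>k\<in>el K. el (B k))"
        proof
          fix y assume y: "y \<in> el W"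
          show "y \<in> (\<Union>k\<in>el K. el (B k))"
          proof (cases "y \<in> el K")
            case True then show ?thesis using elB by auto
          next
            case False
            then obtain x where x: "x \<in> el K" "\<not> R x y" using K(4)[OF y] by blast
            then have "y \<in> el (B x)" using elB[OF x(1)] y False by auto
            with x(1) show ?thesis by blast
          qed
        qed
      qed
      then show False using W(1) unfolding unc_def by blast
    qed
    moreover have "el K \<subseteq> el V" using K(2) W(1) unfolding unc_def by blast
    ultimately show ?thesis using K(1,3) by blast
  next
    case False
    define Q where "Q W x \<longleftrightarrow> x \<in> el W \<and> unc (nn W x)" for W x
    have DQ: "D (\<lambda>e. Q (e 0) (e (Suc 0)))" unfolding Q_def by (intro df D_lift1[OF Dunc] Tm_lift2[OF Tnn])
    define S where "S = mk {W \<in> {y. is_set M y \<and> el y \<subseteq> el V}. unc W}"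
    have "small {W \<in> {y. is_set M y \<and> el y \<subseteq> el V}. unc W}" by (intro small_Collect small_Pow V Dunc)
    then have "el S = {W \<in> {y. is_set M y \<and> el y \<subseteq> el V}. unc W}" unfolding S_def by (rule el_mk)
    then have elS: "W \<in> el S \<longleftrightarrow> unc W" for W unfolding unc_def by blast
    have SU: "S \<in> U" by (simp add: S_def)
    have ex: "\<exists>x\<in>el V. Q W x" if W: "W \<in> el S" for W
    proof -
      obtain x where x: "x \<in> el W" "\<not> card_le M (nn W x) om" using False W elS by blast
      have "el (nn W x) \<subseteq> el V" using elnn[OF el_U[OF W] el_U[OF x(1)]] W elS unfolding unc_def by auto
      then show ?thesis using x W elS set_nn unfolding Q_def unc_def by blast
    qed
    obtain c where c: "c \<in> U" "\<And>W. W \<in> el S \<Longrightarrow> ap c W \<in> el V \<and> Q W (ap c W)"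
      by (rule choice[where Z=V, OF AC DQ SU V(1) ex]) blast+
    define h where "h W = nn W (ap c W)" for W
    have Th: "Tm (\<lambda>e. h (e 0))" unfolding h_def by (intro Tm_lift2[OF Tnn] df c)
    \<comment> \<open>\<open>V\<close> is only assumed to be in the universe; \<open>V0\<close> is
      the set with the same elements.\<close>
    define V0 where "V0 = mk (el V)"
    have elV0: "el V0 = el V" unfolding V0_def by (intro el_mk small_el V)
    have V0U: "V0 \<in> U" by (simp add: V0_def)
    have "\<not> card_le M V0 om"
      using card_le_trans[OF card_le_subset[of V V0]] V elV0 by blast
    then have V0: "V0 \<in> el S" unfolding elS unc_def using elV0 by (simp add: V0_def)
    \<comment> \<open>A descending sequence of uncountable sets: each stage passes to the
      non-neighbours of the vertex chosen in the previous one.\<close>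
    define w where "w n = nrec V0 h n" for n
    have Tw: "Tm (\<lambda>e. w (e 0))" unfolding w_def by (intro df V0U Tm_lift1[OF Th])
    have w0: "w ze = V0" and ws: "w (sc n) = h (w n)" if "n \<in> el om" for n
      unfolding w_def using nrec_ze[OF Th V0U] nrec_sc[OF Th V0U] that by auto
    have wz: "w ze = V0" using w0[OF ze_om] .
    have hS: "h W \<in> el S" if "W \<in> el S" for W
      using c(2)[OF that] unfolding elS h_def Q_def by blast
    have wS: "w n \<in> el S" if "n \<in> el om" for n
      using that
    proof (rule om_induct[where P="\<lambda>n. w n \<in> el S"])
      show "D (\<lambda>e. w (e 0) \<in> el S)" by (intro df Tm_lift1[OF Tw] SU)
      show "w ze \<in> el S" using wz V0 by simp
      show "w (sc n) \<in> el S" if "n \<in> el om" "w n \<in> el S" for n using ws[OF that(1)] hS[OF that(2)] by simp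
    qed
    define p where "p n = ap c (w n)" for n
    have Tp: "Tm (\<lambda>e. p (e 0))" unfolding p_def by (intro df c Tm_lift1[OF Tw])
    have pw: "p n \<in> el (w n)" and pV: "p n \<in> el V" if "n \<in> el om" for n
      using c(2)[OF wS[OF that]] unfolding p_def Q_def by blast+
    have elws: "el (w (sc n)) = {y \<in> el (w n). y \<noteq> p n \<and> \<not> R (p n) y}" if "n \<in> el om" for n
      unfolding ws[OF that] h_def p_def by (rule elnn[OF el_U[OF wS[OF that]] ap_U])
    have dec: "\<forall>m\<in>el n. el (w n) \<subseteq> {y. y \<noteq> p m \<and> \<not> R (p m) y}" if "n \<in> el om" for n
      using that
    proof (rule om_induct[where P="\<lambda>n. \<forall>m\<in>el n. el (w n) \<subseteq> {y. y \<noteq> p m \<and> \<not> R (p m) y}"])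
      \<comment> \<open>The comprehension in the goal ranges over the whole type and not over the
        universe, so definability is shown for the bounded form of the inclusion.\<close>
      have "D (\<lambda>e. \<forall>m\<in>el (e 0). \<forall>y\<in>el (w (e 0)). y \<noteq> p m \<and> \<not> R (p m) y)"
        by (intro df D_lift2[OF R] Tm_lift1[OF Tw] Tm_lift1[OF Tp])
      then show "D (\<lambda>e. \<forall>m\<in>el (e 0). el (w (e 0)) \<subseteq> {y. y \<noteq> p m \<and> \<not> R (p m) y})"
        by (simp only: subset_iff mem_Collect_eq Ball_def)
      show "\<forall>m\<in>el ze. el (w ze) \<subseteq> {y. y \<noteq> p m \<and> \<not> R (p m) y}" by simp
      fix n assume n: "n \<in> el om" "\<forall>m\<in>el n. el (w n) \<subseteq> {y. y \<noteq> p m \<and> \<not> R (p m) y}"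
      then show "\<forall>m\<in>el (sc n). el (w (sc n)) \<subseteq> {y. y \<noteq> p m \<and> \<not> R (p m) y}"
        using elws[OF n(1)] el_sc[of n] by auto
    qed
    have lt: "p n \<noteq> p m \<and> \<not> R (p m) (p n)" if "n \<in> el om" "m \<in> el n" for m n
      using dec[OF that(1)] that(2) pw[OF that(1)] by blast
    have ne: "p n \<noteq> p m \<and> \<not> R (p m) (p n)" if "n \<in> el om" "m \<in> el om" "n \<noteq> m" for m n
      using nat_linear[OF that(1,2)] that lt sym by metis
    define I where "I = mk (p ` el om)"
    have elI: "el I = p ` el om" unfolding I_def by (intro el_mk small_image Tp small_el om_U)
    have "card_le M om I"
    proof (rule card_leI[OF Tp om_U])
      show "inj_on p (el om)" using ne by (meson inj_onI)
    qed (simp add: elI)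
    moreover have "\<forall>x\<in>el I. \<forall>y\<in>el I. x \<noteq> y \<longrightarrow> \<not> R x y" unfolding elI using ne by blast
    moreover have "is_set M I" "el I \<subseteq> el V" using elI pV by (auto simp: I_def)
    ultimately show ?thesis by blast
  qed
qed

end

section \<open>Fraenkel--Mostowski models with finite supports\<close>

locale perm_group = zfa M for M :: "'m struct" +
  fixes G \<Gamma> :: 'm
  assumes set_G: "is_set M G"
    and G_perm: "\<And>\<phi>. \<phi> \<in> el G \<Longrightarrow> perm \<phi>"
    and G_id: "\<exists>\<iota>\<in>el G. \<forall>a\<in>el At. ap \<iota> a = a"
    and G_comp: "\<And>\<phi> \<psi>. \<phi> \<in> el G \<Longrightarrow> \<psi> \<in> el G \<Longrightarrow> \<exists>\<chi>\<in>el G. \<forall>a\<in>el At. ap \<chi> a = ap \<phi> (ap \<psi> a)"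
    and G_inv: "\<And>\<phi>. \<phi> \<in> el G \<Longrightarrow> \<exists>\<psi>\<in>el G. \<forall>a\<in>el At. ap \<psi> (ap \<phi> a) = a"
    and filter: "is_finite_support_filter M G \<Gamma>"
begin

lemma G_U [simp, df]: "G \<in> U" using set_G by (rule set_U)

section \<open>Pointwise stabilisers and supports\<close>

definition fx :: "'m \<Rightarrow> 'm set" where
  "fx E = {\<phi> \<in> el G. \<forall>t\<in>el E. ap \<phi> t = t}"

definition fs :: "'m \<Rightarrow> bool" where
  "fs E \<longleftrightarrow> kfin E \<and> el E \<subseteq> el At"

definition supports :: "'m \<Rightarrow> 'm \<Rightarrow> bool" where
  "supports E x \<longleftrightarrow> (\<forall>\<phi>\<in>fx E. pe \<phi> x = x)"

lemma fx_G: "\<phi> \<in> fx E \<Longrightarrow> \<phi> \<in> el G" by (simp add: fx_def)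
lemma fx_perm: "\<phi> \<in> fx E \<Longrightarrow> perm \<phi>" using fx_G G_perm by blast
lemma fx_U: "\<phi> \<in> fx E \<Longrightarrow> \<phi> \<in> U" using fx_perm perm_U by blast
lemma fx_mono: "el E \<subseteq> el E' \<Longrightarrow> fx E' \<subseteq> fx E" by (auto simp: fx_def)
lemma fs_U: "fs E \<Longrightarrow> E \<in> U" unfolding fs_def using kfin_U by blast
lemma supports_mono: "el E \<subseteq> el E' \<Longrightarrow> supports E x \<Longrightarrow> supports E' x"
  unfolding supports_def using fx_mono by blast
lemma supportsD: "supports E x \<Longrightarrow> \<phi> \<in> fx E \<Longrightarrow> pe \<phi> x = x" by (simp add: supports_def)

lemma fs_ze [simp]: "fs ze" by (simp add: fs_def)
lemma fs_un: "fs E \<Longrightarrow> fs F \<Longrightarrow> fs (un E F)"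
  unfolding fs_def using kfin_un el_un[of E F] kfin_U by simp
lemma fs_ins: "fs E \<Longrightarrow> a \<in> el At \<Longrightarrow> fs (ins a E)"
  unfolding fs_def using kfin_ins[of E a] el_ins[of a E] kfin_U el_U[of a At] by simp
lemma el_unf: "fs E \<Longrightarrow> fs F \<Longrightarrow> el (un E F) = el E \<union> el F" using fs_U el_un by blast
lemma el_insf: "fs E \<Longrightarrow> a \<in> el At \<Longrightarrow> el (ins a E) = insert a (el E)" using fs_U el_ins el_U by blast
lemma supports_un1: "fs E \<Longrightarrow> fs F \<Longrightarrow> supports E x \<Longrightarrow> supports (un E F) x"
  by (rule supports_mono[of E]) (simp_all add: el_unf)
lemma supports_un2: "fs E \<Longrightarrow> fs F \<Longrightarrow> supports F x \<Longrightarrow> supports (un E F) x"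
  by (rule supports_mono[of F]) (simp_all add: el_unf)

lemma D_sup [df]: "Tm t \<Longrightarrow> Tm u \<Longrightarrow> D (\<lambda>e. supports (t e) (u e))"
proof (rule D_lift2[where R=supports])
  show "D (\<lambda>e. supports (e 0) (e (Suc 0)))" unfolding supports_def fx_def by (intro df)
qed

lemma Ds_fx: "E \<in> U \<Longrightarrow> Ds (\<lambda>e. fx E)" unfolding fx_def by (intro df)
lemma small_fx: "E \<in> U \<Longrightarrow> small (fx E)"
  by (rule small_subset[OF small_el[OF G_U] _ Ds_fx]) (auto simp: fx_def)

lemma fx_id: assumes "el E \<subseteq> el At" obtains \<iota> where "\<iota> \<in> fx E" "\<And>x. x \<in> U \<Longrightarrow> pe \<iota> x = x"
proof -
  obtain \<iota> where i: "\<iota> \<in> el G" "\<forall>a\<in>el At. ap \<iota> a = a" using G_id by blast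
  have "pe \<iota> x = x" if "x \<in> U" for x using pe_id[OF G_perm[OF i(1)] _ that] i(2) by blast
  moreover have "\<iota> \<in> fx E" using i assms unfolding fx_def by blast
  ultimately show ?thesis using that by blast
qed

lemma fx_comp: assumes "\<phi> \<in> fx E" "\<psi> \<in> fx E'"
  obtains \<chi> where "\<chi> \<in> el G" "\<And>x. x \<in> U \<Longrightarrow> pe \<chi> x = pe \<phi> (pe \<psi> x)" "\<And>a. a \<in> el At \<Longrightarrow> ap \<chi> a = ap \<phi> (ap \<psi> a)"
proof -
  obtain \<chi> where c: "\<chi> \<in> el G" "\<forall>a\<in>el At. ap \<chi> a = ap \<phi> (ap \<psi> a)" using G_comp fx_G assms by metis
  have "pe \<chi> x = pe \<phi> (pe \<psi> x)" if "x \<in> U" for x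
    using pe_comp[OF fx_perm[OF assms(1)] fx_perm[OF assms(2)] G_perm[OF c(1)] _ that] c(2) by blast
  then show ?thesis using that c by blast
qed

lemma fx_inv: assumes "\<phi> \<in> fx E" "el E \<subseteq> el At"
  obtains \<psi> where "\<psi> \<in> fx E" "\<And>x. x \<in> U \<Longrightarrow> pe \<psi> (pe \<phi> x) = x" "\<And>x. x \<in> U \<Longrightarrow> pe \<phi> (pe \<psi> x) = x"
    "\<And>a. a \<in> el At \<Longrightarrow> ap \<psi> (ap \<phi> a) = a" "\<And>a. a \<in> el At \<Longrightarrow> ap \<phi> (ap \<psi> a) = a"
proof -
  obtain \<psi> where c: "\<psi> \<in> el G" "\<forall>a\<in>el At. ap \<psi> (ap \<phi> a) = a" using G_inv fx_G assms(1) by metis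
  have p: "perm \<phi>" "perm \<psi>" using fx_perm assms(1) G_perm c(1) by blast+
  obtain \<iota> where i: "\<iota> \<in> el G" "\<forall>a\<in>el At. ap \<iota> a = a" using G_id by blast
  have pi: "perm \<iota>" using G_perm i(1) by blast
  have idx: "pe \<iota> x = x" if "x \<in> U" for x using pe_id[OF pi _ that] i(2) by blast
  have 1: "pe \<psi> (pe \<phi> x) = x" if "x \<in> U" for x
    using pe_comp[OF p(2,1) pi _ that] c(2) i(2) idx[OF that] by metis
  have 2: "pe \<phi> (pe \<psi> x) = x" if "x \<in> U" for x
    using pe_inj[OF p(2) pe_U that] 1[OF pe_U] by metis
  have 3: "ap \<phi> (ap \<psi> a) = a" if "a \<in> el At" for a
    using 2[OF el_U[OF that]] pe_atom[OF perm_U[OF p(2)] that] pe_atom[OF perm_U[OF p(1)] perm_At[OF p(2) that]] by simp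
  have "\<psi> \<in> fx E" using c assms unfolding fx_def by (auto dest!: bspec subsetD)
  then show ?thesis using that[of \<psi>] 1 2 3 c(2) by blast
qed

lemma fx_ap: "\<phi> \<in> fx E \<Longrightarrow> a \<in> el At \<Longrightarrow> pe \<phi> a = ap \<phi> a"
  using pe_atom fx_U by blast

lemma fx_At: "\<phi> \<in> fx E \<Longrightarrow> a \<in> el At \<Longrightarrow> ap \<phi> a \<in> el At"
  using perm_At fx_perm by blast

lemma Fix_eq: assumes "el E \<subseteq> el At" shows "Fix M G E = fx E"
proof -
  have "perm_ext M \<phi> t = ap \<phi> t" if "\<phi> \<in> el G" "t \<in> el E" for \<phi> t
  proof -
    have t: "t \<in> el At" using that assms by blast
    have "is_function_on M \<phi> At" using G_perm[OF that(1)] unfolding perm_def by blast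
    from perm_ext_eq[OF this el_U[OF t]] pe_atom[OF perm_U[OF G_perm[OF that(1)]] t] show ?thesis by simp
  qed
  then show ?thesis unfolding Fix_def fx_def by auto
qed

lemma Sym_eq: assumes "x \<in> U" shows "Sym M G x = {\<phi> \<in> el G. pe \<phi> x = x}"
proof -
  have "perm_ext M \<phi> x = pe \<phi> x" if "\<phi> \<in> el G" for \<phi>
    using G_perm[OF that] perm_ext_eq[OF _ assms] unfolding perm_def by blast
  then show ?thesis unfolding Sym_def by auto
qed

lemma sub_At_eq: assumes "is_set M E" "el E \<subseteq> el At" shows "card_less M E om \<and> Fix M G E \<subseteq> S \<longleftrightarrow> fs E \<and> fx E \<subseteq> S"
  unfolding fs_def Fix_eq[OF assms(2)] fin_iff[OF assms(1)] using assms by blast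

lemma filter_iff: "H \<in> el \<Gamma> \<longleftrightarrow> is_subgroup M H G \<and> (\<exists>E. fs E \<and> fx E \<subseteq> el H)"
proof -
  have "H \<in> el \<Gamma> \<longleftrightarrow> is_subgroup M H G \<and> (\<exists>E. is_set M E \<and> el E \<subseteq> el At \<and> card_less M E om \<and> Fix M G E \<subseteq> el H)"
    using filter unfolding is_finite_support_filter_def by simp
  also have "(\<exists>E. is_set M E \<and> el E \<subseteq> el At \<and> card_less M E om \<and> Fix M G E \<subseteq> el H) \<longleftrightarrow> (\<exists>E. fs E \<and> fx E \<subseteq> el H)"
    using sub_At_eq[of _ "el H"] kfin_set unfolding fs_def by metis
  finally show ?thesis .
qed

lemma G_fx_ze: "fx ze = el G" by (simp add: fx_def)

text \<open>The stabiliser of \<open>x\<close> is always a subgroup, and by separation it is a set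
  of \<open>M\<close>. Hence its membership in \<open>\<Gamma>\<close> amounts to the existence of a
  finite support.\<close>

lemma sym_iff: assumes x: "x \<in> U" shows "is_symmetric M G \<Gamma> x \<longleftrightarrow> (\<exists>E. fs E \<and> supports E x)"
proof
  assume "is_symmetric M G \<Gamma> x"
  then obtain H where H: "H \<in> el \<Gamma>" "el H = Sym M G x" unfolding is_symmetric_def by blast
  then obtain E where "fs E" "fx E \<subseteq> el H" using filter_iff by blast
  then show "\<exists>E. fs E \<and> supports E x" using H(2) unfolding Sym_eq[OF x] supports_def by blast
next
  assume "\<exists>E. fs E \<and> supports E x"
  then obtain E where E: "fs E" "supports E x" by blast
  define H where "H = mk {\<phi> \<in> el G. pe \<phi> x = x}"
  have "small {\<phi> \<in> el G. pe \<phi> x = x}" by (intro small_Collect small_el df) (simp_all add: x)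
  then have elH: "el H = {\<phi> \<in> el G. pe \<phi> x = x}" unfolding H_def by (rule el_mk)
  have app: "app M \<phi> a = ap \<phi> a" if "\<phi> \<in> el H" "a \<in> el At" for \<phi> a
    using app_ap[OF that(2)] G_perm[of \<phi>] that(1) elH unfolding perm_def by simp
  have A: "ap \<phi> a \<in> el At" if "\<phi> \<in> el H" "a \<in> el At" for \<phi> a
    using perm_At[OF G_perm that(2)] that(1) elH by simp
  have "is_perm_group M H"
    unfolding is_perm_group_def
  proof (intro conjI ballI)
    show "is_set M H" by (simp add: H_def)
    show "is_perm M \<phi>" if "\<phi> \<in> el H" for \<phi> using that elH G_perm is_perm_iff by simp
    have z: "el ze \<subseteq> el At" by simp
    obtain \<iota> where i: "\<iota> \<in> fx ze" "\<And>x. x \<in> U \<Longrightarrow> pe \<iota> x = x" using fx_id[OF z] by metis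
    have iH: "\<iota> \<in> el H" using i x elH G_fx_ze by simp
    have "app M \<iota> a = a" if "a \<in> el At" for a
      using app[OF iH that] fx_ap[OF i(1) that] i(2)[OF el_U[OF that]] by simp
    then show "\<exists>\<iota>\<in>el H. \<forall>a\<in>el At. app M \<iota> a = a" using iH by blast
    fix \<phi> assume p: "\<phi> \<in> el H"
    then have pf: "\<phi> \<in> fx ze" using elH G_fx_ze by simp
    show "\<exists>\<chi>\<in>el H. \<forall>a\<in>el At. app M \<chi> a = app M \<phi> (app M \<psi> a)" if q: "\<psi> \<in> el H" for \<psi>
    proof -
      have qf: "\<psi> \<in> fx ze" using q elH G_fx_ze by simp
      obtain \<chi> where c: "\<chi> \<in> el G" "\<And>x. x \<in> U \<Longrightarrow> pe \<chi> x = pe \<phi> (pe \<psi> x)" "\<And>a. a \<in> el At \<Longrightarrow> ap \<chi> a = ap \<phi> (ap \<psi> a)"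
        by (rule fx_comp[OF pf qf]) blast
      have "\<chi> \<in> el H" using c(1) c(2)[OF x] p q elH by simp
      then show ?thesis using app A c(3) p q by (intro bexI[of _ \<chi>]) auto
    qed
    obtain \<psi> where c: "\<psi> \<in> fx ze" "\<And>x. x \<in> U \<Longrightarrow> pe \<psi> (pe \<phi> x) = x" "\<And>a. a \<in> el At \<Longrightarrow> ap \<psi> (ap \<phi> a) = a"
      using fx_inv[OF pf z] by metis
    have "\<psi> \<in> el H" using c(1) c(2)[OF x] p elH G_fx_ze by simp
    then show "\<exists>\<psi>\<in>el H. \<forall>a\<in>el At. app M \<psi> (app M \<phi> a) = a" using app A c(3) p by (intro bexI[of _ \<psi>]) auto
  qed
  then have "is_subgroup M H G" unfolding is_subgroup_def elH by simp
  moreover have "fx E \<subseteq> el H" using E(2) elH fx_G unfolding supports_def by blast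
  ultimately have "H \<in> el \<Gamma>" using filter_iff E(1) by blast
  then show "is_symmetric M G \<Gamma> x" unfolding is_symmetric_def Sym_eq[OF x] using elH by blast
qed

section \<open>The universe of the submodel\<close>

abbreviation N :: "'m struct" where "N \<equiv> FM_model M G \<Gamma>"
definition NU :: "'m set" where "NU = {x \<in> U. \<forall>y\<in>insert x (tcs x). \<exists>E. fs E \<and> supports E y}"

lemma univ_N: "univ N = NU"
  unfolding FM_model_def NU_def using trans_closure_eq sym_iff small_sub_U[OF small_tcs] by (auto 0 4 simp: subset_iff)

lemma mem_N [simp]: "mem N = mem M" and atoms_N [simp]: "atoms N = At" by (simp_all add: FM_model_def)

lemma NU_U: "x \<in> NU \<Longrightarrow> x \<in> U" by (simp add: NU_def)
lemma NU_sup: assumes "x \<in> NU" obtains E where "fs E" "supports E x" using assms unfolding NU_def by blast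

lemma NU_el: assumes "x \<in> NU" "y \<in> el x" shows "y \<in> NU"
proof -
  have xU: "x \<in> U" and yU: "y \<in> U" using assms NU_U el_U by blast+
  have y: "y \<in> tcs x" using el_sub_tcs[OF xU] assms(2) by blast
  have T: "is_transitive M (mk (tcs x))"
    unfolding is_transitive_def el_mk_tcs[OF xU] using tcs_trans[OF xU] by simp
  have "tcs y \<subseteq> tcs x" using tcs_least[OF yU T] tcs_trans[OF xU y] unfolding el_mk_tcs[OF xU] by blast
  then show ?thesis using assms(1) yU y unfolding NU_def by blast
qed

lemma NU_I: assumes x: "is_set M x" "el x \<subseteq> NU" and E: "fs E" "supports E x" shows "x \<in> NU"
proof -
  have xU: "x \<in> U" using x(1) by (rule set_U)
  \<comment> \<open>A transitive set around the elements of \<open>x\<close>, hence a bound for the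
    transitive closure, all of whose members are known to have finite supports.\<close>
  let ?S = "el x \<union> (\<Union>z\<in>el x. el (mk (tcs z)))"
  have sm: "small ?S" by (intro small_Un small_UN small_el xU df)
  have zs: "el (mk (tcs z)) = tcs z" if "z \<in> el x" for z using el_mk_tcs[OF el_U[OF that]] .
  have "is_transitive M (mk ?S)" unfolding is_transitive_def el_mk[OF sm]
  proof (intro conjI ballI)
    fix t assume "t \<in> ?S"
    then consider "t \<in> el x" | z where "z \<in> el x" "t \<in> tcs z" using zs by blast
    then show "el t \<subseteq> ?S"
    proof cases
      case 1 then show ?thesis using el_sub_tcs[OF el_U[OF 1]] zs[OF 1] by blast
    next
      case 2 then show ?thesis using tcs_trans[OF el_U[OF 2(1)] 2(2)] zs[OF 2(1)] by blast
    qed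
  qed simp
  then have "tcs x \<subseteq> ?S" using tcs_least[OF xU, of "mk ?S"] unfolding el_mk[OF sm] by blast
  moreover have "\<exists>E. fs E \<and> supports E y" if "y \<in> ?S" for y
    using that x(2) zs unfolding NU_def by blast
  ultimately show ?thesis using xU E unfolding NU_def by blast
qed

lemma NU_trans_I: assumes "is_transitive M T" "x \<in> el T" "\<And>y. y \<in> el T \<Longrightarrow> \<exists>E. fs E \<and> supports E y" shows "x \<in> NU"
proof -
  have xU: "x \<in> U" using assms(2) by (rule el_U)
  have "tcs x \<subseteq> el T" using tcs_least[OF xU assms(1)] assms(1,2) unfolding is_transitive_def by blast
  then show ?thesis unfolding NU_def using assms(2,3) xU by blast
qed

lemma supports_om: "n \<in> el om \<Longrightarrow> supports E n" unfolding supports_def using pe_om fx_perm by blast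
lemma om_NU: "n \<in> el om \<Longrightarrow> n \<in> NU"
proof (rule NU_trans_I[of om])
  show "is_transitive M om" unfolding is_transitive_def using om_trans by simp
qed (use supports_om fs_ze in blast)+
lemma omega_NU: "om \<in> NU"
proof (rule NU_I[OF set_om _ fs_ze])
  show "el om \<subseteq> NU" using om_NU by blast
  show "supports ze om" unfolding supports_def using pe_omega fx_perm by blast
qed
lemma ze_NU: "ze \<in> NU" by (rule om_NU) simp

lemma supports_ins: "a \<in> el At \<Longrightarrow> fs E \<Longrightarrow> supports (ins a E) a"
  unfolding supports_def using fx_ap[of _ _ a] el_insf[of E a] by (auto simp: fx_def)
lemma atom_NU: assumes "a \<in> el At" shows "a \<in> NU"
proof -
  have aU: "a \<in> U" using assms by (rule el_U)
  have "is_transitive M ze" by (simp add: is_transitive_def)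
  then have "tcs a \<subseteq> {}" using tcs_least[OF aU] el_atom[OF assms] by force
  then show ?thesis unfolding NU_def using aU supports_ins[OF assms fs_ze] fs_ins[OF fs_ze assms] by blast
qed
lemma At_NU: "At \<in> NU"
proof (rule NU_I[OF set_At _ fs_ze])
  show "el At \<subseteq> NU" using atom_NU by blast
  show "supports ze At" unfolding supports_def using pe_atoms fx_perm by blast
qed

section \<open>Absoluteness between the transitive submodel and the ground model\<close>

lemma el_N: assumes "x \<in> NU" shows "elts N x = el x"
proof -
  have "y \<in> NU \<longleftrightarrow> y \<in> U" if "mem M y x" for y
    using NU_el[OF assms, of y] NU_U that unfolding elts_def by blast
  then show ?thesis unfolding elts_def univ_N mem_N by blast
qed

lemma is_set_N: "is_set N x \<longleftrightarrow> x \<in> NU \<and> is_set M x"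
  unfolding is_set_def univ_N atoms_N el_N[OF At_NU] using NU_U by blast

lemma is_upair_N: "is_upair N p x y \<longleftrightarrow> p \<in> NU \<and> is_upair M p x y"
  unfolding is_upair_def is_set_N using el_N by auto

lemma is_opair_N: "is_opair N p x y \<longleftrightarrow> p \<in> NU \<and> is_opair M p x y"
proof -
  have "a \<in> NU \<and> b \<in> NU" if "p \<in> NU" "is_upair M p a b" for a b
    using that NU_el unfolding is_upair_def by blast
  then show ?thesis unfolding is_opair_def is_upair_N univ_N using NU_U by meson
qed

lemma rel_N: "r \<in> NU \<Longrightarrow> rel N r x y \<longleftrightarrow> rel M r x y"
  unfolding rel_def is_opair_N using el_N NU_el by auto

lemma opair_NU: assumes "p \<in> NU" "is_opair M p x y" shows "x \<in> NU \<and> y \<in> NU"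
proof -
  obtain a b where "is_upair M a x x" "is_upair M b x y" "is_upair M p a b" using assms(2) unfolding is_opair_def by blast
  then have "a \<in> el p" "b \<in> el p" "x \<in> el b" "y \<in> el b" unfolding is_upair_def by blast+
  then show ?thesis using NU_el assms(1) by blast
qed

lemma rel_NU: "r \<in> NU \<Longrightarrow> rel M r x y \<Longrightarrow> x \<in> NU \<and> y \<in> NU"
  unfolding rel_def using opair_NU NU_el by blast

lemma is_function_on_N: assumes "X \<in> NU" shows "is_function_on N f X \<longleftrightarrow> f \<in> NU \<and> is_function_on M f X"
proof (cases "f \<in> NU \<and> is_set M f")
  case True
  then have f: "f \<in> NU" by blast
  have 1: "(\<exists>y\<in>NU. is_opair N p x y) \<longleftrightarrow> (\<exists>y\<in>U. is_opair M p x y)" if "p \<in> el f" for p x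
    using NU_el[OF f that] opair_NU[of p x] NU_U unfolding is_opair_N by blast
  have 2: "y \<in> NU \<and> rel N f x y \<longleftrightarrow> y \<in> U \<and> rel M f x y" for x y
    using rel_NU[OF f] NU_U unfolding rel_N[OF f] by blast
  show ?thesis
    unfolding is_function_on_def is_set_N el_N[OF f] el_N[OF assms] univ_N 2 using True 1 by simp
next
  case False then show ?thesis unfolding is_function_on_def is_set_N by blast
qed

lemma app_N: assumes "f \<in> NU" shows "app N f x = app M f x"
proof -
  have "y \<in> NU \<and> rel N f x y \<longleftrightarrow> y \<in> U \<and> rel M f x y" for y
    using rel_NU[OF assms] NU_U unfolding rel_N[OF assms] by blast
  then show ?thesis unfolding app_def univ_N by simp
qed

lemma is_map_N: assumes "X \<in> NU" "Y \<in> NU" shows "is_map N f X Y \<longleftrightarrow> f \<in> NU \<and> is_map M f X Y"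
  unfolding is_map_def is_function_on_N[OF assms(1)] el_N[OF assms(1)] el_N[OF assms(2)] using app_N by auto

lemma is_injection_N: assumes "X \<in> NU" "Y \<in> NU" shows "is_injection N f X Y \<longleftrightarrow> f \<in> NU \<and> is_injection M f X Y"
proof -
  have "app N f = app M f" if "f \<in> NU" using app_N[OF that] by blast
  then show ?thesis unfolding is_injection_def is_map_N[OF assms] el_N[OF assms(1)] by auto
qed

lemma is_bijection_N: assumes "X \<in> NU" "Y \<in> NU" shows "is_bijection N f X Y \<longleftrightarrow> f \<in> NU \<and> is_bijection M f X Y"
proof -
  have "app N f = app M f" if "f \<in> NU" using app_N[OF that] by blast
  then show ?thesis unfolding is_bijection_def is_map_N[OF assms] el_N[OF assms(1)] el_N[OF assms(2)] by auto
qed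

text \<open>Being an injection is absolute, but the range of the quantifier is not: the whole
  difference between the two models lies in the requirement that \<open>f\<close> has a finite
  support.\<close>

lemma card_le_N: assumes "X \<in> NU" "Y \<in> NU"
  shows "card_le N X Y \<longleftrightarrow> (\<exists>f\<in>NU. is_function_on M f X \<and> (\<forall>x\<in>el X. ap f x \<in> el Y) \<and> inj_on (ap f) (el X))"
  unfolding card_le_def is_injection_N[OF assms] is_injection_iff univ_N by blast

lemma card_eq_N: assumes "X \<in> NU" "Y \<in> NU"
  shows "card_eq N X Y \<longleftrightarrow> (\<exists>f\<in>NU. is_function_on M f X \<and> bij_betw (ap f) (el X) (el Y))"
  unfolding card_eq_def is_bijection_N[OF assms] is_bijection_iff univ_N by blast

lemma card_le_NM: "X \<in> NU \<Longrightarrow> Y \<in> NU \<Longrightarrow> card_le N X Y \<Longrightarrow> card_le M X Y"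
  unfolding card_le_def is_injection_N univ_N using NU_U by blast
lemma card_eq_NM: "X \<in> NU \<Longrightarrow> Y \<in> NU \<Longrightarrow> card_eq N X Y \<Longrightarrow> card_eq M X Y"
  unfolding card_eq_def is_bijection_N univ_N using NU_U by blast

lemma is_inductive_N: "is_inductive N i \<longleftrightarrow> i \<in> NU \<and> is_inductive M i"
proof (cases "i \<in> NU")
  case True
  have 1: "is_empty N e \<longleftrightarrow> is_empty M e" if "e \<in> el i" for e
    unfolding is_empty_def is_set_N using NU_el[OF True that] el_N by blast
  have 2: "is_succ N y x \<longleftrightarrow> is_succ M y x" if "x \<in> el i" "y \<in> el i" for x y
    unfolding is_succ_def is_set_N using NU_el[OF True] that el_N by metis
  show ?thesis unfolding is_inductive_def is_set_N el_N[OF True] using True 1 2 by auto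
next
  case False then show ?thesis unfolding is_inductive_def is_set_N by blast
qed

lemma omega_N [simp]: "omega N = om"
  unfolding omega_def[of N]
proof (rule the_equality)
  have "is_inductive N om" using is_inductive_N omega_NU omega_props(1) by blast
  moreover have le: "elts N om \<subseteq> elts N i" if "is_inductive N i" for i
    using that omega_props(2) el_N omega_NU unfolding is_inductive_N by metis
  ultimately show *: "is_inductive N om \<and> (\<forall>i\<in>univ N. is_inductive N i \<longrightarrow> elts N om \<subseteq> elts N i)" by blast
  fix w assume w: "is_inductive N w \<and> (\<forall>i\<in>univ N. is_inductive N i \<longrightarrow> elts N w \<subseteq> elts N i)"
  then have "elts N w = elts N om" using * le unfolding univ_N by (metis is_inductive_N subset_antisym)
  then have "el w = el om" using w el_N omega_NU unfolding is_inductive_N by metis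
  moreover have "is_set M w" using w unfolding is_inductive_def[of N] is_set_N by blast
  ultimately show "w = om" using set_ext[OF _ set_om] by blast
qed

lemma has_choice_N: assumes "X \<in> NU"
  shows "has_choice_function N X \<longleftrightarrow> (\<exists>f\<in>NU. is_function_on M f X \<and> (\<forall>x\<in>el X. ap f x \<in> el x))"
proof -
  have "app N f x = ap f x \<and> elts N x = el x" if "f \<in> NU" "is_function_on M f X" "x \<in> el X" for f x
    using app_N[OF that(1)] app_ap[OF that(3,2)] el_N[OF NU_el[OF assms that(3)]] by simp
  then show ?thesis
    unfolding has_choice_function_def is_function_on_N[OF assms] univ_N el_N[OF assms] by (metis (no_types, lifting))
qed

section \<open>Equivariant functions and invariant sets\<close>

lemma pe_sup_set: assumes "supports E X" "X \<in> U" "\<phi> \<in> fx E" shows "pe \<phi> ` el X = el X"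
  using el_pe[OF fx_perm[OF assms(3)] assms(2)] supportsD[OF assms(1,3)] by simp

text \<open>One inclusion suffices for invariance, since the inverse permutation is in
  \<open>fx E\<close> as well and supplies the other.\<close>

lemma supports_setI:
  assumes "is_set M X" "el E \<subseteq> el At" and *: "\<And>\<phi> x. \<phi> \<in> fx E \<Longrightarrow> x \<in> el X \<Longrightarrow> pe \<phi> x \<in> el X"
  shows "supports E X"
  unfolding supports_def
proof
  fix \<phi> assume p: "\<phi> \<in> fx E"
  have XU: "X \<in> U" using assms(1) by (rule set_U)
  obtain \<psi> where q: "\<psi> \<in> fx E" "\<And>x. x \<in> U \<Longrightarrow> pe \<phi> (pe \<psi> x) = x"
    using fx_inv[OF p assms(2)] by metis
  have "el X \<subseteq> pe \<phi> ` el X"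
  proof
    fix x assume x: "x \<in> el X"
    have "x = pe \<phi> (pe \<psi> x)" using q(2)[OF el_U[OF x]] by simp
    moreover have "pe \<psi> x \<in> el X" using *[OF q(1) x] .
    ultimately show "x \<in> pe \<phi> ` el X" by (rule image_eqI)
  qed
  moreover have "pe \<phi> ` el X \<subseteq> el X" using *[OF p] by (rule image_subsetI)
  ultimately have "pe \<phi> ` el X = el X" by (rule subset_antisym[rotated])
  then show "pe \<phi> X = X"
    using set_ext[OF pe_is_set[OF fx_perm[OF p] assms(1)] assms(1)] el_pe[OF fx_perm[OF p] XU] by simp
qed

text \<open>Applied to the pair of \<open>x\<close> and its value, \<open>\<phi>\<close> gives
  another pair in the same graph.\<close>

lemma pe_ap:
  assumes f: "is_function_on M f X" and \<phi>: "perm \<phi>" "pe \<phi> f = f" and x: "x \<in> el X"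
  shows "pe \<phi> x \<in> el X" "pe \<phi> (ap f x) = ap f (pe \<phi> x)"
proof -
  have xU: "x \<in> U" using x by (rule el_U)
  have "pr x (ap f x) \<in> el f" using ap_iff[OF f x] by simp
  then have "pe \<phi> (pr x (ap f x)) \<in> pe \<phi> ` el f" by (rule imageI)
  then have "pr (pe \<phi> x) (pe \<phi> (ap f x)) \<in> el f"
    using el_pe[OF \<phi>(1) fun_U[OF f]] \<phi>(2) pe_pr[OF \<phi>(1) xU ap_U] by simp
  then have *: "pr (pe \<phi> x) (pe \<phi> (ap f x)) \<in> (\<lambda>x. pr x (ap f x)) ` el X" unfolding fun_el[OF f] .
  then obtain z where z: "z \<in> el X" "pr (pe \<phi> x) (pe \<phi> (ap f x)) = pr z (ap f z)" by (rule imageE) (rule that)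
  then have "pe \<phi> x = z \<and> pe \<phi> (ap f x) = ap f z" using pr_eq_iff el_U[OF z(1)] by simp
  then show "pe \<phi> x \<in> el X" "pe \<phi> (ap f x) = ap f (pe \<phi> x)" using z(1) by simp_all
qed

lemma supports_ap: assumes "is_function_on M f X" "supports E f" "supports E x" "x \<in> el X" shows "supports E (ap f x)"
  unfolding supports_def using pe_ap(2)[OF assms(1) fx_perm _ assms(4)] supportsD[OF assms(2)] supportsD[OF assms(3)] by simp

lemma pr_NU: assumes "x \<in> NU" "y \<in> NU" shows "pr x y \<in> NU"
proof -
  have up: "mk {a, b} \<in> NU" if ab: "a \<in> NU" "b \<in> NU" for a b
  proof -
    obtain E F where E: "fs E" "supports E a" "fs F" "supports F b" using NU_sup ab by metis
    have U: "a \<in> U" "b \<in> U" using ab NU_U by blast+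
    show ?thesis
    proof (rule NU_I)
      show "el (mk {a, b}) \<subseteq> NU" using el_upair U ab by simp
      show "fs (un E F)" using E fs_un by blast
      show "supports (un E F) (mk {a, b})"
        unfolding supports_def
      proof
        fix \<phi> assume p: "\<phi> \<in> fx (un E F)"
        have "pe \<phi> a = a" "pe \<phi> b = b" using supportsD[OF supports_un1[OF E(1,3,2)] p] supportsD[OF supports_un2[OF E(1,3,4)] p] by blast+
        then show "pe \<phi> (mk {a, b}) = mk {a, b}" using pe_mk[OF fx_perm[OF p], of "{a, b}"] U by (simp add: small_insert)
      qed
    qed simp
  qed
  show ?thesis unfolding pr_def using up[OF up[OF assms(1) assms(1)] up[OF assms]] by simp
qed

text \<open>Equivariance under \<open>fx E\<close> means that \<open>fx E\<close> permutes the
  graph; this is the criterion by which functions are placed in the submodel.\<close>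

lemma gr_NU:
  assumes F: "Tm (\<lambda>e. F (e 0))" and X: "X \<in> NU" and FN: "\<And>x. x \<in> el X \<Longrightarrow> F x \<in> NU"
    and E: "fs E" "supports E X" and eq: "\<And>\<phi> x. \<phi> \<in> fx E \<Longrightarrow> x \<in> el X \<Longrightarrow> pe \<phi> (F x) = F (pe \<phi> x)"
  shows "gr F X \<in> NU"
proof (rule NU_I[OF _ _ E(1)])
  have XU: "X \<in> U" using X by (rule NU_U)
  note elg = el_gr[OF F XU]
  show s: "is_set M (gr F X)" by (simp add: gr_def)
  show "el (gr F X) \<subseteq> NU" unfolding elg using pr_NU NU_el[OF X] FN by (intro image_subsetI) blast
  show "supports E (gr F X)"
  proof (rule supports_setI[OF s])
    show "el E \<subseteq> el At" using E(1) by (simp add: fs_def)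
    fix \<phi> p assume p: "\<phi> \<in> fx E" "p \<in> el (gr F X)"
    then obtain x where x: "x \<in> el X" "p = pr x (F x)" unfolding elg by blast
    have "pe \<phi> p = pr (pe \<phi> x) (F (pe \<phi> x))"
      unfolding x(2) using pe_pr[OF fx_perm[OF p(1)] el_U[OF x(1)] NU_U[OF FN[OF x(1)]]] eq[OF p(1) x(1)] by simp
    moreover have "pe \<phi> x \<in> el X" using pe_sup_set[OF E(2) XU p(1)] x(1) by blast
    ultimately show "pe \<phi> p \<in> el (gr F X)" unfolding elg by (rule image_eqI)
  qed
qed

lemma card_le_N_I:
  assumes F: "Tm (\<lambda>e. F (e 0))" and X: "X \<in> NU" "Y \<in> NU" and FY: "\<And>x. x \<in> el X \<Longrightarrow> F x \<in> el Y" and inj: "inj_on F (el X)"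
    and E: "fs E" "supports E X" and eq: "\<And>\<phi> x. \<phi> \<in> fx E \<Longrightarrow> x \<in> el X \<Longrightarrow> pe \<phi> (F x) = F (pe \<phi> x)"
  shows "card_le N X Y"
  unfolding card_le_N[OF X]
proof (intro bexI[of _ "gr F X"] conjI ballI)
  have XU: "X \<in> U" using X(1) by (rule NU_U)
  show "gr F X \<in> NU" using gr_NU[OF F X(1) _ E eq] NU_el[OF X(2)] FY by blast
  show "is_function_on M (gr F X) X" by (rule gr_fun[OF F XU])
  show "ap (gr F X) x \<in> el Y" if "x \<in> el X" for x using ap_gr[OF F XU that] FY[OF that] by simp
  show "inj_on (ap (gr F X)) (el X)" using inj inj_on_cong[of "el X" "ap (gr F X)" F] ap_gr[OF F XU] by simp
qed

lemma supports_pointwise: assumes "is_set M X" "fs E" "\<And>x. x \<in> el X \<Longrightarrow> supports E x" shows "supports E X"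
proof (rule supports_setI[OF assms(1)])
  show "el E \<subseteq> el At" using assms(2) by (simp add: fs_def)
  show "pe \<phi> x \<in> el X" if "\<phi> \<in> fx E" "x \<in> el X" for \<phi> x
    using supportsD[OF assms(3)[OF that(2)] that(1)] that(2) by simp
qed

text \<open>On points that \<open>fx E\<close> fixes, with values that it fixes, every function of
  \<open>M\<close> is equivariant. So over such sets the submodel inherits injections and choice
  functions from \<open>M\<close>.\<close>

lemma fun_NU:
  assumes f: "is_function_on M f X" and X: "X \<in> NU" and sX: "is_set M X" and E: "fs E"
    and s: "\<And>x. x \<in> el X \<Longrightarrow> supports E x" and t: "\<And>x. x \<in> el X \<Longrightarrow> ap f x \<in> NU \<and> supports E (ap f x)"
  shows "f \<in> NU"
proof -
  have XU: "X \<in> U" using X by (rule NU_U)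
  have F: "Tm (\<lambda>e. ap f (e 0))" by (intro df fun_U[OF f])
  have "supports E X" using sX E s by (rule supports_pointwise)
  have "gr (ap f) X \<in> NU"
  proof (rule gr_NU[OF F X _ E \<open>supports E X\<close>])
    show "ap f x \<in> NU" if "x \<in> el X" for x using t[OF that] by blast
    show "pe \<phi> (ap f x) = ap f (pe \<phi> x)" if "\<phi> \<in> fx E" "x \<in> el X" for \<phi> x
      using supportsD[OF s[OF that(2)] that(1)] supportsD[OF conjunct2[OF t[OF that(2)]] that(1)] by simp
  qed
  moreover have "gr (ap f) X = f" using fun_ext[OF gr_fun[OF F XU] f] ap_gr[OF F XU] by blast
  ultimately show ?thesis by simp
qed

lemma subset_NU: assumes "V \<in> NU" "is_set M S" "el S \<subseteq> el V" "fs E" "\<And>x. x \<in> el S \<Longrightarrow> supports E x" shows "S \<in> NU"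
proof (rule NU_I[OF assms(2) _ assms(4)])
  show "el S \<subseteq> NU" using assms(1,3) NU_el by blast
  show "supports E S" using assms(2,4,5) by (rule supports_pointwise)
qed

end

text \<open>
  The properties of the full symmetric group and of the automorphism group of the rationals that the
  argument uses. By \<open>H0\<close> and \<open>H3\<close> no finite set contains all atoms or an orbit of \<open>fix(E)\<close> outside
  \<open>E\<close>; \<open>H1\<close> makes \<open>E\<close> a support of anything supported by both \<open>E \<union> {a}\<close> and \<open>E \<union> {\<theta> a}\<close>;
  \<open>H2\<close> says that \<open>fix(E)\<close> acts transitively on the unordered pairs of an orbit.
\<close>

locale homogeneous_group = perm_group +
  assumes AC: "AC M"
    and H0: "\<And>F. kfin F \<Longrightarrow> \<exists>a\<in>el At. a \<notin> el F"
    and H1: "\<And>E a \<theta> \<pi>. fs E \<Longrightarrow> a \<in> el At \<Longrightarrow> a \<notin> el E \<Longrightarrow> \<theta> \<in> fx E \<Longrightarrow> \<pi> \<in> fx E \<Longrightarrow> ap \<theta> a \<noteq> a \<Longrightarrow>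
      \<exists>\<sigma>\<in>fx (ins (ap \<theta> a) E). \<exists>\<tau>\<in>fx (ins a E). ap \<pi> a = ap \<tau> (ap \<sigma> a)"
    and H2: "\<And>E a \<phi> \<phi>' \<psi> \<psi>'. fs E \<Longrightarrow> a \<in> el At \<Longrightarrow> a \<notin> el E \<Longrightarrow>
      \<phi> \<in> fx E \<Longrightarrow> \<phi>' \<in> fx E \<Longrightarrow> \<psi> \<in> fx E \<Longrightarrow> \<psi>' \<in> fx E \<Longrightarrow> ap \<phi> a \<noteq> ap \<phi>' a \<Longrightarrow> ap \<psi> a \<noteq> ap \<psi>' a \<Longrightarrow>
      \<exists>\<chi>\<in>fx E. (ap \<chi> (ap \<phi> a) = ap \<psi> a \<and> ap \<chi> (ap \<phi>' a) = ap \<psi>' a) \<or>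
        (ap \<chi> (ap \<phi> a) = ap \<psi>' a \<and> ap \<chi> (ap \<phi>' a) = ap \<psi> a)"
    and H3: "\<And>E a F. fs E \<Longrightarrow> a \<in> el At \<Longrightarrow> a \<notin> el E \<Longrightarrow> kfin F \<Longrightarrow> \<exists>\<phi>\<in>fx E. ap \<phi> a \<notin> el F"
begin

lemma fx_comp': assumes "fs E" "\<phi> \<in> fx E" "\<psi> \<in> fx E"
  obtains \<chi> where "\<chi> \<in> fx E" "\<And>x. x \<in> U \<Longrightarrow> pe \<chi> x = pe \<phi> (pe \<psi> x)" "\<And>a. a \<in> el At \<Longrightarrow> ap \<chi> a = ap \<phi> (ap \<psi> a)"
proof -
  obtain \<chi> where c: "\<chi> \<in> el G" "\<And>x. x \<in> U \<Longrightarrow> pe \<chi> x = pe \<phi> (pe \<psi> x)" "\<And>a. a \<in> el At \<Longrightarrow> ap \<chi> a = ap \<phi> (ap \<psi> a)"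
    using fx_comp[OF assms(2,3)] by metis
  have "ap \<chi> t = t" if "t \<in> el E" for t
  proof -
    have "t \<in> el At" using that assms(1) unfolding fs_def by blast
    then show ?thesis using c(3)[of t] assms(2,3) that unfolding fx_def by simp
  qed
  then have "\<chi> \<in> fx E" using c(1) unfolding fx_def by blast
  then show ?thesis using that c by blast
qed

lemma fsD: "fs E \<Longrightarrow> el E \<subseteq> el At" by (simp add: fs_def)

text \<open>The atoms of some support of \<open>x\<close> are added to \<open>E0\<close> one by one.
  \<open>a\<close> is an atom whose addition first gives a support, and \<open>E\<close> is the set
  just before; the search is an induction over finite sets in the sense of \<open>M\<close>.\<close>

lemma new_atom:
  assumes E0: "fs E0" and x: "x \<in> NU" "\<not> supports E0 x"
  obtains E a where "fs E" "el E0 \<subseteq> el E" "a \<in> el At" "a \<notin> el E" "supports (ins a E) x" "\<not> supports E x"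
proof -
  have xU: "x \<in> U" using x(1) by (rule NU_U)
  obtain F where F: "fs F" "supports F x" using NU_sup[OF x(1)] by blast
  have E0U: "E0 \<in> U" using E0 by (rule fs_U)
  define C where "C E a \<longleftrightarrow> kfin E \<and> el E \<subseteq> el At \<and> el E0 \<subseteq> el E \<and> a \<notin> el E \<and> supports (ins a E) x \<and> \<not> supports E x" for E a
  define Q where "Q F \<longleftrightarrow> (el F \<subseteq> el At \<and> supports (un E0 F) x \<longrightarrow> (\<exists>E\<in>U. \<exists>a\<in>el At. C E a))" for F
  have eqs: "supports E x \<longleftrightarrow> supports E' x" if "el E = el E'" for E E'
    unfolding supports_def fx_def that ..
  have "Q F" using F(1)[unfolded fs_def, THEN conjunct1]
  proof (rule kfin_induct[where P=Q])
    show "D (\<lambda>e. Q (e 0))" unfolding Q_def C_def by (intro df) (simp_all add: E0U xU)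
    have "el (un E0 ze) = el E0" using el_un[OF E0U] by simp
    then show "Q ze" unfolding Q_def using eqs[of "un E0 ze" E0] x(2) by blast
  next
    fix S b assume S: "kfin S" "b \<in> el F" "el S \<subseteq> el F" "Q S"
    have b: "b \<in> el At" and bU: "b \<in> U" using S(2) F(1) fsD el_U by blast+
    have Sf: "fs S" using S(1,3) F(1) unfolding fs_def by blast
    have SU: "S \<in> U" using S(1) by (rule kfin_U)
    have e1: "el (un E0 S) = el E0 \<union> el S" by (rule el_un[OF E0U SU])
    have e2: "el (un E0 (ins b S)) = insert b (el (un E0 S))" using el_un[OF E0U] el_ins[OF bU SU] e1 by simp
    have e3: "el (ins b (un E0 S)) = insert b (el (un E0 S))" by (rule el_ins[OF bU un_U])
    show "Q (ins b S)" unfolding Q_def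
    proof (intro impI)
      assume h: "el (ins b S) \<subseteq> el At \<and> supports (un E0 (ins b S)) x"
      show "\<exists>E\<in>U. \<exists>a\<in>el At. C E a"
      proof (cases "supports (un E0 S) x")
        case True
        then show ?thesis using S(4) Sf unfolding Q_def fs_def by blast
      next
        case False
        have "fs (un E0 S)" by (rule fs_un[OF E0 Sf])
        moreover have s: "supports (ins b (un E0 S)) x" using h eqs[of "un E0 (ins b S)" "ins b (un E0 S)"] e2 e3 by simp
        moreover have "b \<notin> el (un E0 S)"
        proof
          assume "b \<in> el (un E0 S)"
          then have "el (ins b (un E0 S)) = el (un E0 S)" using e3 by (simp add: insert_absorb)
          then show False using s False eqs by blast
        qed
        ultimately have "C (un E0 S) b" using False e1 unfolding C_def fs_def by blast
        then show ?thesis using b un_U by blast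
      qed
    qed
  qed
  moreover have "supports (un E0 F) x" using supports_un2[OF E0 F] .
  ultimately obtain E a where "a \<in> el At" "C E a" using F(1) unfolding Q_def fs_def by blast
  then show ?thesis using that[of E a] unfolding C_def fs_def by blast
qed

end

section \<open>The orbit of an element with one indispensable atom\<close>

locale support_orbit = homogeneous_group +
  fixes E a x :: 'a
  assumes E: "fs E" and a: "a \<in> el At" "a \<notin> el E" and x: "x \<in> NU"
    and xa: "supports (ins a E) x" and xE: "\<not> supports E x"
begin

lemma xU: "x \<in> U" using x by (rule NU_U)
lemma EU: "E \<in> U" using E by (rule fs_U)

lemma stab_ins: "\<phi> \<in> fx E \<Longrightarrow> ap \<phi> b = b \<Longrightarrow> b \<in> el At \<Longrightarrow> \<phi> \<in> fx (ins b E)"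
  unfolding fx_def using el_insf[OF E, of b] by auto

lemma fx_ins: "b \<in> el At \<Longrightarrow> \<phi> \<in> fx (ins b E) \<Longrightarrow> \<phi> \<in> fx E \<and> ap \<phi> b = b"
  unfolding fx_def using el_insf[OF E, of b] by auto

lemma stab_a: "\<phi> \<in> fx E \<Longrightarrow> ap \<phi> a = a \<Longrightarrow> pe \<phi> x = x"
  using supportsD[OF xa stab_ins[OF _ _ a(1)]] by blast

text \<open>Otherwise \<open>x\<close> is also supported by \<open>E \<union> {\<theta> a}\<close>, and \<open>H1\<close> makes \<open>E\<close> a support of \<open>x\<close>.\<close>

lemma stab_x: assumes \<theta>: "\<theta> \<in> fx E" "pe \<theta> x = x" shows "ap \<theta> a = a"
proof (rule ccontr)
  assume ne: "ap \<theta> a \<noteq> a"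
  let ?b = "ap \<theta> a"
  have b: "?b \<in> el At" using fx_At[OF \<theta>(1) a(1)] .
  obtain \<theta>' where t: "\<theta>' \<in> fx E" "\<And>x. x \<in> U \<Longrightarrow> pe \<theta>' (pe \<theta> x) = x" "\<And>x. x \<in> U \<Longrightarrow> pe \<theta> (pe \<theta>' x) = x"
    "\<And>a. a \<in> el At \<Longrightarrow> ap \<theta>' (ap \<theta> a) = a" "\<And>a. a \<in> el At \<Longrightarrow> ap \<theta> (ap \<theta>' a) = a"
    using fx_inv[OF \<theta>(1) fsD[OF E]] by metis
  \<comment> \<open>The conjugate of \<sigma> by \<theta> fixes \<open>a\<close> and hence
    \<open>x\<close>. Since \<theta> fixes \<open>x\<close>, so does \<sigma>.\<close>
  have sb: "pe \<sigma> x = x" if s: "\<sigma> \<in> fx (ins ?b E)" for \<sigma>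
  proof -
    have sE: "\<sigma> \<in> fx E" "ap \<sigma> ?b = ?b" using fx_ins[OF b s] by blast+
    obtain \<rho> where r: "\<rho> \<in> fx E" "\<And>x. x \<in> U \<Longrightarrow> pe \<rho> x = pe \<sigma> (pe \<theta> x)" "\<And>a. a \<in> el At \<Longrightarrow> ap \<rho> a = ap \<sigma> (ap \<theta> a)"
      using fx_comp'[OF E sE(1) \<theta>(1)] by metis
    obtain \<rho>' where r': "\<rho>' \<in> fx E" "\<And>x. x \<in> U \<Longrightarrow> pe \<rho>' x = pe \<theta>' (pe \<rho> x)" "\<And>a. a \<in> el At \<Longrightarrow> ap \<rho>' a = ap \<theta>' (ap \<rho> a)"
      using fx_comp'[OF E t(1) r(1)] by metis
    have "ap \<rho>' a = a" using r'(3)[OF a(1)] r(3)[OF a(1)] sE(2) t(4)[OF a(1)] by simp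
    then have "pe \<rho>' x = x" using stab_a r'(1) by blast
    then have "pe \<theta>' (pe \<sigma> x) = x" using r'(2)[OF xU] r(2)[OF xU] \<theta>(2) by simp
    then have "pe \<sigma> x = pe \<theta> x" using t(3)[OF pe_U] by metis
    then show ?thesis using \<theta>(2) by simp
  qed
  \<comment> \<open>A product \<tau> \<sigma> of two permutations fixing \<open>x\<close> agrees
    with \<pi> at \<open>a\<close>. Its inverse composed with \<pi> fixes \<open>a\<close> and
    therefore \<open>x\<close>, so that \<pi> fixes \<open>x\<close> too.\<close>
  have "pe \<pi> x = x" if p: "\<pi> \<in> fx E" for \<pi>
  proof -
    obtain \<sigma> \<tau> where st: "\<sigma> \<in> fx (ins ?b E)" "\<tau> \<in> fx (ins a E)" "ap \<pi> a = ap \<tau> (ap \<sigma> a)"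
      using H1[OF E a \<theta>(1) p ne] by blast
    have stE: "\<sigma> \<in> fx E" "\<tau> \<in> fx E" using fx_ins[OF b st(1)] fx_ins[OF a(1) st(2)] by blast+
    obtain \<rho> where r: "\<rho> \<in> fx E" "\<And>x. x \<in> U \<Longrightarrow> pe \<rho> x = pe \<tau> (pe \<sigma> x)" "\<And>a. a \<in> el At \<Longrightarrow> ap \<rho> a = ap \<tau> (ap \<sigma> a)"
      using fx_comp'[OF E stE(2,1)] by metis
    have rx: "pe \<rho> x = x" using r(2)[OF xU] sb[OF st(1)] supportsD[OF xa st(2)] by simp
    obtain \<rho>' where i: "\<rho>' \<in> fx E" "\<And>x. x \<in> U \<Longrightarrow> pe \<rho>' (pe \<rho> x) = x" "\<And>x. x \<in> U \<Longrightarrow> pe \<rho> (pe \<rho>' x) = x"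
      "\<And>a. a \<in> el At \<Longrightarrow> ap \<rho>' (ap \<rho> a) = a"
      using fx_inv[OF r(1) fsD[OF E]] by metis
    obtain \<kappa> where k: "\<kappa> \<in> fx E" "\<And>x. x \<in> U \<Longrightarrow> pe \<kappa> x = pe \<rho>' (pe \<pi> x)" "\<And>a. a \<in> el At \<Longrightarrow> ap \<kappa> a = ap \<rho>' (ap \<pi> a)"
      using fx_comp'[OF E i(1) p] by metis
    have "ap \<kappa> a = a" using k(3)[OF a(1)] st(3) r(3)[OF a(1)] i(4)[OF a(1)] by simp
    then have "pe \<kappa> x = x" using stab_a k(1) by blast
    then have "pe \<rho>' (pe \<pi> x) = x" using k(2)[OF xU] by simp
    then have "pe \<pi> x = pe \<rho> x" using i(3)[OF pe_U] by metis
    then show ?thesis using rx by simp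
  qed
  then show False using xE unfolding supports_def by blast
qed

text \<open>In \<open>fx E\<close> the stabilisers of \<open>x\<close> and \<open>a\<close>
  coincide, by \<open>stab_a\<close> and \<open>stab_x\<close>; apply this to the inverse of \<psi>
  composed with \<phi>. The result is that the two orbits correspond bijectively.\<close>

lemma key: assumes "\<phi> \<in> fx E" "\<psi> \<in> fx E" shows "pe \<phi> x = pe \<psi> x \<longleftrightarrow> ap \<phi> a = ap \<psi> a"
proof -
  obtain \<rho> where i: "\<rho> \<in> fx E" "\<And>x. x \<in> U \<Longrightarrow> pe \<rho> (pe \<psi> x) = x" "\<And>x. x \<in> U \<Longrightarrow> pe \<psi> (pe \<rho> x) = x"
      "\<And>a. a \<in> el At \<Longrightarrow> ap \<rho> (ap \<psi> a) = a" "\<And>a. a \<in> el At \<Longrightarrow> ap \<psi> (ap \<rho> a) = a"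
    using fx_inv[OF assms(2) fsD[OF E]] by metis
  obtain \<kappa> where k: "\<kappa> \<in> fx E" "\<And>x. x \<in> U \<Longrightarrow> pe \<kappa> x = pe \<rho> (pe \<phi> x)" "\<And>a. a \<in> el At \<Longrightarrow> ap \<kappa> a = ap \<rho> (ap \<phi> a)"
    using fx_comp'[OF E i(1) assms(1)] by metis
  have "pe \<kappa> x = x \<longleftrightarrow> ap \<kappa> a = a" using stab_x[OF k(1)] stab_a[OF k(1)] by blast
  moreover have "pe \<phi> x = pe \<psi> x \<longleftrightarrow> pe \<kappa> x = x" using k(2)[OF xU] i(2)[OF xU] i(3)[OF pe_U] by metis
  moreover have "ap \<phi> a = ap \<psi> a \<longleftrightarrow> ap \<kappa> a = a"
    using k(3)[OF a(1)] i(4)[OF a(1)] i(5)[OF fx_At[OF assms(1) a(1)]] by metis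
  ultimately show ?thesis by blast
qed

definition Ob :: 'a where "Ob = mk ((\<lambda>\<phi>. pe \<phi> x) ` fx E)"

lemma el_Ob: "el Ob = (\<lambda>\<phi>. pe \<phi> x) ` fx E"
  unfolding Ob_def
proof (rule el_mk, rule small_image[OF _ small_fx[OF EU]])
  show "Tm (\<lambda>e. pe (e 0) x)" by (intro df xU)
qed

lemma Ob_closed: assumes "\<phi> \<in> fx E" "y \<in> el Ob" shows "pe \<phi> y \<in> el Ob"
proof -
  obtain \<psi> where p: "y = pe \<psi> x" "\<psi> \<in> fx E" using assms(2) unfolding el_Ob by (rule imageE)
  obtain \<chi> where c: "\<chi> \<in> fx E" "\<And>x. x \<in> U \<Longrightarrow> pe \<chi> x = pe \<phi> (pe \<psi> x)" using fx_comp'[OF E assms(1) p(2)] by metis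
  have "pe \<phi> y = pe \<chi> x" using c(2)[OF xU] p(1) by simp
  then show ?thesis unfolding el_Ob using c(1) by (rule image_eqI)
qed

lemma set_Ob: "is_set M Ob" and Ob_U: "Ob \<in> U" by (simp_all add: Ob_def)

lemma supports_Ob: "supports E Ob"
  using set_Ob fsD[OF E] Ob_closed by (rule supports_setI)

lemma Ob_sub: assumes "V \<in> NU" "supports E V" "x \<in> el V" shows "el Ob \<subseteq> el V"
proof -
  have "pe \<phi> x \<in> el V" if "\<phi> \<in> fx E" for \<phi>
    using pe_sup_set[OF assms(2) NU_U[OF assms(1)] that] assms(3) by blast
  then show ?thesis unfolding el_Ob by (rule image_subsetI)
qed

lemma Ob_NU: assumes "V \<in> NU" "supports E V" "x \<in> el V" shows "Ob \<in> NU"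
  by (rule NU_I[OF set_Ob _ E supports_Ob]) (use Ob_sub[OF assms] NU_el[OF assms(1)] in blast)

text \<open>\<open>H3\<close> is used twice: first to move \<open>a\<close> to an atom outside
  \<open>E\<close> and \<open>F\<close>, then to move that atom while \<open>E\<close> and
  \<open>F\<close> stay fixed. By \<open>key\<close> the corresponding point of the orbit moves as
  well.\<close>

lemma Ob_moves: assumes F: "fs F"
  obtains y \<psi> where "y \<in> el Ob" "\<psi> \<in> fx F" "pe \<psi> y \<in> el Ob" "pe \<psi> y \<noteq> y"
proof -
  let ?H = "un E F"
  have H: "fs ?H" by (rule fs_un[OF E F])
  have eH: "el ?H = el E \<union> el F" by (rule el_unf[OF E F])
  obtain \<phi> where p: "\<phi> \<in> fx E" "ap \<phi> a \<notin> el ?H" using H3[OF E a H[unfolded fs_def, THEN conjunct1]] by blast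
  let ?b = "ap \<phi> a"
  have b: "?b \<in> el At" by (rule fx_At[OF p(1) a(1)])
  obtain \<psi> where q: "\<psi> \<in> fx ?H" "ap \<psi> ?b \<notin> el (ins ?b ze)"
    using H3[OF H b p(2) kfin_ins[OF kfin_ze el_U[OF b]]] by blast
  have ne: "ap \<psi> ?b \<noteq> ?b" using q(2) el_insf[OF fs_ze b] by simp
  have qE: "\<psi> \<in> fx E" and qF: "\<psi> \<in> fx F" using q(1) fx_mono[of E ?H] fx_mono[of F ?H] eH by blast+
  obtain \<chi> where c: "\<chi> \<in> fx E" "\<And>x. x \<in> U \<Longrightarrow> pe \<chi> x = pe \<psi> (pe \<phi> x)" "\<And>a. a \<in> el At \<Longrightarrow> ap \<chi> a = ap \<psi> (ap \<phi> a)"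
    using fx_comp'[OF E qE p(1)] by metis
  have y: "pe \<phi> x \<in> el Ob" unfolding el_Ob using p(1) by (rule imageI)
  have "pe \<chi> x \<noteq> pe \<phi> x" using key[OF c(1) p(1)] c(3)[OF a(1)] ne by simp
  then have "pe \<psi> (pe \<phi> x) \<noteq> pe \<phi> x" using c(2)[OF xU] by simp
  with y show ?thesis using that[of "pe \<phi> x" \<psi>] qF Ob_closed[OF qE y] by blast
qed

text \<open>A function into \<omega> supported by \<open>F\<close> takes equal values at
  \<open>y\<close> and at its image under any member of \<open>fx F\<close>, and
  \<open>Ob_moves\<close> makes these two points different.\<close>

lemma not_card_le: assumes "Y \<in> NU" "el Ob \<subseteq> el Y" shows "\<not> card_le N Y om"
proof
  assume "card_le N Y om"
  then obtain f where f: "f \<in> NU" "is_function_on M f Y" "\<And>y. y \<in> el Y \<Longrightarrow> ap f y \<in> el om" "inj_on (ap f) (el Y)"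
    unfolding card_le_N[OF assms(1) omega_NU] by blast
  obtain F where F: "fs F" "supports F f" using NU_sup[OF f(1)] by blast
  obtain y \<psi> where y: "y \<in> el Ob" "\<psi> \<in> fx F" "pe \<psi> y \<in> el Ob" "pe \<psi> y \<noteq> y" using Ob_moves[OF F(1)] by metis
  have Y: "y \<in> el Y" "pe \<psi> y \<in> el Y" using y assms(2) by blast+
  have "ap f (pe \<psi> y) = pe \<psi> (ap f y)" using pe_ap(2)[OF f(2) fx_perm[OF y(2)] supportsD[OF F(2) y(2)] Y(1)] by simp
  also have "\<dots> = ap f y" using pe_om[OF fx_perm[OF y(2)] f(3)[OF Y(1)]] .
  finally show False using inj_onD[OF f(4) _ Y(2,1)] y(4) by blast
qed

text \<open>Every value of an enumeration supported by \<open>F\<close> is itself supported by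
  \<open>F\<close>, whereas some point of the orbit is not.\<close>

lemma not_card_eq: assumes "Y \<in> NU" "el Ob \<subseteq> el Y" shows "\<not> card_eq N om Y"
proof
  assume "card_eq N om Y"
  then obtain f where f: "f \<in> NU" "is_function_on M f om" "bij_betw (ap f) (el om) (el Y)"
    unfolding card_eq_N[OF omega_NU assms(1)] by blast
  obtain F where F: "fs F" "supports F f" using NU_sup[OF f(1)] by blast
  obtain y \<psi> where y: "y \<in> el Ob" "\<psi> \<in> fx F" "pe \<psi> y \<in> el Ob" "pe \<psi> y \<noteq> y" using Ob_moves[OF F(1)] by metis
  have "y \<in> ap f ` el om" using y(1) assms(2) f(3) unfolding bij_betw_def by blast
  then obtain n where n: "y = ap f n" "n \<in> el om" by (rule imageE)
  have "pe \<psi> y = y" unfolding n(1) using supportsD[OF supports_ap[OF f(2) F(2) supports_om[OF n(2)] n(2)] y(2)] .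
  with y(4) show False by blast
qed

lemma clique_or_independent:
  assumes Ed: "supports E Ed" "Ed \<in> U"
  shows "(\<forall>y\<in>el Ob. \<forall>z\<in>el Ob. y \<noteq> z \<longrightarrow> mk {y, z} \<in> el Ed) \<or> (\<forall>y\<in>el Ob. \<forall>z\<in>el Ob. y \<noteq> z \<longrightarrow> mk {y, z} \<notin> el Ed)"
proof (rule ccontr)
  assume "\<not> ?thesis"
  then obtain y z y' z' where *: "y \<in> el Ob" "z \<in> el Ob" "y \<noteq> z" "mk {y, z} \<notin> el Ed"
    "y' \<in> el Ob" "z' \<in> el Ob" "y' \<noteq> z'" "mk {y', z'} \<in> el Ed" by blast
  obtain \<phi> \<phi>' \<psi> \<psi>' where p: "\<phi> \<in> fx E" "y' = pe \<phi> x" "\<phi>' \<in> fx E" "z' = pe \<phi>' x"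
      "\<psi> \<in> fx E" "y = pe \<psi> x" "\<psi>' \<in> fx E" "z = pe \<psi>' x"
    using * unfolding el_Ob by (elim imageE) (rule that)
  have ne: "ap \<phi> a \<noteq> ap \<phi>' a" "ap \<psi> a \<noteq> ap \<psi>' a" using key p * by metis+
  obtain \<chi> where c: "\<chi> \<in> fx E" "(ap \<chi> (ap \<phi> a) = ap \<psi> a \<and> ap \<chi> (ap \<phi>' a) = ap \<psi>' a) \<or>
        (ap \<chi> (ap \<phi> a) = ap \<psi>' a \<and> ap \<chi> (ap \<phi>' a) = ap \<psi> a)"
    using H2[OF E a p(1,3,5,7) ne] by blast
  have t: "pe \<chi> (pe \<phi> x) = pe \<psi> x" if f: "\<phi> \<in> fx E" "\<psi> \<in> fx E" "ap \<chi> (ap \<phi> a) = ap \<psi> a" for \<phi> \<psi>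
  proof -
    obtain \<rho> where r: "\<rho> \<in> fx E" "\<And>x. x \<in> U \<Longrightarrow> pe \<rho> x = pe \<chi> (pe \<phi> x)" "\<And>a. a \<in> el At \<Longrightarrow> ap \<rho> a = ap \<chi> (ap \<phi> a)"
      using fx_comp'[OF E c(1) f(1)] by metis
    then show ?thesis using key[OF r(1) f(2)] f(3) xU a(1) by simp
  qed
  have "{pe \<chi> y', pe \<chi> z'} = {y, z}"
    using c(2)
  proof (elim disjE conjE)
    assume "ap \<chi> (ap \<phi> a) = ap \<psi> a" "ap \<chi> (ap \<phi>' a) = ap \<psi>' a"
    then have "pe \<chi> y' = y" "pe \<chi> z' = z" using t[OF p(1,5)] t[OF p(3,7)] p(2,4,6,8) by simp_all
    then show ?thesis by simp
  next
    assume "ap \<chi> (ap \<phi> a) = ap \<psi>' a" "ap \<chi> (ap \<phi>' a) = ap \<psi> a"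
    then have "pe \<chi> y' = z" "pe \<chi> z' = y" using t[OF p(1,7)] t[OF p(3,5)] p(2,4,6,8) by simp_all
    then show ?thesis by blast
  qed
  moreover have "pe \<chi> (mk {y', z'}) = mk {pe \<chi> y', pe \<chi> z'}"
    using pe_mk[OF fx_perm[OF c(1)], of "{y', z'}"] el_U[OF *(5)] el_U[OF *(6)] by (simp add: small_insert)
  moreover have "pe \<chi> (mk {y', z'}) \<in> el Ed" using pe_sup_set[OF Ed c(1)] *(8) by blast
  ultimately show False using *(4) by simp
qed

end

section \<open>The principles in the submodel\<close>

context homogeneous_group begin

lemma orbit_ex:
  assumes "fs E0" "x \<in> NU" "\<not> supports E0 x"
  obtains E a where "support_orbit M G \<Gamma> E a x" "el E0 \<subseteq> el E"
proof -
  obtain E a where *: "fs E" "el E0 \<subseteq> el E" "a \<in> el At" "a \<notin> el E" "supports (ins a E) x" "\<not> supports E x"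
    using new_atom[OF assms] by metis
  have "support_orbit M G \<Gamma> E a x" by unfold_locales (rule * assms)+
  then show ?thesis using that *(2) by blast
qed

text \<open>Otherwise the orbit of \<open>u\<close>, which stays inside \<open>y\<close> because
  \<open>y\<close> is supported, would be a part of \<open>y\<close> that is not countable in the
  submodel.\<close>

lemma elem_supported:
  assumes y: "y \<in> NU" "fs E0" "supports E0 y" "card_le N y om" and u: "u \<in> el y"
  shows "supports E0 u"
proof (rule ccontr)
  assume "\<not> supports E0 u"
  then obtain E a where o: "support_orbit M G \<Gamma> E a u" "el E0 \<subseteq> el E"
    using orbit_ex[OF y(2) NU_el[OF y(1) u]] by metis
  interpret support_orbit M G \<Gamma> E a u by (rule o(1))
  have "el Ob \<subseteq> el y" using Ob_sub[OF y(1) supports_mono[OF o(2) y(3)] u] .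
  from not_card_le[OF y(1) this] y(4) show False ..
qed

lemma graph_N: assumes "is_graph N V Ed"
  shows "V \<in> NU" "Ed \<in> NU" "is_set M V"
    "e \<in> el Ed \<Longrightarrow> \<exists>x\<in>el V. \<exists>y\<in>el V. x \<noteq> y \<and> e = mk {x, y}"
proof -
  show V: "V \<in> NU" "Ed \<in> NU" "is_set M V" using assms unfolding is_graph_def is_set_N by blast+
  show "e \<in> el Ed \<Longrightarrow> \<exists>x\<in>el V. \<exists>y\<in>el V. x \<noteq> y \<and> e = mk {x, y}"
    using assms unfolding is_graph_def is_upair_N is_upair_iff el_N[OF V(1)] el_N[OF V(2)] by blast
qed

lemma is_edge_N: assumes "Ed \<in> NU" "x \<in> NU" "y \<in> NU" shows "is_edge N Ed x y \<longleftrightarrow> mk {x, y} \<in> el Ed"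
  unfolding is_edge_def is_upair_N is_upair_iff el_N[OF assms(1)] using NU_el[OF assms(1)] NU_U assms by blast

text \<open>The edges with both ends in \<open>K\<close> have to form a set of the submodel; a
  common support of \<open>Ed\<close> and \<open>K\<close> supports it.\<close>

lemma clique_I:
  assumes g: "is_graph N V Ed" and K: "K \<in> NU" "is_set M K" "el K \<subseteq> el V"
    and cl: "\<And>x y. x \<in> el K \<Longrightarrow> y \<in> el K \<Longrightarrow> x \<noteq> y \<Longrightarrow> mk {x, y} \<in> el Ed"
  shows "\<exists>E'. is_clique_subgraph N V Ed K E'"
proof -
  note gN = graph_N[OF g]
  have EdU: "Ed \<in> U" and KU: "K \<in> U" using gN(2) K(1) NU_U by blast+
  define E' where "E' = mk {e \<in> el Ed. el e \<subseteq> el K}"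
  have "small {e \<in> el Ed. el e \<subseteq> el K}" by (intro small_Collect small_el EdU df KU)
  then have elE': "el E' = {e \<in> el Ed. el e \<subseteq> el K}" unfolding E'_def by (rule el_mk)
  have setE': "is_set M E'" by (simp add: E'_def)
  obtain S T where S: "fs S" "supports S Ed" and T: "fs T" "supports T K" using NU_sup gN(2) K(1) by metis
  have E'N: "E' \<in> NU"
  proof (rule NU_I[OF setE' _ fs_un[OF S(1) T(1)]])
    show "el E' \<subseteq> NU" unfolding elE' using NU_el[OF gN(2)] by blast
    show "supports (un S T) E'"
    proof (rule supports_setI[OF setE' fsD[OF fs_un[OF S(1) T(1)]]])
      fix \<phi> e assume p: "\<phi> \<in> fx (un S T)" and e: "e \<in> el E'"
      have e': "e \<in> el Ed" "el e \<subseteq> el K" using e unfolding elE' by blast+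
      have "pe \<phi> e \<in> el Ed" using pe_sup_set[OF supports_un1[OF S(1) T(1) S(2)] EdU p] e'(1) by blast
      moreover have "pe \<phi> ` el e \<subseteq> el K"
        using pe_sup_set[OF supports_un2[OF S(1) T(1) T(2)] KU p] image_mono[OF e'(2), of "pe \<phi>"] by simp
      ultimately show "pe \<phi> e \<in> el E'" unfolding elE' using el_pe[OF fx_perm[OF p] el_U[OF e'(1)]] by simp
    qed
  qed
  have inE': "mk {x, y} \<in> el E'" if "x \<in> el K" "y \<in> el K" "x \<noteq> y" for x y
    unfolding elE' using cl[OF that] el_upair[OF el_U[OF that(1)] el_U[OF that(2)]] that by simp
  have "is_clique_subgraph N V Ed K E'"
    unfolding is_clique_subgraph_def is_graph_def is_subset_def is_set_N el_N[OF K(1)] el_N[OF E'N] el_N[OF gN(1)] el_N[OF gN(2)]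
  proof (intro conjI ballI impI)
    fix e assume e: "e \<in> el E'"
    then have eK: "e \<in> el Ed" "el e \<subseteq> el K" unfolding elE' by blast+
    obtain x y where xy: "x \<in> el V" "y \<in> el V" "x \<noteq> y" "e = mk {x, y}" using gN(4)[OF eK(1)] by blast
    have "el e = {x, y}" using el_upair[OF el_U[OF xy(1)] el_U[OF xy(2)]] xy(4) by simp
    then have "x \<in> el K" "y \<in> el K" using eK(2) by blast+
    moreover have "is_upair N e x y"
      unfolding is_upair_N is_upair_iff using xy NU_el[OF E'N e] el_U by blast
    ultimately show "\<exists>x\<in>el K. \<exists>y\<in>el K. x \<noteq> y \<and> is_upair N e x y" using xy(3) by blast
  next
    fix x y assume "x \<in> el K" "y \<in> el K" "x \<noteq> y"
    then show "is_edge N E' x y" using is_edge_N[OF E'N] NU_el[OF K(1)] inE' by blast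
  qed (use K E'N setE' elE' gN in auto)
  then show ?thesis ..
qed

lemma pointwise_card_le: assumes X: "X \<in> NU" "is_set M X" and E: "fs E" "\<And>x. x \<in> el X \<Longrightarrow> supports E x"
  shows "card_le N X om \<longleftrightarrow> card_le M X om"
proof
  assume "card_le M X om"
  then obtain f where f: "is_function_on M f X" "\<And>x. x \<in> el X \<Longrightarrow> ap f x \<in> el om" "inj_on (ap f) (el X)"
    by (rule card_leE) blast
  have "f \<in> NU" by (rule fun_NU[OF f(1) X E]) (simp_all add: om_NU[OF f(2)] supports_om[OF f(2)])
  then show "card_le N X om" unfolding card_le_N[OF X(1) omega_NU] using f by blast
qed (rule card_le_NM[OF X(1) omega_NU])

theorem EDM_T_N: "EDM_T N"
  unfolding EDM_T_def omega_N
proof (intro allI impI)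
  fix V Ed assume "is_graph N V Ed \<and> \<not> card_le N V om"
  then have g: "is_graph N V Ed" and unc: "\<not> card_le N V om" by blast+
  note gN = graph_N[OF g]
  have EdU: "Ed \<in> U" and VU: "V \<in> U" using gN NU_U by blast+
  obtain S T where S: "fs S" "supports S Ed" and T: "fs T" "supports T V" using NU_sup gN(1,2) by metis
  define E0 where "E0 = un S T"
  have E0: "fs E0" "supports E0 Ed" "supports E0 V"
    unfolding E0_def using fs_un[OF S(1) T(1)] supports_un1[OF S(1) T(1) S(2)] supports_un2[OF S(1) T] by blast+
  let ?G = "(\<exists>I. is_independent N V Ed I \<and> \<not> card_less N I om) \<or>
       (\<exists>V' E'. is_clique_subgraph N V Ed V' E' \<and> \<not> card_le N V' om)"
  have ind: "is_independent N V Ed I" if I: "I \<in> NU" "is_set M I" "el I \<subseteq> el V"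
     "\<forall>x\<in>el I. \<forall>y\<in>el I. x \<noteq> y \<longrightarrow> mk {x, y} \<notin> el Ed" for I
    unfolding is_independent_def is_subset_def is_set_N el_N[OF I(1)] el_N[OF gN(1)]
    using I is_edge_N[OF gN(2)] NU_el[OF I(1)] by simp
  show ?G
  proof (cases "\<forall>x\<in>el V. supports E0 x")
    case True
    have uncM: "\<not> card_le M V om" using unc pointwise_card_le[OF gN(1,3) E0(1)] True by blast
    define R where "R x y \<longleftrightarrow> mk {x, y} \<in> el Ed" for x y
    have DR: "D (\<lambda>e. R (e 0) (e (Suc 0)))" unfolding R_def by (intro df EdU)
    have symR: "R x y \<Longrightarrow> R y x" for x y unfolding R_def by (simp add: insert_commute)
    have "(\<exists>I. is_set M I \<and> el I \<subseteq> el V \<and> card_le M om I \<and> (\<forall>x\<in>el I. \<forall>y\<in>el I. x \<noteq> y \<longrightarrow> \<not> R x y)) \<or>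
      (\<exists>K. is_set M K \<and> el K \<subseteq> el V \<and> \<not> card_le M K om \<and> (\<forall>x\<in>el K. \<forall>y\<in>el K. x \<noteq> y \<longrightarrow> R x y))"
      by (rule EDM_ground[OF AC VU uncM DR]) (erule symR)
    then show ?thesis
    proof (elim disjE exE conjE)
      fix I assume I: "is_set M I" "el I \<subseteq> el V" "card_le M om I" "\<forall>x\<in>el I. \<forall>y\<in>el I. x \<noteq> y \<longrightarrow> \<not> R x y"
      have s: "\<And>x. x \<in> el I \<Longrightarrow> supports E0 x" using I(2) True by blast
      have IN: "I \<in> NU" using subset_NU[OF gN(1) I(1,2) E0(1) s] .
      \<comment> \<open>If \<open>I\<close> is countable in the submodel, it is countable and
        infinite in \<open>M\<close>, and a bijection with \<omega> in \<open>M\<close> is supported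
        by \<open>E0\<close>. So \<open>I\<close> has cardinality aleph_0 in the submodel and is not
        below it.\<close>
      have "\<not> card_less N I om"
      proof
        assume l: "card_less N I om"
        then have "card_le M I om" using card_le_NM[OF IN omega_NU] unfolding card_less_def by blast
        moreover have "\<not> kfin I" using kfin_not_om_le I(3) by blast
        ultimately have "card_eq M I om" using infinite_card_eq_om I(1) by blast
        then obtain f where f: "is_function_on M f I" "bij_betw (ap f) (el I) (el om)" by (rule card_eqE) blast
        have "ap f x \<in> el om" if "x \<in> el I" for x using f(2) that unfolding bij_betw_def by blast
        then have "f \<in> NU" by (intro fun_NU[OF f(1) IN I(1) E0(1) s]) (simp_all add: om_NU supports_om)
        then have "card_eq N I om" unfolding card_eq_N[OF IN omega_NU] using f by blast
        then show False using l unfolding card_less_def by blast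
      qed
      then show ?G using ind[OF IN I(1,2)] I(4) unfolding R_def by blast
    next
      fix K assume K: "is_set M K" "el K \<subseteq> el V" "\<not> card_le M K om" "\<forall>x\<in>el K. \<forall>y\<in>el K. x \<noteq> y \<longrightarrow> R x y"
      have s: "\<And>x. x \<in> el K \<Longrightarrow> supports E0 x" using K(2) True by blast
      have KN: "K \<in> NU" using subset_NU[OF gN(1) K(1,2) E0(1) s] .
      have "\<not> card_le N K om" using K(3) card_le_NM[OF KN omega_NU] by blast
      moreover have "\<exists>E'. is_clique_subgraph N V Ed K E'"
        by (rule clique_I[OF g KN K(1,2)]) (use K(4) in \<open>simp add: R_def\<close>)
      ultimately show ?G by blast
    qed
  next
    case False
    then obtain x where xv: "x \<in> el V" "\<not> supports E0 x" by blast
    then obtain E a where o: "support_orbit M G \<Gamma> E a x" "el E0 \<subseteq> el E"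
      using orbit_ex[OF E0(1) NU_el[OF gN(1) xv(1)]] by metis
    interpret support_orbit M G \<Gamma> E a x by (rule o(1))
    have ON: "Ob \<in> NU" and OV: "el Ob \<subseteq> el V"
      using Ob_NU[OF gN(1) supports_mono[OF o(2) E0(3)] xv(1)] Ob_sub[OF gN(1) supports_mono[OF o(2) E0(3)] xv(1)] by blast+
    have On: "\<not> card_le N Ob om" by (rule not_card_le[OF ON subset_refl])
    from clique_or_independent[OF supports_mono[OF o(2) E0(2)] EdU] show ?thesis
    proof
      assume "\<forall>y\<in>el Ob. \<forall>z\<in>el Ob. y \<noteq> z \<longrightarrow> mk {y, z} \<in> el Ed"
      then have "\<exists>E'. is_clique_subgraph N V Ed Ob E'" by (intro clique_I[OF g ON set_Ob OV]) blast
      then show ?thesis using On by blast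
    next
      assume "\<forall>y\<in>el Ob. \<forall>z\<in>el Ob. y \<noteq> z \<longrightarrow> mk {y, z} \<notin> el Ed"
      then have "is_independent N V Ed Ob" by (rule ind[OF ON set_Ob OV])
      then show ?thesis using On unfolding card_less_def by blast
    qed
  qed
qed

text \<open>An orbit need not contain a copy of \<omega>, so it is not enough for |Y| > aleph_0. The
  range of an injection of \<omega> into the family is joined to it. Its members are supported by
  \<open>E0\<close>, as values of a supported function at numbers, and their elements can be chosen
  by any choice function of \<open>M\<close>.\<close>

theorem PC_gt_N: "PC_gt N"
  unfolding PC_gt_def omega_N
proof (intro allI impI)
  fix X assume X: "is_family_of_finite_sets N X \<and> card_less N om X"
  then have XN: "X \<in> NU" and Xset: "is_set M X" unfolding is_family_of_finite_sets_def is_set_N by blast+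
  have XU: "X \<in> U" using XN by (rule NU_U)
  have fam: "is_set M y \<and> el y \<noteq> {} \<and> card_le N y om \<and> y \<in> NU" if "y \<in> el X" for y
  proof -
    have yN: "y \<in> NU" using NU_el[OF XN that] .
    have "is_set N y \<and> elts N y \<noteq> {} \<and> card_less N y om"
      using X that unfolding is_family_of_finite_sets_def el_N[OF XN] omega_N by blast
    then show ?thesis using yN unfolding is_set_N el_N[OF yN] card_less_def by blast
  qed
  have "card_le N om X" using X unfolding card_less_def by blast
  then obtain f where f: "f \<in> NU" "is_function_on M f om" "\<And>n. n \<in> el om \<Longrightarrow> ap f n \<in> el X" "inj_on (ap f) (el om)"
    unfolding card_le_N[OF omega_NU XN] by blast
  obtain S T where S: "fs S" "supports S f" and T: "fs T" "supports T X" using NU_sup f(1) XN by metis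
  define E0 where "E0 = un S T"
  have E0: "fs E0" "supports E0 f" "supports E0 X"
    unfolding E0_def using fs_un[OF S(1) T(1)] supports_un1[OF S(1) T(1) S(2)] supports_un2[OF S(1) T] by blast+
  have "has_choice_function M X" using AC Xset fam unfolding AC_def by blast
  then obtain c where c: "c \<in> U" "is_function_on M c X" "\<forall>x\<in>el X. app M c x \<in> el x"
    unfolding has_choice_function_def by blast
  have cel: "ap c y \<in> el y" if "y \<in> el X" for y using bspec[OF c(3) that] app_ap[OF that c(2)] by simp
  have csup: "ap c y \<in> NU \<and> supports E0 (ap c y)" if "y \<in> el X" "supports E0 y" for y
    using elem_supported[OF _ E0(1) that(2), of "ap c y"] NU_el[of y "ap c y"] fam[OF that(1)] cel[OF that(1)] by blast
  show "\<exists>Y. is_subset N Y X \<and> card_less N om Y \<and> has_choice_function N Y"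
  proof (cases "\<forall>y\<in>el X. supports E0 y")
    case True
    have "c \<in> NU" by (rule fun_NU[OF c(2) XN Xset E0(1)]) (use True csup in blast)+
    then have "has_choice_function N X" unfolding has_choice_N[OF XN] using c(2) cel by blast
    moreover have "is_subset N X X" unfolding is_subset_def is_set_N using XN Xset by blast
    ultimately show ?thesis using X by blast
  next
    case False
    then obtain x where xv: "x \<in> el X" "\<not> supports E0 x" by blast
    then obtain E a where o: "support_orbit M G \<Gamma> E a x" "el E0 \<subseteq> el E"
      using orbit_ex[OF E0(1) NU_el[OF XN xv(1)]] by metis
    interpret support_orbit M G \<Gamma> E a x by (rule o(1))
    have E0E: "supports E y" if "supports E0 y" for y using supports_mono[OF o(2) that] .
    have OX: "el Ob \<subseteq> el X" using Ob_sub[OF XN E0E[OF E0(3)] xv(1)] .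
    define Z where "Z = mk (ap f ` el om)"
    have elZ: "el Z = ap f ` el om" unfolding Z_def by (intro el_mk small_ap_image NU_U[OF f(1)] small_el om_U)
    have ZU: "Z \<in> U" by (simp add: Z_def)
    have ZX: "el Z \<subseteq> el X" unfolding elZ using f(3) by blast
    have Zs: "supports E0 y" if yZ: "y \<in> el Z" for y
    proof -
      obtain n where "y = ap f n" "n \<in> el om" using yZ unfolding elZ by (rule imageE)
      then show ?thesis using supports_ap[OF f(2) E0(2) supports_om] by blast
    qed
    define Y where "Y = un Z Ob"
    have elY: "el Y = el Z \<union> el Ob" unfolding Y_def by (rule el_un[OF ZU Ob_U])
    have setY: "is_set M Y" by (simp add: Y_def)
    have YX: "el Y \<subseteq> el X" unfolding elY using ZX OX by blast
    have supY: "supports E Y"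
    proof (rule supports_setI[OF setY fsD[OF E]])
      fix \<phi> y assume p: "\<phi> \<in> fx E" and y: "y \<in> el Y"
      then show "pe \<phi> y \<in> el Y" using Ob_closed[OF p] supportsD[OF E0E[OF Zs] p] unfolding elY by (metis Un_iff)
    qed
    have YN: "Y \<in> NU" by (rule NU_I[OF setY _ E supY]) (use YX NU_el[OF XN] in blast)
    have YU: "Y \<in> U" using YN by (rule NU_U)
    \<comment> \<open>A member of \<open>Z\<close> is fixed by \<open>fx E\<close>. If it lay in the
      orbit, it would be \<open>x\<close> itself, and \<open>E0\<close> would support
      \<open>x\<close>.\<close>
    have disj: "y \<notin> el Z" if y: "y \<in> el Ob" for y
    proof
      assume yZ: "y \<in> el Z"
      obtain \<phi> where p: "y = pe \<phi> x" "\<phi> \<in> fx E" using y unfolding el_Ob by (rule imageE)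
      obtain \<psi> where q: "\<psi> \<in> fx E" "\<And>x. x \<in> U \<Longrightarrow> pe \<psi> (pe \<phi> x) = x" using fx_inv[OF p(2) fsD[OF E]] by metis
      have "x = pe \<psi> y" using q(2)[OF xU] p(1) by simp
      then have "x = y" using supportsD[OF E0E[OF Zs[OF yZ]] q(1)] by simp
      then show False using Zs[OF yZ] xv(2) by simp
    qed
    have lt: "card_less N om Y"
      unfolding card_less_def
    proof
      show "\<not> card_eq N om Y" by (rule not_card_eq[OF YN]) (simp add: elY)
      show "card_le N om Y" unfolding card_le_N[OF omega_NU YN] using f(1,2,4) elY elZ by blast
    qed
    obtain u where u: "u \<in> el x" using fam[OF xv(1)] by blast
    have uU: "u \<in> U" using u by (rule el_U)
    have ua: "supports (ins a E) u"
      by (rule elem_supported[OF _ fs_ins[OF E a(1)] xa _ u]) (use fam[OF xv(1)] in blast)+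
    define h where "h y = tot (\<lambda>v. \<exists>\<phi>\<in>fx E. y = pe \<phi> x \<and> v = pe \<phi> u)" for y
    \<comment> \<open>Well defined: if \<phi> x = \<psi> x, the inverse of \<psi> composed with
      \<phi> fixes \<open>x\<close>, hence \<open>a\<close> by \<open>stab_x\<close>, and hence
      \<open>u\<close>, which is supported by \<open>ins a E\<close>.\<close>
    have h: "h (pe \<phi> x) = pe \<phi> u" if p: "\<phi> \<in> fx E" for \<phi>
      unfolding h_def
    proof (rule tot_eqI)
      show "\<exists>\<psi>\<in>fx E. pe \<phi> x = pe \<psi> x \<and> pe \<phi> u = pe \<psi> u" using p by blast
      fix v assume "\<exists>\<psi>\<in>fx E. pe \<phi> x = pe \<psi> x \<and> v = pe \<psi> u"
      then obtain \<psi> where q: "\<psi> \<in> fx E" "pe \<phi> x = pe \<psi> x" "v = pe \<psi> u" by blast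
      obtain \<rho> where i: "\<rho> \<in> fx E" "\<And>x. x \<in> U \<Longrightarrow> pe \<rho> (pe \<psi> x) = x" "\<And>x. x \<in> U \<Longrightarrow> pe \<psi> (pe \<rho> x) = x"
        using fx_inv[OF q(1) fsD[OF E]] by metis
      obtain \<kappa> where k: "\<kappa> \<in> fx E" "\<And>x. x \<in> U \<Longrightarrow> pe \<kappa> x = pe \<rho> (pe \<phi> x)"
        using fx_comp'[OF E i(1) p] by metis
      have "pe \<kappa> x = x" using k(2)[OF xU] q(2) i(2)[OF xU] by simp
      then have "\<kappa> \<in> fx (ins a E)" using stab_ins[OF k(1) stab_x[OF k(1)] a(1)] by blast
      then have "pe \<kappa> u = u" using supportsD[OF ua] by blast
      then show "v = pe \<phi> u" using k(2)[OF uU] i(3)[OF pe_U] q(3) by metis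
    qed simp
    have Th: "Tm (\<lambda>e. h (e 0))" unfolding h_def fx_def by (intro df xU uU EU)
    \<comment> \<open>On \<open>Z\<close> both the sets and their chosen elements are fixed by
      \<open>fx E\<close>; on the orbit the choice is transported from \<open>x\<close>. Either way
      \<open>F\<close> is equivariant.\<close>
    define F where "F y = (if y \<in> el Z then ap c y else h y)" for y
    have TF: "Tm (\<lambda>e. F (e 0))" unfolding F_def by (intro df ZU c(1) Tm_lift1[OF Th])
    have FOb: "F (pe \<phi> x) = pe \<phi> u" if p: "\<phi> \<in> fx E" for \<phi>
    proof -
      have "pe \<phi> x \<in> el Ob" unfolding el_Ob using p by (rule imageI)
      then show ?thesis using disj h[OF p] by (simp add: F_def)
    qed
    have Fel: "F y \<in> el y" if y: "y \<in> el Y" for y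
    proof (cases "y \<in> el Z")
      case True then show ?thesis using cel ZX by (auto simp: F_def)
    next
      case False
      then have "y \<in> el Ob" using y elY by blast
      then obtain \<phi> where p: "y = pe \<phi> x" "\<phi> \<in> fx E" unfolding el_Ob by (rule imageE)
      have "pe \<phi> u \<in> pe \<phi> ` el x" using u by (rule imageI)
      then show ?thesis unfolding p(1) FOb[OF p(2)] el_pe[OF fx_perm[OF p(2)] xU] .
    qed
    have Feq: "pe \<chi> (F y) = F (pe \<chi> y)" if ch: "\<chi> \<in> fx E" and y: "y \<in> el Y" for \<chi> y
    proof (cases "y \<in> el Z")
      case True
      have "pe \<chi> y = y" using supportsD[OF E0E[OF Zs[OF True]] ch] .
      moreover have "pe \<chi> (ap c y) = ap c y" using supportsD[OF E0E ch] csup Zs[OF True] ZX True by blast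
      ultimately show ?thesis using True by (simp add: F_def)
    next
      case False
      then have "y \<in> el Ob" using y elY by blast
      then obtain \<phi> where p: "y = pe \<phi> x" "\<phi> \<in> fx E" unfolding el_Ob by (rule imageE)
      obtain \<rho> where r: "\<rho> \<in> fx E" "\<And>x. x \<in> U \<Longrightarrow> pe \<rho> x = pe \<chi> (pe \<phi> x)" using fx_comp'[OF E ch p(2)] by metis
      have "F (pe \<chi> y) = pe \<rho> u" using FOb[OF r(1)] r(2)[OF xU] p(1) by simp
      also have "\<dots> = pe \<chi> (F y)" using r(2)[OF uU] FOb[OF p(2)] p(1) by simp
      finally show ?thesis by simp
    qed
    have "gr F Y \<in> NU"
      by (rule gr_NU[OF TF YN _ E supY Feq]) (use Fel NU_el[OF NU_el[OF YN]] in blast)+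
    then have "has_choice_function N Y"
      unfolding has_choice_N[OF YN] using gr_fun[OF TF YU] ap_gr[OF TF YU] Fel
      by (intro bexI[of _ "gr F Y"]) auto
    moreover have "is_subset N Y X" unfolding is_subset_def is_set_N el_N[OF YN] el_N[OF XN] using YN setY YX by blast
    ultimately show ?thesis using lt by blast
  qed
qed

section \<open>Dedekind finiteness of the atoms and the false principles\<close>

lemma fixed_atom: assumes "fs F" "a \<in> el At" "supports F a" shows "a \<in> el F"
proof (rule ccontr)
  assume "a \<notin> el F"
  then obtain \<phi> where p: "\<phi> \<in> fx F" "ap \<phi> a \<notin> el (ins a ze)"
    using H3[OF assms(1,2) _ kfin_ins[OF kfin_ze el_U[OF assms(2)]]] by blast
  have "ap \<phi> a = a" using supportsD[OF assms(3) p(1)] fx_ap[OF p(1) assms(2)] by simp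
  then show False using p(2) el_insf[OF fs_ze assms(2)] by simp
qed

text \<open>
  Applied below to the set of atoms and to the family of their singletons. An element \<open>s a\<close> supported
  by \<open>F\<close> has \<open>a \<in> F\<close>, so a sequence in the submodel takes only finitely many values.
\<close>

lemma dedekind_finite:
  assumes s: "Tm (\<lambda>e. s (e 0))" "\<And>a b. a \<in> el At \<Longrightarrow> b \<in> el At \<Longrightarrow> s a = s b \<Longrightarrow> a = b"
    and eq: "\<And>\<phi> a. perm \<phi> \<Longrightarrow> a \<in> el At \<Longrightarrow> pe \<phi> (s a) = s (ap \<phi> a)"
    and X: "X \<in> NU" "el X = s ` el At"
  shows "\<not> card_le N X om" "Y \<in> NU \<Longrightarrow> el Y \<subseteq> el X \<Longrightarrow> \<not> card_le N om Y"
proof -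
  have fixs: "a \<in> el F" if "fs F" "a \<in> el At" "supports F (s a)" for F a
  proof (rule fixed_atom[OF that(1,2)])
    show "supports F a" unfolding supports_def
    proof
      fix \<phi> assume p: "\<phi> \<in> fx F"
      have "s (ap \<phi> a) = s a" using eq[OF fx_perm[OF p] that(2)] supportsD[OF that(3) p] by simp
      then have "ap \<phi> a = a" using s(2)[OF fx_At[OF p that(2)] that(2)] by blast
      then show "pe \<phi> a = a" using fx_ap[OF p that(2)] by simp
    qed
  qed
  show "\<not> card_le N X om"
  proof
    assume "card_le N X om"
    then obtain f where f: "f \<in> NU" "is_function_on M f X" "\<And>x. x \<in> el X \<Longrightarrow> ap f x \<in> el om" "inj_on (ap f) (el X)"
      unfolding card_le_N[OF X(1) omega_NU] by blast
    obtain F where F: "fs F" "supports F f" using NU_sup[OF f(1)] by blast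
    obtain a where a: "a \<in> el At" "a \<notin> el F" using H0 F(1) unfolding fs_def by blast
    have sa: "s a \<in> el X" unfolding X(2) using a(1) by (rule imageI)
    have "supports F (s a)" unfolding supports_def
    proof
      fix \<phi> assume p: "\<phi> \<in> fx F"
      note pa = pe_ap[OF f(2) fx_perm[OF p] supportsD[OF F(2) p] sa]
      have "ap f (pe \<phi> (s a)) = ap f (s a)" using pa(2) pe_om[OF fx_perm[OF p] f(3)[OF sa]] by simp
      then show "pe \<phi> (s a) = s a" using inj_onD[OF f(4) _ pa(1) sa] by blast
    qed
    then show False using fixs[OF F(1) a(1)] a(2) by blast
  qed
  show "\<not> card_le N om Y" if Y: "Y \<in> NU" "el Y \<subseteq> el X"
  proof
    assume "card_le N om Y"
    then obtain f where f: "f \<in> NU" "is_function_on M f om" "\<And>n. n \<in> el om \<Longrightarrow> ap f n \<in> el Y" "inj_on (ap f) (el om)"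
      unfolding card_le_N[OF omega_NU Y(1)] by blast
    obtain F where F: "fs F" "supports F f" using NU_sup[OF f(1)] by blast
    let ?S = "mk (s ` el F)"
    have kF: "kfin F" using F(1) by (simp add: fs_def)
    have elS: "el ?S = s ` el F" by (intro el_mk small_image s(1) small_el kfin_U kF)
    have "ap f n \<in> el ?S" if n: "n \<in> el om" for n
    proof -
      have "ap f n \<in> s ` el At" using f(3)[OF n] Y(2) X(2) by blast
      then obtain a where a: "ap f n = s a" "a \<in> el At" by (rule imageE)
      have "supports F (s a)" using supports_ap[OF f(2) F(2) supports_om[OF n] n] a(1) by simp
      then have "a \<in> el F" using fixs[OF F(1) a(2)] by blast
      then show ?thesis unfolding elS a(1) by (rule imageI)
    qed
    then have "card_le M om ?S" unfolding card_le_def is_injection_iff using f NU_U by blast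
    then show False using kfin_not_om_le kfin_image[OF kF s(1)] by blast
  qed
qed

text \<open>Choosing is not the obstacle, since singletons have a choice function. The family is not
  countable, but no part of it contains a copy of \<omega>, so no subfamily satisfies |Y| >
  aleph_0.\<close>

theorem not_PC_nle_N: "\<not> PC_nle N"
proof -
  define s where "s a = mk {a}" for a
  have Ts: "Tm (\<lambda>e. s (e 0))" unfolding s_def by (intro df)
  have els: "el (s a) = {a}" if "a \<in> el At" for a unfolding s_def using el_sing[OF el_U[OF that]] .
  have inj: "a = b" if "a \<in> el At" "b \<in> el At" "s a = s b" for a b
    using els[OF that(1)] unfolding that(3) els[OF that(2)] by (rule singleton_inject[symmetric])
  have eq: "pe \<phi> (s a) = s (ap \<phi> a)" if "perm \<phi>" "a \<in> el At" for \<phi> a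
    unfolding s_def using pe_mk[OF that(1), of "{a}"] pe_atom[OF perm_U[OF that(1)] that(2)] el_U[OF that(2)]
    by (simp only: small_insert small_empty image_insert image_empty)
  define X where "X = mk (s ` el At)"
  have elX: "el X = s ` el At" unfolding X_def by (intro el_mk small_image Ts small_el At_U)
  have sN: "s a \<in> NU" if a: "a \<in> el At" for a
  proof (rule NU_I[OF _ _ fs_ins[OF fs_ze a]])
    show "is_set M (s a)" by (simp add: s_def)
    show "el (s a) \<subseteq> NU" using els[OF a] atom_NU[OF a] by simp
    show "supports (ins a ze) (s a)" unfolding supports_def
    proof
      fix \<phi> assume p: "\<phi> \<in> fx (ins a ze)"
      then have "ap \<phi> a = a" unfolding fx_def using el_insf[OF fs_ze a] by simp
      then show "pe \<phi> (s a) = s a" using eq[OF fx_perm[OF p] a] by simp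
    qed
  qed
  have setX: "is_set M X" by (simp add: X_def)
  have XN: "X \<in> NU"
  proof (rule NU_I[OF setX _ fs_ze])
    show "el X \<subseteq> NU" unfolding elX using sN by (rule image_subsetI)
    show "supports ze X"
    proof (rule supports_setI[OF setX])
      fix \<phi> x assume p: "\<phi> \<in> fx ze" and x: "x \<in> el X"
      obtain a where a: "x = s a" "a \<in> el At" using x unfolding elX by (rule imageE)
      have "pe \<phi> x = s (ap \<phi> a)" using eq[OF fx_perm[OF p] a(2)] a(1) by simp
      then show "pe \<phi> x \<in> el X" unfolding elX using fx_At[OF p a(2)] by (rule image_eqI)
    qed simp
  qed
  have ded1: "\<not> card_le N X om"
    by (rule dedekind_finite(1)[OF Ts _ _ XN elX]) (erule (2) inj, erule (1) eq)
  have ded2: "\<not> card_le N om Y" if "Y \<in> NU" "el Y \<subseteq> el X" for Y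
    by (rule dedekind_finite(2)[OF Ts _ _ XN elX that]) (erule (2) inj, erule (1) eq)
  have "is_family_of_finite_sets N X"
    unfolding is_family_of_finite_sets_def omega_N el_N[OF XN]
  proof (intro conjI ballI)
    show "is_set N X" unfolding is_set_N using XN setX by blast
    fix x assume x: "x \<in> el X"
    obtain a where a: "x = s a" "a \<in> el At" using x unfolding elX by (rule imageE)
    have xN: "x \<in> NU" using sN[OF a(2)] a(1) by simp
    have xs: "is_set M x" using a(1) by (simp add: s_def)
    show "is_set N x" "elts N x \<noteq> {}" unfolding is_set_N el_N[OF xN] using xN xs els[OF a(2)] a(1) by auto
    have "s a = ins a ze" unfolding s_def ins_def by simp
    then have kx: "kfin x" using a kfin_ins[OF kfin_ze el_U[OF a(2)]] by simp
    have "supports (ins a ze) y" if "y \<in> el x" for y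
      using that els[OF a(2)] a(1) supports_ins[OF a(2) fs_ze] by simp
    then have "card_le N x om"
      using pointwise_card_le[OF xN xs fs_ins[OF fs_ze a(2)]] kfin_card_le[OF kx] by blast
    moreover have "\<not> card_eq N x om"
      using card_eq_NM[OF xN omega_NU] kx fin_iff[OF xs] unfolding card_less_def by blast
    ultimately show "card_less N x om" unfolding card_less_def by blast
  qed
  moreover have "\<not> (is_subset N Y X \<and> card_less N om Y)" for Y
  proof
    assume Y: "is_subset N Y X \<and> card_less N om Y"
    then have YN: "Y \<in> NU" unfolding is_subset_def is_set_N by blast
    then have "el Y \<subseteq> el X" using Y unfolding is_subset_def el_N[OF YN] el_N[OF XN] by blast
    then show False using ded2[OF YN] Y unfolding card_less_def by blast
  qed
  ultimately show ?thesis unfolding PC_nle_def omega_N using ded1 by blast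
qed

text \<open>A clique in the graph without edges has at most one vertex, whereas \<open>H0\<close>
  provides two atoms.\<close>

lemma empty_graph:
  assumes "is_clique_subgraph N At ze V' E'"
  shows "card_le N V' om" "\<not> card_eq N V' At"
proof -
  have g: "is_graph N V' E'" and sub: "is_subset N V' At" "is_subset N E' ze"
    and cl: "\<forall>x\<in>elts N V'. \<forall>y\<in>elts N V'. x \<noteq> y \<longrightarrow> is_edge N E' x y"
    using assms unfolding is_clique_subgraph_def by blast+
  have V: "V' \<in> NU" and E': "E' \<in> NU" and sV: "is_set M V'" using graph_N[OF g] by blast+
  have VU: "V' \<in> U" using V by (rule NU_U)
  have "el E' = {}" using sub(2) unfolding is_subset_def el_N[OF E'] el_N[OF ze_NU] by simp
  then have one: "x = y" if "x \<in> el V'" "y \<in> el V'" for x y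
    using cl that is_edge_N[OF E'] NU_el[OF V] unfolding el_N[OF V] by blast
  obtain S where S: "fs S" "supports S V'" using NU_sup[OF V] by blast
  show "card_le N V' om"
  proof (rule card_le_N_I[where F="\<lambda>x. ze", OF _ V omega_NU _ _ S])
    show "Tm (\<lambda>e. ze)" by (intro df)
    show "inj_on (\<lambda>x. ze) (el V')" using one by (auto intro: inj_onI)
    show "pe \<phi> ze = ze" if "\<phi> \<in> fx S" for \<phi> using pe_om[OF fx_perm[OF that] ze_om] .
  qed simp
  show "\<not> card_eq N V' At"
  proof
    assume "card_eq N V' At"
    then obtain f where f: "bij_betw (ap f) (el V') (el At)" unfolding card_eq_N[OF V At_NU] by blast
    obtain a where a: "a \<in> el At" using H0[OF kfin_ze] by blast
    obtain b where b: "b \<in> el At" "b \<notin> el (ins a ze)" using H0[OF kfin_ins[OF kfin_ze el_U[OF a]]] by blast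
    have "a \<in> ap f ` el V'" "b \<in> ap f ` el V'" using f a b(1) unfolding bij_betw_def by blast+
    then have "a = b" using one by blast
    then show False using b(2) el_insf[OF fs_ze a] by simp
  qed
qed

lemma empty_graph_uncountable:
  "is_graph N At ze" "\<not> card_le N At om" "is_independent N At ze I \<Longrightarrow> \<not> card_le N om I"
proof -
  have eq: "pe \<phi> a = ap \<phi> a" if "perm \<phi>" "a \<in> el At" for \<phi> a
    using pe_atom[OF perm_U[OF that(1)] that(2)] .
  have im: "el At = (\<lambda>a. a) ` el At" by simp
  have A: "\<not> card_le N At om"
    by (rule dedekind_finite(1)[where s="\<lambda>a. a", OF Tm_var _ _ At_NU im]) (assumption, erule (1) eq)
  have A': "\<not> card_le N om Y" if "Y \<in> NU" "el Y \<subseteq> el At" for Y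
    by (rule dedekind_finite(2)[where s="\<lambda>a. a", OF Tm_var _ _ At_NU im that]) (assumption, erule (1) eq)
  show "is_graph N At ze" unfolding is_graph_def is_set_N el_N[OF ze_NU] using At_NU ze_NU set_At by simp
  show "\<not> card_le N At om" by (rule A)
  show "\<not> card_le N om I" if "is_independent N At ze I"
  proof -
    have I: "I \<in> NU" using that unfolding is_independent_def is_subset_def is_set_N by blast
    then show ?thesis using that A'[OF I] unfolding is_independent_def is_subset_def el_N[OF I] el_N[OF At_NU] by blast
  qed
qed

theorem not_EDM_DM_N: "\<not> EDM_DM N"
  unfolding EDM_DM_def omega_N using empty_graph_uncountable empty_graph(2) by blast

theorem not_EDM_BG_N: "\<not> EDM_BG N"
  unfolding EDM_BG_def omega_N using empty_graph_uncountable empty_graph(1) by blast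

theorem submodel_principles: "EDM_T N \<and> PC_gt N \<and> \<not> PC_nle N \<and> \<not> EDM_DM N \<and> \<not> EDM_BG N"
  using EDM_T_N PC_gt_N not_PC_nle_N not_EDM_DM_N not_EDM_BG_N by blast

end

section \<open>The basic Fraenkel model\<close>

context zfa begin

lemma perm_gr:
  assumes "Tm (\<lambda>e. F (e 0))" "bij_betw F (el At) (el At)"
  shows "perm (gr F At)" "a \<in> el At \<Longrightarrow> ap (gr F At) a = F a"
proof -
  have a: "ap (gr F At) a = F a" if "a \<in> el At" for a by (rule ap_gr[OF assms(1) At_U that])
  then show "a \<in> el At \<Longrightarrow> ap (gr F At) a = F a" .
  show "perm (gr F At)"
    unfolding perm_def using gr_fun[OF assms(1) At_U] bij_betw_cong[of "el At" "ap (gr F At)" F] a assms(2) by simp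
qed

lemma perm_bij: "perm \<phi> \<Longrightarrow> bij_betw (ap \<phi>) (el At) (el At)" by (simp add: perm_def)

lemma perm_inj: assumes "perm \<phi>" "a \<in> el At" "b \<in> el At" "ap \<phi> a = ap \<phi> b" shows "a = b"
  using inj_onD[OF bij_betw_imp_inj_on[OF perm_bij[OF assms(1)]] assms(4,2,3)] .

lemma perm_id_ex: "\<exists>\<iota>. perm \<iota> \<and> (\<forall>a\<in>el At. ap \<iota> a = a)"
proof -
  have "Tm (\<lambda>e. e 0)" by (intro df)
  from perm_gr[where F="\<lambda>a. a", OF this] show ?thesis by (metis bij_betw_id eq_id_iff)
qed

lemma perm_comp_ex: assumes "perm \<phi>" "perm \<psi>" shows "\<exists>\<chi>. perm \<chi> \<and> (\<forall>a\<in>el At. ap \<chi> a = ap \<phi> (ap \<psi> a))"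
proof -
  have T: "Tm (\<lambda>e. ap \<phi> (ap \<psi> (e 0)))" by (intro df perm_U assms)
  have "bij_betw (ap \<phi> \<circ> ap \<psi>) (el At) (el At)" using perm_bij assms bij_betw_trans by blast
  then have B: "bij_betw (\<lambda>a. ap \<phi> (ap \<psi> a)) (el At) (el At)" by (simp add: comp_def)
  show ?thesis using perm_gr[OF T B] by blast
qed

lemma perm_inv_ex: assumes "perm \<phi>" shows "\<exists>\<psi>. perm \<psi> \<and> (\<forall>a\<in>el At. ap \<psi> (ap \<phi> a) = a \<and> ap \<phi> (ap \<psi> a) = a)"
proof -
  define F where "F b = tot (\<lambda>a. a \<in> el At \<and> ap \<phi> a = b)" for b
  have T: "Tm (\<lambda>e. F (e 0))" unfolding F_def by (intro df perm_U assms At_U)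
  have inj: "inj_on (ap \<phi>) (el At)" and im: "ap \<phi> ` el At = el At" using perm_bij[OF assms] unfolding bij_betw_def by blast+
  have 1: "F (ap \<phi> a) = a" if "a \<in> el At" for a unfolding F_def using tot_inv[OF inj that] .
  have 2: "F b \<in> el At \<and> ap \<phi> (F b) = b" if "b \<in> el At" for b
  proof -
    have "b \<in> ap \<phi> ` el At" using that im by simp
    then obtain a where "b = ap \<phi> a" "a \<in> el At" by (rule imageE)
    then show ?thesis using 1 by simp
  qed
  have B: "bij_betw F (el At) (el At)"
    by (rule bij_betw_byWitness[where f'="ap \<phi>"]) (use 1 2 im in auto)
  from perm_gr[OF T B] 1 2 perm_At[OF assms] show ?thesis by (intro exI[of _ "gr F At"]) simp
qed

lemma transposition_ex:
  assumes "a \<in> el At" "b \<in> el At"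
  shows "\<exists>\<phi>. perm \<phi> \<and> ap \<phi> a = b \<and> ap \<phi> b = a \<and> (\<forall>x\<in>el At. x \<noteq> a \<longrightarrow> x \<noteq> b \<longrightarrow> ap \<phi> x = x)"
proof -
  define F where "F x = (if x = a then b else if x = b then a else x)" for x
  have T: "Tm (\<lambda>e. F (e 0))" unfolding F_def using assms el_U by (intro df) auto
  have B: "bij_betw F (el At) (el At)"
    by (rule bij_betw_byWitness[where f'=F]) (use assms in \<open>auto simp: F_def\<close>)
  show ?thesis using perm_gr[OF T B] assms by (intro exI[of _ "gr F At"]) (simp add: F_def)
qed

lemma not_kfin_cover: assumes "card_le M om At" "kfin F" shows "\<exists>a\<in>el At. a \<notin> el F"
proof (rule ccontr)
  assume "\<not> ?thesis"
  then have "el At \<subseteq> el F" by blast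
  then have "kfin At" using kfin_subset[OF assms(2) set_At] by blast
  then show False using kfin_not_om_le assms(1) by blast
qed

lemma basic_Fraenkel_homogeneous:
  assumes AC: "AC M" and N: "basic_Fraenkel_model M N"
  obtains G \<Gamma> where "homogeneous_group M G \<Gamma>" "N = FM_model M G \<Gamma>"
proof -
  obtain G \<Gamma> where G: "is_set M G" "el G = {\<phi>. is_perm M \<phi>}" "is_finite_support_filter M G \<Gamma>" "N = FM_model M G \<Gamma>"
    and c: "card_eq M At om"
    using N unfolding basic_Fraenkel_model_def by blast
  have Gp: "\<phi> \<in> el G \<longleftrightarrow> perm \<phi>" for \<phi> unfolding G(2) is_perm_iff by simp
  interpret perm_group M G \<Gamma>
  proof unfold_locales
    show "\<exists>\<iota>\<in>el G. \<forall>a\<in>el At. ap \<iota> a = a" using perm_id_ex Gp by blast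
    show "\<exists>\<chi>\<in>el G. \<forall>a\<in>el At. ap \<chi> a = ap \<phi> (ap \<psi> a)" if "\<phi> \<in> el G" "\<psi> \<in> el G" for \<phi> \<psi>
      using perm_comp_ex that Gp by blast
    show "\<exists>\<psi>\<in>el G. \<forall>a\<in>el At. ap \<psi> (ap \<phi> a) = a" if "\<phi> \<in> el G" for \<phi>
      using perm_inv_ex that Gp by blast
  qed (use G Gp in auto)
  have H0: "\<exists>a\<in>el At. a \<notin> el F" if "kfin F" for F
    using not_kfin_cover[OF card_eq_om_le[OF c At_U] that] .
  \<comment> \<open>Transpositions of atoms outside \<open>E\<close> are the only permutations,
    besides the identity, from which the homogeneity properties are built.\<close>
  have swap: "\<exists>\<phi>\<in>fx E. ap \<phi> a = b \<and> ap \<phi> b = a" if fE: "fs E" and ab: "a \<in> el At" "b \<in> el At" "a \<notin> el E" "b \<notin> el E" for E a b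
  proof -
    obtain \<phi> where p: "perm \<phi>" "ap \<phi> a = b" "ap \<phi> b = a" "\<forall>x\<in>el At. x \<noteq> a \<longrightarrow> x \<noteq> b \<longrightarrow> ap \<phi> x = x"
      using transposition_ex[OF ab(1,2)] by blast
    have "ap \<phi> t = t" if "t \<in> el E" for t
    proof -
      have "t \<in> el At" "t \<noteq> a" "t \<noteq> b" using fE ab that unfolding fs_def by blast+
      then show ?thesis using p(4) by blast
    qed
    then have "\<phi> \<in> fx E" using p(1) Gp unfolding fx_def by blast
    then show ?thesis using p by blast
  qed
  have idf: "\<exists>\<iota>\<in>fx E. \<forall>a\<in>el At. ap \<iota> a = a" if "fs E" for E
    using G_id that unfolding fx_def fs_def by blast
  have out: "ap \<phi> a \<in> el At \<and> ap \<phi> a \<notin> el E" if f: "fs E" "\<phi> \<in> fx E" "a \<in> el At" "a \<notin> el E" for E \<phi> a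
  proof
    show A: "ap \<phi> a \<in> el At" by (rule fx_At[OF f(2,3)])
    show "ap \<phi> a \<notin> el E"
    proof
      assume "ap \<phi> a \<in> el E"
      then have "ap \<phi> (ap \<phi> a) = ap \<phi> a" using f(2) unfolding fx_def by blast
      then have "ap \<phi> a = a" using perm_inj[OF fx_perm[OF f(2)] A f(3)] by blast
      then show False using \<open>ap \<phi> a \<in> el E\<close> f(4) by simp
    qed
  qed
  have "homogeneous_group M G \<Gamma>"
  proof unfold_locales
    show "AC M" by (rule AC)
    show "\<exists>a\<in>el At. a \<notin> el F" if "kfin F" for F using H0[OF that] .
  next
    fix E a \<theta> \<pi> assume h: "fs E" "a \<in> el At" "a \<notin> el E" "\<theta> \<in> fx E" "\<pi> \<in> fx E" "ap \<theta> a \<noteq> a"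
    let ?b = "ap \<theta> a" and ?c = "ap \<pi> a"
    have b: "?b \<in> el At" "?b \<notin> el E" and c: "?c \<in> el At" "?c \<notin> el E" using out h by blast+
    have fb: "fs (ins ?b E)" and fa: "fs (ins a E)" using fs_ins h(1,2) b(1) by blast+
    have eb: "el (ins ?b E) = insert ?b (el E)" and ea: "el (ins a E) = insert a (el E)" using el_insf h(1,2) b(1) by blast+
    \<comment> \<open>Unless \<pi> a = \<theta> a, interchanging \<open>a\<close> and \<pi> a leaves
      \<theta> a fixed and \<tau> can be the identity. In the exceptional case \<sigma> has to fix
      the target, so the way leads through a fresh atom \<open>d\<close>.\<close>
    show "\<exists>\<sigma>\<in>fx (ins ?b E). \<exists>\<tau>\<in>fx (ins a E). ?c = ap \<tau> (ap \<sigma> a)"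
    proof (cases "?c = ?b")
      case False
      obtain \<sigma> where s: "\<sigma> \<in> fx (ins ?b E)" "ap \<sigma> a = ?c" using swap[OF fb h(2) c(1)] eb h(3,6) c(2) False by auto
      obtain \<iota> where i: "\<iota> \<in> fx (ins a E)" "\<forall>a\<in>el At. ap \<iota> a = a" using idf[OF fa] by blast
      have "?c = ap \<iota> (ap \<sigma> a)" using s(2) i(2) c(1) by simp
      then show ?thesis using s(1) i(1) by blast
    next
      case True
      obtain d where d: "d \<in> el At" "d \<notin> el (ins a (ins ?b E))" using H0 fs_ins[OF fb h(2)] unfolding fs_def by blast
      have d': "d \<noteq> a" "d \<noteq> ?b" "d \<notin> el E" using d(2) el_insf[OF fb h(2)] eb by auto
      obtain \<sigma> where s: "\<sigma> \<in> fx (ins ?b E)" "ap \<sigma> a = d" using swap[OF fb h(2) d(1)] eb h(3,6) d' by auto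
      obtain \<tau> where t: "\<tau> \<in> fx (ins a E)" "ap \<tau> d = ?b" using swap[OF fa d(1) b(1)] ea h(6) b(2) d' by auto
      have "?c = ap \<tau> (ap \<sigma> a)" using s(2) t(2) True by simp
      then show ?thesis using s(1) t(1) by blast
    qed
  next
    fix E a \<phi> \<phi>' \<psi> \<psi>' assume h: "fs E" "a \<in> el At" "a \<notin> el E" "\<phi> \<in> fx E" "\<phi>' \<in> fx E" "\<psi> \<in> fx E" "\<psi>' \<in> fx E"
      "ap \<phi> a \<noteq> ap \<phi>' a" "ap \<psi> a \<noteq> ap \<psi>' a"
    let ?b = "ap \<phi> a" and ?b' = "ap \<phi>' a" and ?c = "ap \<psi> a" and ?c' = "ap \<psi>' a"
    have A: "?b \<in> el At" "?b \<notin> el E" "?b' \<in> el At" "?b' \<notin> el E" "?c \<in> el At" "?c \<notin> el E" "?c' \<in> el At" "?c' \<notin> el E"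
      using out[OF h(1) _ h(2,3)] h(4-7) by blast+
    \<comment> \<open>First one atom is brought to its target, then the other by a permutation that
      also fixes the target already reached.\<close>
    obtain \<rho> where r: "\<rho> \<in> fx E" "ap \<rho> ?b = ?c" using swap[OF h(1) A(1,5,2,6)] by blast
    have d: "ap \<rho> ?b' \<in> el At" "ap \<rho> ?b' \<notin> el E" using out[OF h(1) r(1) A(3,4)] by blast+
    have dc: "ap \<rho> ?b' \<noteq> ?c" using perm_inj[OF fx_perm[OF r(1)] A(1,3)] r(2) h(8) by metis
    have fc: "fs (ins ?c E)" and ec: "el (ins ?c E) = insert ?c (el E)" using fs_ins el_insf h(1) A(5) by blast+
    obtain \<kappa> where k: "\<kappa> \<in> fx (ins ?c E)" "ap \<kappa> (ap \<rho> ?b') = ?c'"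
      using swap[OF fc d(1) A(7)] ec dc d(2) h(9) A(8) by auto
    obtain \<chi> where c: "\<chi> \<in> el G" "\<And>a. a \<in> el At \<Longrightarrow> ap \<chi> a = ap \<kappa> (ap \<rho> a)" using fx_comp[OF k(1) r(1)] by metis
    have kE: "ap \<kappa> t = t" if "t \<in> insert ?c (el E)" for t using k(1) that unfolding fx_def ec by blast
    have "ap \<chi> t = t" if t: "t \<in> el E" for t
    proof -
      have "t \<in> el At" using t h(1) unfolding fs_def by blast
      moreover have "ap \<rho> t = t" using r(1) t unfolding fx_def by blast
      ultimately show ?thesis using c(2)[of t] kE[of t] t by simp
    qed
    then have "\<chi> \<in> fx E" using c(1) unfolding fx_def by blast
    moreover have "ap \<chi> ?b = ?c" using c(2)[OF A(1)] r(2) kE[of ?c] by simp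
    moreover have "ap \<chi> ?b' = ?c'" using c(2)[OF A(3)] k(2) by simp
    ultimately show "\<exists>\<chi>\<in>fx E. (ap \<chi> ?b = ?c \<and> ap \<chi> ?b' = ?c') \<or> (ap \<chi> ?b = ?c' \<and> ap \<chi> ?b' = ?c)" by blast
  next
    fix E a F assume h: "fs E" "a \<in> el At" "a \<notin> el E" "kfin F"
    have "kfin (un E F)" using h kfin_un unfolding fs_def by blast
    then obtain d where d: "d \<in> el At" "d \<notin> el (un E F)" using H0 by blast
    then have d': "d \<notin> el E" "d \<notin> el F" using el_un[OF fs_U[OF h(1)] kfin_U[OF h(4)]] by blast+
    then show "\<exists>\<phi>\<in>fx E. ap \<phi> a \<notin> el F" using swap[OF h(1,2) d(1) h(3) d'(1)] by auto
  qed
  then show ?thesis using that G(4) by blast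
qed

end

section \<open>Automorphism groups of dense linear orders of the atoms\<close>

text \<open>
  The group of automorphisms of a linear order of the atoms that acts transitively on increasing
  pairs. Gluing two automorphisms at a point where they agree gives another one, and this yields
  the homogeneity over finite sets.
\<close>

locale order_group = perm_group M G \<Gamma> for M :: "'m struct" and G \<Gamma> +
  fixes R :: 'm
  assumes R_U: "R \<in> U"
begin

text \<open>The strict order belonging to a reflexive linear order \<open>R\<close>: a < b means
  that b \<le> a fails.\<close>

definition lt :: "'m \<Rightarrow> 'm \<Rightarrow> bool" where "lt a b \<longleftrightarrow> pr b a \<notin> el R"

lemma D_lt [df]: "Tm t \<Longrightarrow> Tm u \<Longrightarrow> D (\<lambda>e. lt (t e) (u e))"
proof (rule D_lift2[where R=lt])
  show "D (\<lambda>e. lt (e 0) (e (Suc 0)))" unfolding lt_def by (intro df R_U)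
qed

end

locale rat_order_group = order_group +
  assumes G_iff: "\<And>\<phi>. \<phi> \<in> el G \<longleftrightarrow> perm \<phi> \<and> (\<forall>a\<in>el At. \<forall>b\<in>el At. lt a b \<longleftrightarrow> lt (ap \<phi> a) (ap \<phi> b))"
    and lt_irrefl: "\<And>a. a \<in> el At \<Longrightarrow> \<not> lt a a"
    and lt_trans: "\<And>a b c. a \<in> el At \<Longrightarrow> b \<in> el At \<Longrightarrow> c \<in> el At \<Longrightarrow> lt a b \<Longrightarrow> lt b c \<Longrightarrow> lt a c"
    and lt_total: "\<And>a b. a \<in> el At \<Longrightarrow> b \<in> el At \<Longrightarrow> a \<noteq> b \<Longrightarrow> lt a b \<or> lt b a"
    and dense: "\<And>a b. a \<in> el At \<Longrightarrow> b \<in> el At \<Longrightarrow> lt a b \<Longrightarrow> \<exists>c\<in>el At. lt a c \<and> lt c b"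
    and no_top: "\<And>a. a \<in> el At \<Longrightarrow> \<exists>c\<in>el At. lt a c"
    and no_bot: "\<And>a. a \<in> el At \<Longrightarrow> \<exists>c\<in>el At. lt c a"
    and nonempty: "\<exists>a. a \<in> el At"
    and trans2: "\<And>p q r s. p \<in> el At \<Longrightarrow> q \<in> el At \<Longrightarrow> r \<in> el At \<Longrightarrow> s \<in> el At \<Longrightarrow> lt p q \<Longrightarrow> lt r s \<Longrightarrow>
      \<exists>\<phi>\<in>el G. ap \<phi> p = r \<and> ap \<phi> q = s"
begin

lemma lt_asym: "a \<in> el At \<Longrightarrow> b \<in> el At \<Longrightarrow> lt a b \<Longrightarrow> \<not> lt b a"
  using lt_trans lt_irrefl by blast

lemma G_lt: "\<phi> \<in> el G \<Longrightarrow> a \<in> el At \<Longrightarrow> b \<in> el At \<Longrightarrow> lt (ap \<phi> a) (ap \<phi> b) \<longleftrightarrow> lt a b"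
  using G_iff by blast

lemma G_At: "\<phi> \<in> el G \<Longrightarrow> a \<in> el At \<Longrightarrow> ap \<phi> a \<in> el At"
  using G_perm perm_At by blast

lemma glue:
  assumes f: "\<phi> \<in> el G" and g: "\<psi> \<in> el G" and p: "p \<in> el At" "ap \<phi> p = ap \<psi> p"
  shows "\<exists>\<chi>\<in>el G. \<forall>x\<in>el At. ap \<chi> x = (if lt p x then ap \<psi> x else ap \<phi> x)"
proof -
  define F where "F x = (if lt p x then ap \<psi> x else ap \<phi> x)" for x
  have T: "Tm (\<lambda>e. F (e 0))" unfolding F_def by (intro df) (use f g p el_U in blast)+
  have FA: "F x \<in> el At" if "x \<in> el At" for x using G_At f g that by (simp add: F_def)
  have mono: "lt (F x) (F y)" if xy: "x \<in> el At" "y \<in> el At" "lt x y" for x y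
  proof (cases "lt p x")
    case True
    then have "lt p y" using lt_trans[OF p(1) xy(1,2)] xy(3) by blast
    then show ?thesis using True G_lt[OF g xy(1,2)] xy(3) by (simp add: F_def)
  next
    case False
    show ?thesis
    proof (cases "lt p y")
      case True
      have 1: "lt (ap \<psi> p) (ap \<psi> y)" using G_lt[OF g p(1) xy(2)] True by blast
      have "x = p \<or> lt x p" using False lt_total[OF xy(1) p(1)] by blast
      then have "ap \<phi> x = ap \<psi> p \<or> lt (ap \<phi> x) (ap \<psi> p)" using G_lt[OF f xy(1) p(1)] p(2) by auto
      then have "lt (ap \<phi> x) (ap \<psi> y)"
        using 1 lt_trans[OF G_At[OF f xy(1)] G_At[OF g p(1)] G_At[OF g xy(2)]] by metis
      then show ?thesis using True False by (simp add: F_def)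
    next
      case F2: False
      then show ?thesis using False G_lt[OF f xy(1,2)] xy(3) by (simp add: F_def)
    qed
  qed
  have iff: "lt (F x) (F y) \<longleftrightarrow> lt x y" if xy: "x \<in> el At" "y \<in> el At" for x y
    using mono[OF xy] mono[OF xy(2,1)] lt_total[OF xy] lt_asym[OF FA[OF xy(1)] FA[OF xy(2)]] lt_irrefl[OF FA[OF xy(1)]] by metis
  have B: "bij_betw F (el At) (el At)"
    unfolding bij_betw_def
  proof (intro conjI inj_onI subset_antisym)
    show "x = y" if "x \<in> el At" "y \<in> el At" "F x = F y" for x y
      using lt_total[OF that(1,2)] mono[OF that(1,2)] mono[OF that(2,1)] lt_irrefl[OF FA[OF that(2)]] that(3) by metis
    show "F ` el At \<subseteq> el At" using FA by blast
    show "el At \<subseteq> F ` el At"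
    proof
      fix y assume y: "y \<in> el At"
      have "y \<in> ap \<phi> ` el At" "y \<in> ap \<psi> ` el At" using perm_bij[OF G_perm[OF f]] perm_bij[OF G_perm[OF g]] y
        unfolding bij_betw_def by simp_all
      \<comment> \<open>The preimages of \<open>y\<close> under the two maps lie on the same side of
        \<open>p\<close>, because the maps agree at \<open>p\<close>; so the glued map reaches
        \<open>y\<close> through one of them.\<close>
      then obtain u v where uv: "u \<in> el At" "y = ap \<phi> u" "v \<in> el At" "y = ap \<psi> v" by (elim imageE) (rule that)
      show "y \<in> F ` el At"
      proof (cases "lt p v")
        case True
        then have "y = F v" using uv by (simp add: F_def)
        then show ?thesis using uv(3) by (rule image_eqI)
      next
        case False
        have "\<not> lt p u"
        proof
          assume "lt p u"
          then have "lt (ap \<psi> p) (ap \<psi> v)" using G_lt[OF f p(1) uv(1)] p(2) uv(2,4) by simp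
          then show False using G_lt[OF g p(1) uv(3)] False by blast
        qed
        then have "y = F u" using uv by (simp add: F_def)
        then show ?thesis using uv(1) by (rule image_eqI)
      qed
    qed
  qed
  have "perm (gr F At)" "\<And>a. a \<in> el At \<Longrightarrow> ap (gr F At) a = F a" using perm_gr[OF T B] by blast+
  then have "gr F At \<in> el G" unfolding G_iff using iff by simp
  then show ?thesis using \<open>\<And>a. a \<in> el At \<Longrightarrow> ap (gr F At) a = F a\<close> unfolding F_def by blast
qed

text \<open>Four pieces are glued: the identity up to \<open>l\<close>, an automorphism taking l, a
  to l, c, one taking a, u to c, u, and the identity from \<open>u\<close> on.\<close>

lemma bump:
  assumes A: "l \<in> el At" "a \<in> el At" "c \<in> el At" "u \<in> el At" and o: "lt l a" "lt l c" "lt a u" "lt c u"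
  shows "\<exists>\<phi>\<in>el G. ap \<phi> a = c \<and> (\<forall>x\<in>el At. \<not> (lt l x \<and> lt x u) \<longrightarrow> ap \<phi> x = x)"
proof -
  obtain \<iota> where i: "\<iota> \<in> el G" "\<forall>a\<in>el At. ap \<iota> a = a" using G_id by blast
  obtain f where f: "f \<in> el G" "ap f l = l" "ap f a = c" using trans2[OF A(1,2,1,3) o(1,2)] by blast
  obtain g where g: "g \<in> el G" "ap g a = c" "ap g u = u" using trans2[OF A(2,4,3,4) o(3,4)] by blast
  have "ap \<iota> l = ap f l" using i(2) A(1) f(2) by simp
  from glue[OF i(1) f(1) A(1) this] obtain h1 where h1: "h1 \<in> el G"
    "\<forall>x\<in>el At. ap h1 x = (if lt l x then ap f x else ap \<iota> x)" by blast
  have "ap h1 a = ap g a" using h1(2) A(2) o(1) f(3) g(2) by simp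
  from glue[OF h1(1) g(1) A(2) this] obtain h2 where h2: "h2 \<in> el G"
    "\<forall>x\<in>el At. ap h2 x = (if lt a x then ap g x else ap h1 x)" by blast
  have "ap h2 u = ap \<iota> u" using h2(2) A(4) o(3) g(3) i(2) by simp
  from glue[OF h2(1) i(1) A(4) this] obtain h3 where h3: "h3 \<in> el G"
    "\<forall>x\<in>el At. ap h3 x = (if lt u x then ap \<iota> x else ap h2 x)" by blast
  have "ap h3 a = c"
    using h3(2) h2(2) h1(2) A(2) f(3) o(1) lt_asym[OF A(2,4) o(3)] lt_irrefl[OF A(2)] by simp
  moreover have "ap h3 x = x" if x: "x \<in> el At" and n: "\<not> (lt l x \<and> lt x u)" for x
  proof (cases "lt u x")
    case True then show ?thesis using h3(2) i(2) x by simp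
  next
    case F: False
    show ?thesis
    proof (cases "x = u")
      case True then show ?thesis using h3(2) h2(2) F x g(3) o(3) by simp
    next
      case False
      then have "\<not> lt l x" using n F lt_total[OF x A(4)] by blast
      moreover from this have "\<not> lt a x" using lt_trans[OF A(1,2) x o(1)] by blast
      ultimately show ?thesis using h3(2) h2(2) h1(2) i(2) x F by simp
    qed
  qed
  ultimately show ?thesis using h3(1) by blast
qed

lemma gap_above: assumes "kfin F" "a \<in> el At"
  shows "\<exists>u\<in>el At. lt a u \<and> (\<forall>x\<in>el F. x \<in> el At \<longrightarrow> lt a x \<longrightarrow> lt u x)"
  using assms(1)
proof (rule kfin_induct[where P="\<lambda>F. \<exists>u\<in>el At. lt a u \<and> (\<forall>x\<in>el F. x \<in> el At \<longrightarrow> lt a x \<longrightarrow> lt u x)"])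
  have aU: "a \<in> U" using assms(2) by (rule el_U)
  show "D (\<lambda>e. \<exists>u\<in>el At. lt a u \<and> (\<forall>x\<in>el (e 0). x \<in> el At \<longrightarrow> lt a x \<longrightarrow> lt u x))" by (intro df aU)
  show "\<exists>u\<in>el At. lt a u \<and> (\<forall>x\<in>el ze. x \<in> el At \<longrightarrow> lt a x \<longrightarrow> lt u x)" using no_top[OF assms(2)] by simp
  fix S b assume S: "kfin S" "b \<in> el F" "\<exists>u\<in>el At. lt a u \<and> (\<forall>x\<in>el S. x \<in> el At \<longrightarrow> lt a x \<longrightarrow> lt u x)"
  then obtain u where u: "u \<in> el At" "lt a u" "\<forall>x\<in>el S. x \<in> el At \<longrightarrow> lt a x \<longrightarrow> lt u x" by blast
  have e: "el (ins b S) = insert b (el S)" using el_ins[OF el_U[OF S(2)] kfin_U[OF S(1)]] .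
  show "\<exists>u\<in>el At. lt a u \<and> (\<forall>x\<in>el (ins b S). x \<in> el At \<longrightarrow> lt a x \<longrightarrow> lt u x)"
  proof (cases "b \<in> el At \<and> lt a b")
    case True
    \<comment> \<open>\<open>m\<close> is the smaller of \<open>u\<close> and \<open>b\<close>. A
      point strictly between \<open>a\<close> and \<open>m\<close> is taken, since the bound has to
      be strict at \<open>b\<close> as well.\<close>
    have "\<exists>m\<in>el At. lt a m \<and> (m = u \<or> lt m u) \<and> (m = b \<or> lt m b)"
      using lt_total[OF u(1), of b] True u(1,2) by blast
    then obtain m where m: "m \<in> el At" "lt a m" "m = u \<or> lt m u" "m = b \<or> lt m b" by blast
    obtain v where v: "v \<in> el At" "lt a v" "lt v m" using dense[OF assms(2) m(1,2)] by blast
    have vu: "lt v u" and vb: "lt v b" using v m lt_trans u(1) True by blast+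
    have "lt v x" if "x \<in> el (ins b S)" "x \<in> el At" "lt a x" for x
    proof (cases "x = b")
      case False
      then have "lt u x" using that u(3) e by blast
      then show ?thesis using lt_trans[OF v(1) u(1) that(2) vu] by blast
    qed (use vb in simp)
    then show ?thesis using v by blast
  next
    case False
    then show ?thesis using u e by (intro bexI[of _ u]) auto
  qed
qed

lemma gap_below: assumes "kfin F" "a \<in> el At"
  shows "\<exists>u\<in>el At. lt u a \<and> (\<forall>x\<in>el F. x \<in> el At \<longrightarrow> lt x a \<longrightarrow> lt x u)"
  using assms(1)
proof (rule kfin_induct[where P="\<lambda>F. \<exists>u\<in>el At. lt u a \<and> (\<forall>x\<in>el F. x \<in> el At \<longrightarrow> lt x a \<longrightarrow> lt x u)"])
  have aU: "a \<in> U" using assms(2) by (rule el_U)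
  show "D (\<lambda>e. \<exists>u\<in>el At. lt u a \<and> (\<forall>x\<in>el (e 0). x \<in> el At \<longrightarrow> lt x a \<longrightarrow> lt x u))" by (intro df aU)
  show "\<exists>u\<in>el At. lt u a \<and> (\<forall>x\<in>el ze. x \<in> el At \<longrightarrow> lt x a \<longrightarrow> lt x u)" using no_bot[OF assms(2)] by simp
  fix S b assume S: "kfin S" "b \<in> el F" "\<exists>u\<in>el At. lt u a \<and> (\<forall>x\<in>el S. x \<in> el At \<longrightarrow> lt x a \<longrightarrow> lt x u)"
  then obtain u where u: "u \<in> el At" "lt u a" "\<forall>x\<in>el S. x \<in> el At \<longrightarrow> lt x a \<longrightarrow> lt x u" by blast
  have e: "el (ins b S) = insert b (el S)" using el_ins[OF el_U[OF S(2)] kfin_U[OF S(1)]] .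
  show "\<exists>u\<in>el At. lt u a \<and> (\<forall>x\<in>el (ins b S). x \<in> el At \<longrightarrow> lt x a \<longrightarrow> lt x u)"
  proof (cases "b \<in> el At \<and> lt b a")
    case True
    have "\<exists>m\<in>el At. lt m a \<and> (m = u \<or> lt u m) \<and> (m = b \<or> lt b m)"
      using lt_total[OF u(1), of b] True u(1,2) by blast
    then obtain m where m: "m \<in> el At" "lt m a" "m = u \<or> lt u m" "m = b \<or> lt b m" by blast
    obtain v where v: "v \<in> el At" "lt m v" "lt v a" using dense[OF m(1) assms(2) m(2)] by blast
    have vu: "lt u v" and vb: "lt b v" using v m lt_trans u(1) True by blast+
    have "lt x v" if "x \<in> el (ins b S)" "x \<in> el At" "lt x a" for x
    proof (cases "x = b")
      case False
      then have "lt x u" using that u(3) e by blast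
      then show ?thesis using lt_trans[OF that(2) u(1) v(1) _ vu] by blast
    qed (use vb in simp)
    then show ?thesis using v by blast
  next
    case False
    then show ?thesis using u e by (intro bexI[of _ u]) auto
  qed
qed

text \<open>Describes the orbits of \<open>fx E\<close> on the atoms for a finite set
  \<open>E\<close> of atoms: by \<open>same_cut_fx\<close> and \<open>move\<close>, two atoms
  satisfy it exactly when some member of \<open>fx E\<close> takes one to the other.\<close>

definition same_cut :: "'a \<Rightarrow> 'a \<Rightarrow> 'a \<Rightarrow> bool" where
  "same_cut E a c \<longleftrightarrow> (\<forall>e\<in>el E. (lt e a \<longleftrightarrow> lt e c) \<and> (lt a e \<longleftrightarrow> lt c e))"

lemma same_cut_sym: "same_cut E a c \<Longrightarrow> same_cut E c a" and same_cut_trans: "same_cut E a b \<Longrightarrow> same_cut E b c \<Longrightarrow> same_cut E a c"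
  unfolding same_cut_def by blast+

lemma same_cut_fx: assumes "fs E" "\<phi> \<in> fx E" "a \<in> el At" shows "same_cut E a (ap \<phi> a)"
  unfolding same_cut_def
proof
  fix t assume t: "t \<in> el E"
  have tA: "t \<in> el At" using t assms(1) unfolding fs_def by blast
  have "ap \<phi> t = t" using t assms(2) unfolding fx_def by blast
  then show "(lt t a \<longleftrightarrow> lt t (ap \<phi> a)) \<and> (lt a t \<longleftrightarrow> lt (ap \<phi> a) t)"
    using G_lt[OF fx_G[OF assms(2)] tA assms(3)] G_lt[OF fx_G[OF assms(2)] assms(3) tA] by simp
qed

lemma move_up: assumes E: "fs E" and A: "a \<in> el At" "c \<in> el At" "lt a c" and s: "same_cut E a c"
  shows "\<exists>\<phi>\<in>fx E. ap \<phi> a = c"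
proof -
  have kE: "kfin E" using E by (simp add: fs_def)
  \<comment> \<open>Between \<open>l\<close> and \<open>u\<close> there is no element of
    \<open>E\<close>: none near either end by the choice of the gaps, and none from \<open>a\<close>
    to \<open>c\<close> because these two make the same cut. So \<open>bump\<close> applied there
    fixes \<open>E\<close>.\<close>
  obtain u where u: "u \<in> el At" "lt c u" "\<forall>x\<in>el E. x \<in> el At \<longrightarrow> lt c x \<longrightarrow> lt u x" using gap_above[OF kE A(2)] by blast
  obtain l where l: "l \<in> el At" "lt l a" "\<forall>x\<in>el E. x \<in> el At \<longrightarrow> lt x a \<longrightarrow> lt x l" using gap_below[OF kE A(1)] by blast
  obtain \<phi> where p: "\<phi> \<in> el G" "ap \<phi> a = c" "\<forall>x\<in>el At. \<not> (lt l x \<and> lt x u) \<longrightarrow> ap \<phi> x = x"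
    using bump[OF l(1) A(1,2) u(1) l(2) _ _ u(2)] lt_trans[OF l(1) A(1,2) l(2) A(3)] lt_trans[OF A(1,2) u(1) A(3) u(2)] by blast
  have "ap \<phi> t = t" if t: "t \<in> el E" for t
  proof -
    have tA: "t \<in> el At" using t E unfolding fs_def by blast
    have "\<not> (lt l t \<and> lt t u)"
    proof
      assume h: "lt l t \<and> lt t u"
      have "\<not> lt t a" using l(3) t tA h lt_asym[OF l(1) tA] by blast
      moreover have "\<not> lt c t" using u(3) t tA h lt_asym[OF u(1) tA] by blast
      ultimately show False using s t lt_total[OF tA A(1)] lt_total[OF tA A(2)] A(3) lt_irrefl[OF A(1)] unfolding same_cut_def by metis
    qed
    then show ?thesis using p(3) tA by blast
  qed
  then have "\<phi> \<in> fx E" using p(1) unfolding fx_def by blast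
  then show ?thesis using p(2) by blast
qed

lemma move: assumes E: "fs E" and A: "a \<in> el At" "c \<in> el At" and s: "same_cut E a c"
  shows "\<exists>\<phi>\<in>fx E. ap \<phi> a = c"
proof -
  consider "a = c" | "lt a c" | "lt c a" using lt_total[OF A] by blast
  then show ?thesis
  proof cases
    case 1
    have "el E \<subseteq> el At" using E by (simp add: fs_def)
    then obtain \<iota> where i: "\<iota> \<in> fx E" "\<And>x. x \<in> U \<Longrightarrow> pe \<iota> x = x" using fx_id by metis
    then show ?thesis using 1 fx_ap[OF i(1) A(1)] i(2)[OF el_U[OF A(1)]] by auto
  next
    case 2 then show ?thesis using move_up[OF E A _ s] by blast
  next
    case 3
    then obtain \<phi> where p: "\<phi> \<in> fx E" "ap \<phi> c = a" using move_up[OF E A(2,1) _ same_cut_sym[OF s]] by blast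
    have "el E \<subseteq> el At" using E by (simp add: fs_def)
    then obtain \<psi> where "\<psi> \<in> fx E" "\<And>a. a \<in> el At \<Longrightarrow> ap \<psi> (ap \<phi> a) = a" using fx_inv[OF p(1)] by metis
    then show ?thesis using p(2) A(2) by metis
  qed
qed

text \<open>Stated for a relation \<open>L\<close> so that it covers the order and its converse,
  that is \<theta> a above or below \<open>a\<close>. Read \<open>L\<close> as <. If a < c, then
  \<open>a\<close> is moved to some \<open>d\<close> between \<open>a\<close> and \<open>b\<close>
  while \<open>b\<close> stays fixed, and then \<open>d\<close> to \<open>c\<close> while
  \<open>a\<close> stays fixed. Otherwise c \<le> a < b, and \<open>a\<close> is moved to
  \<open>c\<close> directly with \<open>b\<close> fixed.\<close>

lemma two_moves:
  assumes L: "\<And>a b c. a \<in> el At \<Longrightarrow> b \<in> el At \<Longrightarrow> c \<in> el At \<Longrightarrow> L a b \<Longrightarrow> L b c \<Longrightarrow> L a c"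
    "\<And>a. a \<in> el At \<Longrightarrow> \<not> L a a"
    "\<And>a b. a \<in> el At \<Longrightarrow> b \<in> el At \<Longrightarrow> a \<noteq> b \<Longrightarrow> L a b \<or> L b a"
    "\<And>a b. a \<in> el At \<Longrightarrow> b \<in> el At \<Longrightarrow> L a b \<Longrightarrow> \<exists>c\<in>el At. L a c \<and> L c b"
    and sc: "\<And>E x y. same_cut E x y \<longleftrightarrow> (\<forall>e\<in>el E. (L e x \<longleftrightarrow> L e y) \<and> (L x e \<longleftrightarrow> L y e))"
    and E: "fs E" and A: "a \<in> el At" "a \<notin> el E" "b \<in> el At" "c \<in> el At" and ab: "L a b"
    and s: "same_cut E a b" "same_cut E a c"
  shows "\<exists>\<sigma>\<in>fx (ins b E). \<exists>\<tau>\<in>fx (ins a E). c = ap \<tau> (ap \<sigma> a)"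
proof -
  have fa: "fs (ins a E)" and fb: "fs (ins b E)" using fs_ins E A by blast+
  have ea: "el (ins a E) = insert a (el E)" and eb: "el (ins b E) = insert b (el E)" using el_insf E A by blast+
  have asym: "\<not> L y x" if "x \<in> el At" "y \<in> el At" "L x y" for x y using L(1,2) that by blast
  have "\<exists>d\<in>el At. same_cut (ins b E) a d \<and> same_cut (ins a E) d c"
  proof (cases "L a c")
    case True
    obtain d where d: "d \<in> el At" "L a d" "L d b" using L(4)[OF A(1,3) ab] by blast
    have sd: "same_cut E a d" unfolding sc
    proof
      fix t assume t: "t \<in> el E"
      have tA: "t \<in> el At" using t E unfolding fs_def by blast
      have "(L t a \<longleftrightarrow> L t b) \<and> (L a t \<longleftrightarrow> L b t)" using s(1) t unfolding sc by blast
      then show "(L t a \<longleftrightarrow> L t d) \<and> (L a t \<longleftrightarrow> L d t)"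
        using d L(1) A(1,3) tA by meson
    qed
    have "same_cut (ins b E) a d" using sd ab d asym A unfolding sc eb by blast
    moreover have "same_cut (ins a E) d c"
      using same_cut_trans[OF same_cut_sym[OF sd] s(2)] d True asym A unfolding sc ea by blast
    ultimately show ?thesis using d(1) by blast
  next
    case False
    have cb: "L c b" using False L(1)[OF A(1,3,4) ab] L(3)[OF A(3,4)] ab by blast
    have "same_cut (ins b E) a c" using s(2) ab cb asym A unfolding sc eb by blast
    moreover have "same_cut (ins a E) c c" unfolding same_cut_def by blast
    ultimately show ?thesis using A(4) by blast
  qed
  then obtain d where d: "d \<in> el At" "same_cut (ins b E) a d" "same_cut (ins a E) d c" by blast
  then show ?thesis using move[OF fb A(1) d(1,2)] move[OF fa d(1) A(4) d(3)] by metis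
qed

text \<open>\<open>b\<close> is moved to \<open>c\<close> first. The image of \<open>b'\<close> then
  lies above \<open>c\<close>, as \<open>c'\<close> does, so the second move can be made over
  \<open>ins c E\<close>.\<close>

lemma homogeneous2:
  assumes E: "fs E" and A: "b \<in> el At" "b' \<in> el At" "c \<in> el At" "c' \<in> el At" and o: "lt b b'" "lt c c'"
    and s: "same_cut E b c" "same_cut E b' c'"
  shows "\<exists>\<chi>\<in>fx E. ap \<chi> b = c \<and> ap \<chi> b' = c'"
proof -
  obtain \<rho> where r: "\<rho> \<in> fx E" "ap \<rho> b = c" using move[OF E A(1,3) s(1)] by blast
  let ?d = "ap \<rho> b'"
  have d: "?d \<in> el At" using fx_At[OF r(1) A(2)] .
  have cd: "lt c ?d" using G_lt[OF fx_G[OF r(1)] A(1,2)] o(1) r(2) by simp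
  have "same_cut E ?d c'" using same_cut_trans[OF same_cut_sym[OF same_cut_fx[OF E r(1) A(2)]] s(2)] .
  then have "same_cut (ins c E) ?d c'"
    using cd o(2) lt_asym[OF A(3) d] lt_asym[OF A(3,4)] unfolding same_cut_def el_insf[OF E A(3)] by blast
  then obtain \<kappa> where k: "\<kappa> \<in> fx (ins c E)" "ap \<kappa> ?d = c'" using move[OF fs_ins[OF E A(3)] d A(4)] by blast
  obtain \<chi> where x: "\<chi> \<in> el G" "\<And>a. a \<in> el At \<Longrightarrow> ap \<chi> a = ap \<kappa> (ap \<rho> a)" using fx_comp[OF k(1) r(1)] by metis
  have kE: "ap \<kappa> t = t" if "t \<in> insert c (el E)" for t using k(1) that unfolding fx_def el_insf[OF E A(3)] by blast
  have "ap \<chi> t = t" if t: "t \<in> el E" for t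
  proof -
    have "t \<in> el At" using t E unfolding fs_def by blast
    moreover have "ap \<rho> t = t" using r(1) t unfolding fx_def by blast
    ultimately show ?thesis using x(2)[of t] kE[of t] t by simp
  qed
  then have "\<chi> \<in> fx E" using x(1) unfolding fx_def by blast
  moreover have "ap \<chi> b = c" using x(2)[OF A(1)] r(2) kE[of c] by simp
  moreover have "ap \<chi> b' = c'" using x(2)[OF A(2)] k(2) by simp
  ultimately show ?thesis by blast
qed

lemma rational_order_homogeneous: assumes AC: "AC M" shows "homogeneous_group M G \<Gamma>"
proof unfold_locales
  show "AC M" by (rule AC)
  show "\<exists>a\<in>el At. a \<notin> el F" if F: "kfin F" for F
  proof -
    obtain a where a: "a \<in> el At" using nonempty by blast
    obtain u where "u \<in> el At" "lt a u" "\<forall>x\<in>el F. x \<in> el At \<longrightarrow> lt a x \<longrightarrow> lt u x" using gap_above[OF F a] by blast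
    then show ?thesis using lt_irrefl by blast
  qed
next
  fix E a \<theta> \<pi> assume h: "fs E" "a \<in> el At" "a \<notin> el E" "\<theta> \<in> fx E" "\<pi> \<in> fx E" "ap \<theta> a \<noteq> a"
  let ?b = "ap \<theta> a" and ?c = "ap \<pi> a"
  have A: "?b \<in> el At" "?c \<in> el At" using fx_At h by blast+
  have s: "same_cut E a ?b" "same_cut E a ?c" using same_cut_fx h by blast+
  show "\<exists>\<sigma>\<in>fx (ins ?b E). \<exists>\<tau>\<in>fx (ins a E). ?c = ap \<tau> (ap \<sigma> a)"
  proof (cases "lt a ?b")
    case True
    show ?thesis
    proof (rule two_moves[where L=lt])
      show "lt a c" if "a \<in> el At" "b \<in> el At" "c \<in> el At" "lt a b" "lt b c" for a b c using lt_trans[OF that] .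
      show "\<exists>c\<in>el At. lt a c \<and> lt c b" if "a \<in> el At" "b \<in> el At" "lt a b" for a b using dense[OF that] .
      show "same_cut E x y \<longleftrightarrow> (\<forall>e\<in>el E. (lt e x \<longleftrightarrow> lt e y) \<and> (lt x e \<longleftrightarrow> lt y e))" for E x y by (rule same_cut_def)
    qed (use lt_irrefl lt_total in blast, use lt_total in blast, (rule h A True s)+)
  next
    case False
    then have ba: "lt ?b a" using lt_total[OF h(2) A(1) h(6)[symmetric]] by blast
    show ?thesis
    proof (rule two_moves[where L="\<lambda>x y. lt y x"])
      show "lt c a" if "a \<in> el At" "b \<in> el At" "c \<in> el At" "lt b a" "lt c b" for a b c
        using lt_trans[OF that(3,2,1,5,4)] .
      show "lt b a \<or> lt a b" if "a \<in> el At" "b \<in> el At" "a \<noteq> b" for a b using lt_total[OF that] by blast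
      show "\<exists>c\<in>el At. lt c a \<and> lt b c" if "a \<in> el At" "b \<in> el At" "lt b a" for a b using dense[OF that(2,1,3)] by blast
      show "same_cut E x y \<longleftrightarrow> (\<forall>e\<in>el E. (lt x e \<longleftrightarrow> lt y e) \<and> (lt e x \<longleftrightarrow> lt e y))" for E x y
        unfolding same_cut_def by blast
    qed (use lt_irrefl in blast, (rule h A ba s)+)
  qed
next
  fix E a \<phi> \<phi>' \<psi> \<psi>' assume h: "fs E" "a \<in> el At" "a \<notin> el E" "\<phi> \<in> fx E" "\<phi>' \<in> fx E" "\<psi> \<in> fx E" "\<psi>' \<in> fx E"
    "ap \<phi> a \<noteq> ap \<phi>' a" "ap \<psi> a \<noteq> ap \<psi>' a"
  let ?b = "ap \<phi> a" and ?b' = "ap \<phi>' a" and ?c = "ap \<psi> a" and ?c' = "ap \<psi>' a"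
  have A: "?b \<in> el At" "?b' \<in> el At" "?c \<in> el At" "?c' \<in> el At" using fx_At h by blast+
  have s: "same_cut E a ?b" "same_cut E a ?b'" "same_cut E a ?c" "same_cut E a ?c'" using same_cut_fx h by blast+
  have ss: "same_cut E x y" if "same_cut E a x" "same_cut E a y" for x y using same_cut_trans[OF same_cut_sym[OF that(1)] that(2)] .
  note hom = homogeneous2[OF h(1)]
  \<comment> \<open>An automorphism preserves the order, so the smaller atom must go to the smaller
    one; this is why \<open>H2\<close> permits a crossed matching.\<close>
  from lt_total[OF A(1,2) h(8)] lt_total[OF A(3,4) h(9)]
  show "\<exists>\<chi>\<in>fx E. (ap \<chi> ?b = ?c \<and> ap \<chi> ?b' = ?c') \<or> (ap \<chi> ?b = ?c' \<and> ap \<chi> ?b' = ?c)"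
  proof (elim disjE)
    assume "lt ?b ?b'" "lt ?c ?c'"
    from hom[OF A(1,2,3,4) this ss[OF s(1,3)] ss[OF s(2,4)]] show ?thesis by blast
  next
    assume "lt ?b ?b'" "lt ?c' ?c"
    from hom[OF A(1,2,4,3) this ss[OF s(1,4)] ss[OF s(2,3)]] show ?thesis by blast
  next
    assume "lt ?b' ?b" "lt ?c ?c'"
    from hom[OF A(2,1,3,4) this ss[OF s(2,3)] ss[OF s(1,4)]] show ?thesis by blast
  next
    assume "lt ?b' ?b" "lt ?c' ?c"
    from hom[OF A(2,1,4,3) this ss[OF s(2,4)] ss[OF s(1,3)]] show ?thesis by blast
  qed
next
  fix E a F assume h: "fs E" "a \<in> el At" "a \<notin> el E" "kfin F"
  have k: "kfin (un E F)" using h kfin_un unfolding fs_def by blast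
  have e: "el (un E F) = el E \<union> el F" using el_un[OF fs_U[OF h(1)] kfin_U[OF h(4)]] .
  \<comment> \<open>An atom above \<open>a\<close> and below all larger elements of \<open>E\<close>
    and \<open>F\<close>: it makes the same cut of \<open>E\<close> as \<open>a\<close> does and
    avoids \<open>F\<close>.\<close>
  obtain u where u: "u \<in> el At" "lt a u" "\<forall>x\<in>el (un E F). x \<in> el At \<longrightarrow> lt a x \<longrightarrow> lt u x"
    using gap_above[OF k h(2)] by blast
  have uF: "u \<notin> el F" using u e lt_irrefl by blast
  have "same_cut E a u" unfolding same_cut_def
  proof
    fix t assume t: "t \<in> el E"
    have tA: "t \<in> el At" using t h(1) unfolding fs_def by blast
    have "t \<noteq> a" using t h(3) by blast
    then show "(lt t a \<longleftrightarrow> lt t u) \<and> (lt a t \<longleftrightarrow> lt u t)"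
      using u e t tA lt_total[OF tA h(2)] lt_trans[OF tA h(2) u(1)] lt_trans[OF h(2) u(1) tA] lt_asym[OF tA u(1)] lt_asym[OF tA h(2)] by blast
  qed
  then show "\<exists>\<phi>\<in>fx E. ap \<phi> a \<notin> el F" using move[OF h(1,2) u(1)] uF by blast
qed

end

section \<open>The ordered Mostowski model\<close>

context zfa begin

abbreviation fr :: "('m \<times> 'm \<times> 'm) set" where "fr \<equiv> fracs M"
abbreviation fle :: "'m \<times> 'm \<times> 'm \<Rightarrow> 'm \<times> 'm \<times> 'm \<Rightarrow> bool" where "fle \<equiv> frac_le M"

section \<open>The preorder of fractions\<close>

lemma fr_iff: "(x, y, z) \<in> fr \<longleftrightarrow> x \<in> el om \<and> y \<in> el om \<and> z \<in> el om \<and> z \<noteq> ze"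
  by (simp add: fracs_def zero_eq)

lemma fle_iff: assumes "(a, b, c) \<in> fr" "(a', b', c') \<in> fr"
  shows "fle (a, b, c) (a', b', c') \<longleftrightarrow> le (pl (ts a c') (ts b' c)) (pl (ts a' c) (ts b c'))"
  using assms by (simp add: fr_iff nat_add_eq nat_mult_eq nat_le_iff)

lemma feq_iff: assumes "(a, b, c) \<in> fr" "(a', b', c') \<in> fr"
  shows "frac_eq M (a, b, c) (a', b', c') \<longleftrightarrow> pl (ts a c') (ts b' c) = pl (ts a' c) (ts b c')"
  using assms by (simp add: fr_iff nat_add_eq nat_mult_eq)

lemma feq_fle: assumes "u \<in> fr" "v \<in> fr" shows "frac_eq M u v \<longleftrightarrow> fle u v \<and> fle v u"
proof -
  obtain a b c a' b' c' where e: "u = (a, b, c)" "v = (a', b', c')" by (cases u, cases v) blast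
  have o: "(a, b, c) \<in> fr" "(a', b', c') \<in> fr" using assms e by simp_all
  have 2: "pl (ts a' c) (ts b c') = pl (ts b c') (ts a' c)" "pl (ts a c') (ts b' c) = pl (ts b' c) (ts a c')"
    using o by (simp_all add: fr_iff pl_comm)
  show ?thesis unfolding e feq_iff[OF o] fle_iff[OF o] fle_iff[OF o(2,1)] using le_antisym 2 le_refl by metis
qed

lemma fle_refl: "u \<in> fr \<Longrightarrow> fle u u"
  using feq_fle[of u u] by (cases u) simp

lemma fle_total: assumes "u \<in> fr" "v \<in> fr" shows "fle u v \<or> fle v u"
proof -
  obtain a b c a' b' c' where e: "u = (a, b, c)" "v = (a', b', c')" by (cases u, cases v) blast
  have o: "(a, b, c) \<in> fr" "(a', b', c') \<in> fr" using assms e by simp_all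
  show ?thesis unfolding e fle_iff[OF o] fle_iff[OF o(2,1)] by (rule le_total) (use o in \<open>simp_all add: fr_iff\<close>)
qed

lemma le_pl_mono2: assumes "m \<in> el om" "n \<in> el om" "m' \<in> el om" "n' \<in> el om" "le m n" "le m' n'"
  shows "le (pl m m') (pl n n')"
proof -
  have "le (pl m m') (pl n m')" using le_pl_mono assms by blast
  moreover have "le (pl n m') (pl n n')" using le_pl_mono[OF assms(3,4,2,6)] assms by (simp add: pl_comm)
  ultimately show ?thesis using le_trans[of "pl n n'"] assms by simp
qed

lemma le_affine: assumes "m \<in> el om" "n \<in> el om" "k \<in> el om" "K \<in> el om" "k \<noteq> ze"
  shows "le (pl (ts m k) K) (pl (ts n k) K) \<longleftrightarrow> le m n"
  using le_pl_cancel[of "ts m k" "ts n k" K] le_ts_cancel[of m n k] assms by simp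

lemma fle_trans: assumes "u \<in> fr" "v \<in> fr" "w \<in> fr" "fle u v" "fle v w" shows "fle u w"
proof -
  obtain a b c a' b' c' p q r where e: "u = (a, b, c)" "v = (a', b', c')" "w = (p, q, r)" by (cases u, cases v, cases w) blast
  have o: "(a, b, c) \<in> fr" "(a', b', c') \<in> fr" "(p, q, r) \<in> fr" using assms e by simp_all
  note o' = o[unfolded fr_iff]
  \<comment> \<open>The inequalities are multiplied by \<open>r\<close> and \<open>c\<close> and
    then added. Both sides of the sum share the summand \<open>?K\<close> and the factor
    \<open>c'\<close>, which \<open>le_affine\<close> cancels.\<close>
  have 1: "le (ts (pl (ts a c') (ts b' c)) r) (ts (pl (ts a' c) (ts b c')) r)"
    using assms(4) unfolding e fle_iff[OF o(1,2)] by (intro le_ts_mono) (use o' in simp_all)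
  have 2: "le (ts (pl (ts a' r) (ts q c')) c) (ts (pl (ts p c') (ts b' r)) c)"
    using assms(5) unfolding e fle_iff[OF o(2,3)] by (intro le_ts_mono) (use o' in simp_all)
  let ?K = "pl (ts b' (ts c r)) (ts a' (ts c r))"
  have "le (pl (ts (pl (ts a c') (ts b' c)) r) (ts (pl (ts a' r) (ts q c')) c))
    (pl (ts (pl (ts a' c) (ts b c')) r) (ts (pl (ts p c') (ts b' r)) c))"
    by (rule le_pl_mono2[OF _ _ _ _ 1 2]) (use o' in simp_all)
  moreover have "pl (ts (pl (ts a c') (ts b' c)) r) (ts (pl (ts a' r) (ts q c')) c) = pl (ts (pl (ts a r) (ts q c)) c') ?K"
    using o' by (simp add: arith_om)
  moreover have "pl (ts (pl (ts a' c) (ts b c')) r) (ts (pl (ts p c') (ts b' r)) c) = pl (ts (pl (ts p c) (ts b r)) c') ?K"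
    using o' by (simp add: arith_om)
  ultimately show ?thesis
    unfolding e fle_iff[OF o(1,3)] using le_affine[of "pl (ts a r) (ts q c)" "pl (ts p c) (ts b r)" c' ?K] o' by simp
qed

lemma feq_I: assumes "(a, b, c) \<in> fr" "(a', b', c') \<in> fr" "pl (ts a c') (ts b' c) = pl (ts a' c) (ts b c')"
  shows "fle (a, b, c) (a', b', c')" "fle (a', b', c') (a, b, c)"
  using feq_fle[OF assms(1,2)] feq_iff[OF assms(1,2)] assms(3) by simp_all

section \<open>Rational numbers as classes of fractions\<close>

definition tr :: "'m \<times> 'm \<times> 'm \<Rightarrow> 'm" where "tr u = (case u of (x, y, z) \<Rightarrow> pr (pr x y) z)"

lemma tr_inj: "u \<in> fr \<Longrightarrow> v \<in> fr \<Longrightarrow> tr u = tr v \<Longrightarrow> u = v"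
  by (cases u, cases v) (simp add: tr_def fr_iff pr_eq_iff)

lemma is_triple_iff: "v \<in> fr \<Longrightarrow> is_triple M t v \<longleftrightarrow> t = tr v"
  by (cases v) (auto simp: tr_def fr_iff is_opair_iff)

lemma tr_U [simp]: "tr u \<in> U" by (cases u) (simp add: tr_def)

definition cls :: "'m \<times> 'm \<times> 'm \<Rightarrow> 'm set" where "cls u = {t. \<exists>v\<in>fr. frac_eq M u v \<and> t = tr v}"

lemma cls_eq: "cls u = {t \<in> U. \<exists>v\<in>fr. frac_eq M u v \<and> is_triple M t v}"
  unfolding cls_def using is_triple_iff by auto

lemma pr_in_prd: "X \<in> U \<Longrightarrow> Y \<in> U \<Longrightarrow> x \<in> el X \<Longrightarrow> y \<in> el Y \<Longrightarrow> pr x y \<in> el (prd X Y)"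
  using el_prd by blast

lemma small_cls: assumes "u \<in> fr" shows "small (cls u)"
proof -
  obtain a b c where e: "u = (a, b, c)" by (cases u) blast
  have o: "(a, b, c) \<in> fr" using assms e by simp
  \<comment> \<open>Triples of HOL are not terms of the calculus. To see that the class is a set of
    \<open>M\<close>, it is rewritten as a subset of (\<omega> \<times> \<omega>) \<times> \<omega>
    given by an equation between numbers.\<close>
  let ?S = "{t \<in> el (prd (prd om om) om). \<exists>x\<in>el om. \<exists>y\<in>el om. \<exists>z\<in>el om. z \<noteq> ze \<and>
    pl (ts a z) (ts y c) = pl (ts x c) (ts b z) \<and> t = pr (pr x y) z}"
  have "small ?S" by (intro small_Collect small_el df) (use o in \<open>simp_all add: fr_iff\<close>)
  moreover have "cls u = ?S"
  proof (intro set_eqI iffI)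
    fix t assume "t \<in> cls u"
    then obtain v where v: "v \<in> fr" "frac_eq M u v" "t = tr v" unfolding cls_def by blast
    obtain x y z where xyz: "v = (x, y, z)" by (cases v) blast
    have f: "(x, y, z) \<in> fr" using v(1) xyz by simp
    have "pl (ts a z) (ts y c) = pl (ts x c) (ts b z)" using v(2) unfolding e xyz feq_iff[OF o f] .
    moreover have t: "t = pr (pr x y) z" using v(3) xyz by (simp add: tr_def)
    moreover have "t \<in> el (prd (prd om om) om)" unfolding t using f unfolding fr_iff by (intro pr_in_prd prd_U om_U) blast+
    ultimately show "t \<in> ?S" using f unfolding fr_iff by blast
  next
    fix t assume "t \<in> ?S"
    then obtain x y z where h: "x \<in> el om" "y \<in> el om" "z \<in> el om" "z \<noteq> ze"
      "pl (ts a z) (ts y c) = pl (ts x c) (ts b z)" "t = pr (pr x y) z" by blast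
    have f: "(x, y, z) \<in> fr" using h by (simp add: fr_iff)
    have "frac_eq M u (x, y, z)" unfolding e feq_iff[OF o f] by (rule h)
    moreover have "t = tr (x, y, z)" using h(6) by (simp add: tr_def)
    ultimately show "t \<in> cls u" unfolding cls_def using f by blast
  qed
  ultimately show ?thesis by simp
qed

lemma is_rat_of_iff: "is_rat_of M q u \<longleftrightarrow> u \<in> fr \<and> q = mk (cls u)"
  unfolding is_rat_of_def cls_eq[symmetric] using eq_mk_small[OF small_cls] by metis

lemma cls_eq_iff: assumes "u \<in> fr" "v \<in> fr" shows "mk (cls u) = mk (cls v) \<longleftrightarrow> fle u v \<and> fle v u"
proof
  assume "mk (cls u) = mk (cls v)"
  then have "cls u = cls v" using mk_inj small_cls assms by blast
  moreover have "tr v \<in> cls v" unfolding cls_def using assms(2) fle_refl[OF assms(2)] feq_fle[OF assms(2) assms(2)] by blast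
  ultimately have "tr v \<in> cls u" by simp
  then obtain w where w: "w \<in> fr" "frac_eq M u w" "tr v = tr w" unfolding cls_def by blast
  have "v = w" using tr_inj[OF assms(2) w(1,3)] .
  then show "fle u v \<and> fle v u" using w(2) feq_fle[OF assms] by simp
next
  assume h: "fle u v \<and> fle v u"
  have "frac_eq M u w \<longleftrightarrow> frac_eq M v w" if w: "w \<in> fr" for w
    unfolding feq_fle[OF assms(1) w] feq_fle[OF assms(2) w]
    using h fle_trans[OF assms(1,2) w] fle_trans[OF assms(2,1) w] fle_trans[OF w assms] fle_trans[OF w assms(2,1)] by blast
  then have "cls u = cls v" unfolding cls_def by blast
  then show "mk (cls u) = mk (cls v)" by simp
qed

end

section \<open>Atoms indexed by fractions\<close>

locale rational_atoms = zfa M for M :: "'m struct" +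
  fixes R Q f :: 'm
  assumes R: "is_set M R" and Q: "is_rationals M Q" and f: "is_bijection M f (atoms M) Q"
    and Rf: "\<And>a b. a \<in> elts M (atoms M) \<Longrightarrow> b \<in> elts M (atoms M) \<Longrightarrow>
      rel M R a b \<longleftrightarrow> rat_le M (app M f a) (app M f b)"
begin

lemma f_fun: "is_function_on M f At" and f_bij: "bij_betw (ap f) (el At) (el Q)" and f_U: "f \<in> U"
  using f fun_U unfolding is_bijection_iff by blast+

lemma el_Q: "q \<in> el Q \<longleftrightarrow> (\<exists>u\<in>fr. q = mk (cls u))"
  using Q unfolding is_rationals_def is_rat_of_iff by blast

text \<open>The atom at the place (x - y) / z: the one whose image under \<open>f\<close>, a class
  of triples, contains this triple. In this form it is a definable operation on three
  numbers.\<close>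

definition at :: "'m \<Rightarrow> 'm \<Rightarrow> 'm \<Rightarrow> 'm" where
  "at x y z = tot (\<lambda>a. a \<in> el At \<and> pr (pr x y) z \<in> el (ap f a))"

lemma Tm_at [df]: "Tm t \<Longrightarrow> Tm u \<Longrightarrow> Tm v \<Longrightarrow> Tm (\<lambda>e. at (t e) (u e) (v e))"
proof (rule Tm_lift3[where f=at])
  show "Tm (\<lambda>e. at (e 0) (e (Suc 0)) (e (Suc (Suc 0))))" unfolding at_def by (intro df f_U At_U)
qed

definition att :: "'m \<times> 'm \<times> 'm \<Rightarrow> 'm" where "att u = (case u of (x, y, z) \<Rightarrow> at x y z)"

lemma att: assumes "u \<in> fr" shows "att u \<in> el At \<and> ap f (att u) = mk (cls u)"
proof -
  have "mk (cls u) \<in> ap f ` el At" using el_Q assms f_bij unfolding bij_betw_def by blast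
  then obtain a where a: "mk (cls u) = ap f a" "a \<in> el At" by (rule imageE)
  have tu: "tr u \<in> cls u" unfolding cls_def using assms fle_refl[OF assms] feq_fle[OF assms assms] by blast
  have "att u = tot (\<lambda>a. a \<in> el At \<and> tr u \<in> el (ap f a))"
    by (cases u) (simp add: att_def at_def tr_def)
  also have "\<dots> = a"
  proof (rule tot_eqI)
    show "a \<in> U" using a(2) by (rule el_U)
    show "a \<in> el At \<and> tr u \<in> el (ap f a)" using a tu el_mk[OF small_cls[OF assms]] by simp
    fix b assume b: "b \<in> el At \<and> tr u \<in> el (ap f b)"
    then have "ap f b \<in> el Q" using f_bij unfolding bij_betw_def by blast
    then obtain v where v: "v \<in> fr" "ap f b = mk (cls v)" using el_Q by blast
    then have "tr u \<in> cls v" using b el_mk[OF small_cls[OF v(1)]] by simp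
    then obtain w where w: "w \<in> fr" "frac_eq M v w" "tr u = tr w" unfolding cls_def by blast
    have "u = w" using tr_inj[OF assms w(1,3)] .
    then have "mk (cls v) = mk (cls u)" using w(2) feq_fle[OF v(1) assms] cls_eq_iff[OF v(1) assms] by blast
    then have "ap f b = ap f a" using v(2) a(1) by simp
    then show "b = a" using f_bij b a(2) unfolding bij_betw_def by (auto dest: inj_onD)
  qed
  finally show ?thesis using a by simp
qed

lemma att_At: "u \<in> fr \<Longrightarrow> att u \<in> el At" using att by blast

lemma att_surj: assumes "a \<in> el At" obtains u where "u \<in> fr" "a = att u"
proof -
  have "ap f a \<in> el Q" using f_bij assms unfolding bij_betw_def by blast
  then obtain u where u: "u \<in> fr" "ap f a = mk (cls u)" using el_Q by blast
  then have "ap f a = ap f (att u)" using att by simp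
  then have "a = att u" using inj_onD[OF bij_betw_imp_inj_on[OF f_bij] _ assms att_At[OF u(1)]] by blast
  with u that show ?thesis by blast
qed

text \<open>\<open>rat_le\<close> asks for some pair of representatives; transitivity of
  \<open>fle\<close> makes the choice immaterial.\<close>

lemma R_att: assumes u: "u \<in> fr" and v: "v \<in> fr" shows "pr (att u) (att v) \<in> el R \<longleftrightarrow> fle u v"
proof -
  have A: "att u \<in> el At" "att v \<in> el At" using att_At u v by blast+
  have "pr (att u) (att v) \<in> el R \<longleftrightarrow> rel M R (att u) (att v)" unfolding rel_iff using el_U A by blast
  also have "\<dots> \<longleftrightarrow> rat_le M (mk (cls u)) (mk (cls v))"
    using Rf[OF A] app_ap[OF A(1) f_fun] app_ap[OF A(2) f_fun] att[OF u] att[OF v] by simp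
  also have "\<dots> \<longleftrightarrow> (\<exists>u'\<in>fr. \<exists>v'\<in>fr. fle u u' \<and> fle u' u \<and> fle v v' \<and> fle v' v \<and> fle u' v')"
    unfolding rat_le_def is_rat_of_iff using cls_eq_iff[OF u] cls_eq_iff[OF v] by blast
  also have "\<dots> \<longleftrightarrow> fle u v"
    using fle_trans[OF u] fle_trans[OF _ _ v] fle_refl u v by meson
  finally show ?thesis .
qed

lemma att_eq_iff: assumes "u \<in> fr" "v \<in> fr" shows "att u = att v \<longleftrightarrow> fle u v \<and> fle v u"
proof
  assume "att u = att v"
  then show "fle u v \<and> fle v u" using att[OF assms(1)] att[OF assms(2)] cls_eq_iff[OF assms] by metis
next
  assume "fle u v \<and> fle v u"
  then have "ap f (att u) = ap f (att v)" using att[OF assms(1)] att[OF assms(2)] cls_eq_iff[OF assms] by metis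
  then show "att u = att v" using inj_onD[OF bij_betw_imp_inj_on[OF f_bij]] att_At assms by blast
qed

section \<open>Order automorphisms induced by maps of fractions\<close>

definition aut :: "'m \<Rightarrow> bool" where
  "aut \<phi> \<longleftrightarrow> perm \<phi> \<and> (\<forall>a\<in>el At. \<forall>b\<in>el At. pr a b \<in> el R \<longleftrightarrow> pr (ap \<phi> a) (ap \<phi> b) \<in> el R)"

text \<open>Since \<open>F\<close> acts on triples of HOL, its definability is required of the three
  components. The equivalence \<open>mono\<close> makes the induced map on atoms independent of the
  representative and, at the same time, injective and order preserving.\<close>

lemma frac_aut:
  assumes T: "Tm (\<lambda>e. Fa (e 0) (e (Suc 0)) (e (Suc (Suc 0))))" "Tm (\<lambda>e. Fb (e 0) (e (Suc 0)) (e (Suc (Suc 0))))"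
      "Tm (\<lambda>e. Fc (e 0) (e (Suc 0)) (e (Suc (Suc 0))))"
    and F: "\<And>x y z. F (x, y, z) = (Fa x y z, Fb x y z, Fc x y z)"
    and Ffr: "\<And>u. u \<in> fr \<Longrightarrow> F u \<in> fr"
    and mono: "\<And>u v. u \<in> fr \<Longrightarrow> v \<in> fr \<Longrightarrow> fle (F u) (F v) \<longleftrightarrow> fle u v"
    and surj: "\<And>v. v \<in> fr \<Longrightarrow> \<exists>u\<in>fr. fle (F u) v \<and> fle v (F u)"
  shows "\<exists>\<phi>. aut \<phi> \<and> (\<forall>u\<in>fr. ap \<phi> (att u) = att (F u))"
proof -
  define H where "H a = tot (\<lambda>b. \<exists>x\<in>el om. \<exists>y\<in>el om. \<exists>z\<in>el om. z \<noteq> ze \<and> a = at x y z \<and>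
      b = at (Fa x y z) (Fb x y z) (Fc x y z))" for a
  have TH: "Tm (\<lambda>e. H (e 0))" unfolding H_def by (intro df Tm_lift3[OF T(1)] Tm_lift3[OF T(2)] Tm_lift3[OF T(3)])
  have Hu: "H (att u) = att (F u)" if u: "u \<in> fr" for u
    unfolding H_def
  proof (rule tot_eqI)
    show "att (F u) \<in> U" using el_U[OF att_At[OF Ffr[OF u]]] .
    obtain x y z where e: "u = (x, y, z)" by (cases u) blast
    show "\<exists>x\<in>el om. \<exists>y\<in>el om. \<exists>z\<in>el om. z \<noteq> ze \<and> att u = at x y z \<and> att (F u) = at (Fa x y z) (Fb x y z) (Fc x y z)"
      using u unfolding e F att_def by (auto simp: fr_iff)
    fix b assume "\<exists>x\<in>el om. \<exists>y\<in>el om. \<exists>z\<in>el om. z \<noteq> ze \<and> att u = at x y z \<and> b = at (Fa x y z) (Fb x y z) (Fc x y z)"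
    then obtain x y z where h: "x \<in> el om" "y \<in> el om" "z \<in> el om" "z \<noteq> ze" "att u = at x y z"
      "b = at (Fa x y z) (Fb x y z) (Fc x y z)" by blast
    have v: "(x, y, z) \<in> fr" using h by (simp add: fr_iff)
    have "att u = att (x, y, z)" using h(5) by (simp add: att_def)
    then have "att (F u) = att (F (x, y, z))"
      using att_eq_iff[OF u v] att_eq_iff[OF Ffr[OF u] Ffr[OF v]] mono[OF u v] mono[OF v u] by blast
    then show "b = att (F u)" using h(6) by (simp add: att_def F)
  qed
  have B: "bij_betw H (el At) (el At)"
    unfolding bij_betw_def
  proof (intro conjI inj_onI set_eqI iffI)
    fix a b assume ab: "a \<in> el At" "b \<in> el At" "H a = H b"
    obtain u v where uv: "u \<in> fr" "a = att u" "v \<in> fr" "b = att v" using att_surj ab(1,2) by metis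
    have "att (F u) = att (F v)" using ab(3) Hu uv by simp
    then show "a = b" unfolding uv(2,4)
      using att_eq_iff[OF uv(1,3)] att_eq_iff[OF Ffr[OF uv(1)] Ffr[OF uv(3)]] mono[OF uv(1,3)] mono[OF uv(3,1)] by blast
  next
    fix b assume "b \<in> H ` el At"
    then obtain a where a: "b = H a" "a \<in> el At" by (rule imageE)
    obtain u where "u \<in> fr" "a = att u" using att_surj[OF a(2)] by blast
    then show "b \<in> el At" using Hu a(1) att_At Ffr by simp
  next
    fix b assume b: "b \<in> el At"
    obtain v where v: "v \<in> fr" "b = att v" using att_surj[OF b] by blast
    obtain u where u: "u \<in> fr" "fle (F u) v \<and> fle v (F u)" using surj[OF v(1)] by blast
    then have "b = H (att u)" using att_eq_iff[OF Ffr[OF u(1)] v(1)] Hu[OF u(1)] v(2) by simp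
    then show "b \<in> H ` el At" using att_At[OF u(1)] by (rule image_eqI)
  qed
  have p: "perm (gr H At)" "\<And>a. a \<in> el At \<Longrightarrow> ap (gr H At) a = H a" using perm_gr[OF TH B] by blast+
  have "pr a b \<in> el R \<longleftrightarrow> pr (H a) (H b) \<in> el R" if ab: "a \<in> el At" "b \<in> el At" for a b
  proof -
    obtain u v where uv: "u \<in> fr" "a = att u" "v \<in> fr" "b = att v" using att_surj ab(1,2) by metis
    show ?thesis unfolding uv(2,4) Hu[OF uv(1)] Hu[OF uv(3)]
      using R_att[OF uv(1,3)] R_att[OF Ffr[OF uv(1)] Ffr[OF uv(3)]] mono[OF uv(1,3)] by blast
  qed
  then have "aut (gr H At)" unfolding aut_def using p by simp
  then show ?thesis using p(2) Hu att_At by (intro exI[of _ "gr H At"]) simp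
qed

text \<open>Addition of (p - q) / d, carried out on numerators and denominators with positive and
  negative parts kept apart.\<close>

lemma translation:
  assumes e: "(p, q, d) \<in> fr"
  shows "\<exists>\<phi>. aut \<phi> \<and> (\<forall>x y z. (x, y, z) \<in> fr \<longrightarrow> ap \<phi> (att (x, y, z)) = att (pl (ts x d) (ts p z), pl (ts y d) (ts q z), ts z d))"
proof -
  note e' = e[unfolded fr_iff]
  define F where "F = (\<lambda>(x, y, z). (pl (ts x d) (ts p z), pl (ts y d) (ts q z), ts z d))"
  have F: "F (x, y, z) = (pl (ts x d) (ts p z), pl (ts y d) (ts q z), ts z d)" for x y z by (simp add: F_def)
  have U: "p \<in> U" "q \<in> U" "d \<in> U" using e' by simp_all
  have Ffr: "F (x, y, z) \<in> fr" if "(x, y, z) \<in> fr" for x y z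
    using that e' ts_ne_ze[of z d] unfolding F fr_iff by simp
  have "\<exists>\<phi>. aut \<phi> \<and> (\<forall>u\<in>fr. ap \<phi> (att u) = att (F u))"
  proof (rule frac_aut[where Fa="\<lambda>x y z. pl (ts x d) (ts p z)" and Fb="\<lambda>x y z. pl (ts y d) (ts q z)" and Fc="\<lambda>x y z. ts z d" and F=F])
    show "F (x, y, z) = (pl (ts x d) (ts p z), pl (ts y d) (ts q z), ts z d)" for x y z by (rule F)
    show "Tm (\<lambda>e. pl (ts (e 0) d) (ts p (e (Suc (Suc 0)))))" "Tm (\<lambda>e. pl (ts (e (Suc 0)) d) (ts q (e (Suc (Suc 0)))))"
      "Tm (\<lambda>e. ts (e (Suc (Suc 0))) d)" by (intro df U)+
    show "F u \<in> fr" if "u \<in> fr" for u using that Ffr by (cases u) blast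
    show "fle (F u) (F v) \<longleftrightarrow> fle u v" if uv: "u \<in> fr" "v \<in> fr" for u v
    proof -
      obtain a b c a' b' c' where e: "u = (a, b, c)" "v = (a', b', c')" by (cases u, cases v) blast
      have o: "(a, b, c) \<in> fr" "(a', b', c') \<in> fr" using uv e by simp_all
      note o' = o[unfolded fr_iff]
      \<comment> \<open>Translating both fractions multiplies the two sides of the comparison by d^2
        and adds this same summand to each.\<close>
      let ?K = "pl (ts p (ts c (ts c' d))) (ts q (ts c (ts c' d)))"
      have 1: "pl (ts (pl (ts a d) (ts p c)) (ts c' d)) (ts (pl (ts b' d) (ts q c')) (ts c d)) =
          pl (ts (pl (ts a c') (ts b' c)) (ts d d)) ?K" using o' e' by (simp add: arith_om)
      have 2: "pl (ts (pl (ts a' d) (ts p c')) (ts c d)) (ts (pl (ts b d) (ts q c)) (ts c' d)) =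
          pl (ts (pl (ts a' c) (ts b c')) (ts d d)) ?K" using o' e' by (simp add: arith_om)
      show ?thesis
        unfolding e F fle_iff[OF Ffr[OF o(1), unfolded F] Ffr[OF o(2), unfolded F]] fle_iff[OF o] 1 2
        by (rule le_affine) (use o' e' ts_ne_ze[of d d] in simp_all)
    qed
    show "\<exists>u\<in>fr. fle (F u) v \<and> fle v (F u)" if v: "v \<in> fr" for v
    proof -
      obtain a b c where e: "v = (a, b, c)" by (cases v) blast
      have o: "(a, b, c) \<in> fr" using v e by simp
      note o' = o[unfolded fr_iff]
      \<comment> \<open>The preimage is obtained by the opposite translation, in which
        \<open>p\<close> and \<open>q\<close> are exchanged.\<close>
      let ?u = "(pl (ts a d) (ts q c), pl (ts b d) (ts p c), ts c d)"
      have u: "?u \<in> fr" using o' e' ts_ne_ze[of c d] unfolding fr_iff by simp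
      have "fle (F ?u) (a, b, c) \<and> fle (a, b, c) (F ?u)"
        unfolding F by (intro conjI feq_I Ffr[OF u, unfolded F] o) (use o' e' in \<open>simp_all add: arith_om\<close>)
      then show ?thesis using u e by blast
    qed
  qed
  then show ?thesis using F by metis
qed

text \<open>Multiplication by the positive rational j / k. Preimages come from exchanging
  \<open>j\<close> and \<open>k\<close>.\<close>

lemma scaling:
  assumes j: "j \<in> el om" "j \<noteq> ze" and k: "k \<in> el om" "k \<noteq> ze"
  shows "\<exists>\<phi>. aut \<phi> \<and> (\<forall>x y z. (x, y, z) \<in> fr \<longrightarrow> ap \<phi> (att (x, y, z)) = att (ts x j, ts y j, ts z k))"
proof -
  define F where "F = (\<lambda>(x, y, z). (ts x j, ts y j, ts z k))"
  have F: "F (x, y, z) = (ts x j, ts y j, ts z k)" for x y z by (simp add: F_def)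
  have U: "j \<in> U" "k \<in> U" using j k by simp_all
  have Ffr: "F (x, y, z) \<in> fr" if "(x, y, z) \<in> fr" for x y z
    using that j k ts_ne_ze[of z k] unfolding F fr_iff by simp
  have "\<exists>\<phi>. aut \<phi> \<and> (\<forall>u\<in>fr. ap \<phi> (att u) = att (F u))"
  proof (rule frac_aut[where Fa="\<lambda>x y z. ts x j" and Fb="\<lambda>x y z. ts y j" and Fc="\<lambda>x y z. ts z k" and F=F])
    show "F (x, y, z) = (ts x j, ts y j, ts z k)" for x y z by (rule F)
    show "Tm (\<lambda>e. ts (e 0) j)" "Tm (\<lambda>e. ts (e (Suc 0)) j)" "Tm (\<lambda>e. ts (e (Suc (Suc 0))) k)" by (intro df U)+
    show "F u \<in> fr" if "u \<in> fr" for u using that Ffr by (cases u) blast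
    show "fle (F u) (F v) \<longleftrightarrow> fle u v" if uv: "u \<in> fr" "v \<in> fr" for u v
    proof -
      obtain a b c a' b' c' where e: "u = (a, b, c)" "v = (a', b', c')" by (cases u, cases v) blast
      have o: "(a, b, c) \<in> fr" "(a', b', c') \<in> fr" using uv e by simp_all
      note o' = o[unfolded fr_iff]
      have 1: "pl (ts (ts a j) (ts c' k)) (ts (ts b' j) (ts c k)) = ts (pl (ts a c') (ts b' c)) (ts j k)"
        using o' j k by (simp add: arith_om)
      have 2: "pl (ts (ts a' j) (ts c k)) (ts (ts b j) (ts c' k)) = ts (pl (ts a' c) (ts b c')) (ts j k)"
        using o' j k by (simp add: arith_om)
      show ?thesis
        unfolding e F fle_iff[OF Ffr[OF o(1), unfolded F] Ffr[OF o(2), unfolded F]] fle_iff[OF o] 1 2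
        by (rule le_ts_cancel) (use o' j k ts_ne_ze[of j k] in simp_all)
    qed
    show "\<exists>u\<in>fr. fle (F u) v \<and> fle v (F u)" if v: "v \<in> fr" for v
    proof -
      obtain a b c where e: "v = (a, b, c)" by (cases v) blast
      have o: "(a, b, c) \<in> fr" using v e by simp
      note o' = o[unfolded fr_iff]
      let ?u = "(ts a k, ts b k, ts c j)"
      have u: "?u \<in> fr" using o' j k ts_ne_ze[of c j] unfolding fr_iff by simp
      have "fle (F ?u) (a, b, c) \<and> fle (a, b, c) (F ?u)"
        unfolding F by (intro conjI feq_I Ffr[OF u, unfolded F] o) (use o' j k in \<open>simp_all add: arith_om\<close>)
      then show ?thesis using u e by blast
    qed
  qed
  then show ?thesis using F by metis
qed

end

section \<open>The strict order of the atoms and its two-point transitivity\<close>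

context rational_atoms begin

text \<open>The formula of \<open>lt\<close> in \<open>order_group\<close>, stated before a group is
  at hand; the two are identified once the locale is interpreted.\<close>

definition lq :: "'m \<Rightarrow> 'm \<Rightarrow> bool" where "lq a b \<longleftrightarrow> pr b a \<notin> el R"

lemma lq_att: "u \<in> fr \<Longrightarrow> v \<in> fr \<Longrightarrow> lq (att u) (att v) \<longleftrightarrow> \<not> fle v u"
  unfolding lq_def using R_att by blast

lemma lq_irrefl: assumes "a \<in> el At" shows "\<not> lq a a"
proof -
  obtain u where "u \<in> fr" "a = att u" using att_surj[OF assms] by blast
  then show ?thesis using lq_att fle_refl by blast
qed

lemma lq_trans: assumes "a \<in> el At" "b \<in> el At" "c \<in> el At" "lq a b" "lq b c" shows "lq a c"
proof -
  obtain u v w where h: "u \<in> fr" "a = att u" "v \<in> fr" "b = att v" "w \<in> fr" "c = att w"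
    using att_surj assms(1-3) by metis
  have "\<not> fle v u" "\<not> fle w v" using assms(4,5) lq_att h by simp_all
  then have "\<not> fle w u" using fle_total[OF h(3,5)] fle_trans[OF h(3,5,1)] by blast
  then show ?thesis using lq_att h by simp
qed

lemma lq_total: assumes "a \<in> el At" "b \<in> el At" "a \<noteq> b" shows "lq a b \<or> lq b a"
proof -
  obtain u v where h: "u \<in> fr" "a = att u" "v \<in> fr" "b = att v"
    using att_surj assms(1,2) by metis
  then show ?thesis using lq_att att_eq_iff assms(3) by blast
qed

lemma aut_iff: "aut \<phi> \<longleftrightarrow> perm \<phi> \<and> (\<forall>a\<in>el At. \<forall>b\<in>el At. lq a b \<longleftrightarrow> lq (ap \<phi> a) (ap \<phi> b))"
  unfolding aut_def lq_def by blast

lemma aut_perm: "aut \<phi> \<Longrightarrow> perm \<phi>" and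
  aut_lq: "aut \<phi> \<Longrightarrow> a \<in> el At \<Longrightarrow> b \<in> el At \<Longrightarrow> lq (ap \<phi> a) (ap \<phi> b) \<longleftrightarrow> lq a b"
  unfolding aut_iff by blast+

lemma aut_At: "aut \<phi> \<Longrightarrow> a \<in> el At \<Longrightarrow> ap \<phi> a \<in> el At" using aut_perm perm_At by blast

lemma aut_comp: assumes "aut \<phi>" "aut \<psi>" shows "\<exists>\<chi>. aut \<chi> \<and> (\<forall>a\<in>el At. ap \<chi> a = ap \<phi> (ap \<psi> a))"
proof -
  obtain \<chi> where c: "perm \<chi>" "\<forall>a\<in>el At. ap \<chi> a = ap \<phi> (ap \<psi> a)"
    using perm_comp_ex[OF aut_perm[OF assms(1)] aut_perm[OF assms(2)]] by blast
  have "aut \<chi>" unfolding aut_iff using c aut_lq[OF assms(1)] aut_lq[OF assms(2)] aut_At[OF assms(2)] by simp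
  then show ?thesis using c(2) by blast
qed

lemma aut_inv: assumes "aut \<phi>" shows "\<exists>\<psi>. aut \<psi> \<and> (\<forall>a\<in>el At. ap \<psi> (ap \<phi> a) = a \<and> ap \<phi> (ap \<psi> a) = a)"
proof -
  obtain \<psi> where c: "perm \<psi>" "\<forall>a\<in>el At. ap \<psi> (ap \<phi> a) = a \<and> ap \<phi> (ap \<psi> a) = a"
    using perm_inv_ex[OF aut_perm[OF assms]] by blast
  have "lq a b \<longleftrightarrow> lq (ap \<psi> a) (ap \<psi> b)" if "a \<in> el At" "b \<in> el At" for a b
    using aut_lq[OF assms perm_At[OF c(1) that(1)] perm_At[OF c(1) that(2)]] c(2) that by simp
  then show ?thesis unfolding aut_iff using c by blast
qed

lemma aut_id: "\<exists>\<iota>. aut \<iota> \<and> (\<forall>a\<in>el At. ap \<iota> a = a)"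
proof -
  obtain \<iota> where "perm \<iota>" "\<forall>a\<in>el At. ap \<iota> a = a" using perm_id_ex by blast
  then show ?thesis unfolding aut_iff by (intro exI[of _ \<iota>]) simp
qed

definition origin :: 'm where "origin = att (ze, ze, sc ze)"

lemma origin_fr: "(ze, ze, sc ze) \<in> fr" by (simp add: fr_iff)
lemma origin_At: "origin \<in> el At" unfolding origin_def by (rule att_At[OF origin_fr])

lemma to_origin: assumes "a \<in> el At" shows "\<exists>\<phi>. aut \<phi> \<and> ap \<phi> a = origin"
proof -
  obtain p q d where u: "(p, q, d) \<in> fr" "a = att (p, q, d)" using att_surj[OF assms] by (metis prod_cases3)
  note u' = u(1)[unfolded fr_iff]
  \<comment> \<open>Exchanging \<open>p\<close> and \<open>q\<close> represents the negative of the
    rational of \<open>a\<close>, by which one translates.\<close>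
  have w: "(q, p, d) \<in> fr" using u(1) by (simp add: fr_iff)
  obtain \<phi> where \<phi>: "aut \<phi>" "ap \<phi> a = att (pl (ts p d) (ts q d), pl (ts q d) (ts p d), ts d d)"
    using translation[OF w] u by blast
  have v: "(pl (ts p d) (ts q d), pl (ts q d) (ts p d), ts d d) \<in> fr"
    using u' ts_ne_ze[of d d] unfolding fr_iff by simp
  have "att (pl (ts p d) (ts q d), pl (ts q d) (ts p d), ts d d) = origin"
    unfolding origin_def att_eq_iff[OF v origin_fr]
    by (intro conjI feq_I v origin_fr) (use u' in \<open>simp_all add: arith_om\<close>)
  then show ?thesis using \<phi> by auto
qed

text \<open>Gives a positive rational the form m / n with zero negative part, so that quotients of
  positive rationals become ratios of numbers.\<close>

lemma positive: assumes "a \<in> el At" "lq origin a"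
  shows "\<exists>m n. m \<in> el om \<and> m \<noteq> ze \<and> n \<in> el om \<and> n \<noteq> ze \<and> a = att (m, ze, n)"
proof -
  obtain x y z where u: "(x, y, z) \<in> fr" "a = att (x, y, z)" using att_surj[OF assms(1)] by (metis prod_cases3)
  note u' = u(1)[unfolded fr_iff]
  have "\<not> fle (x, y, z) (ze, ze, sc ze)" using assms(2) unfolding origin_def u(2) lq_att[OF origin_fr u(1)] .
  then have "\<not> le x y" unfolding fle_iff[OF u(1) origin_fr] using u' by simp
  then have "le y x" "x \<noteq> y" using le_total u' by (auto simp: le_def)
  then obtain m where m: "m \<in> el om" "x = pl y m" using leE u' by metis
  have "m \<noteq> ze" using m \<open>x \<noteq> y\<close> u' by auto
  have v: "(m, ze, z) \<in> fr" using m u' by (simp add: fr_iff)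
  have "a = att (m, ze, z)"
    unfolding u(2) att_eq_iff[OF u(1) v] by (intro conjI feq_I v u(1)) (use u' m in \<open>simp_all add: arith_om\<close>)
  then show ?thesis using m \<open>m \<noteq> ze\<close> u' by blast
qed

lemma stretch: assumes "a \<in> el At" "b \<in> el At" "lq origin a" "lq origin b"
  shows "\<exists>\<phi>. aut \<phi> \<and> ap \<phi> origin = origin \<and> ap \<phi> a = b"
proof -
  obtain m n where a: "m \<in> el om" "m \<noteq> ze" "n \<in> el om" "n \<noteq> ze" "a = att (m, ze, n)" using positive assms by blast
  obtain m' n' where b: "m' \<in> el om" "m' \<noteq> ze" "n' \<in> el om" "n' \<noteq> ze" "b = att (m', ze, n')" using positive assms by blast
  \<comment> \<open>The scaling factor is m' / n' divided by m / n.\<close>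
  let ?j = "ts m' n" and ?k = "ts n' m"
  have j: "?j \<in> el om" "?j \<noteq> ze" and k: "?k \<in> el om" "?k \<noteq> ze" using a b ts_ne_ze by simp_all
  obtain \<phi> where p: "aut \<phi>" "\<forall>x y z. (x, y, z) \<in> fr \<longrightarrow> ap \<phi> (att (x, y, z)) = att (ts x ?j, ts y ?j, ts z ?k)"
    using scaling[OF j k] by blast
  have fa: "(m, ze, n) \<in> fr" and fb: "(m', ze, n') \<in> fr" using a b by (simp_all add: fr_iff)
  have f1: "(ts ze ?j, ts ze ?j, ts (sc ze) ?k) \<in> fr" and f2: "(ts m ?j, ts ze ?j, ts n ?k) \<in> fr"
    using a b j k ts_ne_ze unfolding fr_iff by simp_all
  have "att (ts ze ?j, ts ze ?j, ts (sc ze) ?k) = origin"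
    unfolding origin_def att_eq_iff[OF f1 origin_fr] by (intro conjI feq_I f1 origin_fr) (use j k in simp_all)
  moreover have "att (ts m ?j, ts ze ?j, ts n ?k) = b"
    unfolding b(5) att_eq_iff[OF f2 fb] by (intro conjI feq_I f2 fb) (use a b j k in \<open>simp_all add: arith_om\<close>)
  ultimately have "ap \<phi> origin = origin" "ap \<phi> a = b"
    using p(2) origin_fr fa unfolding origin_def a(5) by simp_all
  then show ?thesis using p(1) by blast
qed

text \<open>Both pairs are translated so that their first atoms become the origin. A scaling about
  the origin matches the second atoms, and the translation of the target pair is then
  undone.\<close>

lemma aut_trans2:
  assumes A: "p \<in> el At" "q \<in> el At" "r \<in> el At" "s \<in> el At" and o: "lq p q" "lq r s"
  shows "\<exists>\<phi>. aut \<phi> \<and> ap \<phi> p = r \<and> ap \<phi> q = s"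
proof -
  obtain \<phi> where f: "aut \<phi>" "ap \<phi> p = origin" using to_origin A(1) by blast
  obtain \<psi> where g: "aut \<psi>" "ap \<psi> r = origin" using to_origin A(3) by blast
  have q: "ap \<phi> q \<in> el At" and s: "ap \<psi> s \<in> el At" using aut_At f g A by blast+
  have "lq origin (ap \<phi> q)" "lq origin (ap \<psi> s)" using aut_lq[OF f(1) A(1,2)] aut_lq[OF g(1) A(3,4)] f g o by simp_all
  then obtain \<theta> where t: "aut \<theta>" "ap \<theta> origin = origin" "ap \<theta> (ap \<phi> q) = ap \<psi> s" using stretch[OF q s] by blast
  obtain \<psi>' where g': "aut \<psi>'" "\<forall>a\<in>el At. ap \<psi>' (ap \<psi> a) = a" using aut_inv[OF g(1)] by blast
  obtain \<rho> where r: "aut \<rho>" "\<forall>a\<in>el At. ap \<rho> a = ap \<theta> (ap \<phi> a)" using aut_comp[OF t(1) f(1)] by blast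
  obtain \<chi> where c: "aut \<chi>" "\<forall>a\<in>el At. ap \<chi> a = ap \<psi>' (ap \<rho> a)" using aut_comp[OF g'(1) r(1)] by blast
  have "ap \<chi> p = ap \<psi>' (ap \<psi> r)" using c(2) r(2) A f(2) t(2) g(2) by simp
  moreover have "ap \<chi> q = ap \<psi>' (ap \<psi> s)" using c(2) r(2) A t(3) by simp
  ultimately show ?thesis using c(1) g'(2) A by auto
qed

abbreviation one :: 'm where "one \<equiv> att (sc ze, ze, sc ze)"
abbreviation half :: 'm where "half \<equiv> att (sc ze, ze, sc (sc ze))"

text \<open>The only explicit comparison of rationals, 0 < 1/2 < 1. Density and the absence of a
  least atom follow by carrying these three atoms around with \<open>aut_trans2\<close>; the absence
  of a greatest atom needs only a translation of 0 < 1.\<close>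

lemma half: "half \<in> el At" "one \<in> el At" "lq origin half" "lq half one" "lq origin one"
proof -
  have h: "(sc ze, ze, sc (sc ze)) \<in> fr" and o: "(sc ze, ze, sc ze) \<in> fr" by (simp_all add: fr_iff)
  show A: "half \<in> el At" "one \<in> el At" using att_At h o by blast+
  show 1: "lq origin half" unfolding origin_def lq_att[OF origin_fr h] fle_iff[OF h origin_fr] by (simp add: le_def)
  show 2: "lq half one" unfolding lq_att[OF h o] fle_iff[OF o h]
    using sc_ne[of "sc ze"] no_2cycle[of "sc ze" "sc (sc ze)"] by (simp add: le_def el_sc)
  show "lq origin one" using lq_trans[OF origin_At A 1 2] .
qed

lemma lq_dense: assumes "a \<in> el At" "b \<in> el At" "lq a b" shows "\<exists>c\<in>el At. lq a c \<and> lq c b"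
proof -
  obtain \<phi> where p: "aut \<phi>" "ap \<phi> origin = a" "ap \<phi> one = b"
    using aut_trans2[OF origin_At half(2) assms(1,2) half(5) assms(3)] by blast
  have "lq (ap \<phi> origin) (ap \<phi> half)" "lq (ap \<phi> half) (ap \<phi> one)"
    using aut_lq[OF p(1) origin_At half(1)] aut_lq[OF p(1) half(1,2)] half(3,4) by blast+
  then show ?thesis using aut_At[OF p(1) half(1)] p(2,3) by auto
qed

lemma lq_no_top: assumes "a \<in> el At" shows "\<exists>c\<in>el At. lq a c"
proof -
  obtain \<phi> where p: "aut \<phi>" "ap \<phi> a = origin" using to_origin[OF assms] by blast
  obtain \<psi> where q: "aut \<psi>" "\<forall>a\<in>el At. ap \<psi> (ap \<phi> a) = a" using aut_inv[OF p(1)] by blast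
  have "lq (ap \<psi> origin) (ap \<psi> one)" using aut_lq[OF q(1) origin_At half(2)] half(5) by blast
  moreover have "ap \<psi> origin = a" using q(2) assms p(2) by auto
  ultimately show ?thesis using aut_At[OF q(1) half(2)] by auto
qed

lemma lq_no_bot: assumes "a \<in> el At" shows "\<exists>c\<in>el At. lq c a"
proof -
  obtain c where c: "c \<in> el At" "lq a c" using lq_no_top[OF assms] by blast
  obtain \<phi> where p: "aut \<phi>" "ap \<phi> origin = a" "ap \<phi> one = c"
    using aut_trans2[OF origin_At half(2) assms c(1) half(5) c(2)] by blast
  \<comment> \<open>As 1/2 is taken to \<open>a\<close>, the image of the origin lies below
    \<open>a\<close>.\<close>
  obtain \<psi> where q: "aut \<psi>" "ap \<psi> half = a" "ap \<psi> one = c"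
    using aut_trans2[OF half(1,2) assms c(1) half(4) c(2)] by blast
  have "lq (ap \<psi> origin) (ap \<psi> half)" using aut_lq[OF q(1) origin_At half(1)] half(3) by blast
  then show ?thesis using q(2) aut_At[OF q(1) origin_At] by auto
qed

end

lemma (in zfa) ordered_Mostowski_homogeneous:
  assumes AC: "AC M" and N: "ordered_Mostowski_model M N"
  obtains G \<Gamma> where "homogeneous_group M G \<Gamma>" "N = FM_model M G \<Gamma>"
proof -
  obtain R G \<Gamma> where ro: "is_rational_order M R" and G: "is_set M G" "el G = {\<phi>. is_order_automorphism M R \<phi>}"
    "is_finite_support_filter M G \<Gamma>" "N = FM_model M G \<Gamma>"
    using N unfolding ordered_Mostowski_model_def by blast
  obtain Q f where R: "is_set M R" and Q: "is_rationals M Q" "is_bijection M f At Q"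
      "\<forall>a\<in>el At. \<forall>b\<in>el At. rel M R a b \<longleftrightarrow> rat_le M (app M f a) (app M f b)"
    using ro unfolding is_rational_order_def by blast
  interpret rational_atoms M R Q f by unfold_locales (use R Q in blast)+
  have Gp: "\<phi> \<in> el G \<longleftrightarrow> aut \<phi>" for \<phi>
  proof -
    have "rel M R a b \<longleftrightarrow> pr a b \<in> el R" if "a \<in> el At" "b \<in> el At" for a b
      unfolding rel_iff using el_U that by blast
    moreover have "app M \<phi> a = ap \<phi> a \<and> ap \<phi> a \<in> el At" if "perm \<phi>" "a \<in> el At" for a
      using app_ap[OF that(2)] that perm_At unfolding perm_def by blast
    ultimately show ?thesis unfolding G(2) is_order_automorphism_def is_perm_iff aut_def by (simp cong: conj_cong)
  qed
  interpret perm_group M G \<Gamma>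
  proof unfold_locales
    show "\<exists>\<iota>\<in>el G. \<forall>a\<in>el At. ap \<iota> a = a" using aut_id Gp by blast
    show "\<exists>\<chi>\<in>el G. \<forall>a\<in>el At. ap \<chi> a = ap \<phi> (ap \<psi> a)" if "\<phi> \<in> el G" "\<psi> \<in> el G" for \<phi> \<psi>
      using aut_comp that Gp by blast
    show "\<exists>\<psi>\<in>el G. \<forall>a\<in>el At. ap \<psi> (ap \<phi> a) = a" if "\<phi> \<in> el G" for \<phi>
      using aut_inv that Gp by blast
    show "perm \<phi>" if "\<phi> \<in> el G" for \<phi> using that Gp aut_perm by blast
  qed (rule G)+
  interpret O: order_group M G \<Gamma> R by unfold_locales (rule set_U[OF R])
  have lt: "O.lt = lq" unfolding O.lt_def[abs_def] lq_def[abs_def] ..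
  interpret O: rat_order_group M G \<Gamma> R
  proof unfold_locales
    show "\<phi> \<in> el G \<longleftrightarrow> perm \<phi> \<and> (\<forall>a\<in>el At. \<forall>b\<in>el At. O.lt a b \<longleftrightarrow> O.lt (ap \<phi> a) (ap \<phi> b))" for \<phi>
      unfolding lt Gp aut_iff ..
    show "\<exists>\<phi>\<in>el G. ap \<phi> p = r \<and> ap \<phi> q = s"
      if "p \<in> el At" "q \<in> el At" "r \<in> el At" "s \<in> el At" "O.lt p q" "O.lt r s" for p q r s
      using aut_trans2[OF that[unfolded lt]] Gp by blast
    show "\<exists>a. a \<in> el At" using origin_At by blast
    show "\<not> O.lt a a" if "a \<in> el At" for a unfolding lt by (rule lq_irrefl[OF that])
    show "O.lt a c" if "a \<in> el At" "b \<in> el At" "c \<in> el At" "O.lt a b" "O.lt b c" for a b c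
      using lq_trans[OF that[unfolded lt]] unfolding lt .
    show "O.lt a b \<or> O.lt b a" if "a \<in> el At" "b \<in> el At" "a \<noteq> b" for a b
      unfolding lt by (rule lq_total[OF that])
    show "\<exists>c\<in>el At. O.lt a c \<and> O.lt c b" if "a \<in> el At" "b \<in> el At" "O.lt a b" for a b
      using lq_dense[OF that[unfolded lt]] unfolding lt .
    show "\<exists>c\<in>el At. O.lt a c" if "a \<in> el At" for a unfolding lt by (rule lq_no_top[OF that])
    show "\<exists>c\<in>el At. O.lt c a" if "a \<in> el At" for a unfolding lt by (rule lq_no_bot[OF that])
  qed
  show ?thesis using that O.rational_order_homogeneous[OF AC] G(4) by blast
qed

theorem theorem6p4:
  fixes M N :: "'m struct"
  assumes "ZFA M" and "AC M"
    and "basic_Fraenkel_model M N \<or> ordered_Mostowski_model M N"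
  shows "EDM_T N \<and> PC_gt N \<and> \<not> PC_nle N \<and> \<not> EDM_DM N \<and> \<not> EDM_BG N"
proof -
  interpret zfa M by unfold_locales (rule assms(1))
  obtain G \<Gamma> where "homogeneous_group M G \<Gamma>" and N: "N = FM_model M G \<Gamma>"
    using assms(3) basic_Fraenkel_homogeneous[OF assms(2)] ordered_Mostowski_homogeneous[OF assms(2)] by metis
  from homogeneous_group.submodel_principles[OF this(1)] show ?thesis unfolding N .
qed

end
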